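(* Let $\alpha<0$ be a fixed real number, let $\varepsilon\in\{0,1\}$, and let $I\subset\mathbb{R}$ be a bounded interval (of times) containing $t=0$. Then there exists a positive constant $C_I$, depending (for fixed $\alpha$ and $\varepsilon$) only on the length of $I$, such that $$\|S_{\alpha,\varepsilon}(t)\phi\|_{L^4(I\times\mathbb{T}\times\mathbb{R})}\le C_I\,\|\phi\|_{L^2(\mathbb{T}\times\mathbb{R})}$$ for every $\phi\in L^2(\mathbb{T}\times\mathbb{R})$. Moreover, there exists a positive constant $\widetilde C_I$, depending only on the length of $I$, such that $$\left\|\int_0^t S_{\alpha,\varepsilon}(t-t')f(t',\cdot)\,dt'\right\|_{L^4(I\times\mathbb{T}\times\mathbb{R})}\le \widetilde C_I\,\|f\|_{L^{4/3}(I\times\mathbb{T}\times\mathbb{R})}$$ for every $f\in L^{4/3}(I\times\mathbb{T}\times\mathbb{R})$.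
   Context: $\mathbb{T}=\mathbb{R}/2\pi\mathbb{Z}$; points of $\mathbb{T}\times\mathbb{R}$ are written $(x,y)$ with dual Fourier variables $(n,\xi)\in\mathbb{Z}\times\mathbb{R}$. The unitary group $S_{\alpha,\varepsilon}(t)=e^{it(\varepsilon\partial_x^2+\partial_y^2+\alpha\partial_x^4)}$ is defined on the Fourier side by $$[S_{\alpha,\varepsilon}(t)f]^{\wedge}(n,\xi)=e^{-it(\omega_{\alpha,\varepsilon}(n)+\xi^2)}\widehat f(n,\xi),\qquad \omega_{\alpha,\varepsilon}(n)=\varepsilon n^2-\alpha n^4 .$$ *)

theory Defs
  imports "HOL-Analysis.Analysis"
begin

text \<open>
  The torus \<open>\<real> / 2\<pi>\<int>\<close> is represented by its fundamental domain \<open>[0, 2\<pi>)\<close>. Equality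
  of functions is always understood almost everywhere.
\<close>

definition torus :: "real measure" where
  "torus = restrict_space lborel {0..<2 * pi}"

definition cylinder :: "(real \<times> real) measure" where
  "cylinder = torus \<Otimes>\<^sub>M lborel"

definition spacetime :: "real set \<Rightarrow> (real \<times> real \<times> real) measure" where
  "spacetime I = restrict_space lborel I \<Otimes>\<^sub>M cylinder"

definition Lp_functions :: "real \<Rightarrow> 'a measure \<Rightarrow> ('a \<Rightarrow> complex) set" where
  "Lp_functions p M =
     {f \<in> borel_measurable M. integrable M (\<lambda>x. norm (f x) powr p)}"

definition Lp_norm :: "real \<Rightarrow> 'a measure \<Rightarrow> ('a \<Rightarrow> complex) \<Rightarrow> real" where
  "Lp_norm p M f = (\<integral>x. norm (f x) powr p \<partial>M) powr (1 / p)"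

text \<open>
  The Fourier transform is needed on \<open>L\<^sup>2\<close> and on \<open>L\<^sup>4\<^sup>/\<^sup>3\<close>, and the group also has to act
  on functions of the latter class. It is therefore taken in the usual sense of (tempered)
  distributions in \<open>(n, \<xi>)\<close>, with test functions
  \<open>h \<in> C\<^sub>c\<^sup>\<infinity>(\<real>)\<close> in the variable \<open>\<xi>\<close> for each frequency \<open>n\<close>:
  formally, with \<open>f\<^sup>^(n, \<xi>) = \<integral> f(x, y) exp (- i (n x + y \<xi>)) dx dy\<close>,
  \<open>\<integral> f\<^sup>^(n, \<xi>) h(\<xi>) d\<xi> = \<integral> f(x, y) exp (- i n x) h\<^sup>^(y) dx dy\<close>.
  The group is insensitive to the normalization of the transform.
\<close>

definition test_functions :: "(real \<Rightarrow> complex) set" where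
  "test_functions = {h.
     (\<exists>D :: nat \<Rightarrow> real \<Rightarrow> complex. D 0 = h \<and>
        (\<forall>k x. (D k has_vector_derivative D (Suc k) x) (at x))) \<and>
     (\<exists>R. \<forall>x. R < \<bar>x\<bar> \<longrightarrow> h x = 0)}"

definition line_fourier :: "(real \<Rightarrow> complex) \<Rightarrow> real \<Rightarrow> complex" where
  "line_fourier h y = (\<integral>\<xi>. h \<xi> * cis (- (y * \<xi>)) \<partial>lborel)"

definition fourier_integrand ::
    "(real \<times> real \<Rightarrow> complex) \<Rightarrow> int \<Rightarrow> (real \<Rightarrow> complex) \<Rightarrow> real \<times> real \<Rightarrow> complex" where
  "fourier_integrand f n h = (\<lambda>(x, y). f (x, y) * cis (- (of_int n * x)) * line_fourier h y)"

type_synonym freq_distribution = "int \<Rightarrow> (real \<Rightarrow> complex) \<Rightarrow> complex"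

definition fourier :: "(real \<times> real \<Rightarrow> complex) \<Rightarrow> freq_distribution" where
  "fourier f = (\<lambda>n h. \<integral>z. fourier_integrand f n h z \<partial>cylinder)"

text \<open>
  The first argument is a function whose Fourier transform is the given distribution; the
  integrability contained in \<^const>\<open>has_bochner_integral\<close> is automatic for functions in
  \<open>L\<^sup>p\<close>, \<open>1 \<le> p \<le> \<infinity>\<close>.
\<close>

definition has_fourier :: "(real \<times> real \<Rightarrow> complex) \<Rightarrow> freq_distribution \<Rightarrow> bool" where
  "has_fourier f T \<longleftrightarrow>
     (\<forall>n. \<forall>h\<in>test_functions. has_bochner_integral cylinder (fourier_integrand f n h) (T n h))"

definition dispersion :: "real \<Rightarrow> real \<Rightarrow> int \<Rightarrow> real" where
  "dispersion \<alpha> \<epsilon> n = \<epsilon> * (of_int n)\<^sup>2 - \<alpha> * (of_int n) ^ 4"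

text \<open>
  Multiplication of a distribution by \<open>exp (- i t (\<omega>(n) + \<xi>\<^sup>2))\<close>, so that
  \<open>group_multiplier \<alpha> \<epsilon> t (fourier f)\<close> is the Fourier transform of
  \<open>S\<^sub>\<alpha>\<^sub>,\<^sub>\<epsilon>(t) f\<close>.
\<close>

definition group_multiplier ::
    "real \<Rightarrow> real \<Rightarrow> real \<Rightarrow> freq_distribution \<Rightarrow> freq_distribution" where
  "group_multiplier \<alpha> \<epsilon> t T =
     (\<lambda>n h. T n (\<lambda>\<xi>. cis (- (t * (dispersion \<alpha> \<epsilon> n + \<xi>\<^sup>2))) * h \<xi>))"

text \<open>
  \<open>u\<close> is a jointly measurable representative on \<open>I \<times> \<real>/2\<pi>\<int> \<times> \<real>\<close> of
  \<open>t \<mapsto> S\<^sub>\<alpha>\<^sub>,\<^sub>\<epsilon>(t) \<phi>\<close>, for \<open>\<phi>\<close> in \<open>L\<^sup>2\<close>.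
\<close>

definition is_free_evolution ::
    "real \<Rightarrow> real \<Rightarrow> real set \<Rightarrow> (real \<times> real \<Rightarrow> complex) \<Rightarrow>
     (real \<times> real \<times> real \<Rightarrow> complex) \<Rightarrow> bool" where
  "is_free_evolution \<alpha> \<epsilon> I \<phi> u \<longleftrightarrow>
     u \<in> borel_measurable (spacetime I) \<and>
     (AE t in restrict_space lborel I.
        (\<lambda>z. u (t, z)) \<in> Lp_functions 2 cylinder \<and>
        has_fourier (\<lambda>z. u (t, z)) (group_multiplier \<alpha> \<epsilon> t (fourier \<phi>)))"

text \<open>
  \<open>u\<close> is a jointly measurable representative of
  \<open>t \<mapsto> \<integral>\<^sub>0\<^sup>t S\<^sub>\<alpha>\<^sub>,\<^sub>\<epsilon>(t - t') f(t') dt'\<close>, for \<open>f\<close> in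
  \<open>L\<^sup>4\<^sup>/\<^sup>3(I \<times> \<real>/2\<pi>\<int> \<times> \<real>)\<close>. For such \<open>f\<close> the slices
  \<open>S\<^sub>\<alpha>\<^sub>,\<^sub>\<epsilon>(t - t') f(t')\<close> are in general only distributions, and the time integral
  is the weak one. It is an oriented integral, so negative \<open>t\<close> is covered.
\<close>

definition is_duhamel_integral ::
    "real \<Rightarrow> real \<Rightarrow> real set \<Rightarrow> (real \<times> real \<times> real \<Rightarrow> complex) \<Rightarrow>
     (real \<times> real \<times> real \<Rightarrow> complex) \<Rightarrow> bool" where
  "is_duhamel_integral \<alpha> \<epsilon> I f u \<longleftrightarrow>
     u \<in> borel_measurable (spacetime I) \<and>
     (AE t in restrict_space lborel I.
        (\<forall>n. \<forall>h\<in>test_functions. interval_lebesgue_integrable lborel (ereal 0) (ereal t)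
           (\<lambda>t'. group_multiplier \<alpha> \<epsilon> (t - t') (fourier (\<lambda>z. f (t', z))) n h)) \<and>
        has_fourier (\<lambda>z. u (t, z))
          (\<lambda>n h. LBINT t'=ereal 0..ereal t.
             group_multiplier \<alpha> \<epsilon> (t - t') (fourier (\<lambda>z. f (t', z))) n h))"

text \<open>Consistency with the classical Fourier transform of integrable functions.\<close>

lemma test_function_integrable:
  assumes "h \<in> test_functions"
  shows "integrable lborel h"
proof -
  from assms obtain D R where D: "D 0 = h"
      "\<And>k x. (D k has_vector_derivative D (Suc k) x) (at x)"
    and R: "\<And>x. R < \<bar>x\<bar> \<Longrightarrow> h x = 0"
    unfolding test_functions_def by blast
  have "isCont h x" for x
    using D(2)[of 0 x] D(1) has_vector_derivative_continuous by blast
  then have "continuous_on {-R..R} h"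
    by (simp add: continuous_at_imp_continuous_on)
  then have "integrable lborel (\<lambda>x. indicator {-R..R} x *\<^sub>R h x)"
    by (intro borel_integrable_compact) auto
  moreover have "(\<lambda>x. indicator {-R..R} x *\<^sub>R h x) = h"
    using R by (auto simp: fun_eq_iff indicator_def abs_le_iff not_le)
  ultimately show ?thesis by simp
qed

lemma sigma_finite_cylinder: "sigma_finite_measure cylinder"
proof -
  have "sigma_finite_measure torus"
    unfolding torus_def
    by (intro finite_measure.axioms(1) finite_measureI)
      (simp add: emeasure_restrict_space space_restrict_space)
  then interpret pair_sigma_finite torus lborel
    by (simp add: pair_sigma_finite_def lborel.sigma_finite_measure_axioms)
  show ?thesis
    unfolding cylinder_def by (rule sigma_finite_measure_axioms)
qed

lemma fourier_classical:
  assumes f: "integrable cylinder f" and h: "h \<in> test_functions"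
  shows "fourier f n h =
    (\<integral>\<xi>. (\<integral>(x, y). f (x, y) * cis (- (of_int n * x + y * \<xi>)) \<partial>cylinder) * h \<xi> \<partial>lborel)"
proof -
  interpret C: sigma_finite_measure cylinder by (rule sigma_finite_cylinder)
  interpret pair_sigma_finite cylinder lborel ..
  note [measurable] = borel_measurable_integrable[OF f]
    borel_measurable_integrable[OF test_function_integrable[OF h], simplified]
  define F where
    "F z \<xi> = f z * cis (- (of_int n * fst z + snd z * \<xi>)) * h \<xi>" for z \<xi>
  have [measurable]: "fst \<in> borel_measurable cylinder" "snd \<in> borel_measurable cylinder"
    unfolding cylinder_def torus_def
    by (auto intro!: measurable_compose[OF measurable_fst] measurable_restrict_space1
        simp: id_def[symmetric])
  have [measurable]: "cis \<in> borel_measurable borel"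
    by (intro borel_measurable_continuous_onI continuous_on_cis continuous_on_id)
  have F_meas: "case_prod F \<in> borel_measurable (cylinder \<Otimes>\<^sub>M lborel)"
    unfolding F_def by measurable
  have F_int: "integrable (cylinder \<Otimes>\<^sub>M lborel) (case_prod F)"
  proof (rule Fubini_integrable[OF F_meas])
    have "(\<lambda>z. \<integral>\<xi>. norm (F z \<xi>) \<partial>lborel) = (\<lambda>z. norm (f z) * (\<integral>\<xi>. norm (h \<xi>) \<partial>lborel))"
      by (simp add: F_def norm_mult)
    then show "integrable cylinder (\<lambda>z. \<integral>\<xi>. norm (case_prod F (z, \<xi>)) \<partial>lborel)"
      using f by simp
    have "integrable lborel (F z)" for z
    proof (rule Bochner_Integration.integrable_bound)
      show "integrable lborel (\<lambda>\<xi>. f z * h \<xi>)"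
        by (intro integrable_mult_right test_function_integrable[OF h])
      show "F z \<in> borel_measurable lborel"
        unfolding F_def[abs_def] by measurable
    qed (simp add: F_def norm_mult)
    then show "AE z in cylinder. integrable lborel (\<lambda>\<xi>. case_prod F (z, \<xi>))"
      by simp
  qed
  have "fourier f n h = (\<integral>z. (\<integral>\<xi>. F z \<xi> \<partial>lborel) \<partial>cylinder)"
  proof -
    have "F z \<xi> = f z * cis (- (of_int n * fst z)) * (h \<xi> * cis (- (snd z * \<xi>)))" for z \<xi>
    proof -
      have "cis (- (of_int n * fst z + snd z * \<xi>)) =
          cis (- (of_int n * fst z)) * cis (- (snd z * \<xi>))"
        by (simp add: cis_mult)
      then show ?thesis by (simp only: F_def mult_ac)
    qed
    then show ?thesis
      by (simp add: fourier_def fourier_integrand_def line_fourier_def case_prod_beta)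
  qed
  also have "\<dots> = (\<integral>\<xi>. (\<integral>z. F z \<xi> \<partial>cylinder) \<partial>lborel)"
    using Fubini_integral[OF F_int] by simp
  also have "\<dots> = (\<integral>\<xi>. (\<integral>(x, y). f (x, y) * cis (- (of_int n * x + y * \<xi>)) \<partial>cylinder) * h \<xi> \<partial>lborel)"
    by (simp add: F_def case_prod_unfold)
  finally show ?thesis .
qed

end

theory Submission
  imports Defs "HOL-Probability.Probability"
begin

text \<open>
  The Strichartz estimate for \<open>u = S(t) \<phi>\<close> is a statement about \<open>u\<^sup>2\<close> in \<open>L\<^sup>2\<close>. On a bounded time
  interval a Gaussian weight in \<open>t\<close> costs only a constant, a Gaussian weight in \<open>y\<close> can be removed
  in the limit, and with these weights \<open>u\<^sup>2\<close> is the image of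
  \<open>\<phi>\<^sup>^ \<otimes> \<phi>\<^sup>^\<close> under an operator to which Schur's test applies. It remains to bound
  \<open>\<Sum>\<^sub>n \<integral> exp (- (A - \<omega>(n) - \<omega>(N - n) - \<xi>\<^sup>2 - (s - \<xi>)\<^sup>2)\<^sup>2 / 2) d\<xi>\<close> uniformly in \<open>A, N, s\<close>. The integral
  decays like the inverse square root of the distance of \<open>A - \<omega>(n) - \<omega>(N - n)\<close> from its critical value
  \<open>s\<^sup>2 / 2\<close>, and \<open>\<alpha> < 0\<close> makes this distance grow like the fourth power of the distance of \<open>n\<close> from
  one of two points, which gives a convergent sum.

  Duality turns this estimate into one for \<open>\<integral> S(t - s) f(s) ds\<close> over a fixed interval \<open>[p, q]\<close>, in
  terms of \<open>f\<close> in \<open>L\<^sup>4\<^sup>/\<^sup>3\<close>. As \<open>4/3 < 4\<close>, the truncation to \<open>s \<le> t\<close> is achieved, as in the lemma of Christ and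
  Kiselev, by bisecting time at points that halve the mass of \<open>\<bar>f\<bar>\<^sup>4\<^sup>/\<^sup>3\<close>. All this is done for functions
  given by absolutely convergent Fourier integrals; combinations of characters times Gaussians are
  dense, and rapidly converging approximations give the general case. Test functions separate
  the measurable functions with a given Fourier transform, so that the bounds hold for every
  representative.
\<close>

text \<open>The order four is used in one place. Integration over \<xi> contributes only a power
  -1/2 of the energy defect, so a defect growing like d^4 in the distance d of n from resonance
  leaves terms of size 1 / (1 + d^2), summable uniformly in the resonant points; quadratic growth
  would leave 1 / (1 + d) and a divergent sum. The weights are Gaussian because their transforms are
  explicit and positive: the kernel in Schur's test is a Gaussian in the differences of total energy
  and total \<xi>, and its normalization cancels against its width in \<xi>, so the bound is uniform
  in the weight in y. For data in L^(4/3) single time slices evolve to distributions only. Hence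
  estimates are proved for profiles dominated uniformly in time, where all integrals converge
  absolutely, and only the limit is identified weakly. Approximations with error 32^-j in the p-th
  power of the norm give evolutions that converge almost everywhere under one integrable majorant,
  so almost every time slice can be treated with all test functions at once. As 0 lies in I, I is
  contained in [-len, len], so only the length of I enters.\<close>

lemma borel_measurable_cis' [measurable (raw)]:
  fixes f :: "'a \<Rightarrow> real"
  assumes "f \<in> borel_measurable M"
  shows "(\<lambda>x. cis (f x)) \<in> borel_measurable M"
proof -
  have "cis \<in> borel_measurable borel"
    by (intro borel_measurable_continuous_onI continuous_on_cis continuous_on_id)
  from measurable_compose[OF assms this] show ?thesis .
qed

lemma borel_measurable_cnj [measurable (raw)]:
  assumes "f \<in> borel_measurable M"
  shows "(\<lambda>x. cnj (f x)) \<in> borel_measurable M"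
proof -
  have "cnj \<in> borel_measurable borel"
    by (intro borel_measurable_continuous_onI continuous_intros)
  from measurable_compose[OF assms this] show ?thesis .
qed

text \<open>A non-integrable \<open>f\<close> has integral 0, so the bound is available before
  integrability is known.\<close>

lemma ennreal_norm_integral_le:
  fixes f :: "'a \<Rightarrow> complex"
  shows "ennreal (norm (integral\<^sup>L M f)) \<le> (\<integral>\<^sup>+x. ennreal (norm (f x)) \<partial>M)"
  by (cases "integrable M f") (auto simp: integral_norm_bound_ennreal not_integrable_integral_eq)

text \<open>The phase factor has modulus one, so \<open>norm (G k) * norm (H z)\<close> dominates
  the integrand and absolute integrability on the product is automatic. Most exchanges of a Fourier
  integral with another integral below are instances.\<close>

lemma fubini_phase:
  fixes Th :: "'k \<Rightarrow> 'z \<Rightarrow> real" and G :: "'k \<Rightarrow> complex" and H :: "'z \<Rightarrow> complex"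
  assumes "sigma_finite_measure M" "sigma_finite_measure N"
    and Th[measurable]: "(\<lambda>(k, z). Th k z) \<in> borel_measurable (M \<Otimes>\<^sub>M N)"
    and G: "integrable M G" and H: "integrable N H"
  shows "integrable N (\<lambda>z. (\<integral>k. G k * cis (Th k z) \<partial>M) * H z)"
    and "integrable M (\<lambda>k. G k * (\<integral>z. cis (Th k z) * H z \<partial>N))"
    and "(\<integral>z. (\<integral>k. G k * cis (Th k z) \<partial>M) * H z \<partial>N) = (\<integral>k. G k * (\<integral>z. cis (Th k z) * H z \<partial>N) \<partial>M)"
proof -
  interpret M: sigma_finite_measure M by fact
  interpret N: sigma_finite_measure N by fact
  interpret pair_sigma_finite M N ..
  note [measurable] = borel_measurable_integrable[OF G] borel_measurable_integrable[OF H]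
  define F where "F = (\<lambda>k z. G k * cis (Th k z) * H z)"
  have Fm: "case_prod F \<in> borel_measurable (M \<Otimes>\<^sub>M N)"
    unfolding F_def by measurable
  have Fi: "integrable (M \<Otimes>\<^sub>M N) (case_prod F)"
  proof (rule Fubini_integrable[OF Fm])
    have "(\<lambda>k. \<integral>z. norm (F k z) \<partial>N) = (\<lambda>k. norm (G k) * (\<integral>z. norm (H z) \<partial>N))"
      by (simp add: F_def norm_mult)
    then show "integrable M (\<lambda>k. \<integral>z. norm (case_prod F (k, z)) \<partial>N)"
      using G by simp
    have "integrable N (F k)" if "k \<in> space M" for k
    proof (rule Bochner_Integration.integrable_bound)
      show "integrable N (\<lambda>z. G k * H z)" using H by simp
      show "F k \<in> borel_measurable N" using Fm that by simp
    qed (simp add: F_def norm_mult)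
    then show "AE k in M. integrable N (\<lambda>z. case_prod F (k, z))"
      by simp
  qed
  have e1: "(\<integral>k. F k z \<partial>M) = (\<integral>k. G k * cis (Th k z) \<partial>M) * H z" for z
    by (simp add: F_def)
  have e2: "(\<integral>z. F k z \<partial>N) = G k * (\<integral>z. cis (Th k z) * H z \<partial>N)" for k
    by (simp add: F_def mult.assoc)
  show "integrable N (\<lambda>z. (\<integral>k. G k * cis (Th k z) \<partial>M) * H z)"
    using integrable_snd[OF Fi] by (simp add: e1)
  show "integrable M (\<lambda>k. G k * (\<integral>z. cis (Th k z) * H z \<partial>N))"
    using integrable_fst[OF Fi] by (simp add: e2)
  show "(\<integral>z. (\<integral>k. G k * cis (Th k z) \<partial>M) * H z \<partial>N) = (\<integral>k. G k * (\<integral>z. cis (Th k z) * H z \<partial>N) \<partial>M)"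
    using Fubini_integral[OF Fi] by (simp add: e1 e2)
qed

lemma norm_phase_integral_le:
  fixes G :: "'k \<Rightarrow> complex"
  shows "norm (\<integral>k. G k * cis (f k) \<partial>M) \<le> (\<integral>k. norm (G k) \<partial>M)"
  using integral_norm_bound[of M "\<lambda>k. G k * cis (f k)"] by (simp add: norm_mult)

text \<open>The \<open>T T\<^sup>*\<close> argument: the hypothesis is the Schur bound for the kernel of \<open>T\<^sup>* T\<close>.\<close>

lemma schur:
  fixes Th :: "'k \<Rightarrow> 'z \<Rightarrow> real" and G :: "'k \<Rightarrow> complex"
  assumes M: "sigma_finite_measure M" and N: "finite_measure N"
    and Th[measurable]: "(\<lambda>(k, z). Th k z) \<in> borel_measurable (M \<Otimes>\<^sub>M N)"
    and G: "integrable M G"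
    and B: "\<And>k. k \<in> space M \<Longrightarrow>
      (\<integral>\<^sup>+k'. ennreal (norm (\<integral>z. cis (Th k z - Th k' z) \<partial>N)) \<partial>M) \<le> B"
  shows "(\<integral>\<^sup>+z. ennreal ((norm (\<integral>k. G k * cis (Th k z) \<partial>M))\<^sup>2) \<partial>N)
    \<le> B * (\<integral>\<^sup>+k. ennreal ((norm (G k))\<^sup>2) \<partial>M)"
proof -
  interpret M: sigma_finite_measure M by fact
  interpret N: finite_measure N by fact
  interpret pair_sigma_finite M N ..
  have Ns: "sigma_finite_measure N" ..
  note Gm[measurable] = borel_measurable_integrable[OF G]
  define E where "E z = (\<integral>k. G k * cis (Th k z) \<partial>M)" for z
  define W where "W k k' = (\<integral>z. cis (Th k z - Th k' z) \<partial>N)" for k k'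
  have [measurable]: "(\<lambda>(z,k). Th k z) \<in> borel_measurable (N \<Otimes>\<^sub>M M)"
    using measurable_pair_swap[OF Th] by (simp add: case_prod_beta)
  have Em[measurable]: "E \<in> borel_measurable N"
    unfolding E_def by measurable
  have [measurable]: "(\<lambda>(k,k'). W k k') \<in> borel_measurable (M \<Otimes>\<^sub>M M)"
    unfolding W_def by measurable
  have Eb: "norm (E z) \<le> (\<integral>k. norm (G k) \<partial>M)" for z
    unfolding E_def by (rule norm_phase_integral_le)
  have Ei: "integrable N (\<lambda>z. cnj (E z))"
    by (rule N.integrable_const_bound[where B="\<integral>k. norm (G k) \<partial>M"]) (use Eb in auto)
  have Ei2: "integrable N (\<lambda>z. (norm (E z))\<^sup>2)"
    by (rule N.integrable_const_bound[where B="(\<integral>k. norm (G k) \<partial>M)\<^sup>2"]) (use Eb in \<open>auto intro!: power_mono\<close>)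
  have inner: "(\<integral>z. cis (Th k z) * cnj (E z) \<partial>N) = (\<integral>k'. cnj (G k') * W k k' \<partial>M)"
    if k: "k \<in> space M" for k
  proof -
    have Thk[measurable]: "Th k \<in> borel_measurable N"
      using measurable_Pair2[OF Th k] by simp
    have "cnj (E z) = (\<integral>k'. cnj (G k') * cis (- Th k' z) \<partial>M)" for z
      unfolding E_def by (subst Bochner_Integration.integral_cnj[symmetric]) (simp add: cis_cnj)
    then have "(\<integral>z. cis (Th k z) * cnj (E z) \<partial>N)
        = (\<integral>z. (\<integral>k'. cnj (G k') * cis (- Th k' z) \<partial>M) * cis (Th k z) \<partial>N)"
      by (simp add: mult.commute)
    also have "\<dots> = (\<integral>k'. cnj (G k') * (\<integral>z. cis (- Th k' z) * cis (Th k z) \<partial>N) \<partial>M)"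
      by (rule fubini_phase(3)[OF M Ns, of "\<lambda>k z. - Th k z"])
        (use G in \<open>auto intro!: N.integrable_const_bound[where B=1] simp: integrable_cnj\<close>)
    also have "\<dots> = (\<integral>k'. cnj (G k') * W k k' \<partial>M)"
      by (simp add: W_def cis_mult)
    finally show ?thesis .
  qed
  \<comment> \<open>One factor of the square stays expanded as an integral against \<open>G\<close>;
    the other is conjugated and integrated against the phase first. What remains is the quadratic
    form of the kernel \<open>W\<close>.\<close>
  have "complex_of_real (\<integral>z. (norm (E z))\<^sup>2 \<partial>N) = (\<integral>z. E z * cnj (E z) \<partial>N)"
    by (subst Bochner_Integration.integral_of_real[symmetric]) (simp_all only: complex_norm_square Ei2)
  also have "\<dots> = (\<integral>k. G k * (\<integral>z. cis (Th k z) * cnj (E z) \<partial>N) \<partial>M)"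
    unfolding E_def[symmetric]
    using fubini_phase(3)[OF M Ns Th G Ei] by (simp add: E_def)
  also have "\<dots> = (\<integral>k. G k * (\<integral>k'. cnj (G k') * W k k' \<partial>M) \<partial>M)"
    by (intro Bochner_Integration.integral_cong) (simp_all add: inner)
  finally have eq: "complex_of_real (\<integral>z. (norm (E z))\<^sup>2 \<partial>N) = (\<integral>k. G k * (\<integral>k'. cnj (G k') * W k k' \<partial>M) \<partial>M)" .
  \<comment> \<open>\<open>W\<close> is Hermitian, so the row bound \<open>B\<close> is a column
    bound as well.\<close>
  have Wsym: "norm (W k k') = norm (W k' k)" for k k'
  proof -
    have "W k' k = cnj (W k k')"
      unfolding W_def by (subst Bochner_Integration.integral_cnj[symmetric]) (simp add: cis_cnj)
    then show ?thesis by simp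
  qed
  have B': "(\<integral>\<^sup>+k'. ennreal (norm (W k k')) \<partial>M) \<le> B" if "k \<in> space M" for k
    using B[OF that] by (simp add: W_def)
  let ?g = "\<lambda>k. ennreal ((norm (G k))\<^sup>2)"
  let ?S = "\<integral>\<^sup>+k. ?g k \<partial>M"
  have A: "(\<integral>\<^sup>+k. (\<integral>\<^sup>+k'. ?g k * ennreal (norm (W k k')) \<partial>M) \<partial>M) \<le> B * ?S"
  proof -
    have "(\<integral>\<^sup>+k. (\<integral>\<^sup>+k'. ?g k * ennreal (norm (W k k')) \<partial>M) \<partial>M) = (\<integral>\<^sup>+k. ?g k * (\<integral>\<^sup>+k'. ennreal (norm (W k k')) \<partial>M) \<partial>M)"
      by (intro nn_integral_cong nn_integral_cmult) measurable
    also have "\<dots> \<le> (\<integral>\<^sup>+k. B * ?g k \<partial>M)"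
      by (intro nn_integral_mono) (metis B' mult.commute mult_right_mono zero_le)
    also have "\<dots> = B * ?S" by (intro nn_integral_cmult) measurable
    finally show ?thesis .
  qed
  interpret MM: pair_sigma_finite M M ..
  have A': "(\<integral>\<^sup>+k. (\<integral>\<^sup>+k'. ?g k' * ennreal (norm (W k k')) \<partial>M) \<partial>M) \<le> B * ?S"
  proof -
    have "(\<integral>\<^sup>+k. (\<integral>\<^sup>+k'. ?g k' * ennreal (norm (W k k')) \<partial>M) \<partial>M) = (\<integral>\<^sup>+k'. (\<integral>\<^sup>+k. ?g k' * ennreal (norm (W k k')) \<partial>M) \<partial>M)"
      by (rule MM.Fubini'[symmetric]) measurable
    also have "\<dots> = (\<integral>\<^sup>+k. (\<integral>\<^sup>+k'. ?g k * ennreal (norm (W k k')) \<partial>M) \<partial>M)"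
      by (simp add: Wsym)
    finally show ?thesis using A by simp
  qed
  have "ennreal (\<integral>z. (norm (E z))\<^sup>2 \<partial>N) = ennreal (norm (complex_of_real (\<integral>z. (norm (E z))\<^sup>2 \<partial>N)))"
    by simp
  also have "\<dots> \<le> (\<integral>\<^sup>+k. ennreal (norm (G k * (\<integral>k'. cnj (G k') * W k k' \<partial>M))) \<partial>M)"
    unfolding eq by (rule ennreal_norm_integral_le)
  also have "\<dots> \<le> (\<integral>\<^sup>+k. ennreal (norm (G k)) * (\<integral>\<^sup>+k'. ennreal (norm (cnj (G k') * W k k')) \<partial>M) \<partial>M)"
    by (intro nn_integral_mono, subst norm_mult, subst ennreal_mult)
      (auto intro!: mult_left_mono ennreal_norm_integral_le)
  also have "\<dots> = (\<integral>\<^sup>+k. (\<integral>\<^sup>+k'. ennreal (norm (G k)) * ennreal (norm (cnj (G k') * W k k')) \<partial>M) \<partial>M)"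
    by (intro nn_integral_cong nn_integral_cmult[symmetric]) measurable
  \<comment> \<open>The arithmetic-geometric mean inequality separates the two values of
    \<open>G\<close>. Each term is then integrated first over the variable that occurs in it only
    through \<open>W\<close>.\<close>
  also have "\<dots> \<le> (\<integral>\<^sup>+k. (\<integral>\<^sup>+k'. ennreal (1/2) * (?g k * ennreal (norm (W k k')) + ?g k' * ennreal (norm (W k k'))) \<partial>M) \<partial>M)"
  proof (intro nn_integral_mono)
    fix k k'
    have "norm (G k) * norm (G k') \<le> 1/2 * ((norm (G k))\<^sup>2 + (norm (G k'))\<^sup>2)"
      using sum_squares_bound[of "norm (G k)" "norm (G k')"] by simp
    from mult_right_mono[OF this, of "norm (W k k')"]
    have "norm (G k) * (norm (G k') * norm (W k k')) \<le> 1/2 * ((norm (G k))\<^sup>2 * norm (W k k') + (norm (G k'))\<^sup>2 * norm (W k k'))"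
      by (simp add: algebra_simps)
    then show "ennreal (norm (G k)) * ennreal (norm (cnj (G k') * W k k')) \<le> ennreal (1/2) * (?g k * ennreal (norm (W k k')) + ?g k' * ennreal (norm (W k k')))"
      by (simp only: norm_mult complex_mod_cnj ennreal_mult[symmetric] ennreal_plus[symmetric] norm_ge_zero mult_nonneg_nonneg zero_le_power2 add_nonneg_nonneg) (rule ennreal_leI, simp)
  qed
  also have "\<dots> = ennreal (1/2) * ((\<integral>\<^sup>+k. (\<integral>\<^sup>+k'. ?g k * ennreal (norm (W k k')) \<partial>M) \<partial>M) + (\<integral>\<^sup>+k. (\<integral>\<^sup>+k'. ?g k' * ennreal (norm (W k k')) \<partial>M) \<partial>M))"
  proof -
    have "(\<integral>\<^sup>+k'. ennreal (1/2) * (?g k * ennreal (norm (W k k')) + ?g k' * ennreal (norm (W k k'))) \<partial>M)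
      = ennreal (1/2) * ((\<integral>\<^sup>+k'. ?g k * ennreal (norm (W k k')) \<partial>M) + (\<integral>\<^sup>+k'. ?g k' * ennreal (norm (W k k')) \<partial>M))"
      if [measurable]: "k \<in> space M" for k
      by (subst nn_integral_cmult, measurable, subst nn_integral_add, measurable)
    then have "(\<integral>\<^sup>+k. (\<integral>\<^sup>+k'. ennreal (1/2) * (?g k * ennreal (norm (W k k')) + ?g k' * ennreal (norm (W k k'))) \<partial>M) \<partial>M)
      = (\<integral>\<^sup>+k. ennreal (1/2) * ((\<integral>\<^sup>+k'. ?g k * ennreal (norm (W k k')) \<partial>M) + (\<integral>\<^sup>+k'. ?g k' * ennreal (norm (W k k')) \<partial>M)) \<partial>M)"
      by (intro nn_integral_cong)
    also have "\<dots> = ennreal (1/2) * ((\<integral>\<^sup>+k. (\<integral>\<^sup>+k'. ?g k * ennreal (norm (W k k')) \<partial>M) \<partial>M) + (\<integral>\<^sup>+k. (\<integral>\<^sup>+k'. ?g k' * ennreal (norm (W k k')) \<partial>M) \<partial>M))"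
      by (subst nn_integral_cmult, measurable, subst nn_integral_add, measurable)
    finally show ?thesis .
  qed
  also have "\<dots> \<le> ennreal (1/2) * (B * ?S + B * ?S)"
    by (intro mult_left_mono add_mono A A') simp
  also have "\<dots> = B * ?S"
    by (simp only: mult_2[symmetric] mult.assoc[symmetric])
      (metis ennreal_1 ennreal_mult'' ennreal_numeral mult_1 nonzero_eq_divide_eq zero_neq_numeral zero_le_numeral)
  finally show ?thesis
    unfolding E_def[symmetric] by (simp add: nn_integral_eq_integral[OF Ei2])
qed

section \<open>Gaussian integrals and their Fourier transforms\<close>

lemma integrable_gaussian:
  assumes "0 < a"
  shows "integrable lborel (\<lambda>y. exp (- (a * y\<^sup>2) / 2) :: real)"
    and "(\<integral>y. exp (- (a * y\<^sup>2) / 2) \<partial>lborel) = sqrt (2 * pi / a)"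
proof -
  have s: "0 < 1 / sqrt a" using assms by simp
  have "normal_density 0 (1 / sqrt a) y = exp (- (a * y\<^sup>2) / 2) * (1 / sqrt (2 * pi / a))" for y
    using assms by (simp add: normal_density_def power_divide)
  moreover have "1 / sqrt (2 * pi / a) \<noteq> 0" using assms by simp
  ultimately have eq: "exp (- (a * y\<^sup>2) / 2) = normal_density 0 (1 / sqrt a) y * sqrt (2 * pi / a)" for y
    using assms by simp
  show "integrable lborel (\<lambda>y. exp (- (a * y\<^sup>2) / 2))"
    unfolding eq using integrable_normal_density[OF s] by simp
  show "(\<integral>y. exp (- (a * y\<^sup>2) / 2) \<partial>lborel) = sqrt (2 * pi / a)"
    unfolding eq using integral_normal_density[OF s] by simp
qed

text \<open>This is the characteristic function of the standard normal law, with the factor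
  \<open>1 / sqrt (2 * pi)\<close> of the density moved to the other side.\<close>

lemma gaussian_fourier_std:
  "(\<integral>y. cis (y * s) * complex_of_real (exp (- y\<^sup>2 / 2)) \<partial>lborel) = complex_of_real (sqrt (2 * pi) * exp (- s\<^sup>2 / 2))"
proof -
  have "char std_normal_distribution s = (\<integral>y. std_normal_density y *\<^sub>R cis (s * y) \<partial>lborel)"
    unfolding char_def by (subst integral_density) (auto simp: cis_conv_exp mult_ac)
  also have "\<dots> = (\<integral>y. complex_of_real (1 / sqrt (2 * pi)) * (cis (y * s) * complex_of_real (exp (- y\<^sup>2 / 2))) \<partial>lborel)"
    by (intro Bochner_Integration.integral_cong) (auto simp: std_normal_density_def scaleR_conv_of_real mult_ac)
  also have "\<dots> = complex_of_real (1 / sqrt (2 * pi)) * (\<integral>y. cis (y * s) * complex_of_real (exp (- y\<^sup>2 / 2)) \<partial>lborel)"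
    by simp
  finally show ?thesis
    by (simp add: char_std_normal_distribution field_simps exp_of_real)
qed

lemma gaussian_fourier:
  assumes "0 < a"
  shows "(\<integral>y. cis (y * s) * complex_of_real (exp (- (a * y\<^sup>2) / 2)) \<partial>lborel)
    = complex_of_real (sqrt (2 * pi / a) * exp (- s\<^sup>2 / (2 * a)))"
proof -
  have a: "sqrt a \<noteq> 0" "0 < sqrt a" using assms by auto
  have "(\<integral>y. cis (y * (s / sqrt a)) * complex_of_real (exp (- y\<^sup>2 / 2)) \<partial>lborel)
     = \<bar>sqrt a\<bar> *\<^sub>R (\<integral>y. cis ((0 + sqrt a * y) * (s / sqrt a)) * complex_of_real (exp (- (0 + sqrt a * y)\<^sup>2 / 2)) \<partial>lborel)"
    by (rule lborel_integral_real_affine[OF a(1)])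
  also have "\<dots> = sqrt a *\<^sub>R (\<integral>y. cis (y * s) * complex_of_real (exp (- (a * y\<^sup>2) / 2)) \<partial>lborel)"
    using assms by (simp add: power_mult_distrib mult_ac)
  finally have "sqrt a *\<^sub>R (\<integral>y. cis (y * s) * complex_of_real (exp (- (a * y\<^sup>2) / 2)) \<partial>lborel)
      = complex_of_real (sqrt (2 * pi) * exp (- (s / sqrt a)\<^sup>2 / 2))"
    by (simp only: gaussian_fourier_std)
  also have "\<dots> = complex_of_real (sqrt (2 * pi) * exp (- s\<^sup>2 / (2 * a)))"
    using assms by (simp add: power_divide field_simps)
  finally show ?thesis
    using assms a by (simp add: scaleR_conv_of_real real_sqrt_divide field_simps)
qed

section \<open>Counting near resonances\<close>

lemma nn_integral_gaussian:
  assumes "0 < a"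
  shows "(\<integral>\<^sup>+y. ennreal (exp (- (a * (y - r)\<^sup>2) / 2)) \<partial>lborel) = ennreal (sqrt (2 * pi / a))"
proof -
  have "(\<integral>\<^sup>+y. ennreal (exp (- (a * (y - r)\<^sup>2) / 2)) \<partial>lborel)
      = ennreal \<bar>1\<bar> * (\<integral>\<^sup>+y. ennreal (exp (- (a * ((r + 1 * y) - r)\<^sup>2) / 2)) \<partial>lborel)"
    by (rule nn_integral_real_affine) auto
  also have "\<dots> = (\<integral>\<^sup>+y. ennreal (exp (- (a * y\<^sup>2) / 2)) \<partial>lborel)"
    by simp
  also have "\<dots> = ennreal (\<integral>y. exp (- (a * y\<^sup>2) / 2) \<partial>lborel)"
    by (rule nn_integral_eq_integral[OF integrable_gaussian(1)[OF assms]]) simp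
  finally show ?thesis by (simp only: integrable_gaussian(2)[OF assms])
qed

text \<open>With d = r - \<bar>\<eta>\<bar> the right-hand side is 2 d^2 (r + \<bar>\<eta>\<bar>)^2,
  and r + \<bar>\<eta>\<bar> dominates both r and \<bar>d\<bar>, which leaves d^2 r^2 + d^4. The
  loss 1/4 pays for d^4 \<ge> d^2 - 1/4, which keeps the exponent a nondegenerate Gaussian in d even
  when r tends to 0.\<close>

lemma parabola_exponent_pos:
  fixes r \<eta> :: real
  assumes "0 \<le> r"
  shows "(1 + r\<^sup>2) * (r - \<bar>\<eta>\<bar>)\<^sup>2 - 1/4 \<le> (2 * r\<^sup>2 - 2 * \<eta>\<^sup>2)\<^sup>2 / 2"
proof -
  define d where "d = r - \<bar>\<eta>\<bar>"
  have 1: "r\<^sup>2 \<le> (r + \<bar>\<eta>\<bar>)\<^sup>2" "d\<^sup>2 \<le> (r + \<bar>\<eta>\<bar>)\<^sup>2"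
    using assms by (auto simp: d_def power2_eq_square algebra_simps)
  have "(2 * r\<^sup>2 - 2 * \<eta>\<^sup>2)\<^sup>2 / 2 = d\<^sup>2 * (r + \<bar>\<eta>\<bar>)\<^sup>2 + d\<^sup>2 * (r + \<bar>\<eta>\<bar>)\<^sup>2"
  proof -
    have "2 * r\<^sup>2 - 2 * \<eta>\<^sup>2 = 2 * (d * (r + \<bar>\<eta>\<bar>))"
      by (simp add: d_def algebra_simps power2_eq_square)
    then show ?thesis by (simp add: power_mult_distrib)
  qed
  also have "\<dots> \<ge> d\<^sup>2 * r\<^sup>2 + d\<^sup>2 * d\<^sup>2"
    using 1 by (intro add_mono mult_left_mono) auto
  finally have "d\<^sup>2 * r\<^sup>2 + d\<^sup>2 * d\<^sup>2 \<le> (2 * r\<^sup>2 - 2 * \<eta>\<^sup>2)\<^sup>2 / 2" .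
  moreover have "d\<^sup>2 - 1/4 \<le> d\<^sup>2 * d\<^sup>2"
    using zero_le_power2[of "d\<^sup>2 - 1/2"] by (simp add: power2_eq_square algebra_simps)
  ultimately show ?thesis unfolding d_def[symmetric] by (simp add: algebra_simps)
qed

text \<open>The case of negative b = -2 r^2, where b - 2 \<eta>^2 has no zero besides possibly
  \<eta> = 0 and the single centre 0 serves. The difference of the two sides is the displayed sum of
  nonnegative terms.\<close>

lemma parabola_exponent_neg:
  fixes r \<eta> :: real
  shows "(1 + r\<^sup>2) * \<eta>\<^sup>2 - 1/4 \<le> (- (2 * r\<^sup>2) - 2 * \<eta>\<^sup>2)\<^sup>2 / 2"
proof -
  have "0 \<le> (\<eta>\<^sup>2 - 1/2)\<^sup>2 + 2 * (r\<^sup>2)\<^sup>2 + 3 * (r\<^sup>2 * \<eta>\<^sup>2) + (\<eta>\<^sup>2)\<^sup>2"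
    by (intro add_nonneg_nonneg) auto
  then show ?thesis by (simp add: power2_eq_square algebra_simps)
qed

text \<open>Near a zero of \<open>b - 2 \<eta>\<^sup>2\<close> the derivative has size \<open>\<bar>b\<bar>\<^sup>1\<^sup>/\<^sup>2\<close>, which gives the decay in \<open>b\<close>.\<close>

lemma nn_integral_parabola:
  "(\<integral>\<^sup>+\<eta>. ennreal (exp (- (b - 2 * \<eta>\<^sup>2)\<^sup>2 / 2)) \<partial>lborel) \<le> ennreal (2 * exp (1/4) * sqrt pi / sqrt (1 + \<bar>b\<bar> / 2))"
proof -
  define r where "r = sqrt (\<bar>b\<bar> / 2)"
  have r: "0 \<le> r" "r\<^sup>2 = \<bar>b\<bar> / 2" by (auto simp: r_def)
  \<comment> \<open>The Gaussians are centred at the zeros of b - 2 \<eta>^2. For negative b both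
    centres collapse to 0, which only costs a factor 2.\<close>
  define r' where "r' = (if 0 \<le> b then r else 0)"
  let ?g = "\<lambda>c \<eta>. ennreal (exp (- ((2 * (1 + r\<^sup>2)) * (\<eta> - c)\<^sup>2) / 2))"
  have pos: "0 < 2 * (1 + r\<^sup>2)" by (simp add: add_pos_nonneg)
  have pt: "ennreal (exp (- (b - 2 * \<eta>\<^sup>2)\<^sup>2 / 2)) \<le> ennreal (exp (1/4)) * (?g r' \<eta> + ?g (- r') \<eta>)" for \<eta>
  proof -
    have "\<exists>c\<in>{r', - r'}. (1 + r\<^sup>2) * (\<eta> - c)\<^sup>2 - 1/4 \<le> (b - 2 * \<eta>\<^sup>2)\<^sup>2 / 2"
    proof (cases "0 \<le> b")
      case True
      then have b: "b = 2 * r\<^sup>2" using r by simp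
      have "(r - \<bar>\<eta>\<bar>)\<^sup>2 = (\<eta> - (if 0 \<le> \<eta> then r' else - r'))\<^sup>2"
        using True by (auto simp: r'_def power2_eq_square algebra_simps)
      then show ?thesis
        using parabola_exponent_pos[OF r(1), of \<eta>] unfolding b by (auto split: if_splits)
    next
      case False
      then have r': "r' = 0" by (simp add: r'_def)
      from False have b: "b = - (2 * r\<^sup>2)" using r by simp
      show ?thesis
        using parabola_exponent_neg[of r \<eta>] r' unfolding b by simp
    qed
    then obtain c where c: "c \<in> {r', - r'}" and le: "(1 + r\<^sup>2) * (\<eta> - c)\<^sup>2 - 1/4 \<le> (b - 2 * \<eta>\<^sup>2)\<^sup>2 / 2" by blast
    have "exp (- (b - 2 * \<eta>\<^sup>2)\<^sup>2 / 2) \<le> exp (1/4 + - ((2 * (1 + r\<^sup>2)) * (\<eta> - c)\<^sup>2) / 2)"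
      using le by (subst exp_le_cancel_iff) linarith
    then have "ennreal (exp (- (b - 2 * \<eta>\<^sup>2)\<^sup>2 / 2)) \<le> ennreal (exp (1/4)) * ?g c \<eta>"
      by (simp only: exp_add ennreal_mult[symmetric] exp_ge_zero ennreal_leI)
    also have "\<dots> \<le> ennreal (exp (1/4)) * (?g r' \<eta> + ?g (- r') \<eta>)"
      using c by (intro mult_left_mono) auto
    finally show ?thesis .
  qed
  have "(\<integral>\<^sup>+\<eta>. ennreal (exp (- (b - 2 * \<eta>\<^sup>2)\<^sup>2 / 2)) \<partial>lborel) \<le> (\<integral>\<^sup>+\<eta>. ennreal (exp (1/4)) * (?g r' \<eta> + ?g (- r') \<eta>) \<partial>lborel)"
    by (intro nn_integral_mono pt)
  also have "\<dots> = ennreal (exp (1/4)) * ((\<integral>\<^sup>+\<eta>. ?g r' \<eta> \<partial>lborel) + (\<integral>\<^sup>+\<eta>. ?g (- r') \<eta> \<partial>lborel))"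
    by (subst nn_integral_cmult, measurable, subst nn_integral_add, measurable)
  also have "\<dots> = ennreal (exp (1/4) * (sqrt (2 * pi / (2 * (1 + r\<^sup>2))) + sqrt (2 * pi / (2 * (1 + r\<^sup>2)))))"
  proof -
    have "0 \<le> sqrt (2 * pi / (2 * (1 + r\<^sup>2)))" by simp
    then show ?thesis
      by (simp only: nn_integral_gaussian[OF pos] ennreal_mult ennreal_plus add_nonneg_nonneg exp_ge_zero)
  qed
  also have "exp (1/4) * (sqrt (2 * pi / (2 * (1 + r\<^sup>2))) + sqrt (2 * pi / (2 * (1 + r\<^sup>2)))) = 2 * exp (1/4) * sqrt pi / sqrt (1 + \<bar>b\<bar> / 2)"
  proof -
    have q: "2 * pi / (2 * (1 + r\<^sup>2)) = pi / (1 + r\<^sup>2)"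
      by (rule mult_divide_mult_cancel_left) simp
    show ?thesis unfolding q unfolding r(2) real_sqrt_divide by (simp only: mult_2 distrib_left distrib_right add_divide_distrib times_divide_eq_right)
  qed
  finally show ?thesis .
qed

lemma integrable_inverse_one_plus_square:
  "integrable lborel (\<lambda>x. 1 / (1 + x\<^sup>2) :: real)"
  using integrable_inverse_1_plus_square
  by (simp add: set_integrable_def einterval_eq inverse_eq_divide)

text \<open>Comparison with an integral that is uniform in the shift c: moving from n to a point of
  the cell [n, n + 1) changes the summand by a factor of at most 3, and every real number lies in
  exactly one cell. The 1 added in \<open>K\<close> only secures positivity.\<close>

lemma lattice_sum_bound:
  obtains K where "0 < K" "\<And>c. (\<integral>\<^sup>+n. ennreal (1 / (1 + (real_of_int n - c)\<^sup>2)) \<partial>count_space UNIV) \<le> ennreal K"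
proof
  define K where "K = 3 * (\<integral>x. 1 / (1 + x\<^sup>2) \<partial>lborel) + (1::real)"
  have nn: "0 \<le> (\<integral>x. 1 / (1 + x\<^sup>2) \<partial>lborel :: real)"
    by (intro integral_nonneg_AE) auto
  then show "0 < K" unfolding K_def by linarith
  fix c :: real
  interpret C: sigma_finite_measure "count_space (UNIV :: int set)"
    by (rule sigma_finite_measure_count_space)
  interpret pair_sigma_finite "count_space (UNIV :: int set)" "lborel :: real measure" ..
  have m: "(\<lambda>(n::int, x::real). indicator {real_of_int n..<real_of_int n + 1} x * ennreal (3 / (1 + (x - c)\<^sup>2))) \<in> borel_measurable (count_space UNIV \<Otimes>\<^sub>M lborel)"
    by (rule measurable_pair_measure_countable1) auto
  have le: "ennreal (1 / (1 + (real_of_int n - c)\<^sup>2)) \<le> (\<integral>\<^sup>+x. indicator {real_of_int n..<real_of_int n + 1} x * ennreal (3 / (1 + (x - c)\<^sup>2)) \<partial>lborel)" for n :: int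
  proof -
    have "ennreal (1 / (1 + (real_of_int n - c)\<^sup>2)) = (\<integral>\<^sup>+x. ennreal (1 / (1 + (real_of_int n - c)\<^sup>2)) * indicator {real_of_int n..<real_of_int n + 1} x \<partial>lborel)"
      by (simp add: nn_integral_cmult)
    also have "\<dots> \<le> (\<integral>\<^sup>+x. indicator {real_of_int n..<real_of_int n + 1} x * ennreal (3 / (1 + (x - c)\<^sup>2)) \<partial>lborel)"
    proof (intro nn_integral_mono)
      fix x :: real
      show "ennreal (1 / (1 + (real_of_int n - c)\<^sup>2)) * indicator {real_of_int n..<real_of_int n + 1} x \<le> indicator {real_of_int n..<real_of_int n + 1} x * ennreal (3 / (1 + (x - c)\<^sup>2))"
      proof (cases "x \<in> {real_of_int n..<real_of_int n + 1}")
        case True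
        define u where "u = real_of_int n - c"
        define v where "v = x - real_of_int n"
        have v: "0 \<le> v" "v \<le> 1" using True by (auto simp: v_def)
        have "v\<^sup>2 \<le> 1" using v by (simp add: power_le_one)
        moreover have "(u + v)\<^sup>2 \<le> 2 * u\<^sup>2 + 2 * v\<^sup>2"
          using zero_le_power2[of "u - v"] by (simp add: power2_eq_square algebra_simps)
        moreover have "0 \<le> u\<^sup>2" by simp
        ultimately have "1 + (u + v)\<^sup>2 \<le> 3 * (1 + u\<^sup>2)" by argo
        moreover have "x - c = u + v" by (simp add: u_def v_def)
        ultimately have "1 / (1 + u\<^sup>2) \<le> 3 / (1 + (x - c)\<^sup>2)"
          by (simp add: field_simps add_pos_nonneg)
        then show ?thesis using True by (simp add: u_def ennreal_leI)
      qed simp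
    qed
    finally show ?thesis .
  qed
  have "(\<integral>\<^sup>+n. ennreal (1 / (1 + (real_of_int n - c)\<^sup>2)) \<partial>count_space UNIV)
     \<le> (\<integral>\<^sup>+n. (\<integral>\<^sup>+x. indicator {real_of_int n..<real_of_int n + 1} x * ennreal (3 / (1 + (x - c)\<^sup>2)) \<partial>lborel) \<partial>count_space UNIV)"
    by (intro nn_integral_mono le)
  also have "\<dots> = (\<integral>\<^sup>+x. (\<integral>\<^sup>+n. indicator {real_of_int n..<real_of_int n + 1} x * ennreal (3 / (1 + (x - c)\<^sup>2)) \<partial>count_space UNIV) \<partial>lborel)"
    using Fubini'[OF m] by simp
  also have "\<dots> = (\<integral>\<^sup>+x. ennreal (3 / (1 + (x - c)\<^sup>2)) \<partial>lborel)"
  proof (intro nn_integral_cong)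
    fix x :: real
    have "(\<integral>\<^sup>+n. indicator {real_of_int n..<real_of_int n + 1} x * ennreal (3 / (1 + (x - c)\<^sup>2)) \<partial>count_space UNIV)
        = (\<integral>\<^sup>+n. ennreal (3 / (1 + (x - c)\<^sup>2)) * indicator {\<lfloor>x\<rfloor>} n \<partial>count_space UNIV)"
    proof (intro nn_integral_cong)
      fix n :: int
      have "x \<in> {real_of_int n..<real_of_int n + 1} \<longleftrightarrow> n = \<lfloor>x\<rfloor>"
        using floor_eq_iff[of x n] by auto
      then show "indicator {real_of_int n..<real_of_int n + 1} x * ennreal (3 / (1 + (x - c)\<^sup>2)) = ennreal (3 / (1 + (x - c)\<^sup>2)) * indicator {\<lfloor>x\<rfloor>} n"
        by (auto simp: indicator_def)
    qed
    then show "(\<integral>\<^sup>+n. indicator {real_of_int n..<real_of_int n + 1} x * ennreal (3 / (1 + (x - c)\<^sup>2)) \<partial>count_space UNIV) = ennreal (3 / (1 + (x - c)\<^sup>2))"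
      by (simp add: nn_integral_cmult)
  qed
  also have "\<dots> = ennreal \<bar>1\<bar> * (\<integral>\<^sup>+x. ennreal (3 / (1 + (c + 1 * x - c)\<^sup>2)) \<partial>lborel)"
    by (rule nn_integral_real_affine) auto
  also have "\<dots> = (\<integral>\<^sup>+x. ennreal (3 * (1 / (1 + x\<^sup>2))) \<partial>lborel)" by simp
  also have "\<dots> = ennreal (\<integral>x. 3 * (1 / (1 + x\<^sup>2)) \<partial>lborel)"
    by (rule nn_integral_eq_integral) (use integrable_inverse_one_plus_square in \<open>auto intro!: integrable_mult_right simp del: times_divide_eq_right\<close>)
  also have "\<dots> \<le> ennreal K"
    by (rule ennreal_leI) (simp add: K_def del: times_divide_eq_right)
  finally show "(\<integral>\<^sup>+n. ennreal (1 / (1 + (real_of_int n - c)\<^sup>2)) \<partial>count_space UNIV) \<le> ennreal K" .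
qed

lemma pow4_superadd:
  fixes x y :: real
  assumes "0 \<le> x" "0 \<le> y"
  shows "x ^ 4 + y ^ 4 \<le> (x + y) ^ 4"
proof -
  have "(x + y) ^ 4 = x ^ 4 + y ^ 4 + (4 * x^3 * y + 6 * x\<^sup>2 * y\<^sup>2 + 4 * x * y^3)"
    by (simp add: eval_nat_numeral algebra_simps)
  moreover have "0 \<le> 4 * x^3 * y + 6 * x\<^sup>2 * y\<^sup>2 + 4 * x * y^3" using assms by simp
  ultimately show ?thesis by linarith
qed

text \<open>The polynomial q(x) = a x^2 + 2 \<beta> x^4 is increasing for x \<ge> 0, and
  superadditivity of the fourth power turns this into q(x) - q(y) \<ge> 2 \<beta> (x - y)^4.
  \<open>R\<close> is the solution of q(R) = A, or 0 if \<open>A\<close> lies below the range of q;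
  so the defect is at least quartic in the distance of \<bar>\<mu>\<bar> from
  \<open>R\<close>.\<close>

lemma quartic_distance:
  fixes a \<beta> A :: real
  assumes a: "0 \<le> a" and b: "0 < \<beta>"
  obtains R where "0 \<le> R" "\<And>\<mu>. 2 * \<beta> * (R - \<bar>\<mu>\<bar>) ^ 4 \<le> \<bar>A - (a * \<mu>\<^sup>2 + 2 * \<beta> * \<mu> ^ 4)\<bar>"
proof (cases "A \<le> 0")
  case True
  show ?thesis
  proof (rule that[of 0])
    fix \<mu> :: real
    have "0 \<le> a * \<mu>\<^sup>2" "0 \<le> 2 * \<beta> * \<mu> ^ 4" using a b by auto
    moreover have "(0 - \<bar>\<mu>\<bar>) ^ 4 = \<mu> ^ 4" by simp
    ultimately show "2 * \<beta> * (0 - \<bar>\<mu>\<bar>) ^ 4 \<le> \<bar>A - (a * \<mu>\<^sup>2 + 2 * \<beta> * \<mu> ^ 4)\<bar>"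
      using True by simp
  qed simp
next
  case False
  define q where "q = (\<lambda>x::real. a * x\<^sup>2 + 2 * \<beta> * x ^ 4)"
  \<comment> \<open>Large enough for the intermediate value theorem: X \<ge> 1 gives X^4 \<ge> X,
    hence q(X) \<ge> 2 \<beta> X \<ge> A.\<close>
  define X where "X = 1 + A / (2 * \<beta>)"
  have X: "1 \<le> X" using False b by (simp add: X_def)
  then have "X ^ 1 \<le> X ^ 4" by (intro power_increasing) auto
  then have "2 * \<beta> * X \<le> 2 * \<beta> * X ^ 4" using b by simp
  moreover have "A \<le> 2 * \<beta> * X" using b by (simp add: X_def field_simps)
  moreover have "0 \<le> a * X\<^sup>2" using a by simp
  ultimately have "A \<le> q X" unfolding q_def by linarith
  moreover have "q 0 \<le> A" using False by (simp add: q_def)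
  moreover have "continuous_on {0..X} q" unfolding q_def by (intro continuous_intros)
  ultimately obtain R where R: "0 \<le> R" "R \<le> X" "q R = A"
    using IVT'[of q 0 A X] X by auto
  have key: "2 * \<beta> * (x - y) ^ 4 \<le> q x - q y" if "0 \<le> y" "y \<le> x" for x y
  proof -
    have "(x - y) ^ 4 \<le> x ^ 4 - y ^ 4" using pow4_superadd[of "x - y" y] that by simp
    then have "2 * \<beta> * (x - y) ^ 4 \<le> 2 * \<beta> * (x ^ 4 - y ^ 4)" using b by simp
    moreover have "a * y\<^sup>2 \<le> a * x\<^sup>2" using a that by (intro mult_left_mono power_mono)
    ultimately show ?thesis by (simp add: q_def algebra_simps)
  qed
  show ?thesis
  proof (rule that[OF R(1)])
    fix \<mu> :: real
    have q: "q \<bar>\<mu>\<bar> = a * \<mu>\<^sup>2 + 2 * \<beta> * \<mu> ^ 4" by (simp add: q_def)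
    show "2 * \<beta> * (R - \<bar>\<mu>\<bar>) ^ 4 \<le> \<bar>A - (a * \<mu>\<^sup>2 + 2 * \<beta> * \<mu> ^ 4)\<bar>"
    proof (cases "\<bar>\<mu>\<bar> \<le> R")
      case True
      then show ?thesis using key[of "\<bar>\<mu>\<bar>" R] R unfolding q by auto
    next
      case False
      have "(R - \<bar>\<mu>\<bar>) ^ 4 = (\<bar>\<mu>\<bar> - R) ^ 4" by (simp add: eval_nat_numeral algebra_simps)
      then show ?thesis using False key[of R "\<bar>\<mu>\<bar>"] R unfolding q by auto
    qed
  qed
qed

text \<open>The only input on the dispersion into the Strichartz estimate. The sum runs over pairs
  of frequencies (n, \<xi>) and (N - n, s - \<xi>) with prescribed total (N, s); the exponential,
  which is the transform of the Gaussian weight in time, penalizes total energies away from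
  \<open>A\<close>.\<close>

locale bounded_counting =
  fixes w :: "int \<Rightarrow> real" and B :: real
  assumes B_pos: "0 < B"
    and counting: "\<And>A N s. (\<integral>\<^sup>+n. (\<integral>\<^sup>+\<xi>. ennreal (exp (- (A - w n - w (N - n) - \<xi>\<^sup>2 - (s - \<xi>)\<^sup>2)\<^sup>2 / 2)) \<partial>lborel) \<partial>count_space UNIV) \<le> ennreal B"

text \<open>Relative coordinates n = N/2 + \<mu>, \<xi> = s/2 + \<eta> remove the mixed terms:
  \<omega>(n) + \<omega>(N - n) becomes a constant plus a \<mu>^2 + 2 \<beta> \<mu>^4 with \<beta> =
  -\<alpha> > 0 and a \<ge> 0, and \<xi>^2 + (s - \<xi>)^2 becomes s^2/2 + 2 \<eta>^2. The parabola
  bound and \<open>quartic_distance\<close> then leave a lattice sum around each of the two points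
  N/2 + R and N/2 - R.\<close>

lemma bounded_counting_dispersion:
  fixes \<alpha> \<epsilon> :: real
  assumes al: "\<alpha> < 0" and ep: "0 \<le> \<epsilon>"
  obtains B where "bounded_counting (dispersion \<alpha> \<epsilon>) B"
proof -
  define \<beta> where "\<beta> = - \<alpha>"
  have be: "0 < \<beta>" using al by (simp add: \<beta>_def)
  obtain K where K: "0 < K" "\<And>c. (\<integral>\<^sup>+n. ennreal (1 / (1 + (real_of_int n - c)\<^sup>2)) \<partial>count_space UNIV) \<le> ennreal K"
    by (rule lattice_sum_bound) blast
  \<comment> \<open>Chosen for \<open>decay\<close>: (1 + d^2)^2 \<le> 2 (1 + d^4), and 1 + d^4 is
    at most (1 + x/2) / min 1 \<beta>.\<close>
  define c0 where "c0 = sqrt (2 / min 1 \<beta>)"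
  have c0: "0 < c0" using be by (simp add: c0_def)
  define J where "J = 2 * exp (1/4) * sqrt pi"
  have J: "0 < J" by (simp add: J_def)
  have decay: "1 / sqrt (1 + x / 2) \<le> c0 / (1 + d\<^sup>2)" if x: "2 * \<beta> * d ^ 4 \<le> x" for x d :: real
  proof -
    have m: "0 < min 1 \<beta>" using be by simp
    have "0 \<le> \<beta> * d ^ 4" using be by simp
    then have x0: "0 \<le> x" using x by linarith
    have "(1 + d\<^sup>2)\<^sup>2 \<le> 2 * (1 + d ^ 4)"
      using zero_le_power2[of "1 - d\<^sup>2"] by (simp add: eval_nat_numeral algebra_simps)
    then have "min 1 \<beta> * (1 + d\<^sup>2)\<^sup>2 \<le> 2 * (min 1 \<beta> * (1 + d ^ 4))"
      using m by (simp add: mult_left_mono)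
    also have "min 1 \<beta> * (1 + d ^ 4) \<le> 1 + \<beta> * d ^ 4"
      by (simp add: distrib_left add_mono mult_right_mono)
    also have "\<dots> \<le> 1 + x / 2" using x by simp
    finally have "(1 + d\<^sup>2)\<^sup>2 \<le> 2 / min 1 \<beta> * (1 + x / 2)"
      using m by (simp add: field_simps)
    then have "sqrt ((1 + d\<^sup>2)\<^sup>2) \<le> c0 * sqrt (1 + x / 2)"
      unfolding c0_def real_sqrt_mult[symmetric] by (rule real_sqrt_le_mono)
    moreover have "0 < sqrt (1 + x / 2)" using x0 by simp
    ultimately show ?thesis by (simp add: field_simps add_pos_nonneg)
  qed
  define B where "B = J * c0 * (2 * K)"
  have "bounded_counting (dispersion \<alpha> \<epsilon>) B"
  proof
    show "0 < B" using J c0 K(1) by (simp add: B_def)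
    fix A s :: real and N :: int
    let ?w = "dispersion \<alpha> \<epsilon>"
    define h where "h = real_of_int N / 2"
    define a where "a = 2 * \<epsilon> + 12 * \<beta> * h\<^sup>2"
    define A' where "A' = A - s\<^sup>2 / 2 - (2 * \<epsilon> * h\<^sup>2 + 2 * \<beta> * h ^ 4)"
    have a: "0 \<le> a" using ep be by (simp add: a_def)
    obtain R where R: "0 \<le> R" "\<And>\<mu>. 2 * \<beta> * (R - \<bar>\<mu>\<bar>) ^ 4 \<le> \<bar>A' - (a * \<mu>\<^sup>2 + 2 * \<beta> * \<mu> ^ 4)\<bar>"
      by (rule quartic_distance[OF a be]) blast
    have one: "(\<integral>\<^sup>+\<xi>. ennreal (exp (- (A - ?w n - ?w (N - n) - \<xi>\<^sup>2 - (s - \<xi>)\<^sup>2)\<^sup>2 / 2)) \<partial>lborel)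
       \<le> ennreal (J * c0) * (ennreal (1 / (1 + (real_of_int n - (h + R))\<^sup>2)) + ennreal (1 / (1 + (real_of_int n - (h - R))\<^sup>2)))" for n
    proof -
      define \<mu> where "\<mu> = real_of_int n - h"
      have n: "real_of_int n = h + \<mu>" "real_of_int (N - n) = h - \<mu>" by (simp_all add: \<mu>_def h_def)
      have w: "?w n + ?w (N - n) = (2 * \<epsilon> * h\<^sup>2 + 2 * \<beta> * h ^ 4) + (a * \<mu>\<^sup>2 + 2 * \<beta> * \<mu> ^ 4)"
        unfolding dispersion_def n a_def \<beta>_def by (simp add: eval_nat_numeral algebra_simps)
      define b where "b = A' - (a * \<mu>\<^sup>2 + 2 * \<beta> * \<mu> ^ 4)"
      have e: "A - ?w n - ?w (N - n) - (s / 2 + 1 * \<eta>)\<^sup>2 - (s - (s / 2 + 1 * \<eta>))\<^sup>2 = b - 2 * \<eta>\<^sup>2" for \<eta>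
      proof -
        have "(s / 2 + 1 * \<eta>)\<^sup>2 + (s - (s / 2 + 1 * \<eta>))\<^sup>2 = s\<^sup>2 / 2 + 2 * \<eta>\<^sup>2"
          by (simp add: power2_eq_square field_simps)
        then show ?thesis using w by (simp add: b_def A'_def)
      qed
      have "(\<integral>\<^sup>+\<xi>. ennreal (exp (- (A - ?w n - ?w (N - n) - \<xi>\<^sup>2 - (s - \<xi>)\<^sup>2)\<^sup>2 / 2)) \<partial>lborel)
        = ennreal \<bar>1\<bar> * (\<integral>\<^sup>+\<eta>. ennreal (exp (- (A - ?w n - ?w (N - n) - (s / 2 + 1 * \<eta>)\<^sup>2 - (s - (s / 2 + 1 * \<eta>))\<^sup>2)\<^sup>2 / 2)) \<partial>lborel)"
        by (rule nn_integral_real_affine) auto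
      also have "\<dots> = (\<integral>\<^sup>+\<eta>. ennreal (exp (- (b - 2 * \<eta>\<^sup>2)\<^sup>2 / 2)) \<partial>lborel)"
        unfolding e by simp
      also have "\<dots> \<le> ennreal (J / sqrt (1 + \<bar>b\<bar> / 2))"
        unfolding J_def by (rule nn_integral_parabola)
      also have "\<dots> \<le> ennreal (J * c0 * (1 / (1 + (\<mu> - R)\<^sup>2) + 1 / (1 + (\<mu> + R)\<^sup>2)))"
      proof (rule ennreal_leI)
        have "1 / sqrt (1 + \<bar>b\<bar> / 2) \<le> c0 / (1 + (R - \<bar>\<mu>\<bar>)\<^sup>2)"
          by (rule decay) (use R(2)[of \<mu>] in \<open>simp add: b_def\<close>)
        also have "\<dots> \<le> c0 * (1 / (1 + (\<mu> - R)\<^sup>2) + 1 / (1 + (\<mu> + R)\<^sup>2))"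
        proof -
          have "(R - \<bar>\<mu>\<bar>)\<^sup>2 = (\<mu> - R)\<^sup>2 \<or> (R - \<bar>\<mu>\<bar>)\<^sup>2 = (\<mu> + R)\<^sup>2"
            by (cases "0 \<le> \<mu>") (auto simp: power2_eq_square algebra_simps)
          moreover have "0 \<le> 1 / (1 + (\<mu> - R)\<^sup>2)" "0 \<le> 1 / (1 + (\<mu> + R)\<^sup>2)" by auto
          ultimately have "1 / (1 + (R - \<bar>\<mu>\<bar>)\<^sup>2) \<le> 1 / (1 + (\<mu> - R)\<^sup>2) + 1 / (1 + (\<mu> + R)\<^sup>2)" by auto
          from mult_left_mono[OF this, of c0] show ?thesis using c0 by simp
        qed
        finally have "J * (1 / sqrt (1 + \<bar>b\<bar> / 2)) \<le> J * (c0 * (1 / (1 + (\<mu> - R)\<^sup>2) + 1 / (1 + (\<mu> + R)\<^sup>2)))"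
          using J by (intro mult_left_mono) auto
        then show "J / sqrt (1 + \<bar>b\<bar> / 2) \<le> J * c0 * (1 / (1 + (\<mu> - R)\<^sup>2) + 1 / (1 + (\<mu> + R)\<^sup>2))"
          by (simp only: mult.assoc times_divide_eq_right mult_1_right)
      qed
      also have "\<dots> = ennreal (J * c0) * (ennreal (1 / (1 + (real_of_int n - (h + R))\<^sup>2)) + ennreal (1 / (1 + (real_of_int n - (h - R))\<^sup>2)))"
      proof -
        have "\<mu> - R = real_of_int n - (h + R)" "\<mu> + R = real_of_int n - (h - R)" by (auto simp: \<mu>_def)
        moreover have "0 \<le> J * c0" using J c0 by simp
        ultimately show ?thesis
          by (simp only: ennreal_mult ennreal_plus add_nonneg_nonneg divide_nonneg_nonneg zero_le_one zero_le_power2)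
      qed
      finally show ?thesis .
    qed
    have "(\<integral>\<^sup>+n. (\<integral>\<^sup>+\<xi>. ennreal (exp (- (A - ?w n - ?w (N - n) - \<xi>\<^sup>2 - (s - \<xi>)\<^sup>2)\<^sup>2 / 2)) \<partial>lborel) \<partial>count_space UNIV)
      \<le> (\<integral>\<^sup>+n. ennreal (J * c0) * (ennreal (1 / (1 + (real_of_int n - (h + R))\<^sup>2)) + ennreal (1 / (1 + (real_of_int n - (h - R))\<^sup>2))) \<partial>count_space UNIV)"
      by (intro nn_integral_mono one)
    also have "\<dots> = ennreal (J * c0) * ((\<integral>\<^sup>+n. ennreal (1 / (1 + (real_of_int n - (h + R))\<^sup>2)) \<partial>count_space UNIV) + (\<integral>\<^sup>+n. ennreal (1 / (1 + (real_of_int n - (h - R))\<^sup>2)) \<partial>count_space UNIV))"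
      by (subst nn_integral_cmult, simp, subst nn_integral_add, auto)
    also have "\<dots> \<le> ennreal (J * c0) * (ennreal K + ennreal K)"
      by (intro mult_left_mono add_mono K) simp
    also have "\<dots> = ennreal B"
    proof -
      have "0 \<le> J * c0" "0 \<le> K" using J c0 K(1) by simp_all
      then show ?thesis
        by (simp only: B_def mult_2 ennreal_mult ennreal_plus add_nonneg_nonneg)
    qed
    finally show "(\<integral>\<^sup>+n. (\<integral>\<^sup>+\<xi>. ennreal (exp (- (A - ?w n - ?w (N - n) - \<xi>\<^sup>2 - (s - \<xi>)\<^sup>2)\<^sup>2 / 2)) \<partial>lborel) \<partial>count_space UNIV) \<le> ennreal B" .
  qed
  then show ?thesis by (rule that)
qed

section \<open>The Strichartz estimate\<close>

abbreviation freq :: "(int \<times> real) measure" where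
  "freq \<equiv> count_space UNIV \<Otimes>\<^sub>M lborel"

definition phase :: "int \<times> real \<Rightarrow> real \<times> real \<Rightarrow> real" where
  "phase k z = of_int (fst k) * fst z + snd k * snd z"

definition symb :: "(int \<Rightarrow> real) \<Rightarrow> int \<times> real \<Rightarrow> real" where
  "symb w k = w (fst k) + (snd k)\<^sup>2"

text \<open>The free evolution of a profile on the Fourier side, without the factor 1 / (4 pi^2) of
  the inverse transform; this is why \<open>4 * pi\<^sup>2\<close> appears in every Plancherel
  identity. At time 0 it is the plain inverse Fourier integral, whatever the symbol.\<close>

definition ext :: "(int \<Rightarrow> real) \<Rightarrow> (int \<times> real \<Rightarrow> complex) \<Rightarrow> real \<Rightarrow> real \<times> real \<Rightarrow> complex" where
  "ext w g t z = (\<integral>k. g k * cis (phase k z - t * symb w k) \<partial>freq)"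

text \<open>Left unnormalized: the density tends to 1 as \<open>a\<close> tends to 0, so that the
  weight can be removed in the limit.\<close>

definition gauss :: "real \<Rightarrow> real measure" where
  "gauss a = density lborel (\<lambda>y. ennreal (exp (- (a * y\<^sup>2) / 2)))"

interpretation torus: finite_measure torus
  unfolding torus_def by (intro finite_measureI) (simp add: emeasure_restrict_space space_restrict_space)

interpretation int_count: sigma_finite_measure "count_space (UNIV :: int set)"
  by (rule sigma_finite_measure_count_space)

interpretation freq: pair_sigma_finite "count_space (UNIV :: int set)" "lborel :: real measure" ..

interpretation torus_line: pair_sigma_finite torus "lborel :: real measure" ..

interpretation cyl: sigma_finite_measure cylinder
  by (rule sigma_finite_cylinder)

interpretation freq_freq: pair_sigma_finite freq freq ..

interpretation freq_cyl: pair_sigma_finite freq cylinder ..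

lemma sets_gauss [simp, measurable_cong]: "sets (gauss a) = sets borel"
  by (simp add: gauss_def)

lemma measurable_gauss [simp]: "measurable (gauss a) N = measurable borel N"
  by (rule measurable_cong_sets) simp_all

lemma space_gauss [simp]: "space (gauss a) = UNIV"
  by (simp add: gauss_def)

lemma space_torus: "space torus = {0..<2 * pi}"
  by (simp add: torus_def space_restrict_space)

lemma sets_cylinder [measurable_cong]: "sets cylinder = sets (torus \<Otimes>\<^sub>M lborel)"
  unfolding cylinder_def ..

lemma measurable_torus_ident: "(\<lambda>x. x) \<in> borel_measurable torus"
  unfolding torus_def by (intro measurable_restrict_space1) simp

lemma borel_measurable_torusI: "f \<in> borel_measurable borel \<Longrightarrow> f \<in> borel_measurable torus"
  by (rule measurable_compose[OF measurable_torus_ident])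

lemma measurable_fst_cylinder [measurable (raw)]:
  assumes "g \<in> measurable M cylinder"
  shows "(\<lambda>x. fst (g x)) \<in> borel_measurable M"
proof -
  have "fst \<in> borel_measurable cylinder"
    unfolding cylinder_def by (rule measurable_compose[OF measurable_fst measurable_torus_ident])
  from measurable_compose[OF assms this] show ?thesis .
qed

lemma measurable_snd_cylinder [measurable (raw)]:
  assumes "g \<in> measurable M cylinder"
  shows "(\<lambda>x. snd (g x)) \<in> borel_measurable M"
proof -
  have "snd \<in> borel_measurable cylinder"
    unfolding cylinder_def by simp
  from measurable_compose[OF assms this] show ?thesis .
qed

lemma measurable_fst_torus_pair [measurable (raw)]:
  assumes "g \<in> measurable M (torus \<Otimes>\<^sub>M N)"
  shows "(\<lambda>x. fst (g x)) \<in> borel_measurable M"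
  using measurable_compose[OF measurable_compose[OF assms measurable_fst] measurable_torus_ident] by simp

lemma measurable_phase [measurable (raw)]:
  assumes "K \<in> measurable M freq" "(\<lambda>x. fst (Z x)) \<in> borel_measurable M" "(\<lambda>x. snd (Z x)) \<in> borel_measurable M"
  shows "(\<lambda>x. phase (K x) (Z x)) \<in> borel_measurable M"
proof -
  have [measurable]: "(\<lambda>x. real_of_int (fst (K x))) \<in> borel_measurable M" "(\<lambda>x. snd (K x)) \<in> borel_measurable M"
    using measurable_compose[OF measurable_compose[OF assms(1) measurable_fst], of real_of_int borel]
      measurable_compose[OF assms(1) measurable_snd] by simp_all
  show ?thesis unfolding phase_def using assms(2,3) by measurable
qed

lemma measurable_symb [measurable (raw)]:
  assumes "K \<in> measurable M freq"
  shows "(\<lambda>x. symb w (K x)) \<in> borel_measurable M"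
proof -
  have [measurable]: "(\<lambda>x. w (fst (K x))) \<in> borel_measurable M" "(\<lambda>x. snd (K x)) \<in> borel_measurable M"
    using measurable_compose[OF measurable_compose[OF assms measurable_fst], of w borel]
      measurable_compose[OF assms measurable_snd] by simp_all
  show ?thesis unfolding symb_def by measurable
qed

lemma measurable_ext [measurable (raw)]:
  assumes [measurable]: "T \<in> borel_measurable M" "Z \<in> measurable M cylinder"
  assumes [measurable]: "(\<lambda>(x, k). g x k) \<in> borel_measurable (M \<Otimes>\<^sub>M freq)"
  shows "(\<lambda>x. ext w (g x) (T x) (Z x)) \<in> borel_measurable M"
  unfolding ext_def by (rule freq.borel_measurable_lebesgue_integral) measurable

lemma finite_measure_gauss: "0 < a \<Longrightarrow> finite_measure (gauss a)"
  using nn_integral_gaussian[of a 0]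
  by (intro finite_measureI) (simp add: gauss_def emeasure_density)

lemma nn_integral_gauss:
  assumes [measurable]: "f \<in> borel_measurable borel"
  shows "(\<integral>\<^sup>+y. f y \<partial>gauss a) = (\<integral>\<^sup>+y. ennreal (exp (- (a * y\<^sup>2) / 2)) * f y \<partial>lborel)"
  unfolding gauss_def by (subst nn_integral_density) auto

lemma gauss_fourier:
  assumes "0 < a"
  shows "(\<integral>y. cis (y * s) \<partial>gauss a) = complex_of_real (sqrt (2 * pi / a) * exp (- ((1 / a) * s\<^sup>2) / 2))"
proof -
  have "(\<integral>y. cis (y * s) \<partial>gauss a) = (\<integral>y. exp (- (a * y\<^sup>2) / 2) *\<^sub>R cis (y * s) \<partial>lborel)"
    unfolding gauss_def by (subst integral_density) auto
  also have "\<dots> = (\<integral>y. cis (y * s) * complex_of_real (exp (- (a * y\<^sup>2) / 2)) \<partial>lborel)"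
    by (simp add: scaleR_conv_of_real mult.commute)
  finally show ?thesis
    unfolding gaussian_fourier[OF assms] by simp
qed

lemma has_vector_derivative_cis [derivative_intros]:
  "((\<lambda>x. cis (c * x)) has_vector_derivative (\<i> * complex_of_real c * cis (c * x))) (at x within S)"
proof -
  have "((\<lambda>z. exp (\<i> * complex_of_real c * z)) has_field_derivative (\<i> * complex_of_real c * exp (\<i> * complex_of_real c * complex_of_real x))) (at (complex_of_real x))"
    by (auto intro!: derivative_eq_intros)
  from has_vector_derivative_real_field[OF this, of S] show ?thesis
    by (simp add: cis_conv_exp mult_ac)
qed

lemma torus_fourier: "(\<integral>x. cis (of_int n * x) \<partial>torus) = (if n = 0 then complex_of_real (2 * pi) else 0)"
proof -
  have "(\<integral>x. cis (of_int n * x) \<partial>torus) = (\<integral>x. indicator {0..<2 * pi} x *\<^sub>R cis (of_int n * x) \<partial>lborel)"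
    unfolding torus_def by (subst integral_restrict_space) auto
  \<comment> \<open>Closing the fundamental domain adds a null set and makes the fundamental theorem
    of calculus applicable.\<close>
  also have "\<dots> = (\<integral>x. indicator {0..2 * pi} x *\<^sub>R cis (of_int n * x) \<partial>lborel)"
  proof (rule integral_cong_AE)
    show "AE x in lborel. indicator {0..<2 * pi} x *\<^sub>R cis (of_int n * x) = indicator {0..2 * pi} x *\<^sub>R cis (of_int n * x)"
      using AE_lborel_singleton[of "2 * pi"] by eventually_elim (auto simp: indicator_def)
  qed auto
  also have "\<dots> = (if n = 0 then complex_of_real (2 * pi) else 0)"
  proof (cases "n = 0")
    case True
    then show ?thesis by (simp add: scaleR_conv_of_real)
  next
    case False
    let ?F = "\<lambda>x. (1 / (\<i> * of_int n)) * cis (of_int n * x)"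
    have "(\<integral>x. indicator {0..2 * pi} x *\<^sub>R cis (of_int n * x) \<partial>lborel) = ?F (2 * pi) - ?F 0"
    proof (rule integral_FTC_atLeastAtMost)
      show "(?F has_vector_derivative cis (of_int n * x)) (at x within {0..2 * pi})" for x
        using has_vector_derivative_mult_right[OF has_vector_derivative_cis[of "of_int n" x "{0..2 * pi}"], of "1 / (\<i> * of_int n)"] False
        by simp
    qed (auto intro!: continuous_intros)
    also have "cis (of_int n * (2 * pi)) = 1"
      by (rule cis_multiple_2pi[of "of_int n", simplified mult.commute[of "2 * pi"]]) simp
    finally show ?thesis using False by simp
  qed
  finally show ?thesis .
qed

lemma integral_pair_product:
  fixes f :: "'a \<Rightarrow> complex" and g :: "'b \<Rightarrow> complex"
  assumes "sigma_finite_measure M" "sigma_finite_measure N"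
    and f: "integrable M f" and g: "integrable N g"
  shows "integrable (M \<Otimes>\<^sub>M N) (\<lambda>z. f (fst z) * g (snd z))"
    and "(\<integral>z. f (fst z) * g (snd z) \<partial>(M \<Otimes>\<^sub>M N)) = integral\<^sup>L M f * integral\<^sup>L N g"
proof -
  interpret M: sigma_finite_measure M by fact
  interpret N: sigma_finite_measure N by fact
  interpret pair_sigma_finite M N ..
  note [measurable] = borel_measurable_integrable[OF f] borel_measurable_integrable[OF g]
  show i: "integrable (M \<Otimes>\<^sub>M N) (\<lambda>z. f (fst z) * g (snd z))"
    by (rule Fubini_integrable) (use f g in \<open>auto simp: norm_mult\<close>)
  show "(\<integral>z. f (fst z) * g (snd z) \<partial>(M \<Otimes>\<^sub>M N)) = integral\<^sup>L M f * integral\<^sup>L N g"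
    using integral_fst'[OF i] by simp
qed

lemma integrable_cis_finite:
  "finite_measure M \<Longrightarrow> f \<in> borel_measurable M \<Longrightarrow> integrable M (\<lambda>x. cis (f x))"
  by (rule finite_measure.integrable_const_bound[where B=1]) auto

lemma sigma_finite_gauss: "0 < a \<Longrightarrow> sigma_finite_measure (gauss a)"
  using finite_measure_gauss finite_measure.axioms(1) by blast

lemma finite_measure_pair:
  assumes "finite_measure M" "finite_measure N"
  shows "finite_measure (M \<Otimes>\<^sub>M N)"
proof -
  interpret M: finite_measure M by fact
  interpret N: finite_measure N by fact
  show ?thesis
    by (intro finite_measureI) (simp add: space_pair_measure N.emeasure_pair_measure_Times ennreal_mult_eq_top_iff)
qed

lemma finite_torus_gauss: "0 < \<delta> \<Longrightarrow> finite_measure (torus \<Otimes>\<^sub>M gauss \<delta>)"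
  by (intro finite_measure_pair finite_measure_gauss torus.finite_measure_axioms)

lemma torus_gauss_fourier:
  assumes d: "0 < \<delta>"
  shows "(\<integral>z. cis (of_int n * fst z + snd z * s) \<partial>(torus \<Otimes>\<^sub>M gauss \<delta>))
    = complex_of_real ((if n = 0 then 2 * pi else 0) * (sqrt (2 * pi / \<delta>) * exp (- ((1 / \<delta>) * s\<^sup>2) / 2)))"
proof -
  have "(\<integral>z. cis (of_int n * fst z + snd z * s) \<partial>(torus \<Otimes>\<^sub>M gauss \<delta>))
      = (\<integral>z. cis (of_int n * fst z) * cis (snd z * s) \<partial>(torus \<Otimes>\<^sub>M gauss \<delta>))"
    by (simp add: cis_mult)
  also have "\<dots> = (\<integral>x. cis (of_int n * x) \<partial>torus) * (\<integral>y. cis (y * s) \<partial>gauss \<delta>)"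
    by (rule integral_pair_product(2)[of torus "gauss \<delta>" "\<lambda>x. cis (of_int n * x)" "\<lambda>y. cis (y * s)"])
      (auto intro!: borel_measurable_torusI sigma_finite_gauss d integrable_cis_finite finite_measure_gauss torus.finite_measure_axioms torus.sigma_finite_measure_axioms)
  finally show ?thesis
    by (simp add: torus_fourier gauss_fourier[OF d])
qed

lemma nn_integral_torus_gauss:
  assumes d: "0 < \<delta>" and F[measurable]: "F \<in> borel_measurable cylinder"
  shows "(\<integral>\<^sup>+z. F z \<partial>(torus \<Otimes>\<^sub>M gauss \<delta>)) = (\<integral>\<^sup>+z. ennreal (exp (- (\<delta> * (snd z)\<^sup>2) / 2)) * F z \<partial>cylinder)"
proof -
  interpret G: sigma_finite_measure "gauss \<delta>" by (rule sigma_finite_gauss[OF d])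
  have F'[measurable]: "F \<in> borel_measurable (torus \<Otimes>\<^sub>M lborel)"
    using F by (simp add: cylinder_def)
  have [measurable]: "F \<in> borel_measurable (torus \<Otimes>\<^sub>M gauss \<delta>)"
    using F' by (subst measurable_cong_sets[OF sets_pair_measure_cong[OF refl] refl]) (auto simp: )
  have sl: "(\<lambda>y. F (x, y)) \<in> borel_measurable borel" if "x \<in> space torus" for x
    using measurable_Pair2[OF F' that] by simp
  have "(\<integral>\<^sup>+z. F z \<partial>(torus \<Otimes>\<^sub>M gauss \<delta>)) = (\<integral>\<^sup>+x. (\<integral>\<^sup>+y. F (x, y) \<partial>gauss \<delta>) \<partial>torus)"
    by (rule G.nn_integral_fst[symmetric]) measurable
  also have "\<dots> = (\<integral>\<^sup>+x. (\<integral>\<^sup>+y. ennreal (exp (- (\<delta> * y\<^sup>2) / 2)) * F (x, y) \<partial>lborel) \<partial>torus)"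
    by (intro nn_integral_cong nn_integral_gauss sl)
  also have "\<dots> = (\<integral>\<^sup>+z. ennreal (exp (- (\<delta> * (snd z)\<^sup>2) / 2)) * F z \<partial>cylinder)"
    unfolding cylinder_def
    using lborel.nn_integral_fst[of "\<lambda>z. ennreal (exp (- (\<delta> * (snd z)\<^sup>2) / 2)) * F z" torus] by simp
  finally show ?thesis .
qed

text \<open>Fatou's lemma along \<delta> = 1 / (m + 1): the weights tend to 1 pointwise, so a bound
  that is uniform in \<delta> survives without weight.\<close>

lemma cylinder_gauss_limit:
  assumes F[measurable]: "F \<in> borel_measurable cylinder"
    and le: "\<And>\<delta>. 0 < \<delta> \<Longrightarrow> (\<integral>\<^sup>+z. F z \<partial>(torus \<Otimes>\<^sub>M gauss \<delta>)) \<le> C"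
  shows "(\<integral>\<^sup>+z. F z \<partial>cylinder) \<le> C"
proof -
  let ?e = "\<lambda>m z. ennreal (exp (- (1 / real (Suc m) * (snd z)\<^sup>2) / 2)) * F z"
  have lim: "(\<lambda>m. ?e m z) \<longlonglongrightarrow> F z" for z :: "real \<times> real"
  proof -
    have "(\<lambda>m. 1 / real (Suc m)) \<longlonglongrightarrow> 0"
      by (rule LIMSEQ_Suc[OF lim_1_over_n])
    from tendsto_mult_right[OF this, of "(snd z)\<^sup>2"]
    have "(\<lambda>m. exp (- (1 / real (Suc m) * (snd z)\<^sup>2) / 2)) \<longlonglongrightarrow> exp (- 0 / 2)"
      by (intro tendsto_intros) simp_all
    then have "(\<lambda>m. ennreal (exp (- (1 / real (Suc m) * (snd z)\<^sup>2) / 2))) \<longlonglongrightarrow> ennreal 1"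
      by (intro tendsto_ennrealI) simp
    from ennreal_tendsto_cmult[OF _ this, of "F z"] show ?thesis
      by (cases "F z = \<top>") (auto simp: mult.commute ennreal_mult_top ennreal_top_mult less_top)
  qed
  have "(\<integral>\<^sup>+z. F z \<partial>cylinder) = (\<integral>\<^sup>+z. liminf (\<lambda>m. ?e m z) \<partial>cylinder)"
    by (intro nn_integral_cong) (metis lim lim_imp_Liminf sequentially_bot)
  also have "\<dots> \<le> liminf (\<lambda>m. \<integral>\<^sup>+z. ?e m z \<partial>cylinder)"
    by (rule nn_integral_liminf) measurable
  also have "\<dots> \<le> C"
  proof -
    have "(\<integral>\<^sup>+z. ?e m z \<partial>cylinder) \<le> C" for m
      using le[of "1 / real (Suc m)"] nn_integral_torus_gauss[OF _ F, of "1 / real (Suc m)"] by simp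
    then have "liminf (\<lambda>m. \<integral>\<^sup>+z. ?e m z \<partial>cylinder) \<le> liminf (\<lambda>m::nat. C)"
      by (intro Liminf_mono) simp
    then show ?thesis by (simp add: Liminf_const)
  qed
  finally show ?thesis .
qed

text \<open>One half of Plancherel, from Schur's test with a weight in y. The kernel vanishes unless
  the torus frequencies agree and is a Gaussian in the difference of the line frequencies; its
  integral is 2 pi sqrt(2 pi / \<delta>) sqrt(2 pi \<delta>) = 4 pi^2, independent of
  \<delta>.\<close>

lemma ext_L2_le:
  assumes g: "integrable freq g"
  shows "(\<integral>\<^sup>+z. ennreal ((norm (ext w g t z))\<^sup>2) \<partial>cylinder) \<le> ennreal (4 * pi\<^sup>2) * (\<integral>\<^sup>+k. ennreal ((norm (g k))\<^sup>2) \<partial>freq)"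
proof (rule cylinder_gauss_limit)
  note [measurable] = borel_measurable_integrable[OF g]
  show "(\<lambda>z. ennreal ((norm (ext w g t z))\<^sup>2)) \<in> borel_measurable cylinder"
    by measurable
  fix \<delta> :: real assume d: "0 < \<delta>"
  show "(\<integral>\<^sup>+z. ennreal ((norm (ext w g t z))\<^sup>2) \<partial>(torus \<Otimes>\<^sub>M gauss \<delta>)) \<le> ennreal (4 * pi\<^sup>2) * (\<integral>\<^sup>+k. ennreal ((norm (g k))\<^sup>2) \<partial>freq)"
    unfolding ext_def
  proof (rule schur[OF freq.sigma_finite_measure_axioms finite_torus_gauss[OF d] _ g])
    show "(\<lambda>(k, z). phase k z - t * symb w k) \<in> borel_measurable (freq \<Otimes>\<^sub>M (torus \<Otimes>\<^sub>M gauss \<delta>))"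
      by measurable
    fix k :: "int \<times> real"
    have 1: "norm (\<integral>z. cis (phase k z - t * symb w k - (phase k' z - t * symb w k')) \<partial>(torus \<Otimes>\<^sub>M gauss \<delta>))
       = (if fst k' = fst k then 2 * pi else 0) * (sqrt (2 * pi / \<delta>) * exp (- ((1 / \<delta>) * (snd k' - snd k)\<^sup>2) / 2))" for k'
    proof -
      have "cis (phase k z - t * symb w k - (phase k' z - t * symb w k'))
        = cis (t * (symb w k' - symb w k)) * cis (of_int (fst k - fst k') * fst z + snd z * (snd k - snd k'))" for z
        by (simp add: cis_mult phase_def algebra_simps)
      then have "(\<integral>z. cis (phase k z - t * symb w k - (phase k' z - t * symb w k')) \<partial>(torus \<Otimes>\<^sub>M gauss \<delta>))
        = cis (t * (symb w k' - symb w k)) * (\<integral>z. cis (of_int (fst k - fst k') * fst z + snd z * (snd k - snd k')) \<partial>(torus \<Otimes>\<^sub>M gauss \<delta>))"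
        by simp
      then show ?thesis
        unfolding torus_gauss_fourier[OF d] using d
        by (auto simp: norm_mult power2_commute[of "snd k"])
    qed
    have "(\<integral>\<^sup>+k'. ennreal (norm (\<integral>z. cis (phase k z - t * symb w k - (phase k' z - t * symb w k')) \<partial>(torus \<Otimes>\<^sub>M gauss \<delta>))) \<partial>freq)
      = (\<integral>\<^sup>+n. (\<integral>\<^sup>+\<xi>. ennreal ((if n = fst k then 2 * pi else 0) * (sqrt (2 * pi / \<delta>) * exp (- ((1 / \<delta>) * (\<xi> - snd k)\<^sup>2) / 2))) \<partial>lborel) \<partial>count_space UNIV)"
      unfolding 1
      using lborel.nn_integral_fst[of "\<lambda>k'. ennreal ((if fst k' = fst k then 2 * pi else 0) * (sqrt (2 * pi / \<delta>) * exp (- ((1 / \<delta>) * (snd k' - snd k)\<^sup>2) / 2)))" "count_space UNIV", symmetric]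
      by simp
    also have "\<dots> = (\<integral>\<^sup>+n. (ennreal (2 * pi * sqrt (2 * pi / \<delta>)) * (\<integral>\<^sup>+\<xi>. ennreal (exp (- ((1 / \<delta>) * (\<xi> - snd k)\<^sup>2) / 2)) \<partial>lborel)) * indicator {fst k} n \<partial>count_space UNIV)"
    proof (intro nn_integral_cong)
      fix n :: int
      show "(\<integral>\<^sup>+\<xi>. ennreal ((if n = fst k then 2 * pi else 0) * (sqrt (2 * pi / \<delta>) * exp (- ((1 / \<delta>) * (\<xi> - snd k)\<^sup>2) / 2))) \<partial>lborel)
        = (ennreal (2 * pi * sqrt (2 * pi / \<delta>)) * (\<integral>\<^sup>+\<xi>. ennreal (exp (- ((1 / \<delta>) * (\<xi> - snd k)\<^sup>2) / 2)) \<partial>lborel)) * indicator {fst k} n"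
        using d by (subst nn_integral_cmult[symmetric]) (auto simp: ennreal_mult[symmetric] mult.assoc)
    qed
    also have "\<dots> = ennreal (2 * pi * sqrt (2 * pi / \<delta>)) * ennreal (sqrt (2 * pi / (1 / \<delta>)))"
      using d by (subst nn_integral_gaussian, simp, simp)
    also have "\<dots> = ennreal (4 * pi\<^sup>2)"
      using d by (simp add: ennreal_mult[symmetric] real_sqrt_mult real_sqrt_divide power2_eq_square field_simps)
    finally show "(\<integral>\<^sup>+k'. ennreal (norm (\<integral>z. cis (phase k z - t * symb w k - (phase k' z - t * symb w k')) \<partial>(torus \<Otimes>\<^sub>M gauss \<delta>))) \<partial>freq) \<le> ennreal (4 * pi\<^sup>2)"
      by simp
  qed
qed

lemma nn_integral_gauss_spacetime:
  assumes d: "0 < \<delta>" and F[measurable]: "F \<in> borel_measurable (lborel \<Otimes>\<^sub>M cylinder)"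
  shows "(\<integral>\<^sup>+p. F p \<partial>(gauss 1 \<Otimes>\<^sub>M (torus \<Otimes>\<^sub>M gauss \<delta>)))
    = (\<integral>\<^sup>+z. (\<integral>\<^sup>+t. ennreal (exp (- t\<^sup>2 / 2)) * F (t, z) \<partial>lborel) \<partial>(torus \<Otimes>\<^sub>M gauss \<delta>))"
proof -
  interpret T: sigma_finite_measure "gauss 1" by (rule sigma_finite_gauss) simp
  interpret Z: finite_measure "torus \<Otimes>\<^sub>M gauss \<delta>" by (rule finite_torus_gauss[OF d])
  interpret pair_sigma_finite "gauss 1" "torus \<Otimes>\<^sub>M gauss \<delta>" ..
  have s: "sets (torus \<Otimes>\<^sub>M gauss \<delta>) = sets cylinder"
    unfolding cylinder_def by (intro sets_pair_measure_cong) auto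
  have sF: "sets (gauss 1 \<Otimes>\<^sub>M (torus \<Otimes>\<^sub>M gauss \<delta>)) = sets (lborel \<Otimes>\<^sub>M cylinder)"
    by (intro sets_pair_measure_cong s) auto
  have F'[measurable]: "F \<in> borel_measurable (gauss 1 \<Otimes>\<^sub>M (torus \<Otimes>\<^sub>M gauss \<delta>))"
    using F by (simp cong: measurable_cong_sets add: measurable_cong_sets[OF sF refl])
  have sl: "(\<lambda>t. F (t, z)) \<in> borel_measurable borel" if "z \<in> space cylinder" for z
    using measurable_Pair1[OF F that] by simp
  have "(\<integral>\<^sup>+p. F p \<partial>(gauss 1 \<Otimes>\<^sub>M (torus \<Otimes>\<^sub>M gauss \<delta>))) = (\<integral>\<^sup>+z. (\<integral>\<^sup>+t. F (t, z) \<partial>gauss 1) \<partial>(torus \<Otimes>\<^sub>M gauss \<delta>))"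
    by (rule nn_integral_snd[symmetric]) (rule F')
  also have "\<dots> = (\<integral>\<^sup>+z. (\<integral>\<^sup>+t. ennreal (exp (- t\<^sup>2 / 2)) * F (t, z) \<partial>lborel) \<partial>(torus \<Otimes>\<^sub>M gauss \<delta>))"
    using sets_eq_imp_space_eq[OF s] by (intro nn_integral_cong) (simp add: nn_integral_gauss sl)
  finally show ?thesis .
qed

context bounded_counting
begin

text \<open>The indicator determines the second torus frequency, and the second line frequency is
  traded for the total s = \<xi> + \<xi>'. For fixed s what remains is exactly the quantity in
  \<open>counting\<close>, and the Gaussian in s integrates to sqrt(2 pi \<delta>).\<close>

lemma nn_integral_collisions:
  assumes d: "0 < \<delta>"
  shows "(\<integral>\<^sup>+K. ennreal (exp (- (A - symb w (fst K) - symb w (snd K))\<^sup>2 / 2)) *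
      (indicator {N} (fst (fst K) + fst (snd K)) *
        ennreal (exp (- ((1 / \<delta>) * (snd (fst K) + snd (snd K) - s0)\<^sup>2) / 2))) \<partial>(freq \<Otimes>\<^sub>M freq))
    \<le> ennreal (B * sqrt (2 * pi * \<delta>))" (is "(\<integral>\<^sup>+K. ?F K \<partial>(freq \<Otimes>\<^sub>M freq)) \<le> _")
proof -
  let ?h = "\<lambda>s. ennreal (exp (- ((1 / \<delta>) * (s - s0)\<^sup>2) / 2))"
  let ?e = "\<lambda>n s \<xi>. ennreal (exp (- (A - w n - w (N - n) - \<xi>\<^sup>2 - (s - \<xi>)\<^sup>2)\<^sup>2 / 2))"
  have Fm[measurable]: "?F \<in> borel_measurable (freq \<Otimes>\<^sub>M freq)" by measurable
  have inner: "(\<integral>\<^sup>+k'. ?F (k, k') \<partial>freq) = (\<integral>\<^sup>+s. ?h s * ?e (fst k) s (snd k) \<partial>lborel)" for k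
  proof -
    have [measurable]: "(\<lambda>k'. ?F (k, k')) \<in> borel_measurable freq"
      using measurable_Pair2[OF Fm, of k] by (simp add: space_pair_measure)
    have "(\<integral>\<^sup>+k'. ?F (k, k') \<partial>freq) = (\<integral>\<^sup>+n'. (\<integral>\<^sup>+\<xi>'. ?F (k, (n', \<xi>')) \<partial>lborel) \<partial>count_space UNIV)"
      by (rule lborel.nn_integral_fst[symmetric]) measurable
    also have "\<dots> = (\<integral>\<^sup>+n'. (\<integral>\<^sup>+\<xi>'. ?F (k, (N - fst k, \<xi>')) \<partial>lborel) * indicator {N - fst k} n' \<partial>count_space UNIV)"
      by (intro nn_integral_cong) (auto simp: indicator_def)
    also have "\<dots> = (\<integral>\<^sup>+\<xi>'. ?F (k, (N - fst k, \<xi>')) \<partial>lborel)"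
      by simp
    also have "\<dots> = ennreal \<bar>1\<bar> * (\<integral>\<^sup>+s. ?F (k, (N - fst k, - snd k + 1 * s)) \<partial>lborel)"
      by (rule nn_integral_real_affine) (simp_all add: symb_def)
    also have "\<dots> = (\<integral>\<^sup>+s. ?h s * ?e (fst k) s (snd k) \<partial>lborel)"
      by (simp add: symb_def algebra_simps)
    finally show ?thesis .
  qed
  have "(\<integral>\<^sup>+K. ?F K \<partial>(freq \<Otimes>\<^sub>M freq)) = (\<integral>\<^sup>+k. (\<integral>\<^sup>+k'. ?F (k, k') \<partial>freq) \<partial>freq)"
    by (rule freq.nn_integral_fst[symmetric]) measurable
  also have "\<dots> = (\<integral>\<^sup>+k. (\<integral>\<^sup>+s. ?h s * ?e (fst k) s (snd k) \<partial>lborel) \<partial>freq)"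
    unfolding inner ..
  also have "\<dots> = (\<integral>\<^sup>+s. (\<integral>\<^sup>+k. ?h s * ?e (fst k) s (snd k) \<partial>freq) \<partial>lborel)"
  proof -
    interpret FL: pair_sigma_finite freq "lborel :: real measure" ..
    have w: "(\<lambda>x. v (fst (fst x))) \<in> borel_measurable (freq \<Otimes>\<^sub>M (lborel :: real measure))" for v :: "int \<Rightarrow> real"
      by (rule measurable_compose[where f="\<lambda>x. fst (fst x)" and N="count_space UNIV"]) simp_all
    note [measurable] = w[of w] w[of "\<lambda>n. w (N - n)"]
    show ?thesis by (rule FL.Fubini'[symmetric]) measurable
  qed
  also have "\<dots> = (\<integral>\<^sup>+s. ?h s * (\<integral>\<^sup>+n. (\<integral>\<^sup>+\<xi>. ?e n s \<xi> \<partial>lborel) \<partial>count_space UNIV) \<partial>lborel)"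
  proof (intro nn_integral_cong)
    fix s
    have w: "(\<lambda>x. v (fst x)) \<in> borel_measurable freq" for v :: "int \<Rightarrow> real"
      by (rule measurable_compose[where f=fst and N="count_space UNIV"]) simp_all
    note [measurable] = w[of w] w[of "\<lambda>n. w (N - n)"]
    have m: "(\<lambda>k. ?e (fst k) s (snd k)) \<in> borel_measurable freq" by measurable
    have "(\<integral>\<^sup>+k. ?h s * ?e (fst k) s (snd k) \<partial>freq) = ?h s * (\<integral>\<^sup>+k. ?e (fst k) s (snd k) \<partial>freq)"
      by (rule nn_integral_cmult[OF m])
    then show "(\<integral>\<^sup>+k. ?h s * ?e (fst k) s (snd k) \<partial>freq) = ?h s * (\<integral>\<^sup>+n. (\<integral>\<^sup>+\<xi>. ?e n s \<xi> \<partial>lborel) \<partial>count_space UNIV)"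
      using lborel.nn_integral_fst[OF m] by simp
  qed
  also have "\<dots> \<le> (\<integral>\<^sup>+s. ?h s * ennreal B \<partial>lborel)"
    by (intro nn_integral_mono mult_left_mono counting) simp
  also have "\<dots> = (\<integral>\<^sup>+s. ?h s \<partial>lborel) * ennreal B"
    by (rule nn_integral_multc) measurable
  also have "\<dots> = ennreal (sqrt (2 * pi / (1 / \<delta>))) * ennreal B"
    using d by (subst nn_integral_gaussian) auto
  also have "\<dots> = ennreal (B * sqrt (2 * pi * \<delta>))"
    using d B_pos by (simp add: ennreal_mult[symmetric] mult.commute)
  finally show ?thesis .
qed

text \<open>The product of the masses sqrt(2 pi) and 2 pi sqrt(2 pi / \<delta>) of the weights in
  time and space with the bound B sqrt(2 pi \<delta>) for collisions. The parameter \<delta>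
  cancels.\<close>

definition strichartz_const :: real where
  "strichartz_const = 4 * pi\<^sup>2 * sqrt (2 * pi) * B"

lemma strichartz_weighted:
  assumes d: "0 < \<delta>" and g: "integrable freq g"
  shows "(\<integral>\<^sup>+p. ennreal ((norm (ext w g (fst p) (snd p))) ^ 4) \<partial>(gauss 1 \<Otimes>\<^sub>M (torus \<Otimes>\<^sub>M gauss \<delta>)))
    \<le> ennreal strichartz_const * (\<integral>\<^sup>+k. ennreal ((norm (g k))\<^sup>2) \<partial>freq)\<^sup>2"
proof -
  let ?N = "gauss 1 \<Otimes>\<^sub>M (torus \<Otimes>\<^sub>M gauss \<delta>)"
  have one: "(0::real) < 1" by simp
  have fin: "finite_measure ?N"
    by (intro finite_measure_pair finite_measure_gauss finite_torus_gauss d) simp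
  note [measurable] = borel_measurable_integrable[OF g]
  define Th where "Th K p = (phase (fst K) (snd p) - fst p * symb w (fst K)) + (phase (snd K) (snd p) - fst p * symb w (snd K))"
    for K :: "(int \<times> real) \<times> (int \<times> real)" and p :: "real \<times> real \<times> real"
  let ?G = "\<lambda>K. g (fst K) * g (snd K)"
  have iG: "integrable (freq \<Otimes>\<^sub>M freq) ?G"
    by (intro integral_pair_product(1) g freq.sigma_finite_measure_axioms)
  have sq: "(norm (ext w g (fst p) (snd p))) ^ 4 = (norm (\<integral>K. ?G K * cis (Th K p) \<partial>(freq \<Otimes>\<^sub>M freq)))\<^sup>2" for p
  proof -
    have i: "integrable freq (\<lambda>k. g k * cis (phase k (snd p) - fst p * symb w k))"
      by (rule Bochner_Integration.integrable_bound[OF g]) (auto simp: norm_mult)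
    have "(\<integral>K. ?G K * cis (Th K p) \<partial>(freq \<Otimes>\<^sub>M freq)) = ext w g (fst p) (snd p) * ext w g (fst p) (snd p)"
      unfolding ext_def integral_pair_product(2)[OF freq.sigma_finite_measure_axioms freq.sigma_finite_measure_axioms i i, symmetric]
      by (intro Bochner_Integration.integral_cong refl) (simp add: Th_def cis_mult[symmetric] mult_ac)
    then show ?thesis by (simp add: norm_mult power2_eq_square eval_nat_numeral)
  qed
  have "(\<integral>\<^sup>+p. ennreal ((norm (ext w g (fst p) (snd p))) ^ 4) \<partial>?N)
     = (\<integral>\<^sup>+p. ennreal ((norm (\<integral>K. ?G K * cis (Th K p) \<partial>(freq \<Otimes>\<^sub>M freq)))\<^sup>2) \<partial>?N)"
    unfolding sq ..
  also have "\<dots> \<le> ennreal strichartz_const * (\<integral>\<^sup>+K. ennreal ((norm (?G K))\<^sup>2) \<partial>(freq \<Otimes>\<^sub>M freq))"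
  proof (rule schur[OF freq_freq.sigma_finite_measure_axioms fin _ iG])
    show "(\<lambda>(K, p). Th K p) \<in> borel_measurable ((freq \<Otimes>\<^sub>M freq) \<Otimes>\<^sub>M ?N)"
      unfolding Th_def by measurable
    fix K :: "(int \<times> real) \<times> (int \<times> real)"
    let ?A = "symb w (fst K) + symb w (snd K)"
    let ?n = "fst (fst K) + fst (snd K)"
    let ?s = "snd (fst K) + snd (snd K)"
    let ?c = "sqrt (2 * pi) * (2 * pi * sqrt (2 * pi / \<delta>))"
    \<comment> \<open>The kernel factorizes over the three variables: a Gaussian in the difference
      of total energies from t, a Kronecker delta in the total torus frequency from x, and a
      Gaussian in the total line frequency from y.\<close>
    have W: "ennreal (norm (\<integral>p. cis (Th K p - Th K' p) \<partial>?N))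
      = ennreal ?c * (ennreal (exp (- (?A - symb w (fst K') - symb w (snd K'))\<^sup>2 / 2)) *
      (indicator {?n} (fst (fst K') + fst (snd K')) *
        ennreal (exp (- ((1 / \<delta>) * (snd (fst K') + snd (snd K') - ?s)\<^sup>2) / 2))))" for K'
    proof -
      let ?A' = "symb w (fst K') + symb w (snd K')"
      let ?n' = "fst (fst K') + fst (snd K')"
      let ?s' = "snd (fst K') + snd (snd K')"
      have c: "cis (Th K p - Th K' p) = cis (fst p * (?A' - ?A)) * cis (of_int (?n - ?n') * fst (snd p) + snd (snd p) * (?s - ?s'))" for p
        by (simp add: Th_def phase_def cis_mult algebra_simps)
      have "(\<integral>p. cis (Th K p - Th K' p) \<partial>?N) = (\<integral>t. cis (t * (?A' - ?A)) \<partial>gauss 1) * (\<integral>z. cis (of_int (?n - ?n') * fst z + snd z * (?s - ?s')) \<partial>(torus \<Otimes>\<^sub>M gauss \<delta>))"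
        unfolding c
        by (rule integral_pair_product(2)[of "gauss 1" "torus \<Otimes>\<^sub>M gauss \<delta>" "\<lambda>t. cis (t * (?A' - ?A))" "\<lambda>z. cis (of_int (?n - ?n') * fst z + snd z * (?s - ?s'))"])
          (auto intro!: sigma_finite_gauss d integrable_cis_finite finite_measure_gauss finite_torus_gauss finite_measure.axioms(1)[OF finite_torus_gauss])
      also have "\<dots> = complex_of_real (sqrt (2 * pi / 1) * exp (- ((1 / 1) * (?A' - ?A)\<^sup>2) / 2)) *
         complex_of_real ((if ?n - ?n' = 0 then 2 * pi else 0) * (sqrt (2 * pi / \<delta>) * exp (- ((1 / \<delta>) * (?s - ?s')\<^sup>2) / 2)))"
        by (simp only: gauss_fourier[OF one] torus_gauss_fourier[OF d])
      finally have "norm (\<integral>p. cis (Th K p - Th K' p) \<partial>?N) = norm (complex_of_real (sqrt (2 * pi / 1) * exp (- ((1 / 1) * (?A' - ?A)\<^sup>2) / 2)) *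
         complex_of_real ((if ?n - ?n' = 0 then 2 * pi else 0) * (sqrt (2 * pi / \<delta>) * exp (- ((1 / \<delta>) * (?s - ?s')\<^sup>2) / 2))))"
        by (rule arg_cong)
      also have "\<dots> = ?c * (exp (- (?A' - ?A)\<^sup>2 / 2) * ((if ?n = ?n' then 1 else 0) * exp (- ((1 / \<delta>) * (?s - ?s')\<^sup>2) / 2)))"
        using d by (simp only: norm_mult norm_of_real) (auto simp: abs_mult)
      finally have e: "norm (\<integral>p. cis (Th K p - Th K' p) \<partial>?N) = ?c * (exp (- (?A' - ?A)\<^sup>2 / 2) * ((if ?n = ?n' then 1 else 0) * exp (- ((1 / \<delta>) * (?s - ?s')\<^sup>2) / 2)))" .
      have c0: "0 \<le> ?c" using d by simp
      have sw: "(?A' - ?A)\<^sup>2 = (?A - symb w (fst K') - symb w (snd K'))\<^sup>2" "(?s - ?s')\<^sup>2 = (snd (fst K') + snd (snd K') - ?s)\<^sup>2"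
        by (simp_all add: power2_eq_square algebra_simps)
      show ?thesis
        unfolding e sw using c0 by (auto simp: ennreal_mult[symmetric] indicator_def simp del: times_divide_eq_right)
    qed
    have "(\<integral>\<^sup>+K'. ennreal (norm (\<integral>p. cis (Th K p - Th K' p) \<partial>?N)) \<partial>(freq \<Otimes>\<^sub>M freq))
       \<le> ennreal ?c * ennreal (B * sqrt (2 * pi * \<delta>))"
      unfolding W by (subst nn_integral_cmult, measurable, intro mult_left_mono nn_integral_collisions d) simp
    also have "\<dots> = ennreal strichartz_const"
      using d B_pos by (simp add: ennreal_mult[symmetric] strichartz_const_def real_sqrt_mult real_sqrt_divide power2_eq_square field_simps)
    finally show "(\<integral>\<^sup>+K'. ennreal (norm (\<integral>p. cis (Th K p - Th K' p) \<partial>?N)) \<partial>(freq \<Otimes>\<^sub>M freq)) \<le> ennreal strichartz_const" .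
  qed
  also have "(\<integral>\<^sup>+K. ennreal ((norm (?G K))\<^sup>2) \<partial>(freq \<Otimes>\<^sub>M freq)) = (\<integral>\<^sup>+k. ennreal ((norm (g k))\<^sup>2) \<partial>freq)\<^sup>2"
  proof -
    have "(\<integral>\<^sup>+K. ennreal ((norm (?G K))\<^sup>2) \<partial>(freq \<Otimes>\<^sub>M freq))
       = (\<integral>\<^sup>+k. (\<integral>\<^sup>+k'. ennreal ((norm (g k * g k'))\<^sup>2) \<partial>freq) \<partial>freq)"
      using freq.nn_integral_fst[of "\<lambda>K. ennreal ((norm (?G K))\<^sup>2)" freq] by simp
    also have "\<dots> = (\<integral>\<^sup>+k. ennreal ((norm (g k))\<^sup>2) * (\<integral>\<^sup>+k'. ennreal ((norm (g k'))\<^sup>2) \<partial>freq) \<partial>freq)"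
      by (intro nn_integral_cong, subst nn_integral_cmult[symmetric]) (auto simp: norm_mult power_mult_distrib ennreal_mult)
    also have "\<dots> = (\<integral>\<^sup>+k. ennreal ((norm (g k))\<^sup>2) \<partial>freq)\<^sup>2"
      by (subst nn_integral_multc) (auto simp: power2_eq_square)
    finally show ?thesis .
  qed
  finally show ?thesis .
qed

lemma strichartz:
  assumes g: "integrable freq g"
  shows "(\<integral>\<^sup>+t. indicator {- l..l} t * (\<integral>\<^sup>+z. ennreal ((norm (ext w g t z)) ^ 4) \<partial>cylinder) \<partial>lborel)
    \<le> ennreal (exp (l\<^sup>2 / 2) * strichartz_const) * (\<integral>\<^sup>+k. ennreal ((norm (g k))\<^sup>2) \<partial>freq)\<^sup>2"
proof -
  note [measurable] = borel_measurable_integrable[OF g]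
  interpret LC: pair_sigma_finite "lborel :: real measure" cylinder ..
  let ?F = "\<lambda>t z. ennreal ((norm (ext w g t z)) ^ 4)"
  let ?H = "\<lambda>z. (\<integral>\<^sup>+t. indicator {- l..l} t * ?F t z \<partial>lborel)"
  let ?S = "ennreal strichartz_const * (\<integral>\<^sup>+k. ennreal ((norm (g k))\<^sup>2) \<partial>freq)\<^sup>2"
  have "(\<integral>\<^sup>+t. indicator {- l..l} t * (\<integral>\<^sup>+z. ?F t z \<partial>cylinder) \<partial>lborel) = (\<integral>\<^sup>+t. (\<integral>\<^sup>+z. indicator {- l..l} t * ?F t z \<partial>cylinder) \<partial>lborel)"
    by (intro nn_integral_cong nn_integral_cmult[symmetric]) measurable
  \<comment> \<open>With the time integral inside, the weight in y can be removed from a function of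
    position alone.\<close>
  also have "\<dots> = (\<integral>\<^sup>+z. ?H z \<partial>cylinder)"
    by (rule LC.Fubini'[symmetric]) measurable
  also have "\<dots> \<le> ennreal (exp (l\<^sup>2 / 2)) * ?S"
  proof (rule cylinder_gauss_limit)
    show "?H \<in> borel_measurable cylinder" by measurable
    fix \<delta> :: real assume d: "0 < \<delta>"
    have s: "sets (torus \<Otimes>\<^sub>M gauss \<delta>) = sets cylinder"
      unfolding cylinder_def by (intro sets_pair_measure_cong) auto
    let ?K = "\<lambda>z. (\<integral>\<^sup>+t. ennreal (exp (- t\<^sup>2 / 2)) * ?F t z \<partial>lborel)"
    have "?H z \<le> ennreal (exp (l\<^sup>2 / 2)) * ?K z" if "z \<in> space cylinder" for z
    proof -
      have [measurable]: "(\<lambda>t. ?F t z) \<in> borel_measurable borel"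
        using that by measurable
      have "?H z \<le> (\<integral>\<^sup>+t. ennreal (exp (l\<^sup>2 / 2)) * (ennreal (exp (- t\<^sup>2 / 2)) * ?F t z) \<partial>lborel)"
      proof (intro nn_integral_mono)
        fix t :: real
        show "indicator {- l..l} t * ?F t z \<le> ennreal (exp (l\<^sup>2 / 2)) * (ennreal (exp (- t\<^sup>2 / 2)) * ?F t z)"
        proof (cases "t \<in> {- l..l}")
          case True
          then have "\<bar>t\<bar> \<le> \<bar>l\<bar>" by auto
          then have "t\<^sup>2 \<le> l\<^sup>2" using abs_le_square_iff by blast
          then have "1 \<le> exp (l\<^sup>2 / 2 + - t\<^sup>2 / 2)" by simp
          then have "1 \<le> exp (l\<^sup>2 / 2) * exp (- t\<^sup>2 / 2)" by (simp only: exp_add)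
          then have "ennreal 1 \<le> ennreal (exp (l\<^sup>2 / 2)) * ennreal (exp (- t\<^sup>2 / 2))"
            by (simp only: ennreal_mult[symmetric] exp_ge_zero ennreal_leI)
          from mult_right_mono[OF this, of "?F t z"] show ?thesis
            using True by (simp add: mult.assoc)
        qed simp
      qed
      then show ?thesis by (simp add: nn_integral_cmult)
    qed
    then have "(\<integral>\<^sup>+z. ?H z \<partial>(torus \<Otimes>\<^sub>M gauss \<delta>)) \<le> (\<integral>\<^sup>+z. ennreal (exp (l\<^sup>2 / 2)) * ?K z \<partial>(torus \<Otimes>\<^sub>M gauss \<delta>))"
      using sets_eq_imp_space_eq[OF s] by (intro nn_integral_mono) auto
    also have "\<dots> = ennreal (exp (l\<^sup>2 / 2)) * (\<integral>\<^sup>+z. ?K z \<partial>(torus \<Otimes>\<^sub>M gauss \<delta>))"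
    proof (rule nn_integral_cmult)
      have "?K \<in> borel_measurable cylinder" by measurable
      then show "?K \<in> borel_measurable (torus \<Otimes>\<^sub>M gauss \<delta>)"
        by (simp only: measurable_cong_sets[OF s refl])
    qed
    also have "(\<integral>\<^sup>+z. ?K z \<partial>(torus \<Otimes>\<^sub>M gauss \<delta>)) = (\<integral>\<^sup>+p. ?F (fst p) (snd p) \<partial>(gauss 1 \<Otimes>\<^sub>M (torus \<Otimes>\<^sub>M gauss \<delta>)))"
      using nn_integral_gauss_spacetime[OF d, of "\<lambda>p. ?F (fst p) (snd p)"] by simp
    also have "\<dots> \<le> ?S"
      by (rule strichartz_weighted[OF d g])
    finally show "(\<integral>\<^sup>+z. ?H z \<partial>(torus \<Otimes>\<^sub>M gauss \<delta>)) \<le> ennreal (exp (l\<^sup>2 / 2)) * ?S"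
      by (simp add: mult_left_mono)
  qed
  finally show ?thesis
    using B_pos by (simp add: ennreal_mult strichartz_const_def mult.assoc)
qed

end

section \<open>Fourier transforms of test functions on the line\<close>

lemma integrable_mult_cis [simp]:
  fixes g :: "'a \<Rightarrow> complex"
  assumes "integrable M g" "f \<in> borel_measurable M"
  shows "integrable M (\<lambda>x. g x * cis (f x))"
  by (rule Bochner_Integration.integrable_bound[OF assms(1)])
    (use assms borel_measurable_integrable[OF assms(1)] in \<open>auto simp: norm_mult\<close>)

lemma measurable_line_fourier [measurable (raw)]:
  assumes [measurable]: "(\<lambda>(x, \<xi>). h x \<xi>) \<in> borel_measurable (M \<Otimes>\<^sub>M lborel)" "Y \<in> borel_measurable M"
  shows "(\<lambda>x. line_fourier (h x) (Y x)) \<in> borel_measurable M"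
  unfolding line_fourier_def by (rule lborel.borel_measurable_lebesgue_integral) measurable

lemma norm_line_fourier_le: "norm (line_fourier h y) \<le> (\<integral>\<xi>. norm (h \<xi>) \<partial>lborel)"
  unfolding line_fourier_def by (rule norm_phase_integral_le)

lemma measurable_indicator_freq [measurable (raw)]:
  assumes "K \<in> measurable M freq"
  shows "(\<lambda>x. indicator A (fst (K x)) :: 'b :: {zero_neq_one, topological_space}) \<in> borel_measurable M"
  using measurable_compose[OF measurable_compose[OF assms measurable_fst], of "indicator A :: _ \<Rightarrow> 'b" borel] by simp

lemma freq_integral_slice:
  fixes F :: "int \<times> real \<Rightarrow> complex"
  assumes i: "integrable freq (\<lambda>k. indicator {n} (fst k) * F k)"
  shows "(\<integral>k. indicator {n} (fst k) * F k \<partial>freq) = (\<integral>\<xi>. F (n, \<xi>) \<partial>lborel)"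
proof -
  have "(\<integral>k. indicator {n} (fst k) * F k \<partial>freq) = (\<integral>m. (\<integral>\<xi>. indicator {n} m * F (m, \<xi>) \<partial>lborel) \<partial>count_space UNIV)"
    using freq.integral_fst'[OF i] by simp
  also have "\<dots> = (\<Sum>m | m \<in> UNIV \<and> (\<integral>\<xi>. indicator {n} m * F (m, \<xi>) \<partial>lborel) \<noteq> 0. (\<integral>\<xi>. indicator {n} m * F (m, \<xi>) \<partial>lborel))"
    by (rule lebesgue_integral_count_space_finite_support)
      (rule finite_subset[of _ "{n}"], auto simp: indicator_def split: if_splits)
  also have "\<dots> = (\<Sum>m\<in>{n}. (\<integral>\<xi>. indicator {n} m * F (m, \<xi>) \<partial>lborel))"
    by (rule sum.mono_neutral_left) (auto simp: indicator_def split: if_splits)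
  finally show ?thesis by simp
qed

lemma freq_nn_integral_slice:
  assumes [measurable]: "F \<in> borel_measurable freq"
  shows "(\<integral>\<^sup>+k. indicator {n} (fst k) * F k \<partial>freq) = (\<integral>\<^sup>+\<xi>. F (n, \<xi>) \<partial>lborel)"
proof -
  have "(\<integral>\<^sup>+k. indicator {n} (fst k) * F k \<partial>freq) = (\<integral>\<^sup>+m. (\<integral>\<^sup>+\<xi>. indicator {n} m * F (m, \<xi>) \<partial>lborel) \<partial>count_space UNIV)"
    by (subst lborel.nn_integral_fst[symmetric]) auto
  also have "\<dots> = (\<integral>\<^sup>+m. (\<integral>\<^sup>+\<xi>. F (n, \<xi>) \<partial>lborel) * indicator {n} m \<partial>count_space UNIV)"
    by (intro nn_integral_cong) (auto simp: indicator_def)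
  finally show ?thesis by simp
qed

lemma integrable_freq_slice:
  assumes h: "integrable lborel h"
  shows "integrable freq (\<lambda>k. indicator {n} (fst k) * h (snd k) :: complex)"
proof -
  have "integrable (count_space UNIV) (\<lambda>m::int. indicator {n} m *\<^sub>R (1 :: complex))"
    by (intro integrable_scaleR_left integrable_real_indicator) auto
  moreover have "indicator {n} m *\<^sub>R (1 :: complex) = indicator {n} m" for m
    by (simp add: indicator_def)
  ultimately have "integrable (count_space UNIV) (\<lambda>m::int. indicator {n} m :: complex)" by simp
  from integral_pair_product(1)[OF int_count.sigma_finite_measure_axioms lborel.sigma_finite_measure_axioms this h]
  show ?thesis .
qed

lemma cylinder_nn_integral_snd:
  assumes [measurable]: "f \<in> borel_measurable borel"
  shows "(\<integral>\<^sup>+z. f (snd z) \<partial>cylinder) = ennreal (2 * pi) * (\<integral>\<^sup>+y. f y \<partial>lborel)"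
proof -
  have "(\<integral>\<^sup>+z. f (snd z) \<partial>cylinder) = (\<integral>\<^sup>+x. (\<integral>\<^sup>+y. f y \<partial>lborel) \<partial>torus)"
    unfolding cylinder_def by (subst lborel.nn_integral_fst[symmetric]) auto
  also have "\<dots> = ennreal (2 * pi) * (\<integral>\<^sup>+y. f y \<partial>lborel)"
    by (simp add: space_torus torus_def emeasure_restrict_space mult.commute)
  finally show ?thesis .
qed

text \<open>Read off from the estimate on the cylinder by placing \<open>h\<close> at torus
  frequency 0. The reflection accounts for the opposite sign conventions of
  \<open>line_fourier\<close> and \<open>ext\<close>, and a factor 2 pi, the length of the torus,
  cancels.\<close>

lemma line_fourier_L2_le:
  assumes h: "integrable lborel h"
  shows "(\<integral>\<^sup>+y. ennreal ((norm (line_fourier h y))\<^sup>2) \<partial>lborel) \<le> ennreal (2 * pi) * (\<integral>\<^sup>+\<xi>. ennreal ((norm (h \<xi>))\<^sup>2) \<partial>lborel)"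
proof -
  note [measurable] = borel_measurable_integrable[OF h]
  have h': "integrable lborel (\<lambda>\<xi>. h (- \<xi>))"
    using lborel_integrable_real_affine[OF h, of "-1" 0] by simp
  note [measurable] = borel_measurable_integrable[OF h']
  let ?G = "\<lambda>k :: int \<times> real. indicator {0} (fst k) * h (- snd k)"
  have iG: "integrable freq ?G" by (rule integrable_freq_slice[OF h'])
  have e: "ext (\<lambda>_. 0) ?G 0 z = line_fourier h (snd z)" for z
  proof -
    have "ext (\<lambda>_. 0) ?G 0 z = (\<integral>k. indicator {0} (fst k) * (h (- snd k) * cis (phase k z)) \<partial>freq)"
      by (simp add: ext_def mult.assoc)
    also have "\<dots> = (\<integral>\<xi>. h (- \<xi>) * cis (phase (0, \<xi>) z) \<partial>lborel)"
      by (subst freq_integral_slice) (use integrable_mult_cis[OF iG, of "\<lambda>k. phase k z"] in \<open>auto simp: mult.assoc\<close>)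
    also have "\<dots> = \<bar>-1\<bar> *\<^sub>R (\<integral>\<xi>. h (- (0 + -1 * \<xi>)) * cis (phase (0, 0 + -1 * \<xi>) z) \<partial>lborel)"
      by (rule lborel_integral_real_affine) simp
    finally show ?thesis by (simp add: line_fourier_def phase_def mult.commute)
  qed
  have "ennreal (2 * pi) * (\<integral>\<^sup>+y. ennreal ((norm (line_fourier h y))\<^sup>2) \<partial>lborel) = (\<integral>\<^sup>+z. ennreal ((norm (line_fourier h (snd z)))\<^sup>2) \<partial>cylinder)"
    by (rule cylinder_nn_integral_snd[symmetric]) measurable
  also have "\<dots> \<le> ennreal (4 * pi\<^sup>2) * (\<integral>\<^sup>+k. ennreal ((norm (?G k))\<^sup>2) \<partial>freq)"
    using ext_L2_le[OF iG, of "\<lambda>_. 0" 0] unfolding e .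
  also have "(\<integral>\<^sup>+k. ennreal ((norm (?G k))\<^sup>2) \<partial>freq) = (\<integral>\<^sup>+k. indicator {0} (fst k) * ennreal ((norm (h (- snd k)))\<^sup>2) \<partial>freq)"
    by (intro nn_integral_cong) (auto simp: indicator_def)
  also have "\<dots> = (\<integral>\<^sup>+\<xi>. ennreal ((norm (h (- \<xi>)))\<^sup>2) \<partial>lborel)"
    by (subst freq_nn_integral_slice) auto
  also have "\<dots> = (\<integral>\<^sup>+\<xi>. ennreal ((norm (h \<xi>))\<^sup>2) \<partial>lborel)"
    using nn_integral_real_affine[of "\<lambda>\<xi>. ennreal ((norm (h \<xi>))\<^sup>2)" "-1" 0] by simp
  also have "ennreal (4 * pi\<^sup>2) = ennreal (2 * pi) * ennreal (2 * pi)"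
    by (simp add: ennreal_mult[symmetric] power2_eq_square)
  finally show ?thesis
    by (simp add: mult.assoc ennreal_mult_le_mult_iff)
qed

lemma test_function_derivative:
  assumes "h \<in> test_functions"
  obtains h' where "h' \<in> test_functions" "\<And>x. (h has_vector_derivative h' x) (at x)"
proof -
  from assms obtain D R where D: "D 0 = h"
      "\<And>k x. (D k has_vector_derivative D (Suc k) x) (at x)"
    and R: "\<And>x. R < \<bar>x\<bar> \<Longrightarrow> h x = 0"
    unfolding test_functions_def by blast
  have "D (Suc 0) x = 0" if x: "R < \<bar>x\<bar>" for x
  proof -
    have "open {y :: real. R < \<bar>y\<bar>}" by (intro open_Collect_less continuous_intros)
    then have "(h has_vector_derivative 0) (at x)"
      using x R by (intro has_vector_derivative_transform_within_open[OF has_vector_derivative_const[of 0], of "{y. R < \<bar>y\<bar>}"]) auto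
    then show ?thesis using D(2)[of 0 x] D(1) vector_derivative_unique_at by metis
  qed
  moreover have "\<exists>D'. D' 0 = D (Suc 0) \<and> (\<forall>k x. (D' k has_vector_derivative D' (Suc k) x) (at x))"
    by (rule exI[of _ "\<lambda>k. D (Suc k)"]) (simp add: D(2))
  ultimately have "D (Suc 0) \<in> test_functions"
    unfolding test_functions_def by blast
  then show ?thesis using that[of "D (Suc 0)"] D by blast
qed

lemma test_function_continuous:
  assumes "h \<in> test_functions"
  shows "continuous_on UNIV h"
proof (rule test_function_derivative[OF assms])
  fix h' assume "\<And>x. (h has_vector_derivative h' x) (at x)"
  then show ?thesis
    by (intro continuous_at_imp_continuous_on ballI) (rule has_vector_derivative_continuous)
qed

lemma test_function_measurable [measurable]: "h \<in> test_functions \<Longrightarrow> h \<in> borel_measurable borel"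
  by (intro borel_measurable_continuous_onI test_function_continuous)

lemma test_function_bounded:
  assumes "h \<in> test_functions"
  obtains K where "0 \<le> K" "\<And>x. norm (h x) \<le> K"
proof -
  from assms obtain R where R: "\<And>x. R < \<bar>x\<bar> \<Longrightarrow> h x = 0"
    unfolding test_functions_def by blast
  have "compact (h ` {- R..R})"
    by (intro compact_continuous_image continuous_on_subset[OF test_function_continuous[OF assms]]) auto
  then obtain K where K: "\<And>x. x \<in> {- R..R} \<Longrightarrow> norm (h x) \<le> K"
    using compact_imp_bounded bounded_iff by (metis imageI)
  show ?thesis
  proof (rule that[of "max 0 K"])
    fix x show "norm (h x) \<le> max 0 K"
      using K[of x] R[of x] by (cases "R < \<bar>x\<bar>") (auto simp: le_max_iff_disj abs_le_iff not_less)
  qed simp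
qed

lemma line_fourier_derivative:
  assumes h: "h \<in> test_functions" and h': "h' \<in> test_functions"
    and d: "\<And>x. (h has_vector_derivative h' x) (at x)"
  shows "line_fourier h' y = \<i> * of_real y * line_fourier h y"
proof -
  from h obtain R1 where R1: "\<And>x. R1 < \<bar>x\<bar> \<Longrightarrow> h x = 0" unfolding test_functions_def by blast
  from h' obtain R2 where R2: "\<And>x. R2 < \<bar>x\<bar> \<Longrightarrow> h' x = 0" unfolding test_functions_def by blast
  \<comment> \<open>Strictly larger than both support radii, so that the boundary terms of the
    integration by parts vanish.\<close>
  define R where "R = max 0 (max R1 R2) + 1"
  have R: "0 \<le> R" "R1 < R" "R2 < R" by (auto simp: R_def)
  let ?F = "\<lambda>x. h x * cis ((- y) * x)"
  let ?f = "\<lambda>x. h x * (\<i> * of_real (- y) * cis ((- y) * x)) + h' x * cis ((- y) * x)"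
  have i: "integrable lborel (\<lambda>x. h' x * cis (- (y * x)))" "integrable lborel (\<lambda>x. h x * cis (- (y * x)))"
    by (intro integrable_mult_cis test_function_integrable h h'; simp)+
  have "(\<integral>x. indicator {- R..R} x *\<^sub>R ?f x \<partial>lborel) = ?F R - ?F (- R)"
  proof (rule integral_FTC_atLeastAtMost)
    show "continuous_on {- R..R} ?f"
      by (intro continuous_intros continuous_on_subset[OF test_function_continuous] h h') auto
    show "(?F has_vector_derivative ?f x) (at x within {- R..R})" for x
      by (rule has_vector_derivative_mult[OF has_vector_derivative_at_within[OF d] has_vector_derivative_cis])
  qed (use R in auto)
  also have "?F R - ?F (- R) = 0" using R1[of R] R1[of "- R"] R by simp
  also have "(\<lambda>x. indicator {- R..R} x *\<^sub>R ?f x) = (\<lambda>x. h' x * cis (- (y * x)) - \<i> * of_real y * (h x * cis (- (y * x))))"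
  proof
    fix x show "indicator {- R..R} x *\<^sub>R ?f x = h' x * cis (- (y * x)) - \<i> * of_real y * (h x * cis (- (y * x)))"
      using R1[of x] R2[of x] R by (cases "x \<in> {- R..R}") (auto simp: abs_if split: if_splits)
  qed
  also have "(\<integral>x. h' x * cis (- (y * x)) - \<i> * of_real y * (h x * cis (- (y * x))) \<partial>lborel)
     = line_fourier h' y - \<i> * of_real y * line_fourier h y"
    unfolding line_fourier_def using i by simp
  finally show ?thesis by simp
qed

text \<open>Two derivatives suffice: the transform of the second derivative is -y^2 times that of
  \<open>h\<close>, and both transforms are bounded by L^1 norms. Decay of order two already gives
  integrability.\<close>

lemma line_fourier_decay:
  assumes h: "h \<in> test_functions"
  obtains C where "0 \<le> C" "\<And>y. norm (line_fourier h y) \<le> C / (1 + y\<^sup>2)"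
proof -
  obtain h1 where h1: "h1 \<in> test_functions" "\<And>x. (h has_vector_derivative h1 x) (at x)"
    by (rule test_function_derivative[OF h]) blast
  obtain h2 where h2: "h2 \<in> test_functions" "\<And>x. (h1 has_vector_derivative h2 x) (at x)"
    by (rule test_function_derivative[OF h1(1)]) blast
  let ?C = "(\<integral>\<xi>. norm (h \<xi>) \<partial>lborel) + (\<integral>\<xi>. norm (h2 \<xi>) \<partial>lborel)"
  show ?thesis
  proof (rule that[of ?C])
    show "0 \<le> ?C" by (intro add_nonneg_nonneg integral_nonneg_AE) auto
    fix y
    have "line_fourier h2 y = - (of_real (y\<^sup>2) * line_fourier h y)"
      unfolding line_fourier_derivative[OF h1(1) h2] line_fourier_derivative[OF h h1]
    proof -
      have "\<i> * of_real y * (\<i> * of_real y * line_fourier h y) = (\<i> * \<i>) * (of_real y * of_real y * line_fourier h y)"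
        by (simp only: mult_ac)
      then show "\<i> * of_real y * (\<i> * of_real y * line_fourier h y) = - (of_real (y\<^sup>2) * line_fourier h y)"
        by (simp add: power2_eq_square)
    qed
    then have "norm (line_fourier h2 y) = y\<^sup>2 * norm (line_fourier h y)"
      by (simp add: norm_mult norm_power)
    then have "(1 + y\<^sup>2) * norm (line_fourier h y) \<le> ?C"
      using norm_line_fourier_le[of h y] norm_line_fourier_le[of h2 y] by (simp add: distrib_right)
    then show "norm (line_fourier h y) \<le> ?C / (1 + y\<^sup>2)"
      by (simp add: field_simps add_pos_nonneg)
  qed
qed

lemma integrable_line_fourier:
  assumes h: "h \<in> test_functions"
  shows "integrable lborel (line_fourier h)"
proof -
  obtain C where C: "0 \<le> C" "\<And>y. norm (line_fourier h y) \<le> C / (1 + y\<^sup>2)"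
    by (rule line_fourier_decay[OF h]) blast
  show ?thesis
  proof (rule Bochner_Integration.integrable_bound)
    show "integrable lborel (\<lambda>y. C * (1 / (1 + y\<^sup>2)))"
      by (intro integrable_mult_right integrable_inverse_one_plus_square)
    show "line_fourier h \<in> borel_measurable lborel"
      using h by measurable
    show "AE y in lborel. norm (line_fourier h y) \<le> norm (C * (1 / (1 + y\<^sup>2)))"
      using C by (intro AE_I2) (auto simp: abs_of_nonneg)
  qed
qed

text \<open>A Gaussian factor regularizes the left-hand side. By Fubini and rescaling, the
  regularized integral is a Gaussian average of \<open>h\<close> around \<xi> on the scale
  \<open>sqrt (?d m)\<close>, which tends to 2 pi h(\<xi>) because \<open>h\<close> is bounded and
  continuous; the regularization is removed by integrability of the transform.\<close>

lemma line_fourier_inversion: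
  assumes h: "h \<in> test_functions"
  shows "(\<integral>y. line_fourier h y * cis (y * \<xi>) \<partial>lborel) = complex_of_real (2 * pi) * h \<xi>"
proof -
  note [measurable] = test_function_measurable[OF h]
  obtain K where K: "0 \<le> K" "\<And>x. norm (h x) \<le> K" by (rule test_function_bounded[OF h]) blast
  let ?d = "\<lambda>m. 1 / real (Suc m)"
  have d0: "0 < ?d m" for m by simp
  have dlim: "?d \<longlonglongrightarrow> 0" by (rule LIMSEQ_Suc[OF lim_1_over_n])
  let ?L = "\<lambda>m. \<integral>y. line_fourier h y * (cis (y * \<xi>) * complex_of_real (exp (- (?d m * y\<^sup>2) / 2))) \<partial>lborel"
  have lim1: "?L \<longlonglongrightarrow> (\<integral>y. line_fourier h y * cis (y * \<xi>) \<partial>lborel)"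
  proof (rule integral_dominated_convergence[where w="\<lambda>y. norm (line_fourier h y)"])
    show "integrable lborel (\<lambda>y. norm (line_fourier h y))"
      using integrable_line_fourier[OF h] by simp
    show "AE y in lborel. (\<lambda>m. line_fourier h y * (cis (y * \<xi>) * complex_of_real (exp (- (?d m * y\<^sup>2) / 2)))) \<longlonglongrightarrow> line_fourier h y * cis (y * \<xi>)"
    proof (intro AE_I2)
      fix y :: real
      have "(\<lambda>m. line_fourier h y * (cis (y * \<xi>) * complex_of_real (exp (- (?d m * y\<^sup>2) / 2)))) \<longlonglongrightarrow> line_fourier h y * (cis (y * \<xi>) * complex_of_real (exp (- (0 * y\<^sup>2) / 2)))"
        by (intro tendsto_intros dlim) simp
      then show "(\<lambda>m. line_fourier h y * (cis (y * \<xi>) * complex_of_real (exp (- (?d m * y\<^sup>2) / 2)))) \<longlonglongrightarrow> line_fourier h y * cis (y * \<xi>)" by simp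
    qed
    show "AE y in lborel. norm (line_fourier h y * (cis (y * \<xi>) * complex_of_real (exp (- (?d m * y\<^sup>2) / 2)))) \<le> norm (line_fourier h y)" for m
      by (intro AE_I2) (simp add: norm_mult mult_left_le)
  qed measurable
  have step: "?L m = (\<integral>u. h (\<xi> + sqrt (?d m) * u) * complex_of_real (sqrt (2 * pi) * exp (- u\<^sup>2 / 2)) \<partial>lborel)" for m
  proof -
    let ?a = "?d m"
    let ?H = "\<lambda>y. cis (y * \<xi>) * complex_of_real (exp (- (?a * y\<^sup>2) / 2))"
    have iH: "integrable lborel ?H"
      by (rule Bochner_Integration.integrable_bound[OF integrable_gaussian(1)[OF d0, of m]]) (auto simp: norm_mult)
    have "?L m = (\<integral>y. (\<integral>\<eta>. h \<eta> * cis (- (y * \<eta>)) \<partial>lborel) * ?H y \<partial>lborel)"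
      by (simp add: line_fourier_def)
    also have "\<dots> = (\<integral>\<eta>. h \<eta> * (\<integral>y. cis (- (y * \<eta>)) * ?H y \<partial>lborel) \<partial>lborel)"
      by (rule fubini_phase(3)[OF lborel.sigma_finite_measure_axioms lborel.sigma_finite_measure_axioms _ test_function_integrable[OF h] iH])
        measurable
    also have "\<dots> = (\<integral>\<eta>. h \<eta> * complex_of_real (sqrt (2 * pi / ?a) * exp (- (\<xi> - \<eta>)\<^sup>2 / (2 * ?a))) \<partial>lborel)"
    proof (intro Bochner_Integration.integral_cong refl arg_cong2[where f="(*)"])
      fix \<eta>
      have "cis (- (y * \<eta>)) * ?H y = cis (y * (\<xi> - \<eta>)) * complex_of_real (exp (- (?a * y\<^sup>2) / 2))" for y
        by (simp add: mult.assoc[symmetric] cis_mult) (simp add: algebra_simps)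
      then show "(\<integral>y. cis (- (y * \<eta>)) * ?H y \<partial>lborel) = complex_of_real (sqrt (2 * pi / ?a) * exp (- (\<xi> - \<eta>)\<^sup>2 / (2 * ?a)))"
        by (simp only: gaussian_fourier[OF d0])
    qed
    also have "\<dots> = \<bar>sqrt ?a\<bar> *\<^sub>R (\<integral>u. h (\<xi> + sqrt ?a * u) * complex_of_real (sqrt (2 * pi / ?a) * exp (- (\<xi> - (\<xi> + sqrt ?a * u))\<^sup>2 / (2 * ?a))) \<partial>lborel)"
      by (rule lborel_integral_real_affine) simp
    also have "\<dots> = (\<integral>u. \<bar>sqrt ?a\<bar> *\<^sub>R (h (\<xi> + sqrt ?a * u) * complex_of_real (sqrt (2 * pi / ?a) * exp (- (\<xi> - (\<xi> + sqrt ?a * u))\<^sup>2 / (2 * ?a)))) \<partial>lborel)"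
      by (rule integral_scaleR_right[symmetric])
    also have "\<dots> = (\<integral>u. h (\<xi> + sqrt ?a * u) * complex_of_real (sqrt (2 * pi) * exp (- u\<^sup>2 / 2)) \<partial>lborel)"
    proof (intro Bochner_Integration.integral_cong refl)
      fix u :: real
      have e: "(\<xi> - (\<xi> + sqrt ?a * u))\<^sup>2 / (2 * ?a) = u\<^sup>2 / 2"
        by (simp add: power_mult_distrib)
      have "\<bar>sqrt ?a\<bar> * (sqrt (2 * pi / ?a) * exp (- ((\<xi> - (\<xi> + sqrt ?a * u))\<^sup>2 / (2 * ?a)))) = sqrt (2 * pi) * exp (- (u\<^sup>2 / 2))"
        unfolding e using d0[of m] by (simp add: real_sqrt_divide real_sqrt_mult)
      then show "\<bar>sqrt ?a\<bar> *\<^sub>R (h (\<xi> + sqrt ?a * u) * complex_of_real (sqrt (2 * pi / ?a) * exp (- (\<xi> - (\<xi> + sqrt ?a * u))\<^sup>2 / (2 * ?a))))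
        = h (\<xi> + sqrt ?a * u) * complex_of_real (sqrt (2 * pi) * exp (- u\<^sup>2 / 2))"
        by (simp only: scaleR_conv_of_real minus_divide_left[symmetric] mult.left_commute[of "complex_of_real \<bar>sqrt ?a\<bar>"] of_real_mult[symmetric])
    qed
    finally show ?thesis .
  qed
  have g1: "integrable lborel (\<lambda>u. exp (- u\<^sup>2 / 2) :: real)" "(\<integral>u. exp (- u\<^sup>2 / 2) \<partial>lborel) = sqrt (2 * pi)"
    using integrable_gaussian[of 1] by simp_all
  have "(\<lambda>m. \<integral>u. h (\<xi> + sqrt (?d m) * u) * complex_of_real (sqrt (2 * pi) * exp (- u\<^sup>2 / 2)) \<partial>lborel)
     \<longlonglongrightarrow> (\<integral>u. h \<xi> * complex_of_real (sqrt (2 * pi) * exp (- u\<^sup>2 / 2)) \<partial>lborel)"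
  proof (rule integral_dominated_convergence[where w="\<lambda>u. K * sqrt (2 * pi) * exp (- u\<^sup>2 / 2)"])
    show "integrable lborel (\<lambda>u. K * sqrt (2 * pi) * exp (- u\<^sup>2 / 2))"
      by (intro integrable_mult_right g1)
    have cont: "isCont h x" for x
      using test_function_continuous[OF h] by (simp add: continuous_on_eq_continuous_at)
    show "AE u in lborel. (\<lambda>m. h (\<xi> + sqrt (?d m) * u) * complex_of_real (sqrt (2 * pi) * exp (- u\<^sup>2 / 2))) \<longlonglongrightarrow> h \<xi> * complex_of_real (sqrt (2 * pi) * exp (- u\<^sup>2 / 2))"
    proof (intro AE_I2 tendsto_mult_right)
      fix u :: real
      have "(\<lambda>m. \<xi> + sqrt (?d m) * u) \<longlonglongrightarrow> \<xi> + sqrt 0 * u"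
        by (intro tendsto_intros dlim)
      then show "(\<lambda>m. h (\<xi> + sqrt (?d m) * u)) \<longlonglongrightarrow> h \<xi>"
        using isCont_tendsto_compose[OF cont, of "\<lambda>m. \<xi> + sqrt (?d m) * u" \<xi>] by simp
    qed
    show "AE u in lborel. norm (h (\<xi> + sqrt (?d m) * u) * complex_of_real (sqrt (2 * pi) * exp (- u\<^sup>2 / 2))) \<le> K * sqrt (2 * pi) * exp (- u\<^sup>2 / 2)" for m
    proof (intro AE_I2)
      fix u
      show "norm (h (\<xi> + sqrt (?d m) * u) * complex_of_real (sqrt (2 * pi) * exp (- u\<^sup>2 / 2))) \<le> K * sqrt (2 * pi) * exp (- u\<^sup>2 / 2)"
        unfolding norm_mult norm_of_real mult.assoc[of K] by (rule mult_mono) (use K in auto)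
    qed
  qed measurable
  also have "(\<integral>u. h \<xi> * complex_of_real (sqrt (2 * pi) * exp (- u\<^sup>2 / 2)) \<partial>lborel) = h \<xi> * complex_of_real (sqrt (2 * pi) * sqrt (2 * pi))"
  proof -
    have "(\<integral>u. complex_of_real (sqrt (2 * pi) * exp (- u\<^sup>2 / 2)) \<partial>lborel) = complex_of_real (\<integral>u. sqrt (2 * pi) * exp (- u\<^sup>2 / 2) \<partial>lborel)"
      by (rule Bochner_Integration.integral_of_real) (intro integrable_mult_right g1)
    also have "\<dots> = complex_of_real (sqrt (2 * pi) * sqrt (2 * pi))"
      by (simp only: integral_mult_right_zero g1(2))
    finally show ?thesis by (simp only: integral_mult_right_zero)
  qed
  finally have "?L \<longlonglongrightarrow> h \<xi> * complex_of_real (sqrt (2 * pi) * sqrt (2 * pi))"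
    unfolding step .
  from LIMSEQ_unique[OF lim1 this] show ?thesis by (simp add: mult.commute)
qed

lemma integrable_cylinder_snd:
  assumes f: "integrable lborel f"
  shows "integrable cylinder (\<lambda>z. cis (of_int n * fst z) * f (snd z))"
    and "(\<integral>z. cis (of_int n * fst z) * f (snd z) \<partial>cylinder) = (if n = 0 then complex_of_real (2 * pi) else 0) * integral\<^sup>L lborel f"
  using integral_pair_product[of torus lborel "\<lambda>x. cis (of_int n * x)" f]
  by (simp_all add: cylinder_def torus_fourier f torus.sigma_finite_measure_axioms lborel.sigma_finite_measure_axioms
      integrable_cis_finite torus.finite_measure_axioms borel_measurable_torusI)

text \<open>After Fubini, orthogonality on the torus selects the frequency n and the inversion
  formula for \<open>h\<close> returns its value at \<xi>. The transform of the evolution is thus 4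
  pi^2 times the profile times the multiplier.\<close>

lemma has_fourier_ext:
  assumes g: "integrable freq g" and h: "h \<in> test_functions"
  shows "has_bochner_integral cylinder (fourier_integrand (ext w g t) n h)
    (complex_of_real (4 * pi\<^sup>2) * (\<integral>\<xi>. g (n, \<xi>) * cis (- (t * symb w (n, \<xi>))) * h \<xi> \<partial>lborel))"
proof -
  note [measurable] = borel_measurable_integrable[OF g] test_function_measurable[OF h]
  obtain K where K: "0 \<le> K" "\<And>x. norm (h x) \<le> K" by (rule test_function_bounded[OF h]) blast
  let ?H = "\<lambda>z. cis (of_int (- n) * fst z) * line_fourier h (snd z)"
  have iH: "integrable cylinder ?H"
    by (rule integrable_cylinder_snd(1)[OF integrable_line_fourier[OF h]])
  have m: "(\<lambda>(k, z). phase k z - t * symb w k) \<in> borel_measurable (freq \<Otimes>\<^sub>M cylinder)"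
    by measurable
  have e: "fourier_integrand (ext w g t) n h z = ext w g t z * ?H z" for z
    by (cases z) (simp add: fourier_integrand_def mult.assoc)
  have inner: "(\<integral>z. cis (phase k z - t * symb w k) * ?H z \<partial>cylinder)
    = indicator {n} (fst k) * (complex_of_real (4 * pi\<^sup>2) * (cis (- (t * symb w k)) * h (snd k)))" for k
  proof -
    have "cis (phase k z - t * symb w k) * ?H z = cis (- (t * symb w k)) * (cis (of_int (fst k - n) * fst z) * (line_fourier h (snd z) * cis (snd z * snd k)))" for z
    proof -
      have "cis (phase k z - t * symb w k) * cis (of_int (- n) * fst z) = cis (- (t * symb w k)) * cis (of_int (fst k - n) * fst z) * cis (snd z * snd k)"
        by (simp add: cis_mult phase_def algebra_simps)
      then show ?thesis by (simp only: mult_ac)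
    qed
    then have "(\<integral>z. cis (phase k z - t * symb w k) * ?H z \<partial>cylinder)
      = cis (- (t * symb w k)) * (\<integral>z. cis (of_int (fst k - n) * fst z) * (line_fourier h (snd z) * cis (snd z * snd k)) \<partial>cylinder)"
      by (simp only: integral_mult_right_zero)
    also have "(\<integral>z. cis (of_int (fst k - n) * fst z) * (line_fourier h (snd z) * cis (snd z * snd k)) \<partial>cylinder)
      = (if fst k - n = 0 then complex_of_real (2 * pi) else 0) * (complex_of_real (2 * pi) * h (snd k))"
      unfolding line_fourier_inversion[OF h, symmetric]
      by (rule integrable_cylinder_snd(2)) (intro integrable_mult_cis integrable_line_fourier h; simp)
    finally show ?thesis
      by (auto simp: indicator_def power2_eq_square)
  qed
  have i1: "integrable cylinder (\<lambda>z. ext w g t z * ?H z)"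
    unfolding ext_def
    by (rule fubini_phase(1)[OF freq.sigma_finite_measure_axioms cyl.sigma_finite_measure_axioms m g iH])
  have "(\<integral>z. ext w g t z * ?H z \<partial>cylinder) = (\<integral>k. g k * (\<integral>z. cis (phase k z - t * symb w k) * ?H z \<partial>cylinder) \<partial>freq)"
    unfolding ext_def
    by (rule fubini_phase(3)[OF freq.sigma_finite_measure_axioms cyl.sigma_finite_measure_axioms m g iH])
  also have "\<dots> = (\<integral>k. indicator {n} (fst k) * (complex_of_real (4 * pi\<^sup>2) * (g k * cis (- (t * symb w k)) * h (snd k))) \<partial>freq)"
    unfolding inner by (simp only: mult_ac)
  also have "\<dots> = (\<integral>\<xi>. complex_of_real (4 * pi\<^sup>2) * (g (n, \<xi>) * cis (- (t * symb w (n, \<xi>))) * h (snd (n, \<xi>))) \<partial>lborel)"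
  proof (rule freq_integral_slice)
    show "integrable freq (\<lambda>k. indicator {n} (fst k) * (complex_of_real (4 * pi\<^sup>2) * (g k * cis (- (t * symb w k)) * h (snd k))))"
    proof (rule Bochner_Integration.integrable_bound)
      show "integrable freq (\<lambda>k. (4 * pi\<^sup>2 * K) * norm (g k))" using g by simp
      show "AE k in freq. norm (indicator {n} (fst k) * (complex_of_real (4 * pi\<^sup>2) * (g k * cis (- (t * symb w k)) * h (snd k)))) \<le> norm ((4 * pi\<^sup>2 * K) * norm (g k))"
      proof (intro AE_I2)
        fix k :: "int \<times> real"
        have "norm (g k) * norm (h (snd k)) \<le> norm (g k) * K" by (intro mult_left_mono K) simp
        then have "4 * pi\<^sup>2 * (norm (g k) * norm (h (snd k))) \<le> 4 * pi\<^sup>2 * K * norm (g k)"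
          using mult_left_mono[of "norm (g k) * norm (h (snd k))" "norm (g k) * K" "4 * pi\<^sup>2"] by (simp add: mult_ac)
        moreover have "0 \<le> 4 * pi\<^sup>2 * K * norm (g k)" using K by simp
        ultimately show "norm (indicator {n} (fst k) * (complex_of_real (4 * pi\<^sup>2) * (g k * cis (- (t * symb w k)) * h (snd k)))) \<le> norm ((4 * pi\<^sup>2 * K) * norm (g k))"
          using K(1) by (simp add: norm_mult norm_power indicator_def)
      qed
    qed measurable
  qed
  also have "\<dots> = complex_of_real (4 * pi\<^sup>2) * (\<integral>\<xi>. g (n, \<xi>) * cis (- (t * symb w (n, \<xi>))) * h \<xi> \<partial>lborel)"
    by simp
  finally show ?thesis
    unfolding e has_bochner_integral_iff using i1 by simp
qed

section \<open>A dense class of functions\<close>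

text \<open>\<open>f s\<close> is the inverse Fourier transform of \<open>\<gamma> s\<close>, with bounds that are uniform in the parameter \<open>s\<close>.\<close>

definition nice_family :: "(real \<Rightarrow> real \<times> real \<Rightarrow> complex) \<Rightarrow> (real \<Rightarrow> int \<times> real \<Rightarrow> complex) \<Rightarrow> bool" where
  "nice_family f \<gamma> \<longleftrightarrow>
     (\<lambda>(s, z). f s z) \<in> borel_measurable (lborel \<Otimes>\<^sub>M cylinder) \<and>
     (\<lambda>(s, k). \<gamma> s k) \<in> borel_measurable (lborel \<Otimes>\<^sub>M freq) \<and>
     (\<exists>G. integrable freq G \<and> integrable freq (\<lambda>k. (G k)\<^sup>2) \<and> (\<forall>s k. norm (\<gamma> s k) \<le> (G k :: real))) \<and>
     (\<exists>H K. integrable cylinder H \<and> (\<forall>s z. norm (f s z) \<le> H z \<and> H z \<le> (K :: real))) \<and>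
     (\<forall>s z. f s z = ext (\<lambda>_. 0) (\<gamma> s) 0 z) \<and>
     (\<forall>s k. (\<integral>z. f s z * cis (- phase k z) \<partial>cylinder) = complex_of_real (4 * pi\<^sup>2) * \<gamma> s k)"

lemma measurable_phase_fixed [measurable]: "phase k \<in> borel_measurable cylinder"
  unfolding phase_def[abs_def] by measurable

abbreviation nice :: "(real \<times> real \<Rightarrow> complex) \<Rightarrow> (int \<times> real \<Rightarrow> complex) \<Rightarrow> bool" where
  "nice \<phi> g \<equiv> nice_family (\<lambda>_. \<phi>) (\<lambda>_. g)"

lemma nice_family_measurable:
  assumes "nice_family f \<gamma>"
  shows "(\<lambda>(s, z). f s z) \<in> borel_measurable (lborel \<Otimes>\<^sub>M cylinder)" "(\<lambda>(s, k). \<gamma> s k) \<in> borel_measurable (lborel \<Otimes>\<^sub>M freq)"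
    "f s \<in> borel_measurable cylinder" "\<gamma> s \<in> borel_measurable freq"
  using assms measurable_Pair2[of "\<lambda>(s, z). f s z" lborel cylinder borel s] measurable_Pair2[of "\<lambda>(s, k). \<gamma> s k" lborel freq borel s]
  by (simp_all add: nice_family_def)

lemma nice_family_freq_bound:
  assumes "nice_family f \<gamma>"
  obtains G where "integrable freq G" "integrable freq (\<lambda>k. (G k)\<^sup>2)" "\<And>s k. norm (\<gamma> s k) \<le> (G k :: real)"
  using assms unfolding nice_family_def by blast

lemma nice_family_bound:
  assumes "nice_family f \<gamma>"
  obtains H K where "integrable cylinder H" "\<And>s z. norm (f s z) \<le> H z" "\<And>z. H z \<le> (K :: real)"
  using assms unfolding nice_family_def by blast

lemma nice_family_ext: "nice_family f \<gamma> \<Longrightarrow> f s z = ext (\<lambda>_. 0) (\<gamma> s) 0 z"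
  unfolding nice_family_def by blast

lemma nice_family_fourier:
  "nice_family f \<gamma> \<Longrightarrow> (\<integral>z. f s z * cis (- phase k z) \<partial>cylinder) = complex_of_real (4 * pi\<^sup>2) * \<gamma> s k"
  unfolding nice_family_def by blast

lemma nice_family_integrable_freq:
  assumes "nice_family f \<gamma>" shows "integrable freq (\<gamma> s)"
proof (rule nice_family_freq_bound[OF assms])
  fix G assume G: "integrable freq G" "\<And>s k. norm (\<gamma> s k) \<le> (G k :: real)"
  show ?thesis
    by (rule Bochner_Integration.integrable_bound[OF G(1)])
      (use nice_family_measurable(4)[OF assms, of s] G(2) in \<open>auto intro!: AE_I2 intro: order_trans[OF _ abs_ge_self]\<close>)
qed

lemma nice_family_integrable:
  assumes "nice_family f \<gamma>" shows "integrable cylinder (f s)"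
proof (rule nice_family_bound[OF assms])
  fix H K assume H: "integrable cylinder H" "\<And>s z. norm (f s z) \<le> (H z :: real)"
  show ?thesis
    by (rule Bochner_Integration.integrable_bound[OF H(1)])
      (use nice_family_measurable(3)[OF assms, of s] H(2) in \<open>auto intro!: AE_I2 intro: order_trans[OF _ abs_ge_self]\<close>)
qed

lemma ext_add:
  assumes "integrable freq g" "integrable freq g'"
  shows "ext w (\<lambda>k. g k + g' k) t z = ext w g t z + ext w g' t z"
  unfolding ext_def distrib_right
  by (intro Bochner_Integration.integral_add integrable_mult_cis assms) measurable

lemma ext_mult: "ext w (\<lambda>k. c * g k) t z = c * ext w g t z"
  unfolding ext_def by (simp add: mult.assoc)

lemma nice_family_add:
  assumes 1: "nice_family f \<gamma>" and 2: "nice_family f' \<gamma>'"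
  shows "nice_family (\<lambda>s z. f s z + f' s z) (\<lambda>s k. \<gamma> s k + \<gamma>' s k)"
proof -
  obtain G where G: "integrable freq G" "integrable freq (\<lambda>k. (G k)\<^sup>2)" "\<And>s k. norm (\<gamma> s k) \<le> (G k :: real)"
    by (rule nice_family_freq_bound[OF 1]) (rule that)
  obtain G' where G': "integrable freq G'" "integrable freq (\<lambda>k. (G' k)\<^sup>2)" "\<And>s k. norm (\<gamma>' s k) \<le> (G' k :: real)"
    by (rule nice_family_freq_bound[OF 2]) (rule that)
  obtain H K where H: "integrable cylinder H" "\<And>s z. norm (f s z) \<le> H z" "\<And>z. H z \<le> (K :: real)"
    by (rule nice_family_bound[OF 1]) (rule that)
  obtain H' K' where H': "integrable cylinder H'" "\<And>s z. norm (f' s z) \<le> H' z" "\<And>z. H' z \<le> (K' :: real)"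
    by (rule nice_family_bound[OF 2]) (rule that)
  note [measurable] = nice_family_measurable(1,2)[OF 1, unfolded case_prod_beta] nice_family_measurable(1,2)[OF 2, unfolded case_prod_beta]
    borel_measurable_integrable[OF G(1)] borel_measurable_integrable[OF G'(1)]
  have sq: "integrable freq (\<lambda>k. (G k + G' k)\<^sup>2)"
  proof (rule Bochner_Integration.integrable_bound)
    show "integrable freq (\<lambda>k. 2 * (G k)\<^sup>2 + 2 * (G' k)\<^sup>2)" using G G' by simp
    show "AE k in freq. norm ((G k + G' k)\<^sup>2) \<le> norm (2 * (G k)\<^sup>2 + 2 * (G' k)\<^sup>2)"
    proof (intro AE_I2)
      fix k
      have "0 \<le> (G k - G' k)\<^sup>2" by simp
      then have "(G k + G' k)\<^sup>2 \<le> 2 * (G k)\<^sup>2 + 2 * (G' k)\<^sup>2"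
        by (simp add: power2_eq_square algebra_simps)
      then show "norm ((G k + G' k)\<^sup>2) \<le> norm (2 * (G k)\<^sup>2 + 2 * (G' k)\<^sup>2)"
        by (auto intro: order_trans[OF _ abs_ge_self])
    qed
  qed measurable
  show ?thesis
    unfolding nice_family_def
  proof (intro conjI allI)
    show "\<exists>Ga. integrable freq Ga \<and> integrable freq (\<lambda>k. (Ga k)\<^sup>2) \<and> (\<forall>s k. norm (\<gamma> s k + \<gamma>' s k) \<le> (Ga k :: real))"
      by (intro exI[of _ "\<lambda>k. G k + G' k"] conjI allI sq Bochner_Integration.integrable_add G(1) G'(1) norm_triangle_mono G(3) G'(3))
    show "\<exists>Ha Ka. integrable cylinder Ha \<and> (\<forall>s z. norm (f s z + f' s z) \<le> Ha z \<and> Ha z \<le> (Ka :: real))"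
      by (intro exI[of _ "\<lambda>z. H z + H' z"] exI[of _ "K + K'"] conjI allI Bochner_Integration.integrable_add H(1) H'(1) norm_triangle_mono add_mono H H')
    fix s
    show "f s z + f' s z = ext (\<lambda>_. 0) (\<lambda>k. \<gamma> s k + \<gamma>' s k) 0 z" for z
      by (simp add: ext_add nice_family_integrable_freq[OF 1] nice_family_integrable_freq[OF 2] nice_family_ext[OF 1] nice_family_ext[OF 2])
    fix k
    have "(\<integral>z. f s z * cis (- phase k z) + f' s z * cis (- phase k z) \<partial>cylinder) = (\<integral>z. f s z * cis (- phase k z) \<partial>cylinder) + (\<integral>z. f' s z * cis (- phase k z) \<partial>cylinder)"
      by (intro Bochner_Integration.integral_add integrable_mult_cis nice_family_integrable[OF 1] nice_family_integrable[OF 2]) measurable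
    then show "(\<integral>z. (f s z + f' s z) * cis (- phase k z) \<partial>cylinder) = complex_of_real (4 * pi\<^sup>2) * (\<gamma> s k + \<gamma>' s k)"
      by (simp only: distrib_right distrib_left nice_family_fourier[OF 1] nice_family_fourier[OF 2])
  qed measurable
qed

lemma nice_family_mult:
  assumes 1: "nice_family f \<gamma>" and c[measurable]: "c \<in> borel_measurable borel" and cb: "\<And>s. norm (c s) \<le> (B :: real)"
  shows "nice_family (\<lambda>s z. c s * f s z) (\<lambda>s k. c s * \<gamma> s k)"
proof -
  obtain G where G: "integrable freq G" "integrable freq (\<lambda>k. (G k)\<^sup>2)" "\<And>s k. norm (\<gamma> s k) \<le> (G k :: real)"
    by (rule nice_family_freq_bound[OF 1]) (rule that)
  obtain H K where H: "integrable cylinder H" "\<And>s z. norm (f s z) \<le> H z" "\<And>z. H z \<le> (K :: real)"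
    by (rule nice_family_bound[OF 1]) (rule that)
  note [measurable] = nice_family_measurable(1,2)[OF 1, unfolded case_prod_beta]
  have B: "0 \<le> B" using cb[of 0] norm_ge_zero[of "c 0"] by linarith
  show ?thesis
    unfolding nice_family_def
  proof (intro conjI allI)
    have "norm (c s * \<gamma> s k) \<le> B * G k" for s k
      unfolding norm_mult by (intro mult_mono cb G B) simp
    then show "\<exists>Ga. integrable freq Ga \<and> integrable freq (\<lambda>k. (Ga k)\<^sup>2) \<and> (\<forall>s k. norm (c s * \<gamma> s k) \<le> (Ga k :: real))"
      using G by (intro exI[of _ "\<lambda>k. B * G k"]) (simp add: power_mult_distrib)
    have "norm (c s * f s z) \<le> B * H z" for s z
      unfolding norm_mult by (intro mult_mono cb H B) simp
    then show "\<exists>Ha Ka. integrable cylinder Ha \<and> (\<forall>s z. norm (c s * f s z) \<le> Ha z \<and> Ha z \<le> (Ka :: real))"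
      using H B by (intro exI[of _ "\<lambda>z. B * H z"] exI[of _ "B * K"]) (simp add: mult_left_mono)
    fix s
    show "c s * f s z = ext (\<lambda>_. 0) (\<lambda>k. c s * \<gamma> s k) 0 z" for z
      by (simp add: ext_mult nice_family_ext[OF 1])
    fix k
    show "(\<integral>z. c s * f s z * cis (- phase k z) \<partial>cylinder) = complex_of_real (4 * pi\<^sup>2) * (c s * \<gamma> s k)"
      by (simp only: mult.assoc[of "c s"] integral_mult_right_zero nice_family_fourier[OF 1] mult.left_commute)
  qed measurable
qed

lemma nice_add: "nice \<phi> g \<Longrightarrow> nice \<phi>' g' \<Longrightarrow> nice (\<lambda>z. \<phi> z + \<phi>' z) (\<lambda>k. g k + g' k)"
  by (rule nice_family_add)

lemma nice_mult: "nice \<phi> g \<Longrightarrow> nice (\<lambda>z. c * \<phi> z) (\<lambda>k. c * g k)"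
  by (rule nice_family_mult[of "\<lambda>_. \<phi>" "\<lambda>_. g" "\<lambda>_. c" "norm c"]) auto

definition atom :: "int \<Rightarrow> real \<Rightarrow> real \<Rightarrow> real \<times> real \<Rightarrow> complex" where
  "atom n y0 a z = cis (of_int n * fst z) * complex_of_real (exp (- (a * (snd z - y0)\<^sup>2) / 2))"

text \<open>The prefactor is the mass 2 pi sqrt(2 pi / a) of the Gaussian on the cylinder divided by
  4 pi^2, the normalization of \<open>nice_family\<close>.\<close>

definition atom_fourier :: "int \<Rightarrow> real \<Rightarrow> real \<Rightarrow> int \<times> real \<Rightarrow> complex" where
  "atom_fourier n y0 a k = indicator {n} (fst k) *
    (complex_of_real (sqrt (2 * pi / a) / (2 * pi) * exp (- ((1 / a) * (snd k)\<^sup>2) / 2)) * cis (- (snd k * y0)))"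

lemma integrable_shifted_gaussian:
  assumes "0 < a"
  shows "integrable lborel (\<lambda>y. exp (- (a * (y - y0)\<^sup>2) / 2) :: real)"
  using lborel_integrable_real_affine[OF integrable_gaussian(1)[OF assms], of 1 "- y0"] by simp

lemma shifted_gaussian_fourier:
  assumes a: "0 < a"
  shows "(\<integral>y. complex_of_real (exp (- (a * (y - y0)\<^sup>2) / 2)) * cis (y * s) \<partial>lborel)
    = complex_of_real (sqrt (2 * pi / a) * exp (- ((1 / a) * s\<^sup>2) / 2)) * cis (y0 * s)"
proof -
  have "(\<integral>y. complex_of_real (exp (- (a * (y - y0)\<^sup>2) / 2)) * cis (y * s) \<partial>lborel)
     = \<bar>1\<bar> *\<^sub>R (\<integral>y. complex_of_real (exp (- (a * ((y0 + 1 * y) - y0)\<^sup>2) / 2)) * cis ((y0 + 1 * y) * s) \<partial>lborel)"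
    by (rule lborel_integral_real_affine) simp
  also have "\<dots> = (\<integral>y. cis (y0 * s) * (cis (y * s) * complex_of_real (exp (- (a * y\<^sup>2) / 2))) \<partial>lborel)"
  proof -
    have "\<bar>1\<bar> *\<^sub>R I = I" for I :: complex by simp
    moreover have "cis ((y0 + 1 * y) * s) = cis (y0 * s) * cis (y * s)" for y by (simp add: cis_mult distrib_right)
    moreover have "y0 + 1 * y - y0 = y" for y by simp
    ultimately show ?thesis by (simp only: mult_ac)
  qed
  also have "\<dots> = cis (y0 * s) * complex_of_real (sqrt (2 * pi / a) * exp (- s\<^sup>2 / (2 * a)))"
    by (simp only: integral_mult_right_zero gaussian_fourier[OF a])
  finally show ?thesis by (simp add: mult.commute)
qed

lemma nice_atom:
  assumes a: "0 < a"
  shows "nice (atom n y0 a) (atom_fourier n y0 a)"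
proof -
  let ?c = "sqrt (2 * pi / a) / (2 * pi)"
  let ?u = "\<lambda>\<xi>. complex_of_real (?c * exp (- ((1 / a) * \<xi>\<^sup>2) / 2)) * cis (- (\<xi> * y0))"
  have a': "0 < 1 / a" using a by simp
  have iu: "integrable lborel ?u"
    by (intro integrable_mult_cis integrable_of_real integrable_mult_right integrable_gaussian a') simp
  have c0: "0 \<le> ?c" using a by simp
  have ig: "integrable freq (atom_fourier n y0 a)"
    unfolding atom_fourier_def by (rule integrable_freq_slice[OF iu])
  have iv: "integrable lborel (\<lambda>y. complex_of_real (exp (- (a * (y - y0)\<^sup>2) / 2)))"
    by (intro integrable_of_real integrable_shifted_gaussian a)
  have iA: "integrable cylinder (atom n y0 a)"
    unfolding atom_def by (rule integrable_cylinder_snd(1)[OF iv])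
  note [measurable] = borel_measurable_integrable[OF ig] borel_measurable_integrable[OF iA]
  show ?thesis
    unfolding nice_family_def
  proof (intro conjI allI)
    show "\<exists>G. integrable freq G \<and> integrable freq (\<lambda>k. (G k)\<^sup>2) \<and> (\<forall>s k. norm (atom_fourier n y0 a k) \<le> (G k :: real))"
    proof (intro exI[of _ "\<lambda>k. norm (atom_fourier n y0 a k)"] conjI allI order_refl)
      show "integrable freq (\<lambda>k. norm (atom_fourier n y0 a k))" using ig by simp
      \<comment> \<open>Square integrability follows from integrability, since the profile is
        bounded by its prefactor.\<close>
      show "integrable freq (\<lambda>k. (norm (atom_fourier n y0 a k))\<^sup>2)"
      proof (rule Bochner_Integration.integrable_bound)
        show "integrable freq (\<lambda>k. ?c * norm (atom_fourier n y0 a k))" using ig by simp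
        show "AE k in freq. norm ((norm (atom_fourier n y0 a k))\<^sup>2) \<le> norm (?c * norm (atom_fourier n y0 a k))"
        proof (intro AE_I2)
          fix k :: "int \<times> real"
          have "?c * exp (- ((1 / a) * (snd k)\<^sup>2) / 2) \<le> ?c * 1"
            using a by (intro mult_left_mono c0) simp
          then have "norm (atom_fourier n y0 a k) \<le> ?c"
          proof -
            have "0 \<le> ?c * exp (- ((1 / a) * (snd k)\<^sup>2) / 2)" by (rule mult_nonneg_nonneg[OF c0 exp_ge_zero])
            then have "norm (?u (snd k)) = ?c * exp (- ((1 / a) * (snd k)\<^sup>2) / 2)"
              by (simp only: norm_mult[of _ "cis _"] norm_of_real norm_cis mult_1_right abs_of_nonneg)
            with \<open>?c * exp _ \<le> ?c * 1\<close> c0 show ?thesis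
              by (cases "fst k = n") (simp_all only: atom_fourier_def indicator_simps insert_iff empty_iff if_True mult_1_left mult_1_right mult_zero_left norm_zero simp_thms)
          qed
          then have "norm (atom_fourier n y0 a k) * norm (atom_fourier n y0 a k) \<le> ?c * norm (atom_fourier n y0 a k)"
            by (rule mult_right_mono) simp
          then show "norm ((norm (atom_fourier n y0 a k))\<^sup>2) \<le> norm (?c * norm (atom_fourier n y0 a k))"
            using c0 by (simp only: power2_eq_square real_norm_def abs_mult abs_norm_cancel abs_of_nonneg)
        qed
      qed measurable
    qed
    show "\<exists>H K. integrable cylinder H \<and> (\<forall>s z. norm (atom n y0 a z) \<le> H z \<and> H z \<le> (K :: real))"
      by (intro exI[of _ "\<lambda>z. norm (atom n y0 a z)"] exI[of _ 1] conjI allI order_refl)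
        (use integrable_norm[OF iA] a in \<open>simp_all add: atom_def norm_mult\<close>)
    show "atom n y0 a z = ext (\<lambda>_. 0) (atom_fourier n y0 a) 0 z" for z
    proof -
      have "ext (\<lambda>_. 0) (atom_fourier n y0 a) 0 z = (\<integral>k. indicator {n} (fst k) * (?u (snd k) * cis (phase k z)) \<partial>freq)"
        by (simp add: ext_def atom_fourier_def mult.assoc)
      also have "\<dots> = (\<integral>\<xi>. ?u (snd (n, \<xi>)) * cis (phase (n, \<xi>) z) \<partial>lborel)"
        using integrable_mult_cis[OF ig, of "\<lambda>k. phase k z"]
        by (intro freq_integral_slice) (simp add: atom_fourier_def mult.assoc)
      also have "\<dots> = (\<integral>\<xi>. (cis (of_int n * fst z) * complex_of_real ?c) * (cis (\<xi> * (snd z - y0)) * complex_of_real (exp (- ((1 / a) * \<xi>\<^sup>2) / 2))) \<partial>lborel)"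
      proof (intro Bochner_Integration.integral_cong refl)
        fix \<xi>
        have "cis (- (\<xi> * y0)) * cis (phase (n, \<xi>) z) = cis (of_int n * fst z) * cis (\<xi> * (snd z - y0))"
          by (simp add: cis_mult phase_def algebra_simps)
        then show "?u (snd (n, \<xi>)) * cis (phase (n, \<xi>) z) = (cis (of_int n * fst z) * complex_of_real ?c) * (cis (\<xi> * (snd z - y0)) * complex_of_real (exp (- ((1 / a) * \<xi>\<^sup>2) / 2)))"
        proof -
          assume e: "cis (- (\<xi> * y0)) * cis (phase (n, \<xi>) z) = cis (of_int n * fst z) * cis (\<xi> * (snd z - y0))"
          have "?u (snd (n, \<xi>)) * cis (phase (n, \<xi>) z) = complex_of_real ?c * complex_of_real (exp (- ((1 / a) * \<xi>\<^sup>2) / 2)) * (cis (- (\<xi> * y0)) * cis (phase (n, \<xi>) z))"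
            by (simp only: snd_conv of_real_mult mult.assoc)
          then show ?thesis unfolding e by (simp only: mult_ac)
        qed
      qed
      also have "\<dots> = (cis (of_int n * fst z) * complex_of_real ?c) * complex_of_real (sqrt (2 * pi / (1 / a)) * exp (- (snd z - y0)\<^sup>2 / (2 * (1 / a))))"
        by (simp only: integral_mult_right_zero gaussian_fourier[OF a'])
      also have "\<dots> = cis (of_int n * fst z) * complex_of_real (?c * (sqrt (2 * pi / (1 / a)) * exp (- (snd z - y0)\<^sup>2 / (2 * (1 / a)))))"
        by (simp only: of_real_mult mult.assoc)
      also have "?c * (sqrt (2 * pi / (1 / a)) * exp (- (snd z - y0)\<^sup>2 / (2 * (1 / a)))) = exp (- (a * (snd z - y0)\<^sup>2) / 2)"
        using a by (simp add: real_sqrt_mult real_sqrt_divide field_simps)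
      finally show ?thesis by (simp add: atom_def)
    qed
    show "(\<integral>z. atom n y0 a z * cis (- phase k z) \<partial>cylinder) = complex_of_real (4 * pi\<^sup>2) * atom_fourier n y0 a k" for k
    proof -
      have "atom n y0 a z * cis (- phase k z) = cis (of_int (n - fst k) * fst z) * (complex_of_real (exp (- (a * (snd z - y0)\<^sup>2) / 2)) * cis (snd z * - snd k))" for z
      proof -
        have "cis (of_int n * fst z) * cis (- phase k z) = cis (of_int (n - fst k) * fst z) * cis (snd z * - snd k)"
          by (simp add: cis_mult phase_def algebra_simps)
        then have "cis (of_int n * fst z) * cis (- phase k z) * complex_of_real (exp (- (a * (snd z - y0)\<^sup>2) / 2))
          = cis (of_int (n - fst k) * fst z) * cis (snd z * - snd k) * complex_of_real (exp (- (a * (snd z - y0)\<^sup>2) / 2))"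
          by (rule arg_cong)
        then show ?thesis by (simp only: atom_def mult.assoc mult.commute[of "complex_of_real (exp (- (a * (snd z - y0)\<^sup>2) / 2))"])
      qed
      then have "(\<integral>z. atom n y0 a z * cis (- phase k z) \<partial>cylinder)
        = (if n - fst k = 0 then complex_of_real (2 * pi) else 0) * (\<integral>y. complex_of_real (exp (- (a * (y - y0)\<^sup>2) / 2)) * cis (y * - snd k) \<partial>lborel)"
        by (simp only:) (rule integrable_cylinder_snd(2), rule integrable_mult_cis[OF iv], simp)
      also have "\<dots> = complex_of_real (4 * pi\<^sup>2) * atom_fourier n y0 a k"
        unfolding shifted_gaussian_fourier[OF a]
        by (auto simp: atom_fourier_def indicator_def power2_eq_square mult.commute)
      finally show ?thesis .
    qed
  qed measurable
qed

section \<open>Approximation of arcs and intervals\<close>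

inductive_set trig :: "(real \<Rightarrow> complex) set" where
  trig_cis: "(\<lambda>x. cis (of_int n * x)) \<in> trig"
| trig_add: "f \<in> trig \<Longrightarrow> g \<in> trig \<Longrightarrow> (\<lambda>x. f x + g x) \<in> trig"
| trig_mult: "f \<in> trig \<Longrightarrow> (\<lambda>x. c * f x) \<in> trig"

inductive_set gaussians :: "(real \<Rightarrow> complex) set" where
  gaussians_exp: "0 < a \<Longrightarrow> (\<lambda>y. complex_of_real (exp (- (a * (y - y0)\<^sup>2) / 2))) \<in> gaussians"
| gaussians_add: "f \<in> gaussians \<Longrightarrow> g \<in> gaussians \<Longrightarrow> (\<lambda>x. f x + g x) \<in> gaussians"
| gaussians_mult: "f \<in> gaussians \<Longrightarrow> (\<lambda>x. c * f x) \<in> gaussians"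

lemma nice_tensor:
  assumes "p \<in> trig" "q \<in> gaussians"
  shows "\<exists>g. nice (\<lambda>z. p (fst z) * q (snd z)) g"
  using assms(1)
proof induction
  case (trig_cis n)
  show ?case using assms(2)
  proof induction
    case (gaussians_exp a y0)
    show ?case using nice_atom[OF gaussians_exp, of n y0] unfolding atom_def by blast
  next
    case (gaussians_add f g)
    then obtain u v where "nice (\<lambda>z. cis (of_int n * fst z) * f (snd z)) u" "nice (\<lambda>z. cis (of_int n * fst z) * g (snd z)) v" by auto
    from nice_add[OF this] show ?case by (auto simp: distrib_left)
  next
    case (gaussians_mult f c)
    then obtain u where "nice (\<lambda>z. cis (of_int n * fst z) * f (snd z)) u" by auto
    from nice_mult[OF this, of c] show ?case by (auto simp: mult.left_commute)
  qed
next
  case (trig_add f g)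
  then obtain u v where "nice (\<lambda>z. f (fst z) * q (snd z)) u" "nice (\<lambda>z. g (fst z) * q (snd z)) v" by auto
  from nice_add[OF this] show ?case by (auto simp: distrib_right)
next
  case (trig_mult f c)
  then obtain u where "nice (\<lambda>z. f (fst z) * q (snd z)) u" by auto
  from nice_mult[OF this, of c] show ?case by (auto simp: mult.assoc)
qed

lemma trig_sum: "finite S \<Longrightarrow> (\<And>i. i \<in> S \<Longrightarrow> f i \<in> trig) \<Longrightarrow> (\<lambda>x. \<Sum>i\<in>S. f i x) \<in> trig"
proof (induction S rule: finite_induct)
  case empty
  then show ?case using trig_mult[OF trig_cis[of 0], of 0] by simp
qed (auto intro: trig_add)

lemma gaussians_sum: "finite S \<Longrightarrow> (\<And>i. i \<in> S \<Longrightarrow> f i \<in> gaussians) \<Longrightarrow> (\<lambda>x. \<Sum>i\<in>S. f i x) \<in> gaussians"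
proof (induction S rule: finite_induct)
  case empty
  then show ?case using gaussians_mult[OF gaussians_exp[of 1 0], of 0] by simp
qed (auto intro: gaussians_add)

lemma trig_cis_mult: "f \<in> trig \<Longrightarrow> (\<lambda>x. cis (of_int n * x) * f x) \<in> trig"
proof (induction rule: trig.induct)
  case (trig_cis m)
  show ?case using trig.trig_cis[of "n + m"] by (simp add: cis_mult distrib_right)
next
  case (trig_add f g)
  from trig.trig_add[OF trig_add(3,4)] show ?case by (simp add: distrib_left)
next
  case (trig_mult f c)
  from trig.trig_mult[OF trig_mult(2), of c] show ?case by (simp add: mult.left_commute)
qed

lemma trig_cos_power: "(\<lambda>x. complex_of_real (cos (x - x0) ^ j)) \<in> trig"
proof (induction j)
  case 0
  show ?case using trig_cis[of 0] by simp
next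
  case (Suc j)
  let ?f = "\<lambda>x. complex_of_real (cos (x - x0) ^ j)"
  have "complex_of_real (cos (x - x0)) = (cis (- x0) / 2) * cis (of_int 1 * x) + (cis x0 / 2) * cis (of_int (- 1) * x)" for x
  proof -
    have "(cis (- x0) / 2) * cis (of_int 1 * x) + (cis x0 / 2) * cis (of_int (- 1) * x) = (cis (x - x0) + cis (- (x - x0))) / 2"
      by (simp add: cis_mult add_divide_distrib)
    also have "\<dots> = complex_of_real (cos (x - x0))" using cos_minus[of "x - x0"] sin_minus[of "x - x0"] by (simp add: complex_eq_iff)
    finally show ?thesis by simp
  qed
  then have "(\<lambda>x. complex_of_real (cos (x - x0) ^ Suc j)) = (\<lambda>x. (cis (- x0) / 2) * (cis (of_int 1 * x) * ?f x) + (cis x0 / 2) * (cis (of_int (- 1) * x) * ?f x))"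
    by (simp add: fun_eq_iff distrib_right mult.assoc)
  also have "\<dots> \<in> trig"
    by (intro trig_add trig_mult trig_cis_mult Suc)
  finally show ?case .
qed

text \<open>Continuous functions increasing to the indicator of \<open>c > c0\<close>; a
  discontinuous indicator could not be approximated uniformly by polynomials.\<close>

definition ramp :: "real \<Rightarrow> nat \<Rightarrow> real \<Rightarrow> real" where
  "ramp c0 m c = min 1 (max 0 (real (Suc m) * (c - c0)))"

lemma ramp_bounds: "0 \<le> ramp c0 m c" "ramp c0 m c \<le> 1" "c \<le> c0 \<Longrightarrow> ramp c0 m c = 0"
  by (auto simp: ramp_def mult_nonneg_nonpos)

lemma ramp_tendsto: "(\<lambda>m. ramp c0 m c) \<longlonglongrightarrow> (if c0 < c then 1 else 0)"
proof (cases "c0 < c")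
  case True
  obtain N where N: "1 / (c - c0) < real N" using reals_Archimedean2 by blast
  have "ramp c0 m c = 1" if "N \<le> m" for m
  proof -
    have "1 / (c - c0) \<le> real (Suc m)" using N that by simp
    then have "1 \<le> real (Suc m) * (c - c0)" using True by (simp add: divide_le_eq)
    then show ?thesis by (simp add: ramp_def)
  qed
  then have "eventually (\<lambda>m. ramp c0 m c = 1) sequentially" by (auto simp: eventually_sequentially)
  then show ?thesis using True by (simp add: tendsto_eventually)
next
  case False
  then show ?thesis by (simp add: ramp_bounds)
qed

lemma continuous_ramp: "continuous_on S (ramp c0 m)"
  unfolding ramp_def[abs_def] by (intro continuous_intros)

lemma weierstrass_sum:
  fixes f :: "real \<Rightarrow> real"
  assumes "continuous_on {- 1..1} f" "0 < e"
  obtains N :: nat and a where "\<And>x. \<bar>x\<bar> \<le> 1 \<Longrightarrow> \<bar>f x - (\<Sum>i\<le>N. a i * x ^ i)\<bar> < e"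
proof -
  obtain P where P: "real_polynomial_function P" "\<And>x. x \<in> {- 1..1} \<Longrightarrow> \<bar>f x - P x\<bar> < e"
    by (rule Stone_Weierstrass_real_polynomial_function[of "{- 1..1}" f e]) (use assms in auto)
  from real_polynomial_function_imp_sum[OF P(1)] obtain a N where "P = (\<lambda>x. \<Sum>i\<le>N. a i * x ^ i)" by blast
  with P(2) show ?thesis by (intro that[where a=a and N=N]) (auto simp: abs_le_iff)
qed

text \<open>The limit set is a superlevel set of cos (x - x0), so polynomials in this cosine that
  approximate the ramps do the job, and periodicity is built in. The bound 2 is 1 for the ramp plus
  1 for the largest approximation error.\<close>

lemma arc_approximation:
  obtains p where "\<And>m. p m \<in> trig" "\<And>m x. norm (p m x) \<le> 2"
    "\<And>x. (\<lambda>m. p m x) \<longlonglongrightarrow> (if cos r < cos (x - x0) then 1 else 0)"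
proof -
  have "\<exists>N a. \<forall>x. \<bar>x\<bar> \<le> 1 \<longrightarrow> \<bar>ramp (cos r) m x - (\<Sum>i\<le>N. a i * x ^ i)\<bar> < 1 / real (Suc m)" for m
  proof -
    have "0 < 1 / real (Suc m)" by simp
    from weierstrass_sum[OF continuous_ramp this] show ?thesis by metis
  qed
  then obtain N a where Na: "\<And>m x. \<bar>x\<bar> \<le> 1 \<Longrightarrow> \<bar>ramp (cos r) m x - (\<Sum>i\<le>N m. a m i * x ^ i)\<bar> < 1 / real (Suc m)"
    by metis
  let ?P = "\<lambda>m c. \<Sum>i\<le>N m. a m i * c ^ i"
  let ?p = "\<lambda>m x. complex_of_real (?P m (cos (x - x0)))"
  show ?thesis
  proof (rule that[of ?p])
    fix m
    show "?p m \<in> trig"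
      unfolding of_real_sum of_real_mult by (intro trig_sum trig_mult trig_cos_power) simp
    fix x
    have "\<bar>?P m (cos (x - x0))\<bar> \<le> \<bar>ramp (cos r) m (cos (x - x0))\<bar> + 1 / real (Suc m)"
      using Na[OF abs_cos_le_one[of "x - x0"], of m] by linarith
    also have "\<dots> \<le> 1 + 1"
      using ramp_bounds(1,2)[of "cos r" m "cos (x - x0)"] by (intro add_mono) auto
    finally show "norm (?p m x) \<le> 2" unfolding norm_of_real by simp
  next
    fix x
    have "(\<lambda>m. ?P m (cos (x - x0)) - ramp (cos r) m (cos (x - x0))) \<longlonglongrightarrow> 0"
    proof (rule tendsto_rabs_zero_cancel, rule tendsto_sandwich[OF _ _ tendsto_const LIMSEQ_Suc[OF lim_1_over_n]])
      show "\<forall>\<^sub>F m in sequentially. \<bar>?P m (cos (x - x0)) - ramp (cos r) m (cos (x - x0))\<bar> \<le> 1 / real (Suc m)"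
        using Na[of "cos (x - x0)"] by (intro always_eventually allI) (simp add: abs_minus_commute less_imp_le)
    qed simp
    from tendsto_add[OF this ramp_tendsto[of "cos r" "cos (x - x0)"]]
    have "(\<lambda>m. ?P m (cos (x - x0))) \<longlonglongrightarrow> (if cos r < cos (x - x0) then 1 else 0)" by simp
    from tendsto_of_real[OF this, where 'a=complex] show "(\<lambda>m. ?p m x) \<longlonglongrightarrow> (if cos r < cos (x - x0) then 1 else 0)"
      by (simp split: if_splits)
  qed
qed

text \<open>The interval is a superlevel set of the Gaussian c(y) = exp (- (y - y0)^2 / 2), whose
  powers are Gaussians with the same centre. Only polynomials in c without constant term decay at
  infinity, so a polynomial is fitted to the ramp divided by c and then multiplied by c.\<close>

lemma interval_approximation:
  assumes r: "0 < r"
  obtains q K where "\<And>m. q m \<in> gaussians" "0 \<le> K" "\<And>m y. norm (q m y) \<le> K * exp (- (y - y0)\<^sup>2 / 2)"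
    "\<And>y. (\<lambda>m. q m y) \<longlonglongrightarrow> (if \<bar>y - y0\<bar> < r then 1 else 0)"
proof -
  define c0 where "c0 = exp (- r\<^sup>2 / 2)"
  have c0: "0 < c0" by (simp add: c0_def)
  \<comment> \<open>The denominator is kept away from 0; where it differs from \<open>c\<close> the
    ramp vanishes.\<close>
  let ?F = "\<lambda>m c. ramp c0 m c / max c c0"
  have "\<exists>N a. \<forall>x. \<bar>x\<bar> \<le> 1 \<longrightarrow> \<bar>?F m x - (\<Sum>i\<le>N. a i * x ^ i)\<bar> < 1 / real (Suc m)" for m
  proof -
    have "continuous_on {- 1..1} (?F m)"
      using c0 by (intro continuous_intros continuous_ramp) (auto simp: max_def)
    from weierstrass_sum[OF this, of "1 / real (Suc m)"] show ?thesis by (metis zero_less_divide_1_iff of_nat_0_less_iff zero_less_Suc)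
  qed
  then obtain N a where Na: "\<And>m x. \<bar>x\<bar> \<le> 1 \<Longrightarrow> \<bar>?F m x - (\<Sum>i\<le>N m. a m i * x ^ i)\<bar> < 1 / real (Suc m)"
    by metis
  let ?Q = "\<lambda>m c. \<Sum>i\<le>N m. a m i * c ^ i"
  let ?c = "\<lambda>y. exp (- (y - y0)\<^sup>2 / 2)"
  let ?q = "\<lambda>m y. complex_of_real (?c y * ?Q m (?c y))"
  have c1: "\<bar>?c y\<bar> \<le> 1" "0 < ?c y" for y by auto
  have cF: "?c y * ?F m (?c y) = ramp c0 m (?c y)" for m y
    using c1[of y] c0 by (cases "?c y \<le> c0") (auto simp: ramp_bounds max_def)
  show ?thesis
  proof (rule that[of ?q "1 / c0 + 1"])
    fix m
    have "?q m = (\<lambda>y. \<Sum>i\<le>N m. complex_of_real (a m i) * complex_of_real (exp (- (real (Suc i) * (y - y0)\<^sup>2) / 2)))"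
    proof
      fix y
      have "?c y * ?c y ^ i = exp (- (real (Suc i) * (y - y0)\<^sup>2) / 2)" for i
        unfolding power_Suc[symmetric] by (subst exp_of_nat_mult[symmetric]) (simp only: times_divide_eq_right mult_minus_right)
      then have "?c y * ?Q m (?c y) = (\<Sum>i\<le>N m. a m i * exp (- (real (Suc i) * (y - y0)\<^sup>2) / 2))"
        unfolding sum_distrib_left by (intro sum.cong refl) (simp only: mult.left_commute)
      then show "?q m y = (\<Sum>i\<le>N m. complex_of_real (a m i) * complex_of_real (exp (- (real (Suc i) * (y - y0)\<^sup>2) / 2)))"
        by (simp only: of_real_sum of_real_mult)
    qed
    also have "\<dots> \<in> gaussians"
      by (intro gaussians_sum gaussians_mult gaussians_exp) auto
    finally show "?q m \<in> gaussians" .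
    show "0 \<le> 1 / c0 + 1" using c0 by simp
    fix y
    have "\<bar>?F m (?c y)\<bar> \<le> 1 / c0"
      using ramp_bounds(1,2)[of c0 m "?c y"] c0 by (auto simp: abs_of_nonneg intro!: frac_le)
    moreover have "1 / real (Suc m) \<le> 1" by simp
    ultimately have "\<bar>?Q m (?c y)\<bar> \<le> 1 / c0 + 1"
      using Na[OF c1(1)[of y], of m] by linarith
    then have "\<bar>?c y\<bar> * \<bar>?Q m (?c y)\<bar> \<le> ?c y * (1 / c0 + 1)"
      using c1(2)[of y] by (intro mult_mono) auto
    then show "norm (?q m y) \<le> (1 / c0 + 1) * ?c y"
      by (simp only: norm_of_real abs_mult mult.commute)
  next
    fix y
    have "(\<lambda>m. ?Q m (?c y) - ?F m (?c y)) \<longlonglongrightarrow> 0"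
    proof (rule tendsto_rabs_zero_cancel, rule tendsto_sandwich[OF _ _ tendsto_const LIMSEQ_Suc[OF lim_1_over_n]])
      show "\<forall>\<^sub>F m in sequentially. \<bar>?Q m (?c y) - ?F m (?c y)\<bar> \<le> 1 / real (Suc m)"
        using Na[OF c1(1)[of y]] by (intro always_eventually allI) (simp add: abs_minus_commute less_imp_le)
    qed simp
    from tendsto_add[OF tendsto_mult_left[OF this, of "?c y"] ramp_tendsto[of c0 "?c y"]]
    have "(\<lambda>m. ?c y * ?Q m (?c y)) \<longlonglongrightarrow> (if c0 < ?c y then 1 else 0)"
      unfolding right_diff_distrib cF diff_add_cancel mult_zero_right add_0 .
    moreover have "c0 < ?c y \<longleftrightarrow> \<bar>y - y0\<bar> < r"
      using r abs_le_square_iff[of r "y - y0"] by (auto simp: c0_def not_le[symmetric])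
    ultimately have "(\<lambda>m. ?c y * ?Q m (?c y)) \<longlonglongrightarrow> (if \<bar>y - y0\<bar> < r then 1 else 0)" by simp
    from tendsto_of_real[OF this, where 'a=complex] show "(\<lambda>m. ?q m y) \<longlonglongrightarrow> (if \<bar>y - y0\<bar> < r then 1 else 0)"
      by (simp split: if_splits)
  qed
qed

section \<open>Closures in L^p\<close>

lemma powr_norm_add_le:
  fixes a b :: complex
  assumes p: "0 < p"
  shows "norm (a + b) powr p \<le> 2 powr p * (norm a powr p + norm b powr p)"
proof -
  define m where "m = max (norm a) (norm b)"
  have m: "0 \<le> m" by (simp add: m_def le_max_iff_disj)
  have "norm (a + b) \<le> 2 * m" using norm_triangle_ineq[of a b] by (simp add: m_def max_def)
  then have "norm (a + b) powr p \<le> (2 * m) powr p" using p by (intro powr_mono2) auto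
  also have "\<dots> = 2 powr p * m powr p" using m by (simp add: powr_mult)
  also have "m powr p \<le> norm a powr p + norm b powr p"
    by (cases "norm a \<le> norm b") (simp_all add: m_def max_def)
  finally show ?thesis by (simp add: mult_left_mono)
qed

text \<open>The closure is formulated with the p-th power of the norm. It satisfies the triangle
  inequality up to the factor \<open>2 powr p\<close>, which is enough for closedness and avoids
  roots.\<close>

locale Lp_closure =
  fixes M :: "'a measure" and p :: real and D :: "('a \<Rightarrow> complex) set"
  assumes p: "0 < p"
    and D_measurable: "f \<in> D \<Longrightarrow> f \<in> borel_measurable M"
    and D_add: "f \<in> D \<Longrightarrow> g \<in> D \<Longrightarrow> (\<lambda>x. f x + g x) \<in> D"
    and D_mult: "f \<in> D \<Longrightarrow> (\<lambda>x. c * f x) \<in> D"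
    and D_zero: "(\<lambda>_. 0) \<in> D"
begin

abbreviation N :: "('a \<Rightarrow> complex) \<Rightarrow> ennreal" where
  "N f \<equiv> (\<integral>\<^sup>+x. ennreal (norm (f x) powr p) \<partial>M)"

definition cl :: "('a \<Rightarrow> complex) \<Rightarrow> bool" where
  "cl f \<longleftrightarrow> f \<in> borel_measurable M \<and> (\<forall>e>0. \<exists>g\<in>D. N (\<lambda>x. f x - g x) < ennreal e)"

lemma cl_measurable: "cl f \<Longrightarrow> f \<in> borel_measurable M"
  by (simp add: cl_def)

lemma N_add_le:
  assumes [measurable]: "f \<in> borel_measurable M" "g \<in> borel_measurable M"
  shows "N (\<lambda>x. f x + g x) \<le> ennreal (2 powr p) * (N f + N g)"
proof -
  have "N (\<lambda>x. f x + g x) \<le> (\<integral>\<^sup>+x. ennreal (2 powr p) * (ennreal (norm (f x) powr p) + ennreal (norm (g x) powr p)) \<partial>M)"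
    by (intro nn_integral_mono) (simp add: ennreal_mult[symmetric] ennreal_plus[symmetric] ennreal_leI powr_norm_add_le[OF p] del: ennreal_plus)
  also have "\<dots> = ennreal (2 powr p) * (N f + N g)"
    by (subst nn_integral_cmult, measurable, subst nn_integral_add, measurable)
  finally show ?thesis .
qed

lemma cl_lim:
  assumes f: "f \<in> borel_measurable M"
    and lim: "\<And>e. 0 < e \<Longrightarrow> \<exists>g. cl g \<and> N (\<lambda>x. f x - g x) < ennreal e"
  shows "cl f"
  unfolding cl_def
proof (intro conjI allI impI f)
  fix e :: real assume e: "0 < e"
  define e' where "e' = e / (2 * 2 powr p)"
  have e': "0 < e'" using e by (simp add: e'_def)
  obtain g where g: "cl g" "N (\<lambda>x. f x - g x) < ennreal e'" using lim[OF e'] by blast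
  then obtain h where h: "h \<in> D" "N (\<lambda>x. g x - h x) < ennreal e'" using e' unfolding cl_def by blast
  note [measurable] = f cl_measurable[OF g(1)] D_measurable[OF h(1)]
  have "N (\<lambda>x. f x - h x) = N (\<lambda>x. (f x - g x) + (g x - h x))" by simp
  also have "\<dots> \<le> ennreal (2 powr p) * (N (\<lambda>x. f x - g x) + N (\<lambda>x. g x - h x))"
    by (rule N_add_le) measurable
  also have "\<dots> < ennreal (2 powr p) * (ennreal e' + ennreal e')"
    by (intro ennreal_mult_strict_left_mono add_strict_mono g(2) h(2)) auto
  also have "\<dots> = ennreal (2 powr p * (e' + e'))"
    using e' by (subst ennreal_plus[symmetric], simp, simp) (simp add: ennreal_mult)
  also have "2 powr p * (e' + e') = e" using e by (simp add: e'_def field_simps)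
  finally show "\<exists>g\<in>D. N (\<lambda>x. f x - g x) < ennreal e" using h(1) by blast
qed

lemma cl_D: "f \<in> D \<Longrightarrow> cl f"
  using p by (auto simp: cl_def D_measurable intro!: bexI[of _ f])

lemma cl_add:
  assumes 1: "cl f" and 2: "cl f'"
  shows "cl (\<lambda>x. f x + f' x)"
  unfolding cl_def
proof (intro conjI allI impI)
  note [measurable] = cl_measurable[OF 1] cl_measurable[OF 2]
  show "(\<lambda>x. f x + f' x) \<in> borel_measurable M" by measurable
  fix e :: real assume e: "0 < e"
  define e' where "e' = e / (2 * 2 powr p)"
  have e': "0 < e'" using e by (simp add: e'_def)
  obtain g where g: "g \<in> D" "N (\<lambda>x. f x - g x) < ennreal e'" using 1 e' unfolding cl_def by blast
  obtain h where h: "h \<in> D" "N (\<lambda>x. f' x - h x) < ennreal e'" using 2 e' unfolding cl_def by blast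
  note [measurable] = D_measurable[OF g(1)] D_measurable[OF h(1)]
  have "N (\<lambda>x. f x + f' x - (g x + h x)) = N (\<lambda>x. (f x - g x) + (f' x - h x))" by (simp add: algebra_simps)
  also have "\<dots> \<le> ennreal (2 powr p) * (N (\<lambda>x. f x - g x) + N (\<lambda>x. f' x - h x))"
    by (rule N_add_le) measurable
  also have "\<dots> < ennreal (2 powr p) * (ennreal e' + ennreal e')"
    by (intro ennreal_mult_strict_left_mono add_strict_mono g(2) h(2)) auto
  also have "\<dots> = ennreal (2 powr p * (e' + e'))"
    using e' by (subst ennreal_plus[symmetric], simp, simp) (simp add: ennreal_mult)
  also have "2 powr p * (e' + e') = e" using e by (simp add: e'_def field_simps)
  finally have "N (\<lambda>x. f x + f' x - (g x + h x)) < ennreal e" .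
  then show "\<exists>g\<in>D. N (\<lambda>x. f x + f' x - g x) < ennreal e" by (rule bexI[OF _ D_add[OF g(1) h(1)]])
qed

lemma cl_mult:
  assumes 1: "cl f"
  shows "cl (\<lambda>x. c * f x)"
  unfolding cl_def
proof (intro conjI allI impI)
  note [measurable] = cl_measurable[OF 1]
  show "(\<lambda>x. c * f x) \<in> borel_measurable M" by measurable
  fix e :: real assume e: "0 < e"
  define e' where "e' = e / (norm c powr p + 1)"
  have c: "0 < norm c powr p + 1" by (simp add: add_nonneg_pos)
  have e': "0 < e'" using e c by (simp add: e'_def)
  obtain g where g: "g \<in> D" "N (\<lambda>x. f x - g x) < ennreal e'" using 1 e' unfolding cl_def by blast
  note [measurable] = D_measurable[OF g(1)]
  have "N (\<lambda>x. c * f x - c * g x) = (\<integral>\<^sup>+x. ennreal (norm c powr p) * ennreal (norm (f x - g x) powr p) \<partial>M)"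
    by (intro nn_integral_cong) (simp add: right_diff_distrib[symmetric] norm_mult powr_mult ennreal_mult)
  also have "\<dots> = ennreal (norm c powr p) * N (\<lambda>x. f x - g x)"
    by (rule nn_integral_cmult) measurable
  also have "\<dots> \<le> ennreal (norm c powr p) * ennreal e'"
    by (rule mult_left_mono[OF less_imp_le[OF g(2)]]) simp
  also have "\<dots> < ennreal e"
  proof -
    have "norm c powr p * e' < e" using e c by (simp add: e'_def field_simps)
    then show ?thesis using e e' by (simp add: ennreal_mult[symmetric] ennreal_lessI)
  qed
  finally have "N (\<lambda>x. c * f x - c * g x) < ennreal e" .
  then show "\<exists>g\<in>D. N (\<lambda>x. c * f x - g x) < ennreal e" by (rule bexI[OF _ D_mult[OF g(1)]])
qed

lemma cl_sum: "finite S \<Longrightarrow> (\<And>i. i \<in> S \<Longrightarrow> cl (f i)) \<Longrightarrow> cl (\<lambda>x. \<Sum>i\<in>S. f i x)"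
  by (induction S rule: finite_induct) (auto intro: cl_add cl_D[OF D_zero])

text \<open>The p-th powers of the differences are dominated by (2 w)^p, because the bound by
  \<open>w\<close> passes to the limit \<open>f\<close>.\<close>

lemma cl_dominated:
  assumes g: "\<And>i::nat. cl (g i)" and f: "f \<in> borel_measurable M"
    and lim: "AE x in M. (\<lambda>i. g i x) \<longlonglongrightarrow> f x"
    and bound: "\<And>i. AE x in M. norm (g i x) \<le> w x"
    and w[measurable]: "w \<in> borel_measurable M" and fin: "(\<integral>\<^sup>+x. ennreal (w x powr p) \<partial>M) < \<infinity>"
  shows "cl f"
proof (rule cl_lim[OF f])
  note [measurable] = f cl_measurable[OF g]
  have iw: "integrable M (\<lambda>x. 2 powr p * w x powr p)"
    using fin by (intro integrable_mult_right integrableI_bounded) auto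
  have "(\<lambda>i. \<integral>x. norm (f x - g i x) powr p \<partial>M) \<longlonglongrightarrow> (\<integral>x. 0 \<partial>M)"
  proof (rule integral_dominated_convergence[OF _ _ iw])
    show "AE x in M. (\<lambda>i. norm (f x - g i x) powr p) \<longlonglongrightarrow> 0"
      using lim
    proof eventually_elim
      case (elim x)
      have "(\<lambda>i. norm (f x - g i x)) \<longlonglongrightarrow> norm (f x - f x)" by (intro tendsto_intros elim)
      from tendsto_powr2[OF this tendsto_const, of p] p show ?case by simp
    qed
    have all: "AE x in M. \<forall>i. norm (g i x) \<le> w x" using bound by (simp add: AE_all_countable)
    show "AE x in M. norm (norm (f x - g i x) powr p) \<le> 2 powr p * w x powr p" for i
      using all lim
    proof eventually_elim
      case (elim x)
      have "norm (f x) \<le> w x"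
        by (rule Lim_bounded[OF tendsto_norm[OF elim(2)]]) (use elim(1) in auto)
      then have "norm (f x - g i x) \<le> 2 * w x"
        using elim(1)[rule_format, of i] norm_triangle_ineq4[of "f x" "g i x"] by linarith
      moreover have "0 \<le> w x" using elim(1)[rule_format, of 0] norm_ge_zero order_trans by blast
      ultimately show ?case
        using p by (simp add: powr_mult[symmetric] powr_mono2)
    qed
  qed measurable
  then have lim0: "(\<lambda>i. \<integral>x. norm (f x - g i x) powr p \<partial>M) \<longlonglongrightarrow> 0" by simp
  fix e :: real assume e: "0 < e"
  have "eventually (\<lambda>i. (\<integral>x. norm (f x - g i x) powr p \<partial>M) < e) sequentially"
    by (rule order_tendstoD(2)[OF lim0 e])
  then obtain i where i: "(\<integral>x. norm (f x - g i x) powr p \<partial>M) < e" by (auto simp: eventually_sequentially)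
  have "integrable M (\<lambda>x. norm (f x - g i x) powr p)"
  proof (rule Bochner_Integration.integrable_bound[OF iw])
    have all: "AE x in M. \<forall>i. norm (g i x) \<le> w x" using bound by (simp add: AE_all_countable)
    show "AE x in M. norm (norm (f x - g i x) powr p) \<le> norm (2 powr p * w x powr p)"
      using all lim
    proof eventually_elim
      case (elim x)
      have "norm (f x) \<le> w x"
        by (rule Lim_bounded[OF tendsto_norm[OF elim(2)]]) (use elim(1) in auto)
      then have "norm (f x - g i x) \<le> 2 * w x"
        using elim(1)[rule_format, of i] norm_triangle_ineq4[of "f x" "g i x"] by linarith
      moreover have "0 \<le> w x" using elim(1)[rule_format, of 0] norm_ge_zero order_trans by blast
      ultimately show ?case
        using p by (simp add: powr_mult[symmetric] powr_mono2)
    qed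
  qed measurable
  from nn_integral_eq_integral[OF this] i e
  show "\<exists>g. cl g \<and> N (\<lambda>x. f x - g x) < ennreal e"
    using g[of i] by (intro exI[of _ "g i"]) (simp add: ennreal_lessI)
qed

context
  fixes G :: "'a set set" and \<Omega> :: "nat \<Rightarrow> 'a set"
  assumes G: "Int_stable G" "G \<subseteq> Pow (space M)" "sets M = sigma_sets (space M) G"
    and \<Omega>: "\<And>i. \<Omega> i \<in> sets M" "incseq \<Omega>" "(\<Union>i. \<Omega> i) = space M" "\<And>i. emeasure M (\<Omega> i) < \<infinity>"
    and base: "\<And>A i. A \<in> G \<Longrightarrow> cl (indicator (A \<inter> \<Omega> i))" "\<And>i. cl (indicator (\<Omega> i))"
begin

text \<open>Dynkin's theorem on the intersection-stable generator. Intersecting with a set of finite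
  measure keeps all indicators in L^p: complements become differences, and disjoint unions become
  limits dominated by the indicator of \<open>\<Omega> i\<close>.\<close>

lemma cl_indicator:
  assumes "A \<in> sets M"
  shows "cl (indicator (A \<inter> \<Omega> i))"
proof -
  have "A \<in> sigma_sets (space M) G" using assms G(3) by simp
  with G(1,2) show ?thesis
  proof (induction rule: sigma_sets_induct_disjoint)
    case (basic A)
    then show ?case by (rule base(1))
  next
    case empty
    then show ?case using cl_D[OF D_zero] by (simp add: indicator_def)
  next
    case (compl A)
    have "indicator ((space M - A) \<inter> \<Omega> i) = (\<lambda>x. indicator (\<Omega> i) x + (- 1) * indicator (A \<inter> \<Omega> i) x :: complex)"
      using sets.sets_into_space[OF \<Omega>(1)[of i]] by (auto simp: fun_eq_iff indicator_def)
    then show ?case using cl_add[OF base(2)[of i] cl_mult[OF compl(2), of "- 1"]] by simp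
  next
    case (union A)
    have sA: "A j \<in> sets M" for j using union(2) G(3) by auto
    note [measurable] = sA \<Omega>(1)
    have eq: "(\<Sum>j<n. indicator (A j \<inter> \<Omega> i) x) = (indicator (\<Union>j<n. A j \<inter> \<Omega> i) x :: complex)" for n x
      by (rule indicator_UN_disjoint[symmetric]) (use union(1) in \<open>auto simp: disjoint_family_on_def\<close>)
    show ?case
    proof (rule cl_dominated[where w="indicator (\<Omega> i)" and g="\<lambda>n x. \<Sum>j<n. indicator (A j \<inter> \<Omega> i) x"])
      show "cl (\<lambda>x. \<Sum>j<n. indicator (A j \<inter> \<Omega> i) x)" for n
        by (intro cl_sum union(3)) simp
      have "(\<Union>j. A j) \<inter> \<Omega> i = (\<Union>j. A j \<inter> \<Omega> i)" by auto
      then show "AE x in M. (\<lambda>n. \<Sum>j<n. indicator (A j \<inter> \<Omega> i) x) \<longlonglongrightarrow> (indicator ((\<Union>j. A j) \<inter> \<Omega> i) x :: complex)"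
        unfolding eq by (intro AE_I2) (simp only: LIMSEQ_indicator_UN)
      show "AE x in M. norm (\<Sum>j<n. indicator (A j \<inter> \<Omega> i) x :: complex) \<le> indicator (\<Omega> i) x" for n
        unfolding eq by (intro AE_I2) (auto simp: indicator_def)
      have "(\<integral>\<^sup>+x. ennreal (indicator (\<Omega> i) x powr p) \<partial>M) = (\<integral>\<^sup>+x. indicator (\<Omega> i) x \<partial>M)"
        using p by (intro nn_integral_cong) (auto simp: indicator_def)
      then show "(\<integral>\<^sup>+x. ennreal (indicator (\<Omega> i) x powr p) \<partial>M) < \<infinity>" using \<Omega>(4)[of i] by simp
    qed measurable
  qed
qed

text \<open>Simple functions converging to \<open>f\<close> under the majorant 2 \<bar>f\<bar> are
  cut off to \<open>\<Omega> i\<close>; each is a finite combination of the indicators treated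
  before.\<close>

lemma cl_Lp:
  assumes f[measurable]: "f \<in> borel_measurable M" and fin: "N f < \<infinity>"
  shows "cl f"
proof -
  from borel_measurable_implies_sequence_metric[OF f, of 0] obtain s where
    s0: "\<forall>i. simple_function M (s i)" "\<forall>x\<in>space M. (\<lambda>i. s i x) \<longlonglongrightarrow> f x"
      "\<forall>i. \<forall>x\<in>space M. dist (s i x) 0 \<le> 2 * dist (f x) 0" by (elim exE conjE) (rule that)
  have s: "\<And>i. simple_function M (s i)" "\<And>x. x \<in> space M \<Longrightarrow> (\<lambda>i. s i x) \<longlonglongrightarrow> f x"
    "\<And>i x. x \<in> space M \<Longrightarrow> norm (s i x) \<le> 2 * norm (f x)" using s0 by (auto simp: dist_norm)
  have cls: "cl (\<lambda>x. indicator (\<Omega> i) x * s i x)" for i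
  proof -
    have "cl (\<lambda>x. \<Sum>v\<in>s i ` space M. v * indicator (s i -` {v} \<inter> space M \<inter> \<Omega> i) x)"
      using s(1)[of i] by (intro cl_sum cl_mult cl_indicator) (auto dest: simple_functionD)
    moreover have "indicator (\<Omega> i) x * s i x = (\<Sum>v\<in>s i ` space M. v * indicator (s i -` {v} \<inter> space M \<inter> \<Omega> i) x)" for x
    proof (cases "x \<in> \<Omega> i")
      case True
      then have x: "x \<in> space M" using sets.sets_into_space[OF \<Omega>(1)[of i]] by auto
      have "(\<Sum>v\<in>s i ` space M. v * indicator (s i -` {v} \<inter> space M \<inter> \<Omega> i) x) = (\<Sum>v\<in>s i ` space M. if v = s i x then v else 0)"
        using True x by (intro sum.cong) (auto simp: indicator_def)
      also have "\<dots> = s i x"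
        using x simple_functionD(1)[OF s(1)[of i]] by (simp add: sum.delta)
      finally show ?thesis using True by simp
    qed simp
    ultimately show ?thesis by simp
  qed
  show ?thesis
  proof (rule cl_dominated[where w="\<lambda>x. 2 * norm (f x)" and g="\<lambda>i x. indicator (\<Omega> i) x * s i x"])
    show "cl (\<lambda>x. indicator (\<Omega> i) x * s i x)" for i by (rule cls)
    show "AE x in M. (\<lambda>i. indicator (\<Omega> i) x * s i x) \<longlonglongrightarrow> f x"
    proof (intro AE_I2)
      fix x assume x: "x \<in> space M"
      have "(\<lambda>i. indicator (\<Omega> i) x :: complex) \<longlonglongrightarrow> indicator (\<Union>i. \<Omega> i) x"
        by (rule LIMSEQ_indicator_incseq[OF \<Omega>(2)])
      from tendsto_mult[OF this s(2)[OF x]] show "(\<lambda>i. indicator (\<Omega> i) x * s i x) \<longlonglongrightarrow> f x"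
        using x \<Omega>(3) by simp
    qed
    show "AE x in M. norm (indicator (\<Omega> i) x * s i x) \<le> 2 * norm (f x)" for i
      using s(3) by (intro AE_I2) (auto simp: indicator_def)
    have "(\<integral>\<^sup>+x. ennreal ((2 * norm (f x)) powr p) \<partial>M) = (\<integral>\<^sup>+x. ennreal (2 powr p) * ennreal (norm (f x) powr p) \<partial>M)"
      by (simp add: powr_mult ennreal_mult)
    also have "\<dots> = ennreal (2 powr p) * N f"
      by (rule nn_integral_cmult) measurable
    also have "\<dots> < \<infinity>" using fin by (simp add: ennreal_mult_less_top)
    finally show "(\<integral>\<^sup>+x. ennreal ((2 * norm (f x)) powr p) \<partial>M) < \<infinity>" .
  qed measurable
qed

end

end

section \<open>Density of nice functions on the cylinder\<close>

abbreviation nices :: "(real \<times> real \<Rightarrow> complex) set" where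
  "nices \<equiv> {\<phi>. \<exists>g. nice \<phi> g}"

lemma nice_zero: "nice (\<lambda>_. 0) (\<lambda>_. 0)"
  using nice_mult[OF nice_atom[of 1 0 0], of 0] by simp

lemma Lp_closure_nices:
  assumes "sets M = sets cylinder" "0 < p"
  shows "Lp_closure M p nices"
proof
  show "f \<in> borel_measurable M" if "f \<in> nices" for f
    using that nice_family_measurable(3) by (auto simp: measurable_cong_sets[OF assms(1) refl])
qed (use assms(2) nice_zero in \<open>auto intro: nice_add nice_mult\<close>)

text \<open>The arc with centre and radius b/2 is (0, b) on the torus. Its endpoint x = 0 fails the
  strict inequality, hence the exclusion of a null set later. Points at distance more than pi from
  the centre are reflected.\<close>

lemma cos_less_cos_iff_arc:
  assumes b: "0 < b" "b \<le> 2 * pi" and x: "0 < x" "x < 2 * pi"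
  shows "cos (b / 2) < cos (x - b / 2) \<longleftrightarrow> x < b"
proof -
  define r where "r = b / 2"
  have r: "0 < r" "r \<le> pi" using b by (auto simp: r_def)
  have br: "b = 2 * r" by (simp add: r_def)
  show ?thesis
  proof (cases "\<bar>x - r\<bar> \<le> pi")
    case True
    have "cos r < cos \<bar>x - r\<bar> \<longleftrightarrow> \<bar>x - r\<bar> < r"
      using True r by (intro cos_mono_less_eq) auto
    then show ?thesis using x unfolding br by auto
  next
    case False
    then have u: "pi < x - r" using x r by auto
    have "cos (x - r) = cos (2 * pi - (x - r))" by simp
    also have "\<dots> \<le> cos r"
      using u x r by (intro cos_monotone_0_pi_le) auto
    finally show ?thesis using u r unfolding br by auto
  qed
qed

definition rectangles :: "(real \<times> real) set set" where
  "rectangles = {a \<times> b | a b. a \<in> (\<inter>) {0..<2 * pi} ` range lessThan \<and> b \<in> range lessThan}"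

lemma sets_cylinder_rectangles: "sets cylinder = sigma_sets ({0..<2 * pi} \<times> UNIV) rectangles"
proof -
  let ?T = "{0..<2 * pi} :: real set"
  let ?A = "(\<inter>) ?T ` range lessThan" and ?B = "range lessThan :: real set set"
  have 1: "sets torus = sets (sigma ?T ?A)"
  proof -
    have "sets torus = (\<inter>) ?T ` sets borel" by (simp add: torus_def sets_restrict_space)
    also have b: "sets borel = sigma_sets UNIV ?B" by (subst borel_Iio) simp
    also have "(\<inter>) ?T ` sigma_sets UNIV ?B = sigma_sets ?T ?A"
    proof (rule sigma_sets_Int)
      show "?T \<in> sigma_sets UNIV ?B" unfolding b[symmetric] by simp
    qed simp
    finally show ?thesis by (subst sets_measure_of) auto
  qed
  have 2: "sets lborel = sets (sigma UNIV ?B)" by (simp only: borel_Iio[symmetric] sets_lborel)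
  have "sets cylinder = sets (sigma ?T ?A \<Otimes>\<^sub>M sigma UNIV ?B)"
    unfolding cylinder_def by (rule sets_pair_measure_cong[OF 1 2])
  also have "sigma ?T ?A \<Otimes>\<^sub>M sigma UNIV ?B = sigma (?T \<times> UNIV) {a \<times> b | a b. a \<in> ?A \<and> b \<in> ?B}"
  proof (rule sigma_prod)
    show "\<exists>E\<subseteq>?A. countable E \<and> ?T = \<Union>E"
      by (intro exI[of _ "{?T}"] conjI) (auto intro!: image_eqI[of _ _ "{..<2 * pi}"])
    have "(UNIV :: real set) = \<Union>((\<lambda>n::nat. {..<real n}) ` UNIV)"
      using reals_Archimedean2 by auto
    then show "\<exists>E\<subseteq>?B. countable E \<and> UNIV = \<Union>E"
      by (intro exI[of _ "(\<lambda>n::nat. {..<real n}) ` UNIV"]) auto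
  qed auto
  also have "sets \<dots> = sigma_sets (?T \<times> UNIV) rectangles"
    unfolding rectangles_def by (subst sets_measure_of) auto
  finally show ?thesis .
qed

lemma Int_stable_rectangles: "Int_stable rectangles"
proof (unfold Int_stable_def rectangles_def, safe)
  fix a b c d :: real
  have "({0..<2 * pi} \<inter> {..<a}) \<times> {..<b} \<inter> ({0..<2 * pi} \<inter> {..<c}) \<times> {..<d} = ({0..<2 * pi} \<inter> {..<min a c}) \<times> {..<min b d}"
    by auto
  then show "\<exists>a' b'. ({0..<2 * pi} \<inter> {..<a}) \<times> {..<b} \<inter> ({0..<2 * pi} \<inter> {..<c}) \<times> {..<d} = a' \<times> b' \<and>
      a' \<in> (\<inter>) {0..<2 * pi} ` range lessThan \<and> b' \<in> range lessThan" by blast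
qed

definition box_exhaustion :: "nat \<Rightarrow> (real \<times> real) set" where
  "box_exhaustion i = {0..<2 * pi} \<times> {- real i<..<real i}"

lemma space_cylinder: "space cylinder = {0..<2 * pi} \<times> UNIV"
  by (simp add: cylinder_def space_pair_measure space_torus)

lemma box_exhaustion:
  "box_exhaustion i \<in> sets cylinder" "incseq box_exhaustion" "(\<Union>i. box_exhaustion i) = space cylinder"
proof -
  have "{0..<2 * pi} \<in> sets torus" using sets.top[of torus] by (simp add: space_torus)
  then show "box_exhaustion i \<in> sets cylinder"
    unfolding cylinder_def box_exhaustion_def by simp
  show "incseq box_exhaustion" by (auto simp: incseq_def box_exhaustion_def)
  have "\<exists>i::nat. - real i < y \<and> y < real i" for y
    using reals_Archimedean2[of "\<bar>y\<bar>"] by (metis abs_less_iff minus_less_iff)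
  then show "(\<Union>i. box_exhaustion i) = space cylinder" by (auto simp: box_exhaustion_def space_cylinder)
qed

text \<open>Two measures satisfy these conditions below: the cylinder measure, and for the
  uniqueness theorem a finite measure with density \<bar>G\<bar> on the cylinder.\<close>

context
  fixes M :: "(real \<times> real) measure" and p :: real
  assumes M: "sets M = sets cylinder" and p: "0 < p"
    and ae: "AE z in M. fst z \<noteq> 0"
    and gauss: "\<And>y0. (\<integral>\<^sup>+z. ennreal (exp (- (snd z - y0)\<^sup>2 / 2) powr p) \<partial>M) < \<infinity>"
begin

interpretation Lp_closure M p nices
  by (rule Lp_closure_nices[OF M p])

lemma space_M: "space M = {0..<2 * pi} \<times> UNIV"
  using sets_eq_imp_space_eq[OF M] by (simp add: space_cylinder)

text \<open>Products of trigonometric sums and Gaussian sums are nice, and they converge to the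
  rectangle under a Gaussian majorant. An interval is taken with both ends finite, since the
  approximation is centred at its midpoint.\<close>

lemma cl_rectangle: "cl (indicator (({0..<2 * pi} \<inter> {..<b}) \<times> {c<..<d}))"
proof (cases "0 < b \<and> c < d")
  case False
  then have "indicator (({0..<2 * pi} \<inter> {..<b}) \<times> {c<..<d}) = (\<lambda>_. 0 :: complex)"
    by (auto simp: fun_eq_iff indicator_def)
  then show ?thesis using cl_D[OF D_zero] by simp
next
  case True
  define b' where "b' = min b (2 * pi)"
  have b': "0 < b'" "b' \<le> 2 * pi" using True by (auto simp: b'_def)
  define y0 where "y0 = (c + d) / 2"
  define r where "r = (d - c) / 2"
  have r: "0 < r" using True by (simp add: r_def)
  obtain P where P: "\<And>m. P m \<in> trig" "\<And>m x. norm (P m x) \<le> 2"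
    "\<And>x. (\<lambda>m. P m x) \<longlonglongrightarrow> (if cos (b' / 2) < cos (x - b' / 2) then 1 else 0)"
    by (rule arc_approximation) (rule that)
  obtain Q K where Q: "\<And>m. Q m \<in> gaussians" "0 \<le> K" "\<And>m y. norm (Q m y) \<le> K * exp (- (y - y0)\<^sup>2 / 2)"
    "\<And>y. (\<lambda>m. Q m y) \<longlonglongrightarrow> (if \<bar>y - y0\<bar> < r then 1 else 0)"
    by (rule interval_approximation[OF r]) (rule that)
  have sb: "({0..<2 * pi} \<inter> {..<b}) \<times> {c<..<d} \<in> sets M"
  proof -
    have "{0..<2 * pi} \<inter> {..<b} \<in> sets torus" by (auto simp: torus_def sets_restrict_space)
    then show ?thesis unfolding M cylinder_def by simp
  qed
  have [measurable]: "snd \<in> borel_measurable M"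
    using measurable_snd_cylinder[of "\<lambda>x. x" cylinder] by (simp add: measurable_cong_sets[OF M refl])
  show ?thesis
  proof (rule cl_dominated[where g="\<lambda>m z. P m (fst z) * Q m (snd z)" and w="\<lambda>z. 2 * K * exp (- (snd z - y0)\<^sup>2 / 2)"])
    show "cl (\<lambda>z. P m (fst z) * Q m (snd z))" for m
      by (rule cl_D) (use nice_tensor[OF P(1) Q(1)] in simp)
    show "AE z in M. (\<lambda>m. P m (fst z) * Q m (snd z)) \<longlonglongrightarrow> (indicator (({0..<2 * pi} \<inter> {..<b}) \<times> {c<..<d}) z :: complex)"
      using ae AE_space
    proof eventually_elim
      case (elim z)
      have z: "0 < fst z" "fst z < 2 * pi" using elim by (auto simp: space_M)
      have 1: "cos (b' / 2) < cos (fst z - b' / 2) \<longleftrightarrow> fst z < b"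
        using cos_less_cos_iff_arc[OF b' z] z by (simp add: b'_def)
      have 2: "\<bar>snd z - y0\<bar> < r \<longleftrightarrow> snd z \<in> {c<..<d}"
        by (auto simp: y0_def r_def abs_less_iff field_simps)
      have "(if cos (b' / 2) < cos (fst z - b' / 2) then 1 else 0) * (if \<bar>snd z - y0\<bar> < r then 1 else 0)
        = (indicator (({0..<2 * pi} \<inter> {..<b}) \<times> {c<..<d}) z :: complex)"
        unfolding 1 2 using z by (cases z) (auto simp: indicator_def)
      with tendsto_mult[OF P(3)[of "fst z"] Q(4)[of "snd z"]] show ?case by simp
    qed
    show "AE z in M. norm (P m (fst z) * Q m (snd z)) \<le> 2 * K * exp (- (snd z - y0)\<^sup>2 / 2)" for m
      unfolding norm_mult mult.assoc by (intro AE_I2 mult_mono P Q) auto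
    have "(\<integral>\<^sup>+z. ennreal ((2 * K * exp (- (snd z - y0)\<^sup>2 / 2)) powr p) \<partial>M) = (\<integral>\<^sup>+z. ennreal ((2 * K) powr p) * ennreal (exp (- (snd z - y0)\<^sup>2 / 2) powr p) \<partial>M)"
      using Q(2) by (intro nn_integral_cong) (simp add: powr_mult ennreal_mult)
    also have "\<dots> = ennreal ((2 * K) powr p) * (\<integral>\<^sup>+z. ennreal (exp (- (snd z - y0)\<^sup>2 / 2) powr p) \<partial>M)"
      by (rule nn_integral_cmult) measurable
    also have "\<dots> < \<infinity>" using gauss[of y0] by (simp add: ennreal_mult_less_top)
    finally show "(\<integral>\<^sup>+z. ennreal ((2 * K * exp (- (snd z - y0)\<^sup>2 / 2)) powr p) \<partial>M) < \<infinity>" .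
  qed (use sb in measurable)
qed

text \<open>On the box the Gaussian is bounded below, so its integrability controls the
  measure.\<close>

lemma emeasure_box_exhaustion: "emeasure M (box_exhaustion i) < \<infinity>"
proof -
  have [measurable]: "snd \<in> borel_measurable M"
    using measurable_snd_cylinder[of "\<lambda>x. x" cylinder] by (simp add: measurable_cong_sets[OF M refl])
  let ?e = "\<lambda>z :: real \<times> real. ennreal (exp (- (snd z - 0)\<^sup>2 / 2) powr p)"
  let ?C = "ennreal (exp ((real i)\<^sup>2 / 2) powr p)"
  have "emeasure M (box_exhaustion i) = (\<integral>\<^sup>+z. indicator (box_exhaustion i) z \<partial>M)"
    using box_exhaustion(1)[of i] M by simp
  also have "\<dots> \<le> (\<integral>\<^sup>+z. ?C * ?e z \<partial>M)"
  proof (intro nn_integral_mono)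
    fix z :: "real \<times> real"
    show "indicator (box_exhaustion i) z \<le> ?C * ?e z"
    proof (cases "z \<in> box_exhaustion i")
      case True
      then have "\<bar>snd z\<bar> \<le> \<bar>real i\<bar>" by (auto simp: box_exhaustion_def)
      then have "(snd z)\<^sup>2 \<le> (real i)\<^sup>2" using abs_le_square_iff by blast
      then have "1 \<le> exp ((real i)\<^sup>2 / 2) * exp (- (snd z - 0)\<^sup>2 / 2)"
        by (simp add: exp_add[symmetric])
      then have "1 \<le> (exp ((real i)\<^sup>2 / 2) * exp (- (snd z - 0)\<^sup>2 / 2)) powr p"
        using p by (intro ge_one_powr_ge_zero) auto
      then have "ennreal 1 \<le> ?C * ?e z"
        by (simp only: ennreal_mult[symmetric] powr_ge_zero powr_mult exp_ge_zero ennreal_leI)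
      then show ?thesis using True by simp
    qed simp
  qed
  also have "\<dots> = ?C * (\<integral>\<^sup>+z. ?e z \<partial>M)"
    by (rule nn_integral_cmult) measurable
  also have "\<dots> < \<infinity>" using gauss[of 0] by (simp add: ennreal_mult_less_top)
  finally show ?thesis .
qed

lemma cl_rectangle_box: "A \<in> rectangles \<Longrightarrow> cl (indicator (A \<inter> box_exhaustion i))"
proof -
  assume "A \<in> rectangles"
  then obtain b d where A: "A = ({0..<2 * pi} \<inter> {..<b}) \<times> {..<d}" by (auto simp: rectangles_def)
  have "A \<inter> box_exhaustion i = ({0..<2 * pi} \<inter> {..<b}) \<times> {- real i<..<min d (real i)}"
    by (auto simp: A box_exhaustion_def)
  then show ?thesis using cl_rectangle by simp
qed

lemma cl_box: "cl (indicator (box_exhaustion i))"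
proof -
  have "box_exhaustion i = ({0..<2 * pi} \<inter> {..<2 * pi}) \<times> {- real i<..<real i}" by (auto simp: box_exhaustion_def)
  then show ?thesis using cl_rectangle by simp
qed

lemma rectangles_Pow: "rectangles \<subseteq> Pow (space M)" "sets M = sigma_sets (space M) rectangles"
  by (auto simp: rectangles_def space_M M sets_cylinder_rectangles)

lemma nices_cl_indicator:
  "A \<in> sets M \<Longrightarrow> Lp_closure.cl M p nices (indicator (A \<inter> box_exhaustion i))"
  by (rule cl_indicator[OF Int_stable_rectangles rectangles_Pow _ box_exhaustion(2) _ emeasure_box_exhaustion cl_rectangle_box cl_box])
    (use box_exhaustion M sets_eq_imp_space_eq[OF M] in auto)

lemma nices_dense:
  "f \<in> borel_measurable M \<Longrightarrow> (\<integral>\<^sup>+z. ennreal (norm (f z) powr p) \<partial>M) < \<infinity> \<Longrightarrow> Lp_closure.cl M p nices f"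
  by (rule cl_Lp[OF Int_stable_rectangles rectangles_Pow _ box_exhaustion(2) _ emeasure_box_exhaustion cl_rectangle_box cl_box])
    (use box_exhaustion M sets_eq_imp_space_eq[OF M] in auto)

end

lemma nn_integral_gaussian_powr_cylinder:
  assumes p: "0 < p"
  shows "(\<integral>\<^sup>+z. ennreal (exp (- (snd z - y0)\<^sup>2 / 2) powr p) \<partial>cylinder) < \<infinity>"
proof -
  have "(\<integral>\<^sup>+z. ennreal (exp (- (snd z - y0)\<^sup>2 / 2) powr p) \<partial>cylinder) = ennreal (2 * pi) * (\<integral>\<^sup>+y. ennreal (exp (- (y - y0)\<^sup>2 / 2) powr p) \<partial>lborel)"
    by (rule cylinder_nn_integral_snd) simp
  also have "(\<integral>\<^sup>+y. ennreal (exp (- (y - y0)\<^sup>2 / 2) powr p) \<partial>lborel) = ennreal (sqrt (2 * pi / p))"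
  proof -
    have "exp (- (y - y0)\<^sup>2 / 2) powr p = exp (- (p * (y - y0)\<^sup>2) / 2)" for y
      by (simp add: powr_def)
    then show ?thesis by (simp only: nn_integral_gaussian[OF p])
  qed
  also have "ennreal (2 * pi) * ennreal (sqrt (2 * pi / p)) < \<infinity>" by (simp add: ennreal_mult_less_top)
  finally show ?thesis .
qed

lemma AE_cylinder_fst_neq_0: "AE z in cylinder. fst z \<noteq> 0"
proof -
  have "AE x in torus. x \<noteq> 0"
    unfolding torus_def by (subst AE_restrict_space_iff) (use AE_lborel_singleton[of "0 :: real"] in auto)
  then have "AE x in torus. AE y in (lborel :: real measure). fst (x, y) \<noteq> 0"
    by eventually_elim simp
  then show ?thesis
    unfolding cylinder_def by (intro torus_line.AE_pair_measure) measurable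
qed

lemma cylinder_nices_dense:
  assumes "0 < p" "f \<in> borel_measurable cylinder" "(\<integral>\<^sup>+z. ennreal (norm (f z) powr p) \<partial>cylinder) < \<infinity>"
  shows "Lp_closure.cl cylinder p nices f"
  by (rule nices_dense[OF refl assms(1) AE_cylinder_fst_neq_0 nn_integral_gaussian_powr_cylinder assms(2,3)]) (rule assms(1))

lemma cylinder_nices_cl_indicator:
  assumes "0 < p" "A \<in> sets cylinder"
  shows "Lp_closure.cl cylinder p nices (indicator (A \<inter> box_exhaustion i))"
  by (rule nices_cl_indicator[OF refl assms(1) AE_cylinder_fst_neq_0 nn_integral_gaussian_powr_cylinder assms(2)]) (rule assms(1))

section \<open>Uniqueness of Fourier transforms\<close>

text \<open>By Fubini, vanishing of the transform makes \<open>G\<close> orthogonal to every nice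
  function. The conjugate sign \<psi> of \<open>G\<close>, for which G \<psi> = \<bar>G\<bar>, is a
  limit of nice functions, and this forces the integral of \<bar>G\<bar> to vanish.\<close>

lemma L1_fourier_unique:
  assumes G: "integrable cylinder G" and zero: "\<And>k. (\<integral>z. G z * cis (phase k z) \<partial>cylinder) = 0"
  shows "AE z in cylinder. G z = 0"
proof -
  note [measurable] = borel_measurable_integrable[OF G]
  \<comment> \<open>In L^1 of this finite measure the approximation error of \<psi> is exactly the
    integral of \<bar>G\<bar> \<bar>\<psi> - \<phi>\<bar>, and \<psi>, merely bounded, belongs to
    the space.\<close>
  let ?M = "density cylinder (\<lambda>z. ennreal (norm (G z)))"
  have finM: "emeasure ?M (space ?M) < \<infinity>"
    using G by (simp add: emeasure_density integrable_iff_bounded cong: nn_integral_cong)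
  define \<psi> where "\<psi> z = cnj (sgn (G z))" for z
  have \<psi>m[measurable]: "\<psi> \<in> borel_measurable cylinder"
    unfolding \<psi>_def sgn_div_norm by measurable
  have \<psi>b: "norm (\<psi> z) \<le> 1" for z by (simp add: \<psi>_def norm_sgn)
  have \<psi>G: "G z * \<psi> z = complex_of_real (norm (G z))" for z
    by (cases "G z = 0") (simp_all add: \<psi>_def sgn_div_norm complex_norm_square[symmetric] power2_eq_square scaleR_conv_of_real divide_simps)
  have sM: "sets ?M = sets cylinder" by simp
  have "Lp_closure.cl ?M 1 nices \<psi>"
  proof (rule nices_dense[OF sM])
    show "AE z in ?M. fst z \<noteq> 0"
      using AE_cylinder_fst_neq_0 by (subst AE_density) auto
    have le: "(\<integral>\<^sup>+z. ennreal (f z powr 1) \<partial>?M) < \<infinity>" if "\<And>z. f z \<le> 1" "\<And>z. 0 \<le> f z" for f :: "real \<times> real \<Rightarrow> real"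
    proof -
      have "(\<integral>\<^sup>+z. ennreal (f z powr 1) \<partial>?M) \<le> (\<integral>\<^sup>+z. 1 \<partial>?M)"
        using that by (intro nn_integral_mono) simp
      also have "\<dots> < \<infinity>" using finM by simp
      finally show ?thesis .
    qed
    show "(\<integral>\<^sup>+z. ennreal (exp (- (snd z - y0)\<^sup>2 / 2) powr 1) \<partial>?M) < \<infinity>" for y0 by (rule le) auto
    show "(\<integral>\<^sup>+z. ennreal (norm (\<psi> z) powr 1) \<partial>?M) < \<infinity>" by (rule le) (use \<psi>b in auto)
  qed simp_all
  note cl\<psi> = this
  interpret Lp_closure ?M 1 nices by (rule Lp_closure_nices) auto
  from cl\<psi> have dense: "\<exists>\<phi>\<in>nices. (\<integral>\<^sup>+z. ennreal (norm (\<psi> z - \<phi> z) powr 1) \<partial>?M) < ennreal e" if "0 < e" for e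
    using that by (simp add: cl_def)
  have le: "(\<integral>\<^sup>+z. ennreal (norm (G z)) \<partial>cylinder) \<le> ennreal e" if e: "0 < e" for e
  proof -
    obtain \<phi> g where n: "nice \<phi> g" and small: "(\<integral>\<^sup>+z. ennreal (norm (\<psi> z - \<phi> z) powr 1) \<partial>?M) < ennreal e"
      using dense[OF e] by auto
    have [measurable]: "\<phi> \<in> borel_measurable cylinder" using nice_family_measurable(3)[OF n] .
    have m: "(\<lambda>(k, z). phase k z - 0 * symb (\<lambda>_. 0) k) \<in> borel_measurable (freq \<Otimes>\<^sub>M cylinder)" by measurable
    have \<phi>: "\<phi> = (\<lambda>z. \<integral>k. g k * cis (phase k z - 0 * symb (\<lambda>_. 0) k) \<partial>freq)"
      using nice_family_ext[OF n] by (auto simp: fun_eq_iff ext_def)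
    note fub = fubini_phase[OF freq.sigma_finite_measure_axioms cyl.sigma_finite_measure_axioms m nice_family_integrable_freq[OF n] G]
    have i1: "integrable cylinder (\<lambda>z. \<phi> z * G z)" using fub(1) unfolding \<phi> .
    have "(\<integral>z. \<phi> z * G z \<partial>cylinder) = 0"
      unfolding \<phi> fub(3) using zero by (simp add: mult.commute)
    moreover have i2: "integrable cylinder (\<lambda>z. G z * \<psi> z)" unfolding \<psi>G using G by simp
    ultimately have "(\<integral>z. G z * (\<psi> z - \<phi> z) \<partial>cylinder) = (\<integral>z. G z * \<psi> z \<partial>cylinder)"
      using i1 by (simp add: right_diff_distrib mult.commute)
    also have "\<dots> = complex_of_real (\<integral>z. norm (G z) \<partial>cylinder)"
      unfolding \<psi>G using G by (intro Bochner_Integration.integral_of_real) simp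
    finally have "norm (\<integral>z. G z * (\<psi> z - \<phi> z) \<partial>cylinder) = (\<integral>z. norm (G z) \<partial>cylinder)"
      by (simp add: integral_nonneg_AE)
    then have "(\<integral>\<^sup>+z. ennreal (norm (G z)) \<partial>cylinder) = ennreal (norm (\<integral>z. G z * (\<psi> z - \<phi> z) \<partial>cylinder))"
      using nn_integral_eq_integral[OF integrable_norm[OF G]] by simp
    also have "\<dots> \<le> (\<integral>\<^sup>+z. ennreal (norm (G z * (\<psi> z - \<phi> z))) \<partial>cylinder)"
      by (rule ennreal_norm_integral_le)
    also have "\<dots> = (\<integral>\<^sup>+z. ennreal (norm (\<psi> z - \<phi> z) powr 1) \<partial>?M)"
      by (subst nn_integral_density) (auto simp: norm_mult ennreal_mult)
    also have "\<dots> \<le> ennreal e" using small by simp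
    finally show ?thesis .
  qed
  have "(\<integral>\<^sup>+z. ennreal (norm (G z)) \<partial>cylinder) \<le> 0"
    by (rule ennreal_le_epsilon) (use le in auto)
  then show ?thesis by (simp add: nn_integral_0_iff_AE)
qed

section \<open>A smooth bump function\<close>

text \<open>The standard flat function exp (-1/x) with a polynomial in 1/x as a factor: a class that
  is closed under differentiation, so that all derivatives are obtained at once.\<close>

definition flat :: "real poly \<Rightarrow> real \<Rightarrow> real" where
  "flat P x = (if 0 < x then poly P (1 / x) * exp (- (1 / x)) else 0)"

text \<open>Differentiation of P(1/x) exp (-1/x) gives x^-2 (P - P')(1/x) exp (-1/x), and
  \<open>[:0, 0, 1:]\<close> is the polynomial for x^-2.\<close>

definition flat_deriv :: "real poly \<Rightarrow> real poly" where
  "flat_deriv P = [:0, 0, 1:] * (P - pderiv P)"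

lemma poly_exp_tendsto: "((\<lambda>u. poly P u * exp (- u)) \<longlongrightarrow> (0 :: real)) at_top"
proof -
  have "((\<lambda>u. \<Sum>i\<le>degree P. coeff P i * (u ^ i / exp u)) \<longlongrightarrow> (\<Sum>i\<le>degree P. coeff P i * 0)) at_top"
    by (intro tendsto_intros tendsto_power_div_exp_0)
  moreover have "(\<Sum>i\<le>degree P. coeff P i * (u ^ i / exp u)) = poly P u * exp (- u)" for u
    by (simp add: poly_altdef sum_distrib_right exp_minus divide_inverse mult.assoc)
  ultimately show ?thesis by simp
qed

lemma DERIV_flat: "(flat P has_real_derivative flat (flat_deriv P) x) (at x)"
proof -
  consider "x < 0" | "x = 0" | "0 < x" by linarith
  then show ?thesis
  proof cases
    case 1
    have "((\<lambda>_. 0) has_real_derivative 0) (at x)" by simp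
    then have "(flat P has_real_derivative 0) (at x)"
      by (rule has_field_derivative_transform_within_open[of _ _ _ "{..<0}"]) (use 1 in \<open>auto simp: flat_def\<close>)
    then show ?thesis using 1 by (simp add: flat_def)
  next
    case 3
    have "((\<lambda>x. poly P (1 / x) * exp (- (1 / x))) has_real_derivative flat (flat_deriv P) x) (at x)"
      using 3 by (auto intro!: derivative_eq_intros DERIV_chain'[of "\<lambda>x. 1 / x" _ x _ "poly P"] poly_DERIV
          simp: flat_def flat_deriv_def power2_eq_square field_simps)
    then show ?thesis
      by (rule has_field_derivative_transform_within_open[of _ _ _ "{0<..}"]) (use 3 in \<open>auto simp: flat_def\<close>)
  next
    case 2
    \<comment> \<open>In the variable u = 1/h the difference quotient is u P(u) exp (-u), again a
      polynomial against an exponential.\<close>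
    have "((\<lambda>h. flat P h / h) \<longlongrightarrow> 0) (at_right 0)"
    proof (rule Lim_transform_eventually)
      show "((\<lambda>h. poly ([:0, 1:] * P) (inverse h) * exp (- inverse h)) \<longlongrightarrow> 0) (at_right 0)"
        by (rule filterlim_compose[OF poly_exp_tendsto filterlim_inverse_at_top_right])
      show "\<forall>\<^sub>F h in at_right 0. poly ([:0, 1:] * P) (inverse h) * exp (- inverse h) = flat P h / h"
        using eventually_at_right_less[of "0 :: real"] by eventually_elim (simp add: flat_def field_simps)
    qed
    moreover have "((\<lambda>h. flat P h / h) \<longlongrightarrow> 0) (at_left 0)"
    proof (rule Lim_transform_eventually[OF tendsto_const])
      show "\<forall>\<^sub>F h in at_left 0. 0 = flat P h / h"
        using eventually_at_left_real[of "-1" "0 :: real"] by (auto elim!: eventually_mono simp: flat_def)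
    qed
    ultimately have "((\<lambda>h. flat P h / h) \<longlongrightarrow> 0) (at 0)" by (simp add: filterlim_split_at)
    then show ?thesis using 2 by (simp add: DERIV_def flat_def)
  qed
qed

text \<open>Sums are included because of the product rule; the sign produced by 1 - x is absorbed
  into the polynomial.\<close>

inductive_set bumps :: "(real \<Rightarrow> real) set" where
  bumps_flat: "(\<lambda>x. flat P (1 + x) * flat Q (1 - x)) \<in> bumps"
| bumps_add: "f \<in> bumps \<Longrightarrow> g \<in> bumps \<Longrightarrow> (\<lambda>x. f x + g x) \<in> bumps"

lemma bumps_derivative:
  assumes "f \<in> bumps"
  shows "\<exists>f'\<in>bumps. \<forall>x. (f has_real_derivative f' x) (at x)"
  using assms
proof induction
  case (bumps_flat P Q)
  have d1: "((\<lambda>x. flat P (1 + x)) has_real_derivative flat (flat_deriv P) (1 + x) * 1) (at x)" for x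
    by (rule DERIV_chain2[OF DERIV_flat]) (auto intro!: derivative_eq_intros)
  have d2: "((\<lambda>x. flat Q (1 - x)) has_real_derivative flat (flat_deriv Q) (1 - x) * (- 1)) (at x)" for x
    by (rule DERIV_chain2[OF DERIV_flat]) (auto intro!: derivative_eq_intros)
  have neg: "flat (- R) y = - flat R y" for R y by (simp add: flat_def)
  let ?f' = "\<lambda>x. flat (flat_deriv P) (1 + x) * flat Q (1 - x) + flat P (1 + x) * flat (- flat_deriv Q) (1 - x)"
  have "?f' \<in> bumps" by (intro bumps_add bumps.bumps_flat)
  moreover have "((\<lambda>x. flat P (1 + x) * flat Q (1 - x)) has_real_derivative ?f' x) (at x)" for x
    using DERIV_mult[OF d1[of x] d2[of x]] by (simp add: neg mult.commute add.commute)
  ultimately show ?case by (intro bexI[of _ ?f'] allI)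
next
  case (bumps_add f g)
  then obtain f' g' where "f' \<in> bumps" "g' \<in> bumps" "\<And>x. (f has_real_derivative f' x) (at x)" "\<And>x. (g has_real_derivative g' x) (at x)"
    by blast
  then show ?case by (intro bexI[of _ "\<lambda>x. f' x + g' x"]) (auto intro: DERIV_add bumps.bumps_add)
qed

definition bump :: "real \<Rightarrow> real" where
  "bump x = flat 1 (1 + x) * flat 1 (1 - x)"

lemma bump_pos_iff: "0 < bump x \<longleftrightarrow> \<bar>x\<bar> < 1"
  by (auto simp: bump_def flat_def)

lemma bump_eq_0: "1 \<le> \<bar>x\<bar> \<Longrightarrow> bump x = 0"
  by (auto simp: bump_def flat_def)

lemma bump_test_function:
  assumes R: "0 < R"
  shows "(\<lambda>\<xi>. complex_of_real (bump (R * (\<xi> - \<xi>0)))) \<in> test_functions"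
proof -
  \<comment> \<open>A derivative within \<open>bumps\<close>, chosen once and for all, can be
    iterated to the sequence of derivatives that \<open>test_functions\<close> demands.\<close>
  define der where "der f = (SOME f'. f' \<in> bumps \<and> (\<forall>x. (f has_real_derivative f' x) (at x)))" for f :: "real \<Rightarrow> real"
  have der: "der f \<in> bumps" "\<And>x. (f has_real_derivative der f x) (at x)" if "f \<in> bumps" for f
    using someI_ex[of "\<lambda>f'. f' \<in> bumps \<and> (\<forall>x. (f has_real_derivative f' x) (at x))"] bumps_derivative[OF that]
    unfolding der_def by blast+
  define E where "E k = (der ^^ k) bump" for k
  have "bump \<in> bumps" unfolding bump_def[abs_def] by (rule bumps_flat)
  then have E: "E k \<in> bumps" for k unfolding E_def by (induction k) (auto intro: der)
  have E': "(E k has_real_derivative E (Suc k) x) (at x)" for k x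
    using der(2)[OF E[of k]] by (simp add: E_def)
  let ?D = "\<lambda>k x. complex_of_real (R ^ k * E k (R * (x - \<xi>0)))"
  have "(?D k has_vector_derivative ?D (Suc k) x) (at x)" for k x
  proof (rule has_vector_derivative_of_real)
    have "((\<lambda>x. E k (R * (x - \<xi>0))) has_real_derivative E (Suc k) (R * (x - \<xi>0)) * R) (at x)"
      by (rule DERIV_chain2[OF E']) (auto intro!: derivative_eq_intros)
    from DERIV_cmult[OF this, of "R ^ k"]
    show "((\<lambda>x. R ^ k * E k (R * (x - \<xi>0))) has_field_derivative R ^ Suc k * E (Suc k) (R * (x - \<xi>0))) (at x)"
      by (simp add: mult_ac)
  qed
  moreover have "?D 0 = (\<lambda>\<xi>. complex_of_real (bump (R * (\<xi> - \<xi>0))))" by (simp add: E_def)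
  moreover have "complex_of_real (bump (R * (\<xi> - \<xi>0))) = 0" if "\<bar>\<xi>0\<bar> + 1 / R < \<bar>\<xi>\<bar>" for \<xi>
  proof -
    have "1 / R \<le> \<bar>\<xi> - \<xi>0\<bar>" using that by linarith
    then have "1 \<le> R * \<bar>\<xi> - \<xi>0\<bar>" using R by (simp add: pos_divide_le_eq mult.commute)
    then have "1 \<le> \<bar>R * (\<xi> - \<xi>0)\<bar>" unfolding abs_mult using R by simp
    then show ?thesis by (simp add: bump_eq_0)
  qed
  ultimately show ?thesis
    unfolding test_functions_def by (intro CollectI conjI exI[of _ ?D] exI[of _ "\<bar>\<xi>0\<bar> + 1 / R"]) auto
qed

lemma line_fourier_bump_scaled:
  assumes R: "0 < R"
  shows "line_fourier (\<lambda>\<xi>. complex_of_real (bump (R * (\<xi> - \<xi>0)))) y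
    = cis (- (y * \<xi>0)) * (complex_of_real (1 / R) * line_fourier (\<lambda>u. complex_of_real (bump u)) (y / R))"
proof -
  have "line_fourier (\<lambda>\<xi>. complex_of_real (bump (R * (\<xi> - \<xi>0)))) y
     = \<bar>1 / R\<bar> *\<^sub>R (\<integral>u. complex_of_real (bump (R * ((\<xi>0 + 1 / R * u) - \<xi>0))) * cis (- (y * (\<xi>0 + 1 / R * u))) \<partial>lborel)"
    unfolding line_fourier_def by (rule lborel_integral_real_affine) (use R in simp)
  also have "\<dots> = complex_of_real (1 / R) * (\<integral>u. cis (- (y * \<xi>0)) * (complex_of_real (bump u) * cis (- (y / R * u))) \<partial>lborel)"
  proof -
    have "complex_of_real (bump (R * ((\<xi>0 + 1 / R * u) - \<xi>0))) * cis (- (y * (\<xi>0 + 1 / R * u)))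
      = cis (- (y * \<xi>0)) * (complex_of_real (bump u) * cis (- (y / R * u)))" for u
    proof -
      have "cis (- (y * (\<xi>0 + 1 / R * u))) = cis (- (y * \<xi>0)) * cis (- (y / R * u))"
        by (simp add: cis_mult algebra_simps)
      moreover have "R * ((\<xi>0 + 1 / R * u) - \<xi>0) = u" using R by simp
      ultimately show ?thesis by (simp only: mult.left_commute)
    qed
    then show ?thesis using R by (simp only: scaleR_conv_of_real) simp
  qed
  finally show ?thesis by (simp add: line_fourier_def)
qed

text \<open>For \<bar>s\<bar> \<le> 1 and \<bar>u\<bar> < 1 the angle s u stays below pi/2, so the
  real part is the integral of a function that is positive on the support of the bump.\<close>

lemma line_fourier_bump_nonzero:
  assumes s: "\<bar>s\<bar> \<le> 1"
  shows "line_fourier (\<lambda>u. complex_of_real (bump u)) s \<noteq> 0"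
proof
  assume zero: "line_fourier (\<lambda>u. complex_of_real (bump u)) s = 0"
  have t: "(\<lambda>u. complex_of_real (bump u)) \<in> test_functions"
    using bump_test_function[of 1 0] by simp
  have i: "integrable lborel (\<lambda>u. complex_of_real (bump u) * cis (- (s * u)))"
    by (intro integrable_mult_cis test_function_integrable t) simp
  have "(\<integral>u. Re (complex_of_real (bump u) * cis (- (s * u))) \<partial>lborel) = 0"
    using integral_Re[OF i] zero by (simp add: line_fourier_def)
  then have int0: "(\<integral>u. bump u * cos (s * u) \<partial>lborel) = 0" by simp
  have ir: "integrable lborel (\<lambda>u. bump u * cos (s * u))"
    using integrable_Re[OF i] by simp
  have pos: "0 < bump u * cos (s * u)" if u: "\<bar>u\<bar> < 1" for u
  proof -
    have "\<bar>s * u\<bar> \<le> 1 * 1" unfolding abs_mult using s u by (intro mult_mono) auto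
    then have "\<bar>s * u\<bar> < pi / 2" using pi_gt3 by simp
    then have "0 < cos (s * u)" by (intro cos_gt_zero_pi) auto
    then show ?thesis using u by (simp add: bump_pos_iff)
  qed
  have nn: "0 \<le> bump u * cos (s * u)" for u
    using pos[of u] bump_eq_0[of u] by (cases "\<bar>u\<bar> < 1") auto
  have "AE u in lborel. bump u * cos (s * u) = 0"
    using integral_nonneg_eq_0_iff_AE[OF ir] nn int0 by simp
  then have "AE u in lborel. u \<notin> {- 1<..<1 :: real}"
  proof eventually_elim
    case (elim u)
    then show ?case using pos[of u] by force
  qed
  then have "emeasure lborel {- 1<..<1 :: real} = 0"
    by (subst (asm) AE_iff_measurable[of "{- 1<..<1}"]) auto
  then show False by simp
qed

text \<open>Bumps translated to \<xi>0 have transforms B(y) cis (-y \<xi>0) with one fixed function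
  B. Testing with all of them says that (f - g) B is integrable with vanishing transform, so it is
  null. Concentrating the bump by the factor m + 1 stretches its transform, and B has no zeros for
  \<bar>y\<bar> \<le> m + 1.\<close>

lemma has_fourier_unique:
  assumes f: "has_fourier f T" and g: "has_fourier g T"
  shows "AE z in cylinder. f z = g z"
proof -
  let ?b = "\<lambda>u. complex_of_real (bump u)"
  have "AE z in cylinder. \<bar>snd z\<bar> \<le> real (Suc m) \<longrightarrow> f z = g z" for m
  proof -
    let ?R = "real (Suc m)"
    have R: "0 < ?R" by simp
    let ?B = "\<lambda>y. complex_of_real (1 / ?R) * line_fourier ?b (y / ?R)"
    let ?G = "\<lambda>z. (f z - g z) * ?B (snd z)"
    have key: "has_bochner_integral cylinder (\<lambda>z. ?G z * cis (- phase k z)) 0" for k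
    proof -
      let ?h = "\<lambda>\<xi>. ?b (?R * (\<xi> - snd k))"
      have "has_bochner_integral cylinder (\<lambda>z. fourier_integrand f (fst k) ?h z - fourier_integrand g (fst k) ?h z) (T (fst k) ?h - T (fst k) ?h)"
        using f g bump_test_function[OF R] unfolding has_fourier_def by (intro has_bochner_integral_diff) auto
      moreover have "fourier_integrand f (fst k) ?h z - fourier_integrand g (fst k) ?h z = ?G z * cis (- phase k z)" for z
      proof -
        have c: "cis (- (of_int (fst k) * fst z)) * cis (- (snd z * snd k)) = cis (- phase k z)"
          by (simp add: cis_mult phase_def algebra_simps)
        have "fourier_integrand u (fst k) ?h z = u z * ?B (snd z) * (cis (- (of_int (fst k) * fst z)) * cis (- (snd z * snd k)))" for u
          unfolding fourier_integrand_def line_fourier_bump_scaled[OF R] case_prod_beta by (simp add: mult_ac)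
        then show ?thesis unfolding c by (simp only: left_diff_distrib)
      qed
      ultimately show ?thesis by simp
    qed
    have "AE z in cylinder. ?G z = 0"
    proof (rule L1_fourier_unique)
      show "integrable cylinder ?G"
        using key[of "(0, 0)"] by (simp add: has_bochner_integral_iff phase_def)
      show "(\<integral>z. ?G z * cis (phase k z) \<partial>cylinder) = 0" for k
      proof -
        have "- phase (- fst k, - snd k) z = phase k z" for z by (simp add: phase_def)
        then show ?thesis using has_bochner_integral_integral_eq[OF key[of "(- fst k, - snd k)"]] by (simp only:)
      qed
    qed
    then show ?thesis
    proof eventually_elim
      case (elim z)
      show ?case
      proof
        assume "\<bar>snd z\<bar> \<le> ?R"
        then have "\<bar>snd z / ?R\<bar> \<le> 1" using R by (simp only: abs_divide abs_of_nat divide_le_eq_1_pos)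
        moreover have "complex_of_real (1 / ?R) \<noteq> 0" unfolding of_real_eq_0_iff by simp
        ultimately have "?B (snd z) \<noteq> 0" using line_fourier_bump_nonzero by simp
        then show "f z = g z" using elim by simp
      qed
    qed
  qed
  then have "AE z in cylinder. \<forall>m. \<bar>snd z\<bar> \<le> real (Suc m) \<longrightarrow> f z = g z"
    by (simp only: AE_all_countable) simp
  then show ?thesis
  proof eventually_elim
    case (elim z)
    obtain m :: nat where "\<bar>snd z\<bar> \<le> real m" using real_arch_simple by blast
    then have "\<bar>snd z\<bar> \<le> real (Suc m)" by simp
    then show ?case using elim by blast
  qed
qed

text \<open>Equality holds here because a nice function is given together with both directions of
  its transform: the conjugate factor is expanded by inversion, and Fubini produces the transform of
  the other.\<close>

lemma nice_family_plancherel: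
  assumes n: "nice_family f \<gamma>"
  shows "(\<integral>\<^sup>+z. ennreal ((norm (f s z))\<^sup>2) \<partial>cylinder) = ennreal (4 * pi\<^sup>2) * (\<integral>\<^sup>+k. ennreal ((norm (\<gamma> s k))\<^sup>2) \<partial>freq)"
proof -
  obtain G where G: "integrable freq G" "integrable freq (\<lambda>k. (G k)\<^sup>2)" "\<And>s k. norm (\<gamma> s k) \<le> (G k :: real)"
    by (rule nice_family_freq_bound[OF n]) (rule that)
  obtain H K where H: "integrable cylinder H" "\<And>s z. norm (f s z) \<le> H z" "\<And>z. H z \<le> (K :: real)"
    by (rule nice_family_bound[OF n]) (rule that)
  note [measurable] = nice_family_measurable(3,4)[OF n, of s]
  have ig: "integrable freq (\<lambda>k. cnj (\<gamma> s k))" using nice_family_integrable_freq[OF n, of s] by simp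
  have i2: "integrable freq (\<lambda>k. (norm (\<gamma> s k))\<^sup>2)"
    by (rule Bochner_Integration.integrable_bound[OF G(2)]) (use G(3) in \<open>auto intro!: AE_I2 power_mono\<close>)
  have i3: "integrable cylinder (\<lambda>z. (norm (f s z))\<^sup>2)"
  proof (rule Bochner_Integration.integrable_bound)
    show "integrable cylinder (\<lambda>z. K * H z)" using H by simp
    show "AE z in cylinder. norm ((norm (f s z))\<^sup>2) \<le> norm (K * H z)"
    proof (intro AE_I2)
      fix z
      have "norm (f s z) * norm (f s z) \<le> K * H z"
        using H(2)[of s z] H(3)[of z] norm_ge_zero[of "f s z"] by (intro mult_mono) linarith+
      then show "norm ((norm (f s z))\<^sup>2) \<le> norm (K * H z)" by (simp add: power2_eq_square)
    qed
  qed measurable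
  have m: "(\<lambda>(k, z). - phase k z) \<in> borel_measurable (freq \<Otimes>\<^sub>M cylinder)" by measurable
  have c: "cnj (f s z) = (\<integral>k. cnj (\<gamma> s k) * cis (- phase k z) \<partial>freq)" for z
    unfolding nice_family_ext[OF n] ext_def
    by (subst Bochner_Integration.integral_cnj[symmetric]) (simp add: cis_cnj)
  have "complex_of_real (\<integral>z. (norm (f s z))\<^sup>2 \<partial>cylinder) = (\<integral>z. cnj (f s z) * f s z \<partial>cylinder)"
    by (subst Bochner_Integration.integral_of_real[symmetric], rule i3) (simp only: complex_norm_square mult.commute[of "f s _"])
  also have "\<dots> = (\<integral>k. cnj (\<gamma> s k) * (\<integral>z. cis (- phase k z) * f s z \<partial>cylinder) \<partial>freq)"
    unfolding c by (rule fubini_phase(3)[OF freq.sigma_finite_measure_axioms cyl.sigma_finite_measure_axioms m ig nice_family_integrable[OF n]])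
  also have "\<dots> = (\<integral>k. complex_of_real (4 * pi\<^sup>2 * (norm (\<gamma> s k))\<^sup>2) \<partial>freq)"
  proof (intro Bochner_Integration.integral_cong refl)
    fix k
    have "(\<integral>z. cis (- phase k z) * f s z \<partial>cylinder) = complex_of_real (4 * pi\<^sup>2) * \<gamma> s k"
      unfolding mult.commute[of _ "f s _"] by (rule nice_family_fourier[OF n])
    then show "cnj (\<gamma> s k) * (\<integral>z. cis (- phase k z) * f s z \<partial>cylinder) = complex_of_real (4 * pi\<^sup>2 * (norm (\<gamma> s k))\<^sup>2)"
    proof -
      assume e: "(\<integral>z. cis (- phase k z) * f s z \<partial>cylinder) = complex_of_real (4 * pi\<^sup>2) * \<gamma> s k"
      have rot: "a * (b * c) = b * (c * a)" for a b c :: complex by (simp only: mult_ac)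
      show ?thesis unfolding e of_real_mult[of "4 * pi\<^sup>2"] complex_norm_square by (rule rot)
    qed
  qed
  also have "\<dots> = complex_of_real (\<integral>k. 4 * pi\<^sup>2 * (norm (\<gamma> s k))\<^sup>2 \<partial>freq)"
    by (rule Bochner_Integration.integral_of_real) (intro integrable_mult_right i2)
  finally have e: "(\<integral>z. (norm (f s z))\<^sup>2 \<partial>cylinder) = 4 * pi\<^sup>2 * (\<integral>k. (norm (\<gamma> s k))\<^sup>2 \<partial>freq)"
    unfolding of_real_eq_iff by simp
  then show ?thesis
    using nn_integral_eq_integral[OF i2] nn_integral_eq_integral[OF i3]
    by (simp add: ennreal_mult integral_nonneg_AE)
qed

text \<open>Stated for integrable \<open>h\<close>, so that it applies directly to a test function
  multiplied by the propagator.\<close>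

lemma nice_family_fourier_pairing:
  assumes n: "nice_family f \<gamma>" and h: "integrable lborel h"
  shows "fourier (f s) n h = complex_of_real (4 * pi\<^sup>2) * (\<integral>\<xi>. \<gamma> s (n, \<xi>) * h \<xi> \<partial>lborel)"
proof -
  note [measurable] = nice_family_measurable(3)[OF assms(1), of s]
  let ?H = "\<lambda>z. f s z * cis (- (of_int n * fst z))"
  have iH: "integrable cylinder ?H"
    by (intro integrable_mult_cis nice_family_integrable[OF assms(1)]) measurable
  have m: "(\<lambda>(\<xi>, z). - (snd z * \<xi>)) \<in> borel_measurable (lborel \<Otimes>\<^sub>M cylinder)" by measurable
  have "fourier (f s) n h = (\<integral>z. (\<integral>\<xi>. h \<xi> * cis (- (snd z * \<xi>)) \<partial>lborel) * ?H z \<partial>cylinder)"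
  proof -
    have "fourier_integrand (f s) n h = (\<lambda>z. line_fourier h (snd z) * ?H z)"
      by (simp add: fun_eq_iff fourier_integrand_def mult.commute)
    then show ?thesis by (simp only: fourier_def line_fourier_def)
  qed
  also have "\<dots> = (\<integral>\<xi>. h \<xi> * (\<integral>z. cis (- (snd z * \<xi>)) * ?H z \<partial>cylinder) \<partial>lborel)"
    by (rule fubini_phase(3)[OF lborel.sigma_finite_measure_axioms cyl.sigma_finite_measure_axioms m h iH])
  also have "\<dots> = (\<integral>\<xi>. complex_of_real (4 * pi\<^sup>2) * (\<gamma> s (n, \<xi>) * h \<xi>) \<partial>lborel)"
  proof (intro Bochner_Integration.integral_cong refl)
    fix \<xi>
    have "cis (- (snd z * \<xi>)) * ?H z = f s z * cis (- phase (n, \<xi>) z)" for z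
    proof -
      have "cis (- (of_int n * fst z)) * cis (- (snd z * \<xi>)) = cis (- phase (n, \<xi>) z)"
        by (simp add: cis_mult phase_def algebra_simps)
      then have "f s z * (cis (- (of_int n * fst z)) * cis (- (snd z * \<xi>))) = f s z * cis (- phase (n, \<xi>) z)" by simp
      then show ?thesis by (simp only: mult_ac)
    qed
    then show "h \<xi> * (\<integral>z. cis (- (snd z * \<xi>)) * ?H z \<partial>cylinder) = complex_of_real (4 * pi\<^sup>2) * (\<gamma> s (n, \<xi>) * h \<xi>)"
      by (simp only: nice_family_fourier[OF assms(1)] mult_ac)
  qed
  finally show ?thesis by simp
qed

section \<open>The free evolution\<close>

locale time_set =
  fixes I :: "real set"
  assumes I: "is_interval I" "bounded I" "0 \<in> I"
begin

abbreviation len :: real where "len \<equiv> measure lborel I"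

abbreviation TI :: "real measure" where "TI \<equiv> restrict_space lborel I"

lemma I_borel [measurable]: "I \<in> sets borel"
  using I(1) by (rule real_interval_borel_measurable)

lemma emeasure_I: "emeasure lborel I < \<infinity>"
  by (rule emeasure_bounded_finite[OF I(2)])

lemma emeasure_I_eq: "emeasure lborel I = ennreal len"
  using emeasure_I by (simp add: emeasure_eq_ennreal_measure)

text \<open>The interval between 0 and any of its points lies in I, so no point is further from 0
  than the length of I. Through this inclusion the constants depend on the length only.\<close>

lemma I_subset: "I \<subseteq> {- len..len}"
proof
  fix t assume t: "t \<in> I"
  have sub: "{min 0 t..max 0 t} \<subseteq> I"
  proof
    fix s assume "s \<in> {min 0 t..max 0 t}"
    then show "s \<in> I"
      using mem_is_interval_1_I[OF I(1) I(3) t, of s] mem_is_interval_1_I[OF I(1) t I(3), of s]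
      by (cases "0 \<le> t") auto
  qed
  have "ennreal (max 0 t - min 0 t) = emeasure lborel {min 0 t..max 0 t}" by simp
  also have "\<dots> \<le> emeasure lborel I" by (rule emeasure_mono[OF sub]) simp
  finally have "max 0 t - min 0 t \<le> len" by (simp add: emeasure_I_eq)
  then show "t \<in> {- len..len}" by (auto simp: min_def max_def split: if_splits)
qed

lemma space_TI: "space TI = I"
  by (simp add: space_restrict_space)

lemma finite_TI: "finite_measure TI"
  using emeasure_I by (intro finite_measureI) (simp add: emeasure_restrict_space space_TI)

sublocale TI: finite_measure TI
  by (rule finite_TI)

sublocale TC: pair_sigma_finite TI cylinder ..

lemma spacetime_eq: "spacetime I = TI \<Otimes>\<^sub>M cylinder"
  by (simp add: spacetime_def)

lemma space_spacetime: "space (spacetime I) = I \<times> space cylinder"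
  by (simp add: spacetime_eq space_pair_measure space_TI)

lemma nn_integral_spacetime:
  "F \<in> borel_measurable (spacetime I) \<Longrightarrow> (\<integral>\<^sup>+p. F p \<partial>spacetime I) = (\<integral>\<^sup>+t. (\<integral>\<^sup>+z. F (t, z) \<partial>cylinder) \<partial>TI)"
  unfolding spacetime_eq by (rule cyl.nn_integral_fst[symmetric])

lemma nn_integral_TI: "F \<in> borel_measurable borel \<Longrightarrow> (\<integral>\<^sup>+t. F t \<partial>TI) = (\<integral>\<^sup>+t. indicator I t * F t \<partial>lborel)"
  by (subst nn_integral_restrict_space) (auto simp: mult.commute)

lemma measurable_spacetimeI:
  assumes "(\<lambda>(t, z). f t z) \<in> borel_measurable (lborel \<Otimes>\<^sub>M cylinder)"
  shows "(\<lambda>p. f (fst p) (snd p)) \<in> borel_measurable (spacetime I)"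
proof -
  have "(\<lambda>p. (fst p, snd p)) \<in> measurable (spacetime I) (lborel \<Otimes>\<^sub>M cylinder)"
    unfolding spacetime_eq
    by (intro measurable_Pair measurable_snd measurable_compose[OF measurable_fst measurable_restrict_space1]) simp
  from measurable_compose[OF this assms] show ?thesis by (simp add: case_prod_beta)
qed

lemma measurable_spacetime_slice:
  assumes "u \<in> borel_measurable (spacetime I)" "t \<in> I"
  shows "(\<lambda>z. u (t, z)) \<in> borel_measurable cylinder"
  using measurable_Pair2[OF assms(1)[unfolded spacetime_eq], of t] assms(2) by (simp add: space_TI)

lemma AE_spacetime_slice:
  assumes "AE p in spacetime I. P p"
  shows "AE t in TI. AE z in cylinder. P (t, z)"
  using TC.AE_pair[OF assms[unfolded spacetime_eq]] .

lemma AE_TI_in_I: "AE t in TI. t \<in> I"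
  by (rule AE_I2) (simp add: space_TI)

lemma AE_spacetimeI_eq:
  assumes "u \<in> borel_measurable (spacetime I)" "v \<in> borel_measurable (spacetime I)"
    and "AE t in TI. AE z in cylinder. u (t, z) = (v (t, z) :: complex)"
  shows "AE p in spacetime I. u p = v p"
  using assms unfolding spacetime_eq by (intro TC.AE_pair_measure) auto

end

section \<open>Rapidly converging sequences\<close>

text \<open>Weighting the increments by 16^j against their decay 32^-j leaves a convergent series,
  so \<open>F\<close> is integrable and finite almost everywhere. There each increment is at most
  2^-j H^(1/4); telescoping gives 2 * 2^-j H^(1/4), whose fourth power is the stated bound. One
  majorant \<open>H\<close> serves for all j.\<close>

lemma fast_limit:
  fixes u :: "nat \<Rightarrow> 'a \<Rightarrow> complex"
  assumes u[measurable]: "\<And>j. u j \<in> borel_measurable M"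
    and K: "0 \<le> K"
    and diff: "\<And>j. (\<integral>\<^sup>+x. ennreal ((norm (u (Suc j) x - u j x)) ^ 4) \<partial>M) \<le> ennreal (K * (1/32) ^ j)"
  obtains v H where "v \<in> borel_measurable M" "H \<in> borel_measurable M" "\<And>x. 0 \<le> (H x :: real)"
    "(\<integral>\<^sup>+x. ennreal (H x) \<partial>M) < \<infinity>"
    "AE x in M. \<forall>j. (norm (v x - u j x)) ^ 4 \<le> 16 * (1/16) ^ j * H x"
proof -
  define F where "F x = (\<Sum>j. ennreal (16 ^ j * (norm (u (Suc j) x - u j x)) ^ 4))" for x
  have [measurable]: "F \<in> borel_measurable M" unfolding F_def by measurable
  have "(\<integral>\<^sup>+x. F x \<partial>M) = (\<Sum>j. \<integral>\<^sup>+x. ennreal (16 ^ j * (norm (u (Suc j) x - u j x)) ^ 4) \<partial>M)"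
    unfolding F_def by (rule nn_integral_suminf) measurable
  also have "\<dots> \<le> (\<Sum>j. ennreal (K * (1/2) ^ j))"
  proof (intro suminf_le allI)
    fix j
    have "(\<integral>\<^sup>+x. ennreal (16 ^ j * (norm (u (Suc j) x - u j x)) ^ 4) \<partial>M) = ennreal (16 ^ j) * (\<integral>\<^sup>+x. ennreal ((norm (u (Suc j) x - u j x)) ^ 4) \<partial>M)"
      by (subst nn_integral_cmult[symmetric]) (auto simp: ennreal_mult)
    also have "\<dots> \<le> ennreal (16 ^ j) * ennreal (K * (1/32) ^ j)"
      by (intro mult_left_mono diff) simp
    also have "\<dots> = ennreal (K * (1/2) ^ j)"
    proof -
      have "(16 :: real) ^ j * (1/32) ^ j = (1/2) ^ j" unfolding power_mult_distrib[symmetric] by simp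
      then have "16 ^ j * (K * (1/32) ^ j) = K * (1/2) ^ j" by (simp only: mult.left_commute[of _ K])
      then show ?thesis by (subst ennreal_mult[symmetric]) (use K in auto)
    qed
    finally show "(\<integral>\<^sup>+x. ennreal (16 ^ j * (norm (u (Suc j) x - u j x)) ^ 4) \<partial>M) \<le> ennreal (K * (1/2) ^ j)" .
  qed auto
  also have "\<dots> = ennreal (\<Sum>j. K * (1/2) ^ j)"
    by (rule suminf_ennreal_eq[OF _ summable_sums]) (use K in \<open>auto intro!: summable_mult\<close>)
  finally have fin: "(\<integral>\<^sup>+x. F x \<partial>M) < \<infinity>" by (rule le_less_trans) simp
  \<comment> \<open>On the null set where \<open>F\<close> is infinite this is 0, and
    \<open>v\<close> is arbitrary where there is no limit; the estimate excludes both.\<close>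
  define H where "H x = enn2real (F x)" for x
  define v where "v x = lim (\<lambda>j. u j x)" for x
  have [measurable]: "H \<in> borel_measurable M" unfolding H_def by measurable
  have vm: "v \<in> borel_measurable M" unfolding v_def by measurable
  have aeF: "AE x in M. F x \<noteq> \<infinity>" by (rule nn_integral_noteq_infinite) (use fin in auto)
  have est: "AE x in M. \<forall>j. (norm (v x - u j x)) ^ 4 \<le> 16 * (1/16) ^ j * H x"
    using aeF
  proof eventually_elim
    case (elim x)
    have FH: "F x = ennreal (H x)" using elim by (simp add: H_def less_top)
    define h where "h = root 4 (H x)"
    have h: "0 \<le> h" "h ^ 4 = H x" by (simp_all add: h_def H_def)
    have step: "norm (u (Suc j) x - u j x) \<le> (1/2) ^ j * h" for j
    proof -
      have "ennreal (16 ^ j * (norm (u (Suc j) x - u j x)) ^ 4) \<le> F x"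
        unfolding F_def by (rule sum_le_suminf[of _ "{j}", simplified]) auto
      then have "16 ^ j * (norm (u (Suc j) x - u j x)) ^ 4 \<le> h ^ 4"
        unfolding FH h(2) by (simp add: H_def)
      moreover have "(16 :: real) ^ j = (2 ^ j) ^ 4"
      proof -
        have "(16 :: real) ^ j = (2 ^ 4) ^ j" by simp
        then show ?thesis by (simp only: power_mult[symmetric] mult.commute)
      qed
      ultimately have "(2 ^ j * norm (u (Suc j) x - u j x)) ^ 4 \<le> h ^ 4" by (simp only: power_mult_distrib)
      then have "2 ^ j * norm (u (Suc j) x - u j x) \<le> h" using h(1) by (subst (asm) power_mono_iff) auto
      then show ?thesis by (simp add: power_one_over field_simps)
    qed
    have tele: "norm (u (j + d) x - u j x) \<le> 2 * (1/2) ^ j * h - 2 * (1/2) ^ (j + d) * h" for j d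
    proof (induction d)
      case (Suc d)
      have "u (j + Suc d) x - u j x = (u (Suc (j + d)) x - u (j + d) x) + (u (j + d) x - u j x)" by simp
      then have "norm (u (j + Suc d) x - u j x) \<le> norm (u (Suc (j + d)) x - u (j + d) x) + norm (u (j + d) x - u j x)"
        by (simp only: norm_triangle_ineq)
      also have "\<dots> \<le> (1/2) ^ (j + d) * h + (2 * (1/2) ^ j * h - 2 * (1/2) ^ (j + d) * h)"
        by (intro add_mono step Suc)
      also have "\<dots> = 2 * (1/2) ^ j * h - 2 * (1/2) ^ (j + Suc d) * h" by simp
      finally show ?case .
    qed simp
    have tele': "norm (u n x - u j x) \<le> 2 * (1/2) ^ j * h" if "j \<le> n" for n j
    proof -
      have "0 \<le> 2 * (1/2) ^ n * h" using h(1) by simp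
      moreover have "j + (n - j) = n" using that by simp
      ultimately show ?thesis using tele[of j "n - j"] by (simp only:)
    qed
    have "Cauchy (\<lambda>j. u j x)"
    proof (rule metric_CauchyI)
      fix e :: real assume e: "0 < e"
      have "(\<lambda>j. 2 * (2 * (1/2) ^ j * h)) \<longlonglongrightarrow> 2 * (2 * 0 * h)"
        by (intro tendsto_intros LIMSEQ_power_zero) simp
      then have "eventually (\<lambda>j. 2 * (2 * (1/2) ^ j * h) < e) sequentially"
        by (rule order_tendstoD(2)) (use e in simp)
      then obtain J where J: "2 * (2 * (1/2) ^ J * h) < e" by (auto simp: eventually_sequentially)
      show "\<exists>J. \<forall>m\<ge>J. \<forall>n\<ge>J. dist (u m x) (u n x) < e"
      proof (intro exI[of _ J] allI impI)
        fix m n assume "J \<le> m" "J \<le> n"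
        then show "dist (u m x) (u n x) < e"
          using dist_triangle2[of "u m x" "u n x" "u J x"] tele'[of J m] tele'[of J n] J
          by (simp add: dist_norm)
      qed
    qed
    then have conv: "(\<lambda>j. u j x) \<longlonglongrightarrow> v x"
      unfolding v_def by (simp add: Cauchy_convergent convergent_LIMSEQ_iff[symmetric])
    show ?case
    proof
      fix j
      have "norm (v x - u j x) \<le> 2 * (1/2) ^ j * h"
      proof (rule Lim_bounded)
        show "(\<lambda>n. norm (u n x - u j x)) \<longlonglongrightarrow> norm (v x - u j x)" by (intro tendsto_intros conv)
        show "\<forall>n\<ge>j. norm (u n x - u j x) \<le> 2 * (1/2) ^ j * h" using tele' by simp
      qed
      then have "(norm (v x - u j x)) ^ 4 \<le> (2 * (1/2) ^ j * h) ^ 4" by (rule power_mono) simp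
      also have "\<dots> = 16 * (1/16) ^ j * H x"
      proof -
        have "(((1 / 2) :: real) ^ j) ^ 4 = ((1/2) ^ 4) ^ j" by (simp only: power_mult[symmetric] mult.commute)
        also have "(1 / 2 :: real) ^ 4 = 1 / 16" by (simp add: power_divide)
        finally show ?thesis by (simp add: power_mult_distrib h(2))
      qed
      finally show "(norm (v x - u j x)) ^ 4 \<le> 16 * (1/16) ^ j * H x" .
    qed
  qed
  have "(\<integral>\<^sup>+x. ennreal (H x) \<partial>M) = (\<integral>\<^sup>+x. F x \<partial>M)"
    by (rule nn_integral_cong_AE) (use aeF in \<open>auto simp: H_def less_top\<close>)
  then show ?thesis using that[OF vm _ _ _ est] fin by (simp add: H_def)
qed

lemma fast_limit_tendsto:
  fixes v :: complex
  assumes "\<forall>j::nat. (norm (v - u j)) ^ 4 \<le> 16 * (1/16) ^ j * H"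
  shows "u \<longlonglongrightarrow> v"
proof -
  have "(\<lambda>j. 16 * (1/16) ^ j * H) \<longlonglongrightarrow> 16 * 0 * H"
    by (intro tendsto_intros LIMSEQ_power_zero) simp
  then have "(\<lambda>j. (norm (v - u j)) ^ 4) \<longlonglongrightarrow> 0"
  proof -
    assume l: "(\<lambda>j. 16 * (1/16) ^ j * H) \<longlonglongrightarrow> 16 * 0 * H"
    show ?thesis
    proof (rule tendsto_sandwich[OF _ _ tendsto_const])
      show "\<forall>\<^sub>F j in sequentially. (norm (v - u j)) ^ 4 \<le> 16 * (1/16) ^ j * H"
        using assms by (rule always_eventually)
      show "(\<lambda>j. 16 * (1/16) ^ j * H) \<longlonglongrightarrow> 0" using l by simp
    qed simp
  qed
  then have "(\<lambda>j. root 4 ((norm (v - u j)) ^ 4)) \<longlonglongrightarrow> root 4 0" by (rule tendsto_real_root)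
  then have "(\<lambda>j. norm (v - u j)) \<longlonglongrightarrow> 0" by (simp add: real_root_power_cancel)
  then have "(\<lambda>j. v - u j) \<longlonglongrightarrow> 0" by (rule tendsto_norm_zero_cancel)
  from tendsto_diff[OF tendsto_const[of v] this] show ?thesis by simp
qed

text \<open>Let b be the bounded, integrable factor by which a function is multiplied in the pairing
  with \<open>h\<close>. From \<bar>v - u_j\<bar> \<le> 2 * 2^-j H^(1/4) and H^(1/4) \<le> 1 + H,
  the integrands differ by at most 2 * 2^-j (\<bar>b\<bar> + C H). So neither \<open>v\<close> nor
  \<open>u j\<close> needs to be in a particular L^p.\<close>

lemma has_fourier_limit:
  assumes v[measurable]: "v \<in> borel_measurable cylinder" and Hm[measurable]: "H \<in> borel_measurable cylinder"
    and H0: "\<And>z. 0 \<le> H z" and Hi: "(\<integral>\<^sup>+z. ennreal (H z) \<partial>cylinder) < \<infinity>"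
    and close: "AE z in cylinder. \<forall>j. (norm (v z - u j z)) ^ 4 \<le> 16 * (1/16) ^ j * H z"
    and h: "h \<in> test_functions"
    and u: "\<And>j. has_bochner_integral cylinder (fourier_integrand (u j) n h) (a j)"
    and a: "a \<longlonglongrightarrow> A"
  shows "has_bochner_integral cylinder (fourier_integrand v n h) A"
proof -
  note [measurable] = test_function_measurable[OF h]
  have integ: "fourier_integrand f n h z = f z * (cis (- (of_int n * fst z)) * line_fourier h (snd z))" for f z
    by (cases z) (simp add: fourier_integrand_def mult.assoc)
  let ?b = "\<lambda>z. cis (- (of_int n * fst z)) * line_fourier h (snd z)"
  have vm[measurable]: "fourier_integrand v n h \<in> borel_measurable cylinder"
    unfolding integ[abs_def] by measurable
  have um[measurable]: "fourier_integrand (u j) n h \<in> borel_measurable cylinder" for j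
    using u by (simp add: has_bochner_integral_iff borel_measurable_integrable)
  have iH: "integrable cylinder H"
    using Hi H0 by (intro integrableI_bounded) simp_all
  obtain C where C: "0 \<le> C" "\<And>y. norm (line_fourier h y) \<le> C / (1 + y\<^sup>2)" by (rule line_fourier_decay[OF h]) blast
  have bC: "norm (?b z) \<le> C" for z
  proof -
    have "C / (1 + (snd z)\<^sup>2) \<le> C" using C(1) by (simp add: divide_le_eq add_pos_nonneg mult_le_cancel_left1)
    then show ?thesis using C(2)[of "snd z"] by (simp add: norm_mult)
  qed
  have iw: "integrable cylinder (\<lambda>z. norm (?b z) + C * H z)"
  proof -
    have "integrable cylinder (\<lambda>z. cis (of_int (- n) * fst z) * line_fourier h (snd z))"
      by (rule integrable_cylinder_snd(1)[OF integrable_line_fourier[OF h]])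
    then have "integrable cylinder ?b" by simp
    then show ?thesis using iH by simp
  qed
  let ?Q = "\<integral>z. norm (?b z) + C * H z \<partial>cylinder"
  have diff: "AE z in cylinder. norm (fourier_integrand v n h z - fourier_integrand (u j) n h z) \<le> 2 * (1/2) ^ j * (norm (?b z) + C * H z)" for j
    using close
  proof eventually_elim
    case (elim z)
    define r where "r = root 4 (H z)"
    have r: "0 \<le> r" "r ^ 4 = H z" using H0 by (simp_all add: r_def)
    have "(((1 / 2) :: real) ^ j) ^ 4 = ((1/2) ^ 4) ^ j" by (simp only: power_mult[symmetric] mult.commute)
    also have "(1 / 2 :: real) ^ 4 = 1 / 16" by (simp add: power_divide)
    finally have "(norm (v z - u j z)) ^ 4 \<le> (2 * (1/2) ^ j * r) ^ 4"
      using elim[rule_format, of j] by (simp add: power_mult_distrib r(2))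
    then have "norm (v z - u j z) \<le> 2 * (1/2) ^ j * r" using r(1) by (subst (asm) power_mono_iff) auto
    also have "\<dots> \<le> 2 * (1/2) ^ j * (1 + H z)"
    proof (rule mult_left_mono)
      show "r \<le> 1 + H z"
      proof (cases "r \<le> 1")
        case False
        then have "r ^ 1 \<le> r ^ 4" by (intro power_increasing) auto
        then show ?thesis using r by simp
      qed (use H0[of z] in linarith)
    qed simp
    finally have "norm (v z - u j z) * norm (?b z) \<le> 2 * (1/2) ^ j * (1 + H z) * norm (?b z)"
      by (rule mult_right_mono) simp
    also have "\<dots> = 2 * (1/2) ^ j * (norm (?b z) + norm (?b z) * H z)" by (simp add: algebra_simps)
    also have "\<dots> \<le> 2 * (1/2) ^ j * (norm (?b z) + C * H z)"
      using bC[of z] H0[of z] by (intro mult_left_mono add_left_mono mult_right_mono) auto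
    finally show ?case unfolding integ left_diff_distrib[symmetric] norm_mult[of "v z - u j z"] .
  qed
  have id: "integrable cylinder (\<lambda>z. fourier_integrand v n h z - fourier_integrand (u j) n h z)" for j
  proof (rule Bochner_Integration.integrable_bound)
    show "integrable cylinder (\<lambda>z. 2 * (1/2) ^ j * (norm (?b z) + C * H z))" by (intro integrable_mult_right iw)
    show "AE z in cylinder. norm (fourier_integrand v n h z - fourier_integrand (u j) n h z) \<le> norm (2 * (1/2) ^ j * (norm (?b z) + C * H z))"
      using diff[of j] by eventually_elim (auto intro: order_trans[OF _ abs_ge_self])
  qed measurable
  have iu: "integrable cylinder (fourier_integrand (u j) n h)" "(\<integral>z. fourier_integrand (u j) n h z \<partial>cylinder) = a j" for j
    using u by (simp_all add: has_bochner_integral_iff)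
  have iv: "integrable cylinder (fourier_integrand v n h)"
    using Bochner_Integration.integrable_add[OF id[of 0] iu(1)[of 0]] by simp
  have bound: "norm ((\<integral>z. fourier_integrand v n h z \<partial>cylinder) - a j) \<le> 2 * (1/2) ^ j * ?Q" for j
  proof -
    have "(\<integral>z. fourier_integrand v n h z \<partial>cylinder) - a j = (\<integral>z. fourier_integrand v n h z - fourier_integrand (u j) n h z \<partial>cylinder)"
      using iv iu by simp
    also have "norm \<dots> \<le> (\<integral>z. 2 * (1/2) ^ j * (norm (?b z) + C * H z) \<partial>cylinder)"
    proof (rule order_trans[OF integral_norm_bound integral_mono_AE])
      show "integrable cylinder (\<lambda>z. norm (fourier_integrand v n h z - fourier_integrand (u j) n h z))" using id by simp
      show "integrable cylinder (\<lambda>z. 2 * (1/2) ^ j * (norm (?b z) + C * H z))" by (intro integrable_mult_right iw)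
    qed (rule diff)
    finally show ?thesis by simp
  qed
  have "a \<longlonglongrightarrow> (\<integral>z. fourier_integrand v n h z \<partial>cylinder)"
  proof (rule LIMSEQ_I)
    fix r :: real assume r: "0 < r"
    have "(\<lambda>j. 2 * (1/2) ^ j * ?Q) \<longlonglongrightarrow> 2 * 0 * ?Q"
      by (intro tendsto_intros LIMSEQ_power_zero) simp
    then have "eventually (\<lambda>j. 2 * (1/2) ^ j * ?Q < r) sequentially"
      by (rule order_tendstoD(2)) (use r in simp)
    then obtain J where J: "\<And>j. J \<le> j \<Longrightarrow> 2 * (1/2) ^ j * ?Q < r" unfolding eventually_sequentially by blast
    show "\<exists>no. \<forall>j\<ge>no. norm (a j - (\<integral>z. fourier_integrand v n h z \<partial>cylinder)) < r"
    proof (intro exI[of _ J] allI impI)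
      fix j assume "J \<le> j"
      then show "norm (a j - (\<integral>z. fourier_integrand v n h z \<partial>cylinder)) < r"
        using bound[of j] J[of j] unfolding norm_minus_commute[of "a j"] by linarith
    qed
  qed
  from LIMSEQ_unique[OF this a] iv show ?thesis by (simp add: has_bochner_integral_iff)
qed

lemma norm_powr_2: "norm x powr 2 = (norm x)\<^sup>2"
  using powr_realpow'[of "norm x" 2] by simp

lemma norm_powr_4: "norm x powr 4 = (norm x) ^ 4"
  using powr_realpow'[of "norm x" 4] by simp

lemma Lp_functions_iff:
  "f \<in> Lp_functions p M \<longleftrightarrow> f \<in> borel_measurable M \<and> (\<integral>\<^sup>+x. ennreal (norm (f x) powr p) \<partial>M) < \<infinity>"
  by (auto simp: Lp_functions_def integrable_iff_bounded)

lemma norm_diff_sq_le: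
  fixes a b c :: complex
  shows "(norm (a - b))\<^sup>2 \<le> 2 * (norm (c - a))\<^sup>2 + 2 * (norm (c - b))\<^sup>2"
proof -
  have "norm (a - b) \<le> norm (c - a) + norm (c - b)"
    using norm_triangle_ineq4[of "c - b" "c - a"] by simp
  then have "(norm (a - b))\<^sup>2 \<le> (norm (c - a) + norm (c - b))\<^sup>2" by (rule power_mono) simp
  also have "\<dots> \<le> 2 * (norm (c - a))\<^sup>2 + 2 * (norm (c - b))\<^sup>2"
    using zero_le_power2[of "norm (c - a) - norm (c - b)"] by (simp add: power2_eq_square algebra_simps)
  finally show ?thesis .
qed

lemma nn_integral_norm_diff_sq_le:
  fixes a b c :: "'a \<Rightarrow> complex"
  assumes [measurable]: "a \<in> borel_measurable M" "b \<in> borel_measurable M" "c \<in> borel_measurable M"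
  shows "(\<integral>\<^sup>+x. ennreal ((norm (a x - b x))\<^sup>2) \<partial>M)
    \<le> 2 * (\<integral>\<^sup>+x. ennreal ((norm (c x - a x))\<^sup>2) \<partial>M) + 2 * (\<integral>\<^sup>+x. ennreal ((norm (c x - b x))\<^sup>2) \<partial>M)"
proof -
  have "(\<integral>\<^sup>+x. ennreal ((norm (a x - b x))\<^sup>2) \<partial>M) \<le> (\<integral>\<^sup>+x. 2 * ennreal ((norm (c x - a x))\<^sup>2) + 2 * ennreal ((norm (c x - b x))\<^sup>2) \<partial>M)"
  proof (intro nn_integral_mono)
    fix x
    have "ennreal ((norm (a x - b x))\<^sup>2) \<le> ennreal (2 * (norm (c x - a x))\<^sup>2 + 2 * (norm (c x - b x))\<^sup>2)"
      by (rule ennreal_leI[OF norm_diff_sq_le])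
    then show "ennreal ((norm (a x - b x))\<^sup>2) \<le> 2 * ennreal ((norm (c x - a x))\<^sup>2) + 2 * ennreal ((norm (c x - b x))\<^sup>2)"
      by (simp add: ennreal_mult)
  qed
  also have "\<dots> = 2 * (\<integral>\<^sup>+x. ennreal ((norm (c x - a x))\<^sup>2) \<partial>M) + 2 * (\<integral>\<^sup>+x. ennreal ((norm (c x - b x))\<^sup>2) \<partial>M)"
    by (simp add: nn_integral_add nn_integral_cmult)
  finally show ?thesis .
qed

text \<open>A form of the Cauchy-Schwarz inequality without roots: the free parameter
  \<open>l\<close> is adapted to the relative size of the factors.\<close>

lemma nn_integral_mult_le_squares:
  fixes f g :: "'a \<Rightarrow> complex"
  assumes [measurable]: "f \<in> borel_measurable M" "g \<in> borel_measurable M" and l: "0 < l"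
  shows "(\<integral>\<^sup>+x. ennreal (norm (f x * g x)) \<partial>M)
    \<le> ennreal l * (\<integral>\<^sup>+x. ennreal ((norm (f x))\<^sup>2) \<partial>M) + ennreal (1 / l) * (\<integral>\<^sup>+x. ennreal ((norm (g x))\<^sup>2) \<partial>M)"
proof -
  have pt: "norm (f x * g x) \<le> l * (norm (f x))\<^sup>2 + 1 / l * (norm (g x))\<^sup>2" for x
  proof -
    define s where "s = sqrt l"
    have s: "0 < s" "l = s * s" using l by (simp_all add: s_def)
    have "0 \<le> (s * norm (f x) - norm (g x) / s)\<^sup>2" by simp
    also have "\<dots> = l * (norm (f x))\<^sup>2 + 1 / l * (norm (g x))\<^sup>2 - 2 * (norm (f x) * norm (g x))"
      using s by (simp add: power2_eq_square field_simps)
    finally have "2 * (norm (f x) * norm (g x)) \<le> l * (norm (f x))\<^sup>2 + 1 / l * (norm (g x))\<^sup>2" by simp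
    moreover have "0 \<le> norm (f x) * norm (g x)" by simp
    ultimately show ?thesis unfolding norm_mult by linarith
  qed
  have "(\<integral>\<^sup>+x. ennreal (norm (f x * g x)) \<partial>M) \<le> (\<integral>\<^sup>+x. ennreal l * ennreal ((norm (f x))\<^sup>2) + ennreal (1 / l) * ennreal ((norm (g x))\<^sup>2) \<partial>M)"
  proof (intro nn_integral_mono)
    fix x
    have n: "0 \<le> l" "0 \<le> 1 / l" using l by auto
    show "ennreal (norm (f x * g x)) \<le> ennreal l * ennreal ((norm (f x))\<^sup>2) + ennreal (1 / l) * ennreal ((norm (g x))\<^sup>2)"
      using ennreal_leI[OF pt[of x]] by (simp only: ennreal_plus ennreal_mult n zero_le_power2 mult_nonneg_nonneg)
  qed
  also have "\<dots> = ennreal l * (\<integral>\<^sup>+x. ennreal ((norm (f x))\<^sup>2) \<partial>M) + ennreal (1 / l) * (\<integral>\<^sup>+x. ennreal ((norm (g x))\<^sup>2) \<partial>M)"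
    by (simp add: nn_integral_add nn_integral_cmult)
  finally show ?thesis .
qed

lemma fourier_tendsto:
  assumes h: "integrable lborel h" and h2: "(\<integral>\<^sup>+\<xi>. ennreal ((norm (h \<xi>))\<^sup>2) \<partial>lborel) < \<infinity>"
    and m[measurable]: "\<phi> \<in> borel_measurable cylinder" "\<And>j. \<phi>' j \<in> borel_measurable cylinder"
    and f2: "\<And>j. (\<integral>\<^sup>+z. ennreal ((norm (\<phi>' j z))\<^sup>2) \<partial>cylinder) < \<infinity>"
    and close: "\<And>j. (\<integral>\<^sup>+z. ennreal ((norm (\<phi> z - \<phi>' j z))\<^sup>2) \<partial>cylinder) \<le> ennreal ((1/32) ^ j)"
  shows "(\<lambda>j. fourier (\<phi>' j) n h) \<longlonglongrightarrow> fourier \<phi> n h"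
proof -
  note [measurable] = borel_measurable_integrable[OF h]
  let ?b = "\<lambda>z. cis (- (of_int n * fst z)) * line_fourier h (snd z)"
  have b[measurable]: "?b \<in> borel_measurable cylinder" by measurable
  define Q where "Q = (\<integral>\<^sup>+z. ennreal ((norm (?b z))\<^sup>2) \<partial>cylinder)"
  have "Q = ennreal (2 * pi) * (\<integral>\<^sup>+y. ennreal ((norm (line_fourier h y))\<^sup>2) \<partial>lborel)"
    unfolding Q_def norm_mult norm_cis mult_1 by (rule cylinder_nn_integral_snd) measurable
  also have "\<dots> \<le> ennreal (2 * pi) * (ennreal (2 * pi) * (\<integral>\<^sup>+\<xi>. ennreal ((norm (h \<xi>))\<^sup>2) \<partial>lborel))"
    by (intro mult_left_mono line_fourier_L2_le h) simp
  also have "\<dots> < \<infinity>" using h2 by (simp add: ennreal_mult_less_top)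
  finally have Q: "Q < \<infinity>" .
  have fe: "fourier f n h = (\<integral>z. f z * ?b z \<partial>cylinder)" for f
    unfolding fourier_def by (intro Bochner_Integration.integral_cong refl) (simp add: fourier_integrand_def case_prod_beta mult.assoc)
  have int: "integrable cylinder (\<lambda>z. f z * ?b z)"
    if [measurable]: "f \<in> borel_measurable cylinder" and f: "(\<integral>\<^sup>+z. ennreal ((norm (f z))\<^sup>2) \<partial>cylinder) < \<infinity>" for f
  proof (rule integrableI_bounded)
    have "(\<integral>\<^sup>+z. ennreal (norm (f z * ?b z)) \<partial>cylinder) \<le> ennreal 1 * (\<integral>\<^sup>+z. ennreal ((norm (f z))\<^sup>2) \<partial>cylinder) + ennreal (1 / 1) * Q"
      unfolding Q_def by (rule nn_integral_mult_le_squares) (use that in \<open>auto simp: b\<close>)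
    also have "\<dots> < \<infinity>" using f Q by simp
    finally show "(\<integral>\<^sup>+z. ennreal (norm (f z * ?b z)) \<partial>cylinder) < \<infinity>" .
  qed measurable
  have bound: "norm (fourier \<phi> n h - fourier (\<phi>' j) n h) \<le> (1/2) ^ j * (1 + enn2real Q)" for j
  proof -
    have id: "integrable cylinder (\<lambda>z. (\<phi> z - \<phi>' j z) * ?b z)"
      by (rule int) (use close[of j] in \<open>auto intro: le_less_trans\<close>)
    have ij: "integrable cylinder (\<lambda>z. \<phi>' j z * ?b z)" by (rule int) (use f2 in auto)
    have "integrable cylinder (\<lambda>z. (\<phi> z - \<phi>' j z) * ?b z + \<phi>' j z * ?b z)"
      by (intro Bochner_Integration.integrable_add id ij)
    then have ip: "integrable cylinder (\<lambda>z. \<phi> z * ?b z)" by (simp add: left_diff_distrib)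
    have "fourier \<phi> n h - fourier (\<phi>' j) n h = (\<integral>z. (\<phi> z - \<phi>' j z) * ?b z \<partial>cylinder)"
      unfolding fe left_diff_distrib using ip ij by simp
    then have "ennreal (norm (fourier \<phi> n h - fourier (\<phi>' j) n h)) \<le> (\<integral>\<^sup>+z. ennreal (norm ((\<phi> z - \<phi>' j z) * ?b z)) \<partial>cylinder)"
      by (simp only: ennreal_norm_integral_le)
    \<comment> \<open>The parameter 2^j balances the two terms: 2^j 32^-j and 2^-j \<open>Q\<close>
      both tend to 0.\<close>
    also have "\<dots> \<le> ennreal (2 ^ j) * (\<integral>\<^sup>+z. ennreal ((norm (\<phi> z - \<phi>' j z))\<^sup>2) \<partial>cylinder) + ennreal (1 / 2 ^ j) * Q"
      unfolding Q_def by (rule nn_integral_mult_le_squares) (simp_all add: b)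
    also have "\<dots> \<le> ennreal (2 ^ j) * ennreal ((1/32) ^ j) + ennreal (1 / 2 ^ j) * ennreal (enn2real Q)"
      using Q by (intro add_mono mult_left_mono close) auto
    also have "\<dots> = ennreal (2 ^ j * (1/32) ^ j + 1 / 2 ^ j * enn2real Q)"
    proof -
      have n: "0 \<le> (2 :: real) ^ j" "0 \<le> (1/32 :: real) ^ j" "0 \<le> 1 / (2 :: real) ^ j" "0 \<le> enn2real Q" by simp_all
      then show ?thesis by (simp only: ennreal_plus ennreal_mult mult_nonneg_nonneg n)
    qed
    finally have "norm (fourier \<phi> n h - fourier (\<phi>' j) n h) \<le> 2 ^ j * (1/32) ^ j + 1 / 2 ^ j * enn2real Q"
      by (subst (asm) ennreal_le_iff) auto
    also have "(2 :: real) ^ j * (1/32) ^ j = (1/16) ^ j" unfolding power_mult_distrib[symmetric] by simp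
    also have "(1/16 :: real) ^ j \<le> (1/2) ^ j" by (rule power_mono) auto
    finally show ?thesis by (simp add: power_one_over add_divide_distrib)
  qed
  have "(\<lambda>j. (1/2) ^ j * (1 + enn2real Q)) \<longlonglongrightarrow> 0 * (1 + enn2real Q)"
    by (intro tendsto_intros LIMSEQ_power_zero) simp
  then have "(\<lambda>j. (1/2) ^ j * (1 + enn2real Q)) \<longlonglongrightarrow> 0" by simp
  then have "(\<lambda>j. fourier \<phi> n h - fourier (\<phi>' j) n h) \<longlonglongrightarrow> 0"
    by (rule Lim_null_comparison[rotated]) (intro always_eventually allI bound)
  from tendsto_diff[OF tendsto_const[of "fourier \<phi> n h"] this] show ?thesis by simp
qed

lemma test_function_L2: 
  assumes "h \<in> test_functions"
  shows "(\<integral>\<^sup>+\<xi>. ennreal ((norm (h \<xi>))\<^sup>2) \<partial>lborel) < \<infinity>"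
proof -
  obtain K where K: "0 \<le> K" "\<And>x. norm (h x) \<le> K" by (rule test_function_bounded[OF assms]) (rule that)
  note i = integrable_norm[OF test_function_integrable[OF assms]]
  have "(\<integral>\<^sup>+\<xi>. ennreal ((norm (h \<xi>))\<^sup>2) \<partial>lborel) \<le> (\<integral>\<^sup>+\<xi>. ennreal (K * norm (h \<xi>)) \<partial>lborel)"
    by (intro nn_integral_mono ennreal_leI) (simp add: power2_eq_square mult_right_mono K)
  also have "\<dots> = ennreal (\<integral>\<xi>. K * norm (h \<xi>) \<partial>lborel)"
    by (rule nn_integral_eq_integral) (use i K in auto)
  finally show ?thesis by (rule le_less_trans) simp
qed

locale flow_time = bounded_counting "dispersion \<alpha> \<epsilon>" B + time_set I
  for \<alpha> \<epsilon> :: real and B :: real and I :: "real set"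
begin

abbreviation om :: "int \<Rightarrow> real" where "om \<equiv> dispersion \<alpha> \<epsilon>"

definition SC :: real where "SC = exp (len\<^sup>2 / 2) * strichartz_const"

lemma SC_pos: "0 < SC"
  using B_pos by (simp add: SC_def strichartz_const_def)

lemma measurable_ext_spacetime:
  assumes g: "integrable freq g"
  shows "(\<lambda>p. ext om g (fst p) (snd p)) \<in> borel_measurable (spacetime I)"
proof (rule measurable_spacetimeI)
  note [measurable] = borel_measurable_integrable[OF g]
  show "(\<lambda>(t, z). ext om g t z) \<in> borel_measurable (lborel \<Otimes>\<^sub>M cylinder)" by measurable
qed

lemma strichartz_spacetime:
  assumes g: "integrable freq g"
  shows "(\<integral>\<^sup>+p. ennreal ((norm (ext om g (fst p) (snd p))) ^ 4) \<partial>spacetime I)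
    \<le> ennreal SC * (\<integral>\<^sup>+k. ennreal ((norm (g k))\<^sup>2) \<partial>freq)\<^sup>2"
proof -
  note [measurable] = borel_measurable_integrable[OF g] measurable_ext_spacetime[OF g]
  have "(\<integral>\<^sup>+p. ennreal ((norm (ext om g (fst p) (snd p))) ^ 4) \<partial>spacetime I) = (\<integral>\<^sup>+t. (\<integral>\<^sup>+z. ennreal ((norm (ext om g t z)) ^ 4) \<partial>cylinder) \<partial>TI)"
    by (subst nn_integral_spacetime) auto
  also have "\<dots> = (\<integral>\<^sup>+t. indicator I t * (\<integral>\<^sup>+z. ennreal ((norm (ext om g t z)) ^ 4) \<partial>cylinder) \<partial>lborel)"
    by (rule nn_integral_TI) measurable
  also have "\<dots> \<le> (\<integral>\<^sup>+t. indicator {- len..len} t * (\<integral>\<^sup>+z. ennreal ((norm (ext om g t z)) ^ 4) \<partial>cylinder) \<partial>lborel)"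
    using I_subset by (intro nn_integral_mono mult_right_mono) (auto simp: indicator_def)
  also have "\<dots> \<le> ennreal SC * (\<integral>\<^sup>+k. ennreal ((norm (g k))\<^sup>2) \<partial>freq)\<^sup>2"
    unfolding SC_def by (rule strichartz[OF g])
  finally show ?thesis .
qed

lemma multiplier_integrable:
  assumes h: "h \<in> test_functions"
  shows "integrable lborel (\<lambda>\<xi>. cis (- (t * (om n + \<xi>\<^sup>2))) * h \<xi>)"
    "(\<integral>\<^sup>+\<xi>. ennreal ((norm (cis (- (t * (om n + \<xi>\<^sup>2))) * h \<xi>))\<^sup>2) \<partial>lborel) < \<infinity>"
  using integrable_mult_cis[OF test_function_integrable[OF h], of "\<lambda>\<xi>. - (t * (om n + \<xi>\<^sup>2))"] test_function_L2[OF h]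
  by (simp_all add: mult.commute norm_mult)

text \<open>Nice approximations with squared error 32^-j are turned by Plancherel into close
  profiles and by the Strichartz estimate into close evolutions, as \<open>fast_limit\<close>
  requires. The factor 4 in the constant is the square of the factor 2 lost in bounding the L^2
  masses of the approximations by 2 X in the limit.\<close>

lemma free_evolution_exists:
  assumes \<phi>: "\<phi> \<in> Lp_functions 2 cylinder"
  shows "\<exists>u. is_free_evolution \<alpha> \<epsilon> I \<phi> u \<and>
    (\<integral>\<^sup>+p. ennreal ((norm (u p)) ^ 4) \<partial>spacetime I) \<le> ennreal (4 * SC * (\<integral>z. (norm (\<phi> z))\<^sup>2 \<partial>cylinder)\<^sup>2)"
proof -
  have \<phi>m[measurable]: "\<phi> \<in> borel_measurable cylinder" using \<phi> by (simp add: Lp_functions_iff)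
  have \<phi>i: "integrable cylinder (\<lambda>z. (norm (\<phi> z))\<^sup>2)" using \<phi> by (simp add: Lp_functions_def norm_powr_2)
  define X where "X = (\<integral>z. (norm (\<phi> z))\<^sup>2 \<partial>cylinder)"
  have X0: "0 \<le> X" unfolding X_def by (intro integral_nonneg_AE) auto
  have X: "(\<integral>\<^sup>+z. ennreal ((norm (\<phi> z))\<^sup>2) \<partial>cylinder) = ennreal X"
    unfolding X_def by (rule nn_integral_eq_integral[OF \<phi>i]) simp
  interpret Lp_closure cylinder 2 nices by (rule Lp_closure_nices) auto
  have "cl \<phi>"
    by (rule cylinder_nices_dense) (use \<phi> in \<open>auto simp: Lp_functions_iff\<close>)
  then have c: "\<forall>e>0. \<exists>\<psi>\<in>nices. (\<integral>\<^sup>+z. ennreal ((norm (\<phi> z - \<psi> z))\<^sup>2) \<partial>cylinder) < ennreal e"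
    unfolding cl_def norm_powr_2 by (rule conjunct2)
  have "\<exists>F. nice (fst F) (snd F) \<and> (\<integral>\<^sup>+z. ennreal ((norm (\<phi> z - fst F z))\<^sup>2) \<partial>cylinder) < ennreal ((1/32) ^ j)" for j :: nat
  proof -
    obtain \<psi> where \<psi>: "\<psi> \<in> nices" "(\<integral>\<^sup>+z. ennreal ((norm (\<phi> z - \<psi> z))\<^sup>2) \<partial>cylinder) < ennreal ((1/32) ^ j)"
      using c[rule_format, of "(1/32) ^ j"] by (elim bexE[rotated]) (simp_all only: zero_less_power zero_less_divide_1_iff zero_less_numeral)
    from \<psi>(1) obtain \<gamma> where "nice \<psi> \<gamma>" by (elim CollectE exE) (rule that)
    with \<psi>(2) show ?thesis by (intro exI[of _ "(\<psi>, \<gamma>)"]) (simp only: fst_conv snd_conv)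
  qed
  then have "\<forall>j. \<exists>F. nice (fst F) (snd F) \<and> (\<integral>\<^sup>+z. ennreal ((norm (\<phi> z - fst F z))\<^sup>2) \<partial>cylinder) < ennreal ((1/32) ^ j)" by (rule allI)
  from choice[OF this] obtain F where F: "\<forall>j. nice (fst (F j)) (snd (F j)) \<and> (\<integral>\<^sup>+z. ennreal ((norm (\<phi> z - fst (F j) z))\<^sup>2) \<partial>cylinder) < ennreal ((1/32) ^ j)"
    by (rule exE)
  define \<phi>' where "\<phi>' j = fst (F j)" for j
  define g where "g j = snd (F j)" for j
  have n: "nice (\<phi>' j) (g j)" and close: "(\<integral>\<^sup>+z. ennreal ((norm (\<phi> z - \<phi>' j z))\<^sup>2) \<partial>cylinder) < ennreal ((1/32) ^ j)" for j
    using F[rule_format, of j] unfolding \<phi>'_def g_def by (rule conjunct1, rule conjunct2)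
  note [measurable] = nice_family_measurable(3,4)[OF n]
  note gi = nice_family_integrable_freq[OF n]
  \<comment> \<open>Of the factor 4 pi^2 only 4 is kept, just enough to absorb the 4 that arises in
    comparing consecutive approximations.\<close>
  have pl: "(\<integral>\<^sup>+z. ennreal ((norm (\<psi> z))\<^sup>2) \<partial>cylinder) \<ge> 4 * (\<integral>\<^sup>+k. ennreal ((norm (\<gamma> k))\<^sup>2) \<partial>freq)" if "nice \<psi> \<gamma>" for \<psi> \<gamma>
  proof -
    have "1 * 1 \<le> pi * pi" using pi_gt3 by (intro mult_mono) auto
    then have "ennreal 4 \<le> ennreal (4 * pi\<^sup>2)" by (intro ennreal_leI) (simp add: power2_eq_square)
    then show ?thesis unfolding nice_family_plancherel[OF that] by (intro mult_right_mono) auto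
  qed
  have L2: "(\<integral>\<^sup>+z. ennreal ((norm (\<phi>' j z))\<^sup>2) \<partial>cylinder) \<le> ennreal (2 * X + 2 * (1/32) ^ j)" for j
  proof -
    have "(\<integral>\<^sup>+z. ennreal ((norm (\<phi>' j z - 0))\<^sup>2) \<partial>cylinder) \<le> 2 * (\<integral>\<^sup>+z. ennreal ((norm (\<phi> z - \<phi>' j z))\<^sup>2) \<partial>cylinder) + 2 * (\<integral>\<^sup>+z. ennreal ((norm (\<phi> z - 0))\<^sup>2) \<partial>cylinder)"
      by (rule nn_integral_norm_diff_sq_le) measurable
    also have "\<dots> \<le> 2 * ennreal ((1/32) ^ j) + 2 * ennreal X"
      using X by (intro add_mono mult_left_mono less_imp_le[OF close]) auto
    finally show ?thesis using X0 by (simp add: ennreal_mult add.commute)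
  qed
  let ?u = "\<lambda>j p. ext om (g j) (fst p) (snd p)"
  have um[measurable]: "?u j \<in> borel_measurable (spacetime I)" for j
    by (rule measurable_ext_spacetime[OF gi])
  have dg: "(\<integral>\<^sup>+k. ennreal ((norm (g (Suc j) k - g j k))\<^sup>2) \<partial>freq) \<le> ennreal ((1/32) ^ j)" for j
  proof -
    have nd: "nice (\<lambda>z. \<phi>' (Suc j) z - \<phi>' j z) (\<lambda>k. g (Suc j) k - g j k)"
      using nice_add[OF n[of "Suc j"] nice_mult[OF n[of j], of "- 1"]] by simp
    have "4 * (\<integral>\<^sup>+k. ennreal ((norm (g (Suc j) k - g j k))\<^sup>2) \<partial>freq) \<le> (\<integral>\<^sup>+z. ennreal ((norm (\<phi>' (Suc j) z - \<phi>' j z))\<^sup>2) \<partial>cylinder)"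
      by (rule pl[OF nd])
    also have "\<dots> \<le> 2 * (\<integral>\<^sup>+z. ennreal ((norm (\<phi> z - \<phi>' (Suc j) z))\<^sup>2) \<partial>cylinder) + 2 * (\<integral>\<^sup>+z. ennreal ((norm (\<phi> z - \<phi>' j z))\<^sup>2) \<partial>cylinder)"
      by (rule nn_integral_norm_diff_sq_le) measurable
    also have "\<dots> \<le> 2 * ennreal ((1/32) ^ Suc j) + 2 * ennreal ((1/32) ^ j)"
      by (intro add_mono mult_left_mono less_imp_le[OF close]) auto
    also have "\<dots> \<le> 2 * ennreal ((1/32) ^ j) + 2 * ennreal ((1/32) ^ j)"
      by (intro add_mono mult_left_mono ennreal_leI) auto
    also have "\<dots> = 4 * ennreal ((1/32) ^ j)"
      by (simp only: distrib_right[symmetric]) simp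
    finally show ?thesis by (subst (asm) ennreal_mult_le_mult_iff) auto
  qed
  have diff: "(\<integral>\<^sup>+p. ennreal ((norm (?u (Suc j) p - ?u j p)) ^ 4) \<partial>spacetime I) \<le> ennreal (SC * (1/32) ^ j)" for j
  proof -
    have id: "integrable freq (\<lambda>k. g (Suc j) k - g j k)" using gi by simp
    have "?u (Suc j) p - ?u j p = ext om (\<lambda>k. g (Suc j) k - g j k) (fst p) (snd p)" for p
      using ext_add[OF gi[of "Suc j"] integrable_mult_right[OF gi[of j], of "- 1"], of om "fst p" "snd p"] ext_mult[of om "- 1" "g j"]
      by simp
    then have "(\<integral>\<^sup>+p. ennreal ((norm (?u (Suc j) p - ?u j p)) ^ 4) \<partial>spacetime I) \<le> ennreal SC * (\<integral>\<^sup>+k. ennreal ((norm (g (Suc j) k - g j k))\<^sup>2) \<partial>freq)\<^sup>2"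
      using strichartz_spacetime[OF id] by simp
    also have "\<dots> \<le> ennreal SC * (ennreal ((1/32) ^ j))\<^sup>2"
      by (intro mult_left_mono power_mono dg) auto
    also have "\<dots> \<le> ennreal (SC * (1/32) ^ j)"
    proof -
      have "(((1/32) :: real) ^ j)\<^sup>2 \<le> (1/32) ^ j"
        by (simp add: power2_eq_square mult_left_le power_le_one)
      then have "SC * ((1/32) ^ j)\<^sup>2 \<le> SC * (1/32) ^ j" using SC_pos by (intro mult_left_mono) auto
      then show ?thesis using SC_pos by (simp add: ennreal_power ennreal_mult[symmetric] ennreal_leI)
    qed
    finally show ?thesis .
  qed
  obtain u H where um'[measurable]: "u \<in> borel_measurable (spacetime I)" and Hm: "H \<in> borel_measurable (spacetime I)"
    and H0: "\<And>p. 0 \<le> (H p :: real)" and Hi: "(\<integral>\<^sup>+p. ennreal (H p) \<partial>spacetime I) < \<infinity>"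
    and lim: "AE p in spacetime I. \<forall>j. (norm (u p - ?u j p)) ^ 4 \<le> 16 * (1/16) ^ j * H p"
    by (rule fast_limit[OF um less_imp_le[OF SC_pos] diff]) (rule that)
  note [measurable] = Hm
  \<comment> \<open>A majorant integrable on space-time is integrable on almost every slice. The
    exceptional times are fixed here, before frequencies and test functions are chosen.\<close>
  have aeH: "AE t in TI. (\<integral>\<^sup>+z. ennreal (H (t, z)) \<partial>cylinder) \<noteq> \<infinity>"
  proof (rule nn_integral_noteq_infinite)
    show "(\<lambda>t. \<integral>\<^sup>+z. ennreal (H (t, z)) \<partial>cylinder) \<in> borel_measurable TI"
      using Hm unfolding spacetime_eq by measurable
    show "(\<integral>\<^sup>+t. (\<integral>\<^sup>+z. ennreal (H (t, z)) \<partial>cylinder) \<partial>TI) \<noteq> \<infinity>"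
      using Hi by (subst (asm) nn_integral_spacetime) auto
  qed
  have free: "is_free_evolution \<alpha> \<epsilon> I \<phi> u"
    unfolding is_free_evolution_def
  proof (intro conjI um')
    show "AE t in TI. (\<lambda>z. u (t, z)) \<in> Lp_functions 2 cylinder \<and> has_fourier (\<lambda>z. u (t, z)) (group_multiplier \<alpha> \<epsilon> t (fourier \<phi>))"
      using aeH AE_spacetime_slice[OF lim] AE_TI_in_I
    proof eventually_elim
      case (elim t)
      have close_t: "AE z in cylinder. \<forall>j. (norm (u (t, z) - ext om (g j) t z)) ^ 4 \<le> 16 * (1/16) ^ j * H (t, z)"
        using elim(2) by simp
      have utm[measurable]: "(\<lambda>z. u (t, z)) \<in> borel_measurable cylinder" by (rule measurable_spacetime_slice[OF um' elim(3)])
      have Htm[measurable]: "(\<lambda>z. H (t, z)) \<in> borel_measurable cylinder"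
        using measurable_Pair2[OF Hm[unfolded spacetime_eq], of t] elim(3) by (simp add: space_TI)
      \<comment> \<open>The evolution does not increase the L^2 mass of the approximations, and
        Fatou's lemma passes the bound to the slice of the limit.\<close>
      have "(\<integral>\<^sup>+z. ennreal ((norm (u (t, z)))\<^sup>2) \<partial>cylinder) \<le> ennreal (2 * X + 2)"
      proof -
        have "(\<integral>\<^sup>+z. ennreal ((norm (u (t, z)))\<^sup>2) \<partial>cylinder) = (\<integral>\<^sup>+z. liminf (\<lambda>j. ennreal ((norm (ext om (g j) t z))\<^sup>2)) \<partial>cylinder)"
        proof (rule nn_integral_cong_AE)
          show "AE z in cylinder. ennreal ((norm (u (t, z)))\<^sup>2) = liminf (\<lambda>j. ennreal ((norm (ext om (g j) t z))\<^sup>2))"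
            using close_t
          proof eventually_elim
            case (elim z)
            from fast_limit_tendsto[OF elim] have T: "(\<lambda>j. ennreal ((norm (ext om (g j) t z))\<^sup>2)) \<longlonglongrightarrow> ennreal ((norm (u (t, z)))\<^sup>2)"
              by (intro tendsto_intros)
            show ?case by (rule lim_imp_Liminf[OF sequentially_bot T, symmetric])
          qed
        qed
        also have "\<dots> \<le> liminf (\<lambda>j. \<integral>\<^sup>+z. ennreal ((norm (ext om (g j) t z))\<^sup>2) \<partial>cylinder)"
          by (rule nn_integral_liminf) measurable
        also have "\<dots> \<le> liminf (\<lambda>j::nat. ennreal (2 * X + 2))"
        proof (intro Liminf_mono always_eventually allI)
          fix j
          have "(\<integral>\<^sup>+z. ennreal ((norm (ext om (g j) t z))\<^sup>2) \<partial>cylinder) \<le> (\<integral>\<^sup>+z. ennreal ((norm (\<phi>' j z))\<^sup>2) \<partial>cylinder)"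
            unfolding nice_family_plancherel[OF n] by (rule ext_L2_le[OF gi])
          also have "\<dots> \<le> ennreal (2 * X + 2 * (1/32) ^ j)" by (rule L2)
          also have "\<dots> \<le> ennreal (2 * X + 2)" by (intro ennreal_leI) (simp add: power_le_one)
          finally show "(\<integral>\<^sup>+z. ennreal ((norm (ext om (g j) t z))\<^sup>2) \<partial>cylinder) \<le> ennreal (2 * X + 2)" .
        qed
        finally show ?thesis by (simp add: Liminf_const)
      qed
      then have "(\<lambda>z. u (t, z)) \<in> Lp_functions 2 cylinder"
        by (auto simp: Lp_functions_iff norm_powr_2 intro: le_less_trans)
      moreover have "has_fourier (\<lambda>z. u (t, z)) (group_multiplier \<alpha> \<epsilon> t (fourier \<phi>))"
        unfolding has_fourier_def
      proof (intro allI ballI)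
        fix n' h assume h: "h \<in> test_functions"
        let ?h = "\<lambda>\<xi>. cis (- (t * (om n' + \<xi>\<^sup>2))) * h \<xi>"
        show "has_bochner_integral cylinder (fourier_integrand (\<lambda>z. u (t, z)) n' h) (group_multiplier \<alpha> \<epsilon> t (fourier \<phi>) n' h)"
        proof (rule has_fourier_limit[OF utm Htm H0 _ close_t h])
          show "(\<integral>\<^sup>+z. ennreal (H (t, z)) \<partial>cylinder) < \<infinity>" using elim(1) by (simp add: less_top)
          show "has_bochner_integral cylinder (fourier_integrand (\<lambda>z. ext om (g j) t z) n' h) (fourier (\<phi>' j) n' ?h)" for j
            using has_fourier_ext[OF gi[of j] h, of om t n'] unfolding nice_family_fourier_pairing[OF n multiplier_integrable(1)[OF h]]
            by (simp add: symb_def mult.assoc)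
          show "(\<lambda>j. fourier (\<phi>' j) n' ?h) \<longlonglongrightarrow> group_multiplier \<alpha> \<epsilon> t (fourier \<phi>) n' h"
            unfolding group_multiplier_def
          proof (rule fourier_tendsto[OF multiplier_integrable[OF h]])
            show "(\<integral>\<^sup>+z. ennreal ((norm (\<phi>' j z))\<^sup>2) \<partial>cylinder) < \<infinity>" for j
              using L2[of j] by (rule le_less_trans) simp
          qed (auto intro: less_imp_le[OF close])
        qed
      qed
      ultimately show ?case by simp
    qed
  qed
  have "(\<integral>\<^sup>+p. ennreal ((norm (u p)) ^ 4) \<partial>spacetime I) = (\<integral>\<^sup>+p. liminf (\<lambda>j. ennreal ((norm (?u j p)) ^ 4)) \<partial>spacetime I)"
  proof (rule nn_integral_cong_AE)
    show "AE p in spacetime I. ennreal ((norm (u p)) ^ 4) = liminf (\<lambda>j. ennreal ((norm (?u j p)) ^ 4))"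
      using lim
    proof eventually_elim
      case (elim p)
      from fast_limit_tendsto[OF elim] have T: "(\<lambda>j. ennreal ((norm (?u j p)) ^ 4)) \<longlonglongrightarrow> ennreal ((norm (u p)) ^ 4)"
        by (intro tendsto_intros)
      show ?case by (rule lim_imp_Liminf[OF sequentially_bot T, symmetric])
    qed
  qed
  also have "\<dots> \<le> liminf (\<lambda>j. \<integral>\<^sup>+p. ennreal ((norm (?u j p)) ^ 4) \<partial>spacetime I)"
    by (rule nn_integral_liminf) measurable
  also have "\<dots> \<le> liminf (\<lambda>j. ennreal (SC * (2 * X + 2 * (1/32) ^ j)\<^sup>2))"
  proof (intro Liminf_mono always_eventually allI)
    fix j
    have "(\<integral>\<^sup>+k. ennreal ((norm (g j k))\<^sup>2) \<partial>freq) \<le> 4 * (\<integral>\<^sup>+k. ennreal ((norm (g j k))\<^sup>2) \<partial>freq)"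
      using mult_right_mono[of "1 :: ennreal" 4 "\<integral>\<^sup>+k. ennreal ((norm (g j k))\<^sup>2) \<partial>freq"] by simp
    also have "\<dots> \<le> ennreal (2 * X + 2 * (1/32) ^ j)"
      using pl[OF n[of j]] L2[of j] by (rule order_trans)
    finally have "ennreal SC * (\<integral>\<^sup>+k. ennreal ((norm (g j k))\<^sup>2) \<partial>freq)\<^sup>2 \<le> ennreal SC * (ennreal (2 * X + 2 * (1/32) ^ j))\<^sup>2"
      by (intro mult_left_mono power_mono) auto
    also have "\<dots> = ennreal (SC * (2 * X + 2 * (1/32) ^ j)\<^sup>2)"
    proof -
      have "0 \<le> SC" "0 \<le> 2 * X + 2 * (1/32) ^ j" using SC_pos X0 by simp_all
      then show ?thesis by (simp only: ennreal_power ennreal_mult[symmetric] zero_le_power)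
    qed
    finally show "(\<integral>\<^sup>+p. ennreal ((norm (?u j p)) ^ 4) \<partial>spacetime I) \<le> ennreal (SC * (2 * X + 2 * (1/32) ^ j)\<^sup>2)"
      using strichartz_spacetime[OF gi[of j]] by (rule order_trans[rotated])
  qed
  also have "\<dots> = ennreal (SC * (2 * X + 2 * 0)\<^sup>2)"
  proof (rule lim_imp_Liminf)
    show "(\<lambda>j. ennreal (SC * (2 * X + 2 * (1/32) ^ j)\<^sup>2)) \<longlonglongrightarrow> ennreal (SC * (2 * X + 2 * 0)\<^sup>2)"
      by (intro tendsto_intros LIMSEQ_power_zero) simp
  qed simp
  also have "SC * (2 * X + 2 * 0)\<^sup>2 = 4 * SC * X\<^sup>2" by (simp add: power2_eq_square)
  finally show ?thesis using free unfolding X_def by blast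
qed

lemma free_evolution_unique:
  assumes "is_free_evolution \<alpha> \<epsilon> I \<phi> u" "is_free_evolution \<alpha> \<epsilon> I \<phi> v"
  shows "AE p in spacetime I. u p = v p"
proof (rule AE_spacetimeI_eq)
  show "u \<in> borel_measurable (spacetime I)" "v \<in> borel_measurable (spacetime I)"
    using assms by (auto simp: is_free_evolution_def)
  have "AE t in TI. has_fourier (\<lambda>z. u (t, z)) (group_multiplier \<alpha> \<epsilon> t (fourier \<phi>))"
    "AE t in TI. has_fourier (\<lambda>z. v (t, z)) (group_multiplier \<alpha> \<epsilon> t (fourier \<phi>))"
    using assms by (auto simp: is_free_evolution_def)
  then show "AE t in TI. AE z in cylinder. u (t, z) = v (t, z)"
    by eventually_elim (rule has_fourier_unique)
qed

end

section \<open>The retarded estimate\<close>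

text \<open>Young's inequality for the exponents 4/3 and 4 with a free parameter. With u = a^(1/3)
  the product is u^3 b, and either b \<le> l u bounds it by l u^4, or u \<le> b / l bounds it by b^4
  / l^3.\<close>

lemma young_four_thirds:
  fixes a b l :: real
  assumes a: "0 \<le> a" and b: "0 \<le> b" and l: "0 < l"
  shows "a * b \<le> l * a powr (4/3) + 1 / l ^ 3 * b ^ 4"
proof -
  define u where "u = a powr (1/3)"
  have u: "0 \<le> u" by (simp add: u_def)
  have u3: "u ^ 3 = a"
    using powr_realpow'[OF u, of 3] a by (simp add: u_def powr_powr)
  have u4: "a powr (4/3) = u ^ 4"
    using powr_realpow'[OF u, of 4] by (simp add: u_def powr_powr)
  have n: "0 \<le> l * u ^ 4" "0 \<le> 1 / l ^ 3 * b ^ 4" using u b l by simp_all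
  show ?thesis
  proof (cases "b \<le> l * u")
    case True
    then have "u ^ 3 * b \<le> u ^ 3 * (l * u)" using u by (intro mult_left_mono) auto
    also have "\<dots> = l * u ^ 4" by (simp add: eval_nat_numeral)
    finally show ?thesis using n unfolding u4 u3 by simp
  next
    case False
    then have "u \<le> b / l" using l by (simp add: field_simps)
    then have "u ^ 3 \<le> (b / l) ^ 3" using u by (intro power_mono) auto
    then have "u ^ 3 * b \<le> (b / l) ^ 3 * b" using b by (rule mult_right_mono)
    also have "\<dots> = 1 / l ^ 3 * b ^ 4" by (simp add: power_divide eval_nat_numeral)
    finally show ?thesis using n unfolding u4 u3 by simp
  qed
qed

text \<open>The choice l^3 = C N makes the last term equal to \<open>N\<close>, which is absorbed by
  one of the two on the left. Then N \<le> l X, and cubing eliminates l.\<close>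

lemma dual_algebra:
  fixes N C X :: real
  assumes N: "0 \<le> N" and C: "0 < C" and X: "0 \<le> X"
    and le: "\<And>l. 0 < l \<Longrightarrow> 2 * N \<le> l * X + 1 / l ^ 3 * (C * N\<^sup>2)"
  shows "N\<^sup>2 \<le> C * X ^ 3"
proof (cases "N = 0")
  case False
  then have N': "0 < N" using N by simp
  define l where "l = root 3 (C * N)"
  have l: "0 < l" "l ^ 3 = C * N" using C N' by (simp_all add: l_def)
  have "1 / l ^ 3 * (C * N\<^sup>2) = N" unfolding l(2) using C N' by (simp add: power2_eq_square)
  then have "N \<le> l * X" using le[OF l(1)] by simp
  then have "N ^ 3 \<le> (l * X) ^ 3" using N by (intro power_mono) auto
  also have "\<dots> = C * N * X ^ 3" by (simp add: power_mult_distrib l(2))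
  finally have "N * N\<^sup>2 \<le> N * (C * X ^ 3)" by (simp add: eval_nat_numeral mult_ac)
  then show ?thesis using N' by simp
qed (use C X in simp)

section \<open>Time integrals over a fixed interval\<close>

locale nice_duhamel = flow_time \<alpha> \<epsilon> B I
  for \<alpha> \<epsilon> :: real and B :: real and I :: "real set" +
  fixes f :: "real \<Rightarrow> real \<times> real \<Rightarrow> complex" and \<gamma> :: "real \<Rightarrow> int \<times> real \<Rightarrow> complex"
  assumes n: "nice_family f \<gamma>"
begin

text \<open>\<open>V p q t\<close> is \<open>\<integral> S(t - s) f(s) ds\<close> over \<open>s \<in> [p, q]\<close>, and \<open>Gam p q\<close> its profile on the Fourier side.\<close>

definition integrand :: "real \<Rightarrow> real \<Rightarrow> int \<times> real \<Rightarrow> real \<Rightarrow> complex" where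
  "integrand p q k s = (if p \<le> s \<and> s \<le> q then \<gamma> s k * cis (s * symb om k) else 0)"

definition Gam :: "real \<Rightarrow> real \<Rightarrow> int \<times> real \<Rightarrow> complex" where
  "Gam p q k = (\<integral>s. integrand p q k s \<partial>lborel)"

definition V :: "real \<Rightarrow> real \<Rightarrow> real \<Rightarrow> real \<times> real \<Rightarrow> complex" where
  "V p q t z = ext om (Gam p q) t z"

lemma f_measurable [measurable]: "(\<lambda>p. f (fst p) (snd p)) \<in> borel_measurable (lborel \<Otimes>\<^sub>M cylinder)"
  using nice_family_measurable(1)[OF n] by (simp add: case_prod_beta)

lemma \<gamma>_measurable [measurable]: "(\<lambda>p. \<gamma> (fst p) (snd p)) \<in> borel_measurable (lborel \<Otimes>\<^sub>M freq)"
  using nice_family_measurable(2)[OF n] by (simp add: case_prod_beta)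

lemma f_measurable' [measurable (raw)]:
  assumes "S \<in> borel_measurable M" "Z \<in> measurable M cylinder"
  shows "(\<lambda>x. f (S x) (Z x)) \<in> borel_measurable M"
proof -
  have "(\<lambda>x. (S x, Z x)) \<in> measurable M (lborel \<Otimes>\<^sub>M cylinder)" using assms by simp
  from measurable_compose[OF this f_measurable] show ?thesis by simp
qed

lemma \<gamma>_measurable' [measurable (raw)]:
  assumes "S \<in> borel_measurable M" "Z \<in> measurable M freq"
  shows "(\<lambda>x. \<gamma> (S x) (Z x)) \<in> borel_measurable M"
proof -
  have "(\<lambda>x. (S x, Z x)) \<in> measurable M (lborel \<Otimes>\<^sub>M freq)" using assms by simp
  from measurable_compose[OF this \<gamma>_measurable] show ?thesis by simp
qed

lemma integrand_measurable [measurable (raw)]: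
  assumes [measurable]: "P \<in> borel_measurable M" "Q \<in> borel_measurable M" "K \<in> measurable M freq" "S \<in> borel_measurable M"
  shows "(\<lambda>x. integrand (P x) (Q x) (K x) (S x)) \<in> borel_measurable M"
  unfolding integrand_def by measurable

lemma integrand_slice_measurable: "integrand p q k \<in> borel_measurable lborel"
  by (rule integrand_measurable[of "\<lambda>_. p" lborel "\<lambda>_. q" "\<lambda>_. k" "\<lambda>s. s"]) (simp_all add: space_pair_measure)

lemma Gam_measurable [measurable (raw)]:
  assumes [measurable]: "P \<in> borel_measurable M" "Q \<in> borel_measurable M" "K \<in> measurable M freq"
  shows "(\<lambda>x. Gam (P x) (Q x) (K x)) \<in> borel_measurable M"
  unfolding Gam_def by (rule lborel.borel_measurable_lebesgue_integral) measurable

lemma V_measurable [measurable (raw)]: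
  assumes [measurable]: "P \<in> borel_measurable M" "Q \<in> borel_measurable M" "T \<in> borel_measurable M" "Z \<in> measurable M cylinder"
  shows "(\<lambda>x. V (P x) (Q x) (T x) (Z x)) \<in> borel_measurable M"
  unfolding V_def by measurable

lemma dominating:
  obtains G where "integrable freq G" "integrable freq (\<lambda>k. (G k)\<^sup>2)" "\<And>s k. norm (\<gamma> s k) \<le> (G k :: real)" "\<And>k. 0 \<le> G k"
proof -
  obtain G where G: "integrable freq G" "integrable freq (\<lambda>k. (G k)\<^sup>2)" "\<And>s k. norm (\<gamma> s k) \<le> (G k :: real)"
    by (rule nice_family_freq_bound[OF n]) (rule that)
  show ?thesis by (rule that[OF G]) (rule order_trans[OF norm_ge_zero G(3)[of 0]])
qed

lemma norm_integrand_le: "norm (\<gamma> s k) \<le> c \<Longrightarrow> norm (integrand p q k s) \<le> indicator {p..q} s * c"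
  by (auto simp: integrand_def norm_mult indicator_def)

lemma integrable_integrand: "integrable lborel (integrand p q k)"
proof (rule dominating)
  fix G assume G: "\<And>s k. norm (\<gamma> s k) \<le> (G k :: real)" "\<And>k. 0 \<le> G k"
  show ?thesis
  proof (rule Bochner_Integration.integrable_bound)
    show "integrable lborel (\<lambda>s. indicator {p..q} s * G k)"
      by (intro integrable_mult_left integrable_real_indicator) (auto simp: emeasure_lborel_Icc_eq)
    have "norm (integrand p q k s) \<le> norm (indicator {p..q} s * G k)" for s
      unfolding real_norm_def by (rule order_trans[OF norm_integrand_le[OF G(1)] abs_ge_self])
    then show "AE s in lborel. norm (integrand p q k s) \<le> norm (indicator {p..q} s * G k)" by (rule AE_I2)
  qed (rule integrand_slice_measurable)
qed

lemma Gam_add: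
  assumes "p \<le> c" "c \<le> q"
  shows "Gam p q k = Gam p c k + Gam c q k"
proof -
  have "Gam p q k = (\<integral>s. integrand p c k s + integrand c q k s \<partial>lborel)"
    unfolding Gam_def
  proof (rule integral_cong_AE)
    show "AE s in lborel. integrand p q k s = integrand p c k s + integrand c q k s"
      using AE_lborel_singleton[of c] by eventually_elim (use assms in \<open>auto simp: integrand_def\<close>)
    show "(\<lambda>s. integrand p q k s) \<in> borel_measurable lborel"
      by (rule integrand_slice_measurable)
    show "(\<lambda>s. integrand p c k s + integrand c q k s) \<in> borel_measurable lborel"
      by (intro borel_measurable_add integrand_slice_measurable)
  qed
  then show ?thesis
    unfolding Gam_def using integrable_integrand by simp
qed

lemma norm_Gam_le:
  assumes "\<And>s. norm (\<gamma> s k) \<le> c" "p \<le> q"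
  shows "norm (Gam p q k) \<le> (q - p) * c"
proof -
  have "norm (Gam p q k) \<le> (\<integral>s. indicator {p..q} s * c \<partial>lborel)"
    unfolding Gam_def
  proof (rule order_trans[OF integral_norm_bound integral_mono])
    show "integrable lborel (\<lambda>s. norm (integrand p q k s))" using integrable_integrand by simp
    show "integrable lborel (\<lambda>s. indicator {p..q} s * c)"
      by (intro integrable_mult_left integrable_real_indicator) (auto simp: emeasure_lborel_Icc_eq)
  qed (rule norm_integrand_le[OF assms(1)])
  also have "\<dots> = (q - p) * c" using assms(2) by simp
  finally show ?thesis .
qed

lemma Gam_empty:
  assumes "q < p"
  shows "Gam p q = (\<lambda>_. 0)"
proof -
  have "integrand p q k s = 0" for k s using assms by (auto simp: integrand_def)
  then have e: "integrand p q k = (\<lambda>_. 0)" for k by (simp add: fun_eq_iff)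
  show ?thesis unfolding Gam_def[abs_def] e by simp
qed

lemma integrable_Gam:
  "integrable freq (Gam p q)" "integrable freq (\<lambda>k. (norm (Gam p q k))\<^sup>2)"
proof -
  obtain G where G: "integrable freq G" "integrable freq (\<lambda>k. (G k)\<^sup>2)" "\<And>s k. norm (\<gamma> s k) \<le> (G k :: real)" "\<And>k. 0 \<le> G k"
    by (rule dominating) (rule that)
  have b: "norm (Gam p q k) \<le> \<bar>q - p\<bar> * G k" for k
  proof (cases "p \<le> q")
    case True
    with norm_Gam_le[of k "G k" p q, OF G(3) True] show ?thesis by simp
  next
    case False
    then have "Gam p q = (\<lambda>_. 0)" by (intro Gam_empty) simp
    with G(4)[of k] show ?thesis by simp
  qed
  show "integrable freq (Gam p q)"
  proof (rule Bochner_Integration.integrable_bound)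
    show "integrable freq (\<lambda>k. \<bar>q - p\<bar> * G k)" using G by simp
    show "AE k in freq. norm (Gam p q k) \<le> norm (\<bar>q - p\<bar> * G k)"
      unfolding real_norm_def by (intro AE_I2 order_trans[OF b abs_ge_self])
  qed measurable
  show "integrable freq (\<lambda>k. (norm (Gam p q k))\<^sup>2)"
  proof (rule Bochner_Integration.integrable_bound)
    show "integrable freq (\<lambda>k. (\<bar>q - p\<bar>)\<^sup>2 * (G k)\<^sup>2)" by (intro integrable_mult_right G)
    show "AE k in freq. norm ((norm (Gam p q k))\<^sup>2) \<le> norm ((\<bar>q - p\<bar>)\<^sup>2 * (G k)\<^sup>2)"
    proof (intro AE_I2)
      fix k
      have "(norm (Gam p q k))\<^sup>2 \<le> (\<bar>q - p\<bar> * G k)\<^sup>2" by (intro power_mono b) simp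
      then show "norm ((norm (Gam p q k))\<^sup>2) \<le> norm ((\<bar>q - p\<bar>)\<^sup>2 * (G k)\<^sup>2)"
        by (simp add: power_mult_distrib abs_mult)
    qed
  qed measurable
qed

lemma V_add:
  assumes "p \<le> c" "c \<le> q"
  shows "V p q t z = V p c t z + V c q t z"
proof -
  have "Gam p q = (\<lambda>k. Gam p c k + Gam c q k)" using Gam_add[OF assms] by auto
  then show ?thesis unfolding V_def by (simp add: ext_add integrable_Gam)
qed

definition x :: "real \<Rightarrow> ennreal" where
  "x s = (\<integral>\<^sup>+z. ennreal (norm (f s z) powr (4/3)) \<partial>cylinder)"

definition X :: "real \<Rightarrow> real \<Rightarrow> ennreal" where
  "X p q = (\<integral>\<^sup>+s. indicator {p..q} s * x s \<partial>lborel)"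

lemma x_measurable [measurable]: "x \<in> borel_measurable borel"
  unfolding x_def[abs_def] by measurable

text \<open>The bound H^(4/3) \<le> K^(1/3) H is the reason why a nice family has a majorant that is
  both integrable and bounded.\<close>

lemma x_bounded: obtains m where "0 \<le> m" "\<And>s. x s \<le> ennreal m"
proof -
  obtain H K where H: "integrable cylinder H" "\<And>s z. norm (f s z) \<le> H z" "\<And>z. H z \<le> (K :: real)"
    by (rule nice_family_bound[OF n]) (rule that)
  have H0: "0 \<le> H z" for z using order_trans[OF norm_ge_zero H(2)] .
  have K0: "0 \<le> K" using order_trans[OF H0 H(3)] .
  let ?m = "K powr (1/3) * (\<integral>z. H z \<partial>cylinder)"
  show ?thesis
  proof (rule that[of ?m])
    show "0 \<le> ?m" using H0 by (intro mult_nonneg_nonneg integral_nonneg_AE) auto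
    fix s
    have "x s \<le> (\<integral>\<^sup>+z. ennreal (K powr (1/3) * H z) \<partial>cylinder)"
      unfolding x_def
    proof (intro nn_integral_mono ennreal_leI)
      fix z
      have "norm (f s z) powr (4/3) \<le> H z powr (4/3)" using H(2) by (intro powr_mono2) auto
      also have "\<dots> = H z powr (1/3) * H z"
        using H0[of z] powr_add[of "H z" "1/3" 1] by simp
      also have "\<dots> \<le> K powr (1/3) * H z" using H0 H(3) by (intro mult_right_mono powr_mono2) auto
      finally show "norm (f s z) powr (4/3) \<le> K powr (1/3) * H z" .
    qed
    also have "\<dots> = ennreal (\<integral>z. K powr (1/3) * H z \<partial>cylinder)"
      by (rule nn_integral_eq_integral) (use H H0 in auto)
    finally show "x s \<le> ennreal ?m" by simp
  qed
qed

text \<open>Expanding one of the two factors \<open>Gam p q\<close> as a time integral and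
  exchanging the integrals converts the squared norm of the profile into a pairing of
  \<open>f\<close> with \<open>V p q\<close>, in which L^(4/3) meets L^4.\<close>

lemma fourier_duality:
  "complex_of_real (4 * pi\<^sup>2 * (\<integral>k. (norm (Gam p q k))\<^sup>2 \<partial>freq))
    = (\<integral>s. (if p \<le> s \<and> s \<le> q then \<integral>z. cnj (V p q s z) * f s z \<partial>cylinder else 0) \<partial>lborel)"
proof -
  obtain G where G: "integrable freq G" "integrable freq (\<lambda>k. (G k)\<^sup>2)" "\<And>s k. norm (\<gamma> s k) \<le> (G k :: real)" "\<And>k. 0 \<le> G k"
    by (rule dominating) (rule that)
  let ?\<Gamma> = "Gam p q"
  interpret FL: pair_sigma_finite freq "lborel :: real measure" ..
  let ?F = "\<lambda>k s. cnj (?\<Gamma> k) * integrand p q k s"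
  \<comment> \<open>For \<open>q < p\<close> the interval is empty and \<open>Gam\<close> vanishes,
    so the absolute value covers both orders.\<close>
  have b: "norm (?\<Gamma> k) \<le> \<bar>q - p\<bar> * G k" for k
  proof (cases "p \<le> q")
    case True
    with norm_Gam_le[of k "G k" p q, OF G(3) True] show ?thesis by simp
  next
    case False
    then have "Gam p q = (\<lambda>_. 0)" by (intro Gam_empty) simp
    with G(4)[of k] show ?thesis by simp
  qed
  have iF: "integrable (freq \<Otimes>\<^sub>M lborel) (case_prod ?F)"
  proof (rule FL.Fubini_integrable)
    have ns: "(\<integral>s. norm (integrand p q k s) \<partial>lborel) \<le> \<bar>q - p\<bar> * G k" for k
    proof -
      have "(\<integral>s. norm (integrand p q k s) \<partial>lborel) \<le> (\<integral>s. indicator {p..q} s * G k \<partial>lborel)"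
      proof (rule integral_mono)
        show "integrable lborel (\<lambda>s. norm (integrand p q k s))" using integrable_integrand by simp
        show "integrable lborel (\<lambda>s. indicator {p..q} s * G k)"
          by (intro integrable_mult_left integrable_real_indicator) (auto simp: emeasure_lborel_Icc_eq)
      qed (rule norm_integrand_le[OF G(3)])
      also have "\<dots> \<le> \<bar>q - p\<bar> * G k" using G(4)[of k] by (cases "p \<le> q") auto
      finally show ?thesis .
    qed
    show "integrable freq (\<lambda>k. \<integral>s. norm (case_prod ?F (k, s)) \<partial>lborel)"
    proof (rule Bochner_Integration.integrable_bound)
      show "integrable freq (\<lambda>k. (\<bar>q - p\<bar>)\<^sup>2 * (G k)\<^sup>2)" by (intro integrable_mult_right G)
      show "AE k in freq. norm (\<integral>s. norm (case_prod ?F (k, s)) \<partial>lborel) \<le> norm ((\<bar>q - p\<bar>)\<^sup>2 * (G k)\<^sup>2)"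
      proof (intro AE_I2)
        fix k
        have i0: "0 \<le> (\<integral>s. norm (integrand p q k s) \<partial>lborel)" by (intro integral_nonneg_AE) auto
        have "norm (?\<Gamma> k) * (\<integral>s. norm (integrand p q k s) \<partial>lborel) \<le> (\<bar>q - p\<bar> * G k) * (\<bar>q - p\<bar> * G k)"
          using G(4)[of k] by (intro mult_mono b ns i0) auto
        then show "norm (\<integral>s. norm (case_prod ?F (k, s)) \<partial>lborel) \<le> norm ((\<bar>q - p\<bar>)\<^sup>2 * (G k)\<^sup>2)"
          using i0 by (simp add: norm_mult abs_mult power2_eq_square mult_ac)
      qed
    qed measurable
    show "AE k in freq. integrable lborel (\<lambda>s. case_prod ?F (k, s))"
      using integrable_integrand by simp
  qed measurable
  have i\<Gamma>: "integrable freq (\<lambda>k. (norm (?\<Gamma> k))\<^sup>2)" by (rule integrable_Gam)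
  have slice: "(if p \<le> s \<and> s \<le> q then \<integral>z. cnj (V p q s z) * f s z \<partial>cylinder else 0) = complex_of_real (4 * pi\<^sup>2) * (\<integral>k. ?F k s \<partial>freq)" for s
  proof (cases "p \<le> s \<and> s \<le> q")
    case True
    have m: "(\<lambda>(k, z). - phase k z + s * symb om k) \<in> borel_measurable (freq \<Otimes>\<^sub>M cylinder)" by measurable
    have ic: "integrable freq (\<lambda>k. cnj (?\<Gamma> k))" using integrable_Gam(1) by simp
    have c: "cnj (V p q s z) = (\<integral>k. cnj (?\<Gamma> k) * cis (- phase k z + s * symb om k) \<partial>freq)" for z
      unfolding V_def ext_def by (subst Bochner_Integration.integral_cnj[symmetric]) (simp add: cis_cnj)
    have "(\<integral>z. cnj (V p q s z) * f s z \<partial>cylinder) = (\<integral>k. cnj (?\<Gamma> k) * (\<integral>z. cis (- phase k z + s * symb om k) * f s z \<partial>cylinder) \<partial>freq)"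
      unfolding c by (rule fubini_phase(3)[OF freq.sigma_finite_measure_axioms cyl.sigma_finite_measure_axioms m ic nice_family_integrable[OF n]])
    also have "\<dots> = (\<integral>k. complex_of_real (4 * pi\<^sup>2) * ?F k s \<partial>freq)"
    proof (intro Bochner_Integration.integral_cong refl)
      fix k
      have "cis (- phase k z + s * symb om k) * f s z = cis (s * symb om k) * (f s z * cis (- phase k z))" for z
        unfolding cis_mult[symmetric] by (simp only: mult_ac)
      then have e: "(\<integral>z. cis (- phase k z + s * symb om k) * f s z \<partial>cylinder) = cis (s * symb om k) * (complex_of_real (4 * pi\<^sup>2) * \<gamma> s k)"
        by (simp only: integral_mult_right_zero nice_family_fourier[OF n])
      have rot: "a * (b * (c * d)) = c * (a * (d * b))" for a b c d :: complex by (simp only: mult_ac)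
      show "cnj (?\<Gamma> k) * (\<integral>z. cis (- phase k z + s * symb om k) * f s z \<partial>cylinder) = complex_of_real (4 * pi\<^sup>2) * ?F k s"
        unfolding e integrand_def if_P[OF True] by (rule rot)
    qed
    finally show ?thesis using True by simp
  qed (auto simp: integrand_def)
  have "(\<integral>s. (if p \<le> s \<and> s \<le> q then \<integral>z. cnj (V p q s z) * f s z \<partial>cylinder else 0) \<partial>lborel)
    = complex_of_real (4 * pi\<^sup>2) * (\<integral>s. (\<integral>k. ?F k s \<partial>freq) \<partial>lborel)"
    unfolding slice by simp
  also have "(\<integral>s. (\<integral>k. ?F k s \<partial>freq) \<partial>lborel) = (\<integral>k. (\<integral>s. ?F k s \<partial>lborel) \<partial>freq)"
    by (rule FL.Fubini_integral[OF iF])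
  also have "\<dots> = (\<integral>k. complex_of_real ((norm (?\<Gamma> k))\<^sup>2) \<partial>freq)"
    unfolding complex_norm_square by (simp add: Gam_def[symmetric] mult.commute)
  also have "\<dots> = complex_of_real (\<integral>k. (norm (?\<Gamma> k))\<^sup>2 \<partial>freq)"
    by (rule Bochner_Integration.integral_of_real[OF i\<Gamma>])
  finally show ?thesis by simp
qed

lemma X_finite: "X p q < \<infinity>"
proof (rule x_bounded)
  fix m assume m: "0 \<le> m" "\<And>s. x s \<le> ennreal m"
  have "X p q \<le> (\<integral>\<^sup>+s. indicator {p..q} s * ennreal m \<partial>lborel)"
    unfolding X_def by (intro nn_integral_mono mult_left_mono m) simp
  also have "\<dots> < \<infinity>" by (simp add: nn_integral_multc ennreal_mult_less_top emeasure_lborel_Icc_eq)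
  finally show ?thesis .
qed

text \<open>The estimate is dualized by hand: \<open>V p q\<close> is itself a free evolution with
  profile \<open>Gam p q\<close>, so after Young's inequality the Strichartz estimate bounds its
  fourth power by the same squared norm that stands on the left. \<open>dual_algebra\<close>
  resolves this self-referential inequality.\<close>

lemma Gam_L2_bound:
  assumes "- len \<le> p" "q \<le> len"
  shows "(\<integral>k. (norm (Gam p q k))\<^sup>2 \<partial>freq)\<^sup>2 \<le> SC * (enn2real (X p q)) ^ 3"
proof (rule dual_algebra)
  let ?N = "\<integral>k. (norm (Gam p q k))\<^sup>2 \<partial>freq"
  show N0: "0 \<le> ?N" by (intro integral_nonneg_AE) auto
  show "0 < SC" by (rule SC_pos)
  show "0 \<le> enn2real (X p q)" by simp
  have NN: "(\<integral>\<^sup>+k. ennreal ((norm (Gam p q k))\<^sup>2) \<partial>freq) = ennreal ?N"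
    by (rule nn_integral_eq_integral[OF integrable_Gam(2)]) simp
  fix l :: real assume l: "0 < l"
  let ?v = "\<lambda>s. \<integral>\<^sup>+z. ennreal ((norm (V p q s z)) ^ 4) \<partial>cylinder"
  have slice: "ennreal (norm (\<integral>z. cnj (V p q s z) * f s z \<partial>cylinder)) \<le> ennreal l * x s + ennreal (1 / l ^ 3) * ?v s" for s
  proof -
    have "ennreal (norm (\<integral>z. cnj (V p q s z) * f s z \<partial>cylinder)) \<le> (\<integral>\<^sup>+z. ennreal (norm (cnj (V p q s z) * f s z)) \<partial>cylinder)"
      by (rule ennreal_norm_integral_le)
    also have "\<dots> \<le> (\<integral>\<^sup>+z. ennreal l * ennreal (norm (f s z) powr (4/3)) + ennreal (1 / l ^ 3) * ennreal ((norm (V p q s z)) ^ 4) \<partial>cylinder)"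
    proof (intro nn_integral_mono)
      fix z
      have "norm (cnj (V p q s z) * f s z) \<le> l * norm (f s z) powr (4/3) + 1 / l ^ 3 * (norm (V p q s z)) ^ 4"
        using young_four_thirds[OF norm_ge_zero norm_ge_zero l, of "f s z" "V p q s z"] by (simp add: norm_mult mult.commute)
      from ennreal_leI[OF this] show "ennreal (norm (cnj (V p q s z) * f s z)) \<le> ennreal l * ennreal (norm (f s z) powr (4/3)) + ennreal (1 / l ^ 3) * ennreal ((norm (V p q s z)) ^ 4)"
      proof -
        have nn: "0 \<le> l" "0 \<le> 1 / l ^ 3" using l by simp_all
        assume "ennreal (norm (cnj (V p q s z) * f s z)) \<le> ennreal (l * norm (f s z) powr (4/3) + 1 / l ^ 3 * (norm (V p q s z)) ^ 4)"
        then show ?thesis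
          by (simp only: ennreal_plus ennreal_mult nn powr_ge_zero zero_le_power norm_ge_zero mult_nonneg_nonneg)
      qed
    qed
    also have "\<dots> = ennreal l * x s + ennreal (1 / l ^ 3) * ?v s"
      unfolding x_def by (subst nn_integral_add, measurable, subst nn_integral_cmult, measurable, subst nn_integral_cmult, measurable)
    finally show ?thesis .
  qed
  have "ennreal (4 * pi\<^sup>2 * ?N) = ennreal (norm (complex_of_real (4 * pi\<^sup>2 * ?N)))"
  proof -
    have "0 \<le> 4 * pi\<^sup>2 * ?N" using N0 by simp
    then show ?thesis by (simp only: norm_of_real abs_of_nonneg)
  qed
  also have "\<dots> \<le> (\<integral>\<^sup>+s. ennreal (norm (if p \<le> s \<and> s \<le> q then \<integral>z. cnj (V p q s z) * f s z \<partial>cylinder else 0)) \<partial>lborel)"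
    unfolding fourier_duality by (rule ennreal_norm_integral_le)
  \<comment> \<open>The term in \<open>f\<close> keeps the interval [p, q], whose mass is to appear
    in the result; the term in \<open>V\<close> is enlarged to the whole window, for which the
    Strichartz estimate is stated.\<close>
  also have "\<dots> \<le> (\<integral>\<^sup>+s. ennreal l * (indicator {p..q} s * x s) + ennreal (1 / l ^ 3) * (indicator {- len..len} s * ?v s) \<partial>lborel)"
  proof (intro nn_integral_mono)
    fix s
    show "ennreal (norm (if p \<le> s \<and> s \<le> q then \<integral>z. cnj (V p q s z) * f s z \<partial>cylinder else 0))
      \<le> ennreal l * (indicator {p..q} s * x s) + ennreal (1 / l ^ 3) * (indicator {- len..len} s * ?v s)"
    proof (cases "p \<le> s \<and> s \<le> q")
      case True
      then have "s \<in> {- len..len}" "s \<in> {p..q}" using assms by auto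
      then show ?thesis using slice[of s] True by simp
    next
      case False
      then show ?thesis by (simp only: if_False norm_zero ennreal_0 zero_le)
    qed
  qed
  also have "\<dots> = ennreal l * X p q + ennreal (1 / l ^ 3) * (\<integral>\<^sup>+s. indicator {- len..len} s * ?v s \<partial>lborel)"
    unfolding X_def by (subst nn_integral_add, measurable, subst nn_integral_cmult, measurable, subst nn_integral_cmult, measurable)
  also have "\<dots> \<le> ennreal l * X p q + ennreal (1 / l ^ 3) * (ennreal SC * (ennreal ?N)\<^sup>2)"
    unfolding V_def SC_def NN[symmetric] by (intro add_left_mono mult_left_mono strichartz integrable_Gam) simp
  also have "\<dots> = ennreal (l * enn2real (X p q) + 1 / l ^ 3 * (SC * ?N\<^sup>2))"
  proof -
    have X: "X p q = ennreal (enn2real (X p q))" using X_finite[of p q] by simp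
    have nn: "0 \<le> l" "0 \<le> 1 / l ^ 3" "0 \<le> SC" "0 \<le> enn2real (X p q)" "0 \<le> ?N" using l SC_pos N0 by simp_all
    show ?thesis
      by (subst X) (simp only: ennreal_power[OF N0] ennreal_mult ennreal_plus mult_nonneg_nonneg nn zero_le_power2)
  qed
  finally have le: "4 * pi\<^sup>2 * ?N \<le> l * enn2real (X p q) + 1 / l ^ 3 * (SC * ?N\<^sup>2)"
    using l SC_pos by (subst (asm) ennreal_le_iff) (auto intro!: add_nonneg_nonneg mult_nonneg_nonneg)
  \<comment> \<open>Of 4 pi^2 only the coefficient 2 is kept, so that one copy of the norm can be
    absorbed.\<close>
  have "1 * 1 \<le> pi * pi" using pi_gt3 by (intro mult_mono) auto
  then have "2 * ?N \<le> 4 * pi\<^sup>2 * ?N" using N0 by (intro mult_right_mono) (auto simp: power2_eq_square)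
  with le show "2 * ?N \<le> l * enn2real (X p q) + 1 / l ^ 3 * (SC * ?N\<^sup>2)" by simp
qed

lemma V_L4_bound:
  assumes "- len \<le> p" "q \<le> len"
  shows "(\<integral>\<^sup>+t. indicator {- len..len} t * (\<integral>\<^sup>+z. ennreal ((norm (V p q t z)) ^ 4) \<partial>cylinder) \<partial>lborel)
    \<le> ennreal (SC\<^sup>2 * (enn2real (X p q)) ^ 3)"
proof -
  let ?N = "\<integral>k. (norm (Gam p q k))\<^sup>2 \<partial>freq"
  have NN: "(\<integral>\<^sup>+k. ennreal ((norm (Gam p q k))\<^sup>2) \<partial>freq) = ennreal ?N"
    by (rule nn_integral_eq_integral[OF integrable_Gam(2)]) simp
  have N0: "0 \<le> ?N" by (intro integral_nonneg_AE) auto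
  have "(\<integral>\<^sup>+t. indicator {- len..len} t * (\<integral>\<^sup>+z. ennreal ((norm (V p q t z)) ^ 4) \<partial>cylinder) \<partial>lborel) \<le> ennreal SC * (ennreal ?N)\<^sup>2"
    unfolding V_def SC_def NN[symmetric] by (rule strichartz[OF integrable_Gam(1)])
  also have "\<dots> = ennreal (SC * ?N\<^sup>2)"
    using SC_pos N0 by (simp add: ennreal_power ennreal_mult)
  also have "\<dots> \<le> ennreal (SC\<^sup>2 * (enn2real (X p q)) ^ 3)"
    using mult_left_mono[OF Gam_L2_bound[OF assms], of SC] SC_pos
    by (intro ennreal_leI) (simp add: power2_eq_square mult.assoc)
  finally show ?thesis .
qed

end

section \<open>Truncation to the past by bisection\<close>

text \<open>Convexity with weights 2/3 and 1/3 gives the coefficients (3/2)^3 and 3^3, with equality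
  at x = 2 y, hence the double factor in the proof. The asymmetry is essential: halving the mass
  gains 1/8 = 2^-3 on each half, so the first coefficient c must satisfy (1 + c) / 8 < 1, which
  equal weights, with c = 8, would violate.\<close>

lemma pow4_add_le:
  fixes a b :: complex
  shows "(norm (a + b)) ^ 4 \<le> 27 / 8 * (norm b) ^ 4 + 27 * (norm a) ^ 4"
proof -
  define y where "y = norm a"
  define x where "x = norm b"
  have nn: "0 \<le> y" "0 \<le> x" by (simp_all add: x_def y_def)
  have "norm (a + b) \<le> x + y" using norm_triangle_ineq[of a b] by (simp add: x_def y_def)
  then have "(norm (a + b)) ^ 4 \<le> (x + y) ^ 4" by (rule power_mono) simp
  also have "0 \<le> (x - 2 * y)\<^sup>2 * (19 / 8 * x\<^sup>2 + 11 / 2 * (x * y) + 13 / 2 * y\<^sup>2)"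
    using nn by (intro mult_nonneg_nonneg add_nonneg_nonneg) auto
  then have "(x + y) ^ 4 \<le> 27 / 8 * x ^ 4 + 27 * y ^ 4"
    by (simp add: eval_nat_numeral field_simps)
  finally show ?thesis by (simp add: x_def y_def)
qed

lemma pow4_diff_le:
  fixes a b :: complex
  shows "(norm (a - b)) ^ 4 \<le> 8 * (norm a) ^ 4 + 8 * (norm b) ^ 4"
proof -
  define y where "y = norm a"
  define x where "x = norm b"
  have "norm (a - b) \<le> y + x" using norm_triangle_ineq4[of a b] by (simp add: x_def y_def)
  then have "(norm (a - b)) ^ 4 \<le> (y + x) ^ 4" by (rule power_mono) simp
  also have "\<dots> = ((y + x)\<^sup>2)\<^sup>2" by simp
  also have "\<dots> \<le> (2 * (y\<^sup>2 + x\<^sup>2))\<^sup>2"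
  proof (rule power_mono)
    show "(y + x)\<^sup>2 \<le> 2 * (y\<^sup>2 + x\<^sup>2)"
      using zero_le_power2[of "y - x"] by (simp add: power2_eq_square algebra_simps)
  qed simp
  also have "\<dots> = 4 * (y\<^sup>2 + x\<^sup>2)\<^sup>2" unfolding power_mult_distrib[of 2] by simp
  also have "\<dots> \<le> 4 * (2 * ((y\<^sup>2)\<^sup>2 + (x\<^sup>2)\<^sup>2))"
    using zero_le_power2[of "y\<^sup>2 - x\<^sup>2"] by (intro mult_left_mono) (simp_all add: power2_eq_square algebra_simps)
  finally show ?thesis by (simp add: x_def y_def)
qed

context nice_duhamel
begin

text \<open>The upper limit of integration is the time of observation, so \<open>E p q\<close>
  collects the triangle p \<le> s \<le> t \<le> q, whereas \<open>W\<close> has fixed limits and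
  covers rectangles in (s, t).\<close>

definition v :: "real \<Rightarrow> real \<Rightarrow> ennreal" where
  "v p t = (\<integral>\<^sup>+z. ennreal ((norm (V p t t z)) ^ 4) \<partial>cylinder)"

definition E :: "real \<Rightarrow> real \<Rightarrow> ennreal" where
  "E p q = (\<integral>\<^sup>+t. indicator {p..q} t * v p t \<partial>lborel)"

definition W :: "real \<Rightarrow> real \<Rightarrow> real \<Rightarrow> ennreal" where
  "W p c t = (\<integral>\<^sup>+z. ennreal ((norm (V p c t z)) ^ 4) \<partial>cylinder)"

lemma v_measurable [measurable]: "v p \<in> borel_measurable borel"
  unfolding v_def[abs_def] by measurable

lemma W_measurable [measurable]: "W p c \<in> borel_measurable borel"
  unfolding W_def[abs_def] by measurable

text \<open>The size of the constant is irrelevant, since iterating \<open>valid_step\<close> contracts it to the final one.\<close>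

lemma E_apriori: obtains K0 where "0 \<le> K0" "\<And>p q. p \<le> q \<Longrightarrow> E p q \<le> ennreal (K0 * (q - p) ^ 5)"
proof -
  obtain G where G: "integrable freq G" "integrable freq (\<lambda>k. (G k)\<^sup>2)" "\<And>s k. norm (\<gamma> s k) \<le> (G k :: real)" "\<And>k. 0 \<le> G k"
    by (rule dominating) (rule that)
  define G1 where "G1 = (\<integral>k. G k \<partial>freq)"
  define G2 where "G2 = (\<integral>k. (G k)\<^sup>2 \<partial>freq)"
  have nn: "0 \<le> G1" "0 \<le> G2" unfolding G1_def G2_def using G(4) by (auto intro!: integral_nonneg_AE)
  define K0 where "K0 = G1\<^sup>2 * (4 * pi\<^sup>2 * G2)"
  have K0: "0 \<le> K0" using nn by (simp add: K0_def)
  \<comment> \<open>Two of the four factors are bounded in the supremum norm and two in L^2, and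
    each contributes one power of the length t - p.\<close>
  have vb: "v p t \<le> ennreal (K0 * (t - p) ^ 4)" if pt: "p \<le> t" for p t
  proof -
    have b: "norm (Gam p t k) \<le> (t - p) * G k" for k by (rule norm_Gam_le[OF G(3) pt])
    have sup: "norm (V p t t z) \<le> (t - p) * G1" for z
    proof -
      have "norm (V p t t z) \<le> (\<integral>k. norm (Gam p t k) \<partial>freq)"
        unfolding V_def ext_def by (rule norm_phase_integral_le)
      also have "\<dots> \<le> (\<integral>k. (t - p) * G k \<partial>freq)"
        by (rule integral_mono) (use integrable_Gam(1) G b in auto)
      finally show ?thesis by (simp add: G1_def)
    qed
    have "v p t \<le> (\<integral>\<^sup>+z. ennreal (((t - p) * G1)\<^sup>2) * ennreal ((norm (V p t t z))\<^sup>2) \<partial>cylinder)"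
      unfolding v_def
    proof (intro nn_integral_mono)
      fix z
      have "(norm (V p t t z)) ^ 4 = (norm (V p t t z))\<^sup>2 * (norm (V p t t z))\<^sup>2" by (simp add: eval_nat_numeral)
      also have "\<dots> \<le> ((t - p) * G1)\<^sup>2 * (norm (V p t t z))\<^sup>2"
        by (intro mult_right_mono power_mono sup) auto
      finally show "ennreal ((norm (V p t t z)) ^ 4) \<le> ennreal (((t - p) * G1)\<^sup>2) * ennreal ((norm (V p t t z))\<^sup>2)"
        by (simp add: ennreal_mult[symmetric] ennreal_leI)
    qed
    also have "\<dots> = ennreal (((t - p) * G1)\<^sup>2) * (\<integral>\<^sup>+z. ennreal ((norm (V p t t z))\<^sup>2) \<partial>cylinder)"
      by (rule nn_integral_cmult) measurable
    also have "\<dots> \<le> ennreal (((t - p) * G1)\<^sup>2) * (ennreal (4 * pi\<^sup>2) * (\<integral>\<^sup>+k. ennreal ((norm (Gam p t k))\<^sup>2) \<partial>freq))"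
      unfolding V_def by (intro mult_left_mono ext_L2_le integrable_Gam) simp
    also have "\<dots> \<le> ennreal (((t - p) * G1)\<^sup>2) * (ennreal (4 * pi\<^sup>2) * ennreal ((t - p)\<^sup>2 * G2))"
    proof (intro mult_left_mono)
      have "(\<integral>\<^sup>+k. ennreal ((norm (Gam p t k))\<^sup>2) \<partial>freq) \<le> (\<integral>\<^sup>+k. ennreal ((t - p)\<^sup>2 * (G k)\<^sup>2) \<partial>freq)"
      proof (intro nn_integral_mono ennreal_leI)
        fix k show "(norm (Gam p t k))\<^sup>2 \<le> (t - p)\<^sup>2 * (G k)\<^sup>2"
          unfolding power_mult_distrib[symmetric] by (intro power_mono b) simp
      qed
      also have "\<dots> = ennreal (\<integral>k. (t - p)\<^sup>2 * (G k)\<^sup>2 \<partial>freq)"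
        by (rule nn_integral_eq_integral) (use G in auto)
      finally show "(\<integral>\<^sup>+k. ennreal ((norm (Gam p t k))\<^sup>2) \<partial>freq) \<le> ennreal ((t - p)\<^sup>2 * G2)" by (simp add: G2_def)
    qed auto
    also have "\<dots> = ennreal (((t - p) * G1)\<^sup>2 * (4 * pi\<^sup>2 * ((t - p)\<^sup>2 * G2)))"
      using nn by (simp only: ennreal_mult zero_le_power2 mult_nonneg_nonneg zero_le_numeral)
    also have "((t - p) * G1)\<^sup>2 * (4 * pi\<^sup>2 * ((t - p)\<^sup>2 * G2)) = K0 * (t - p) ^ 4"
      by (simp add: K0_def power_mult_distrib eval_nat_numeral mult_ac)
    finally show ?thesis .
  qed
  show ?thesis
  proof (rule that[OF K0])
    fix p q :: real assume pq: "p \<le> q"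
    have "E p q \<le> (\<integral>\<^sup>+t. indicator {p..q} t * ennreal (K0 * (q - p) ^ 4) \<partial>lborel)"
      unfolding E_def
    proof (intro nn_integral_mono)
      fix t
      show "indicator {p..q} t * v p t \<le> indicator {p..q} t * ennreal (K0 * (q - p) ^ 4)"
      proof (cases "t \<in> {p..q}")
        case True
        then have "v p t \<le> ennreal (K0 * (t - p) ^ 4)" by (intro vb) simp
        also have "\<dots> \<le> ennreal (K0 * (q - p) ^ 4)"
          using True K0 by (intro ennreal_leI mult_left_mono power_mono) auto
        finally show ?thesis using True by simp
      qed simp
    qed
    also have "\<dots> = ennreal (q - p) * ennreal (K0 * (q - p) ^ 4)"
      using pq by (subst nn_integral_multc) auto
    also have "\<dots> = ennreal (K0 * (q - p) ^ 5)"
      using pq K0 by (simp add: ennreal_mult[symmetric] eval_nat_numeral mult_ac)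
    finally show "E p q \<le> ennreal (K0 * (q - p) ^ 5)" .
  qed
qed

lemma X_add:
  assumes "p \<le> c" "c \<le> q"
  shows "X p q = X p c + X c q"
proof -
  have "X p q = (\<integral>\<^sup>+s. indicator {p..c} s * x s + indicator {c..q} s * x s \<partial>lborel)"
    unfolding X_def
  proof (rule nn_integral_cong_AE)
    show "AE s in lborel. indicator {p..q} s * x s = indicator {p..c} s * x s + indicator {c..q} s * x s"
      using AE_lborel_singleton[of c]
    proof eventually_elim
      case (elim s)
      then show ?case using assms by (cases "s < c") (auto simp: indicator_def)
    qed
  qed
  then show ?thesis unfolding X_def by (simp add: nn_integral_add)
qed

definition Xr :: "real \<Rightarrow> real \<Rightarrow> real" where "Xr p q = enn2real (X p q)"

lemma X_eq: "X p q = ennreal (Xr p q)"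
  using X_finite[of p q] by (simp add: Xr_def)

lemma Xr_nonneg: "0 \<le> Xr p q" by (simp add: Xr_def)

lemma Xr_add:
  assumes "p \<le> c" "c \<le> q"
  shows "Xr p q = Xr p c + Xr c q"
proof -
  have "ennreal (Xr p q) = ennreal (Xr p c + Xr c q)"
    using X_add[OF assms] unfolding X_eq by (simp add: Xr_nonneg)
  then show ?thesis by (simp add: Xr_nonneg del: ennreal_plus)
qed

lemma Xr_lipschitz: obtains m where "0 \<le> m" "\<And>p q. p \<le> q \<Longrightarrow> Xr p q \<le> m * (q - p)"
proof (rule x_bounded)
  fix m assume m: "0 \<le> m" "\<And>s. x s \<le> ennreal m"
  have "Xr p q \<le> m * (q - p)" if "p \<le> q" for p q
  proof -
    have "X p q \<le> (\<integral>\<^sup>+s. indicator {p..q} s * ennreal m \<partial>lborel)"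
      unfolding X_def by (intro nn_integral_mono mult_left_mono m) simp
    also have "\<dots> = ennreal (m * (q - p))"
      using that m by (subst nn_integral_multc) (auto simp: ennreal_mult mult.commute)
    finally show ?thesis unfolding X_eq using that m by (simp add: ennreal_le_iff)
  qed
  with m(1) show ?thesis by (rule that)
qed

text \<open>The linear term makes \<open>Mu \<eta> p\<close> strictly increasing, so that intervals can be bisected; \<open>\<eta>\<close> is sent to \<open>0\<close> at the end.\<close>

definition Mu :: "real \<Rightarrow> real \<Rightarrow> real \<Rightarrow> real" where "Mu \<eta> p q = Xr p q + \<eta> * (q - p)"

text \<open>The slices have bounded mass, so \<open>Mu\<close> is Lipschitz in its endpoint and the
  intermediate value theorem gives the point of bisection; additivity then halves the other side
  too.\<close>

lemma Mu_bisect: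
  assumes eta: "0 < \<eta>" and pq: "p \<le> q"
  obtains c where "p \<le> c" "c \<le> q" "Mu \<eta> p c = Mu \<eta> p q / 2" "Mu \<eta> c q = Mu \<eta> p q / 2"
proof -
  obtain m where m: "0 \<le> m" "\<And>p q. p \<le> q \<Longrightarrow> Xr p q \<le> m * (q - p)" by (rule Xr_lipschitz) (rule that)
  have add: "Mu \<eta> p d = Mu \<eta> p c + Mu \<eta> c d" if "p \<le> c" "c \<le> d" for c d
    using Xr_add[OF that] by (simp add: Mu_def algebra_simps)
  have nn: "0 \<le> Mu \<eta> c d" if "c \<le> d" for c d
    using Xr_nonneg eta that by (simp add: Mu_def)
  have lip: "\<bar>Mu \<eta> p d - Mu \<eta> p c\<bar> \<le> (m + \<eta>) * \<bar>d - c\<bar>" if "p \<le> c" "p \<le> d" for c d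
  proof -
    have *: "\<bar>Mu \<eta> p d - Mu \<eta> p c\<bar> \<le> (m + \<eta>) * \<bar>d - c\<bar>" if "p \<le> c" "c \<le> d" for c d
    proof -
      have "Mu \<eta> c d \<le> (m + \<eta>) * (d - c)" using m(2)[OF that(2)] by (simp add: Mu_def algebra_simps)
      then show ?thesis using add[OF that] nn[OF that(2)] that by simp
    qed
    show ?thesis using *[of c d] *[of d c] that by (cases "c \<le> d") (auto simp: abs_minus_commute)
  qed
  have "(m + \<eta>)-lipschitz_on {p..q} (Mu \<eta> p)"
    using lip m eta by (intro lipschitz_onI) (auto simp: dist_real_def abs_minus_commute)
  then have "continuous_on {p..q} (Mu \<eta> p)" by (rule lipschitz_on_continuous_on)
  moreover have "Mu \<eta> p p = 0"
    using m(2)[of p p] Xr_nonneg[of p p] by (simp add: Mu_def)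
  ultimately obtain c where c: "p \<le> c" "c \<le> q" "Mu \<eta> p c = Mu \<eta> p q / 2"
    using IVT'[of "Mu \<eta> p" p "Mu \<eta> p q / 2" q] nn[OF pq] pq by auto
  with add[of c q] show ?thesis by (intro that[of c]) auto
qed

text \<open>For t \<ge> c the integral over [p, t] is the one over [p, c] plus the one over [c, t].
  So the triangle over [p, q] consists of two smaller triangles and a rectangle, and on the
  rectangle t may range over the whole window.\<close>

lemma E_split:
  assumes "p \<le> c" "c \<le> q" "- len \<le> p" "q \<le> len"
  shows "E p q \<le> E p c + (ennreal (27 / 8) * E c q + ennreal 27 * (\<integral>\<^sup>+t. indicator {- len..len} t * W p c t \<partial>lborel))"
proof -
  have vle: "v p t \<le> ennreal (27 / 8) * v c t + ennreal 27 * W p c t" if "c \<le> t" for t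
  proof -
    have "v p t \<le> (\<integral>\<^sup>+z. ennreal (27 / 8) * ennreal ((norm (V c t t z)) ^ 4) + ennreal 27 * ennreal ((norm (V p c t z)) ^ 4) \<partial>cylinder)"
      unfolding v_def V_add[OF assms(1) that]
    proof (intro nn_integral_mono)
      fix z
      have "ennreal ((norm (V p c t z + V c t t z)) ^ 4) \<le> ennreal (27 / 8 * (norm (V c t t z)) ^ 4 + 27 * (norm (V p c t z)) ^ 4)"
        by (rule ennreal_leI[OF pow4_add_le])
      also have "\<dots> = ennreal (27 / 8) * ennreal ((norm (V c t t z)) ^ 4) + ennreal 27 * ennreal ((norm (V p c t z)) ^ 4)"
      proof -
        have "0 \<le> (27 / 8 :: real)" "0 \<le> (27 :: real)" by simp_all
        then show ?thesis by (simp only: ennreal_plus ennreal_mult mult_nonneg_nonneg zero_le_power norm_ge_zero)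
      qed
      finally show "ennreal ((norm (V p c t z + V c t t z)) ^ 4) \<le> ennreal (27 / 8) * ennreal ((norm (V c t t z)) ^ 4) + ennreal 27 * ennreal ((norm (V p c t z)) ^ 4)" .
    qed
    also have "\<dots> = ennreal (27 / 8) * v c t + ennreal 27 * W p c t"
      unfolding v_def W_def by (subst nn_integral_add, measurable, subst nn_integral_cmult, measurable, subst nn_integral_cmult, measurable)
    finally show ?thesis .
  qed
  have "E p q \<le> (\<integral>\<^sup>+t. indicator {p..c} t * v p t + (ennreal (27 / 8) * (indicator {c..q} t * v c t) + ennreal 27 * (indicator {- len..len} t * W p c t)) \<partial>lborel)"
    unfolding E_def
  proof (intro nn_integral_mono)
    fix t
    show "indicator {p..q} t * v p t \<le> indicator {p..c} t * v p t + (ennreal (27 / 8) * (indicator {c..q} t * v c t) + ennreal 27 * (indicator {- len..len} t * W p c t))"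
    proof -
      consider "t \<notin> {p..q}" | "t \<in> {p..c}" | "c \<le> t" "t \<le> q" by fastforce
      then show ?thesis
      proof cases
        case 1
        then show ?thesis by simp
      next
        case 2
        then show ?thesis using assms by (simp add: add_increasing2)
      next
        case 3
        then have "t \<in> {- len..len}" "t \<in> {c..q}" "t \<in> {p..q}" using assms by auto
        then show ?thesis using vle[OF 3(1)] by (simp add: add_increasing)
      qed
    qed
  qed
  also have "\<dots> = E p c + (ennreal (27 / 8) * E c q + ennreal 27 * (\<integral>\<^sup>+t. indicator {- len..len} t * W p c t \<partial>lborel))"
    unfolding E_def
    by (subst nn_integral_add, measurable, subst nn_integral_add, measurable, subst nn_integral_cmult, measurable, subst nn_integral_cmult, measurable)
  finally show ?thesis .
qed

lemma W_bound:
  assumes "- len \<le> p" "c \<le> len"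
  shows "(\<integral>\<^sup>+t. indicator {- len..len} t * W p c t \<partial>lborel) \<le> ennreal (SC\<^sup>2 * (Xr p c) ^ 3)"
  using V_L4_bound[OF assms] unfolding W_def Xr_def .

definition valid :: "real \<Rightarrow> real \<Rightarrow> bool" where
  "valid \<eta> A \<longleftrightarrow> (\<forall>p q. - len \<le> p \<longrightarrow> p \<le> q \<longrightarrow> q \<le> len \<longrightarrow> E p q \<le> ennreal (A * (Mu \<eta> p q) ^ 3))"

text \<open>
  Bisecting at the point that halves \<open>Mu\<close> gains a factor below one: the diagonal halves
  contribute \<open>1 / 8\<close> and \<open>27 / 64\<close>, and the off-diagonal square is an untruncated integral.
\<close>

lemma valid_step:
  assumes eta: "0 < \<eta>" and A: "0 \<le> A" and va: "valid \<eta> A"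
  shows "valid \<eta> (35 / 64 * A + 27 / 8 * SC\<^sup>2)"
  unfolding valid_def
proof (intro allI impI)
  fix p q assume pq: "- len \<le> p" "p \<le> q" "q \<le> len"
  obtain c where c: "p \<le> c" "c \<le> q" "Mu \<eta> p c = Mu \<eta> p q / 2" "Mu \<eta> c q = Mu \<eta> p q / 2"
    by (rule Mu_bisect[OF eta pq(2)]) (rule that)
  let ?M = "Mu \<eta> p q"
  have M: "0 \<le> ?M" using Xr_nonneg eta pq by (simp add: Mu_def)
  have 1: "E p c \<le> ennreal (A * (?M / 2) ^ 3)"
    using va pq c unfolding valid_def c(3)[symmetric] by auto
  have 2: "E c q \<le> ennreal (A * (?M / 2) ^ 3)"
    using va pq c unfolding valid_def c(4)[symmetric] by auto
  have "Xr p c \<le> ?M / 2" using c eta unfolding c(3)[symmetric] by (simp add: Mu_def)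
  then have "(Xr p c) ^ 3 \<le> (?M / 2) ^ 3" using Xr_nonneg by (intro power_mono)
  then have 3: "(\<integral>\<^sup>+t. indicator {- len..len} t * W p c t \<partial>lborel) \<le> ennreal (SC\<^sup>2 * (?M / 2) ^ 3)"
    using pq c by (intro order_trans[OF W_bound] ennreal_leI mult_left_mono) auto
  have "E p q \<le> ennreal (A * (?M / 2) ^ 3) + (ennreal (27 / 8) * ennreal (A * (?M / 2) ^ 3) + ennreal 27 * ennreal (SC\<^sup>2 * (?M / 2) ^ 3))"
    by (rule order_trans[OF E_split[OF c(1,2) pq(1,3)]]) (intro add_mono mult_left_mono 1 2 3; simp)
  also have "\<dots> = ennreal (A * (?M / 2) ^ 3 + (27 / 8 * (A * (?M / 2) ^ 3) + 27 * (SC\<^sup>2 * (?M / 2) ^ 3)))"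
  proof -
    have nn: "0 \<le> (27 / 8 :: real)" "0 \<le> (27 :: real)" "0 \<le> A * (?M / 2) ^ 3" "0 \<le> SC\<^sup>2 * (?M / 2) ^ 3"
      using A M by simp_all
    show ?thesis by (simp only: ennreal_plus ennreal_mult mult_nonneg_nonneg add_nonneg_nonneg nn)
  qed
  also have "A * (?M / 2) ^ 3 + (27 / 8 * (A * (?M / 2) ^ 3) + 27 * (SC\<^sup>2 * (?M / 2) ^ 3)) = (35 / 64 * A + 27 / 8 * SC\<^sup>2) * ?M ^ 3"
    by (simp add: power_divide algebra_simps)
  finally show "E p q \<le> ennreal ((35 / 64 * A + 27 / 8 * SC\<^sup>2) * ?M ^ 3)" .
qed

lemma valid_mono:
  assumes "valid \<eta> A" "A \<le> A'" "0 < \<eta>"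
  shows "valid \<eta> A'"
  unfolding valid_def
proof (intro allI impI)
  fix p q assume pq: "- len \<le> p" "p \<le> q" "q \<le> len"
  have "0 \<le> Mu \<eta> p q" using Xr_nonneg assms(3) pq by (simp add: Mu_def)
  then have "A * (Mu \<eta> p q) ^ 3 \<le> A' * (Mu \<eta> p q) ^ 3" using assms(2) by (intro mult_right_mono) auto
  moreover have "E p q \<le> ennreal (A * (Mu \<eta> p q) ^ 3)" using assms(1) pq unfolding valid_def by blast
  ultimately show "E p q \<le> ennreal (A' * (Mu \<eta> p q) ^ 3)" using ennreal_leI order_trans by blast
qed

text \<open>The map in \<open>valid_step\<close> is a contraction with ratio 35/64 whose fixed
  point, 216/29 times the square of \<open>SC\<close>, lies below 8 times that square. Iterating
  from any finite constant therefore removes the dependence on the a priori bound.\<close>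

lemma E_bound_Mu:
  assumes eta: "0 < \<eta>" and pq: "- len \<le> p" "p \<le> q" "q \<le> len"
  shows "E p q \<le> ennreal (8 * SC\<^sup>2 * (Mu \<eta> p q) ^ 3)"
proof -
  obtain K0 where K0: "0 \<le> K0" "\<And>p q. p \<le> q \<Longrightarrow> E p q \<le> ennreal (K0 * (q - p) ^ 5)"
    by (rule E_apriori) (rule that)
  \<comment> \<open>Two of the five powers of the length are bounded by the window, and the other
    three by \<open>Mu\<close>, which dominates \<eta> times the length. A positive \<eta> is needed
    here as well as for bisecting.\<close>
  define A0 where "A0 = K0 * (2 * len)\<^sup>2 / \<eta> ^ 3"
  have A0: "0 \<le> A0" using K0 eta by (simp add: A0_def)
  have v0: "valid \<eta> A0"
    unfolding valid_def
  proof (intro allI impI)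
    fix p q assume pq: "- len \<le> p" "p \<le> q" "q \<le> len"
    have "(q - p)\<^sup>2 \<le> (2 * len)\<^sup>2" using pq by (intro power_mono) auto
    moreover have "(\<eta> * (q - p)) ^ 3 \<le> (Mu \<eta> p q) ^ 3"
      using pq eta Xr_nonneg[of p q] by (intro power_mono) (auto simp: Mu_def)
    ultimately have "K0 * (q - p)\<^sup>2 / \<eta> ^ 3 * (\<eta> * (q - p)) ^ 3 \<le> K0 * (2 * len)\<^sup>2 / \<eta> ^ 3 * (Mu \<eta> p q) ^ 3"
      using K0(1) eta pq by (intro mult_mono divide_right_mono mult_left_mono) auto
    moreover have "K0 * (q - p)\<^sup>2 / \<eta> ^ 3 * (\<eta> * (q - p)) ^ 3 = K0 * (q - p) ^ 5"
      using eta by (simp add: power_mult_distrib eval_nat_numeral)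
    ultimately show "E p q \<le> ennreal (A0 * (Mu \<eta> p q) ^ 3)"
      unfolding A0_def using K0(2)[OF pq(2)] ennreal_leI order_trans by metis
  qed
  \<comment> \<open>The surplus over 8 times the square of \<open>SC\<close> shrinks by 35/64 in
    each step, because 35/64 * 8 + 27/8 = 31/4 does not exceed 8.\<close>
  have vj: "valid \<eta> (8 * SC\<^sup>2 + (35 / 64) ^ j * A0)" for j
  proof (induction j)
    case 0
    show ?case by (rule valid_mono[OF v0 _ eta]) simp
  next
    case (Suc j)
    have "valid \<eta> (35 / 64 * (8 * SC\<^sup>2 + (35 / 64) ^ j * A0) + 27 / 8 * SC\<^sup>2)"
      by (rule valid_step[OF eta _ Suc]) (use A0 in simp)
    then show ?case
    proof (rule valid_mono[OF _ _ eta])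
      have "0 \<le> SC\<^sup>2" by simp
      then show "35 / 64 * (8 * SC\<^sup>2 + (35 / 64) ^ j * A0) + 27 / 8 * SC\<^sup>2 \<le> 8 * SC\<^sup>2 + (35 / 64) ^ Suc j * A0"
        by (simp add: algebra_simps)
    qed
  qed
  have "(\<lambda>j. ennreal ((8 * SC\<^sup>2 + (35 / 64) ^ j * A0) * (Mu \<eta> p q) ^ 3)) \<longlonglongrightarrow> ennreal ((8 * SC\<^sup>2 + 0 * A0) * (Mu \<eta> p q) ^ 3)"
    by (intro tendsto_intros LIMSEQ_power_zero) simp
  moreover have "E p q \<le> ennreal ((8 * SC\<^sup>2 + (35 / 64) ^ j * A0) * (Mu \<eta> p q) ^ 3)" for j
    using vj[of j] pq unfolding valid_def by blast
  ultimately show ?thesis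
    by (intro LIMSEQ_le_const[where X="\<lambda>j. ennreal ((8 * SC\<^sup>2 + (35 / 64) ^ j * A0) * (Mu \<eta> p q) ^ 3)"]) auto
qed

lemma E_bound:
  assumes pq: "- len \<le> p" "p \<le> q" "q \<le> len"
  shows "E p q \<le> ennreal (8 * SC\<^sup>2 * (Xr p q) ^ 3)"
proof -
  have l: "(\<lambda>j. 1 / real (Suc j)) \<longlonglongrightarrow> 0" by (rule LIMSEQ_Suc[OF lim_1_over_n])
  have "(\<lambda>j. ennreal (8 * SC\<^sup>2 * (Xr p q + 1 / real (Suc j) * (q - p)) ^ 3)) \<longlonglongrightarrow> ennreal (8 * SC\<^sup>2 * (Xr p q + 0 * (q - p)) ^ 3)"
    by (intro tendsto_intros l)
  moreover have "E p q \<le> ennreal (8 * SC\<^sup>2 * (Xr p q + 1 / real (Suc j) * (q - p)) ^ 3)" for j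
    using E_bound_Mu[of "1 / real (Suc j)", OF _ pq] by (simp add: Mu_def)
  ultimately show ?thesis
    by (intro LIMSEQ_le_const[where X="\<lambda>j. ennreal (8 * SC\<^sup>2 * (Xr p q + 1 / real (Suc j) * (q - p)) ^ 3)"]) auto
qed

text \<open>The oriented integral from 0 to t as a difference of integrals from the common base
  point -len, which treats positive and negative t alike.\<close>

definition u :: "real \<Rightarrow> real \<times> real \<Rightarrow> complex" where
  "u t z = V (- len) t t z - V (- len) 0 t z"

lemma u_measurable: "(\<lambda>(t, z). u t z) \<in> borel_measurable (lborel \<Otimes>\<^sub>M cylinder)"
  unfolding u_def by measurable

text \<open>The constant is 72 = 8 * 8 + 8: \<open>pow4_diff_le\<close> puts 8 in front of the
  retarded part, bounded with constant 8, and in front of the untruncated part, bounded with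
  constant 1.\<close>

lemma u_L4_bound:
  "(\<integral>\<^sup>+t. indicator {- len..len} t * (\<integral>\<^sup>+z. ennreal ((norm (u t z)) ^ 4) \<partial>cylinder) \<partial>lborel)
    \<le> ennreal (72 * SC\<^sup>2 * (Xr (- len) len) ^ 3)"
proof -
  have len: "0 \<le> len" by simp
  have "(\<integral>\<^sup>+t. indicator {- len..len} t * (\<integral>\<^sup>+z. ennreal ((norm (u t z)) ^ 4) \<partial>cylinder) \<partial>lborel)
    \<le> (\<integral>\<^sup>+t. ennreal 8 * (indicator {- len..len} t * v (- len) t) + ennreal 8 * (indicator {- len..len} t * W (- len) 0 t) \<partial>lborel)"
  proof (intro nn_integral_mono)
    fix t
    have "(\<integral>\<^sup>+z. ennreal ((norm (u t z)) ^ 4) \<partial>cylinder) \<le> (\<integral>\<^sup>+z. ennreal 8 * ennreal ((norm (V (- len) t t z)) ^ 4) + ennreal 8 * ennreal ((norm (V (- len) 0 t z)) ^ 4) \<partial>cylinder)"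
    proof (intro nn_integral_mono)
      fix z
      have "ennreal ((norm (u t z)) ^ 4) \<le> ennreal (8 * (norm (V (- len) t t z)) ^ 4 + 8 * (norm (V (- len) 0 t z)) ^ 4)"
        unfolding u_def by (rule ennreal_leI[OF pow4_diff_le])
      also have "\<dots> = ennreal 8 * ennreal ((norm (V (- len) t t z)) ^ 4) + ennreal 8 * ennreal ((norm (V (- len) 0 t z)) ^ 4)"
        by (simp only: ennreal_plus ennreal_mult mult_nonneg_nonneg zero_le_power norm_ge_zero zero_le_numeral)
      finally show "ennreal ((norm (u t z)) ^ 4) \<le> ennreal 8 * ennreal ((norm (V (- len) t t z)) ^ 4) + ennreal 8 * ennreal ((norm (V (- len) 0 t z)) ^ 4)" .
    qed
    also have "\<dots> = ennreal 8 * v (- len) t + ennreal 8 * W (- len) 0 t"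
      unfolding v_def W_def by (subst nn_integral_add, measurable, subst nn_integral_cmult, measurable, subst nn_integral_cmult, measurable)
    finally show "indicator {- len..len} t * (\<integral>\<^sup>+z. ennreal ((norm (u t z)) ^ 4) \<partial>cylinder)
      \<le> ennreal 8 * (indicator {- len..len} t * v (- len) t) + ennreal 8 * (indicator {- len..len} t * W (- len) 0 t)"
      by (cases "t \<in> {- len..len}") simp_all
  qed
  also have "\<dots> = ennreal 8 * E (- len) len + ennreal 8 * (\<integral>\<^sup>+t. indicator {- len..len} t * W (- len) 0 t \<partial>lborel)"
    unfolding E_def by (subst nn_integral_add, measurable, subst nn_integral_cmult, measurable, subst nn_integral_cmult, measurable)
  also have "\<dots> \<le> ennreal 8 * ennreal (8 * SC\<^sup>2 * (Xr (- len) len) ^ 3) + ennreal 8 * ennreal (SC\<^sup>2 * (Xr (- len) len) ^ 3)"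
  proof (intro add_mono mult_left_mono E_bound order_trans[OF W_bound] ennreal_leI power_mono)
    show "Xr (- len) 0 \<le> Xr (- len) len" using Xr_add[of "- len" 0 len] Xr_nonneg[of 0 len] by simp
  qed (use len Xr_nonneg in auto)
  also have "\<dots> = ennreal (8 * (8 * SC\<^sup>2 * (Xr (- len) len) ^ 3) + 8 * (SC\<^sup>2 * (Xr (- len) len) ^ 3))"
    by (simp only: ennreal_plus ennreal_mult mult_nonneg_nonneg zero_le_power Xr_nonneg zero_le_numeral zero_le_power2)
  also have "8 * (8 * SC\<^sup>2 * (Xr (- len) len) ^ 3) + 8 * (SC\<^sup>2 * (Xr (- len) len) ^ 3) = 72 * SC\<^sup>2 * (Xr (- len) len) ^ 3" by simp
  finally show ?thesis .
qed

end

text \<open>The sign with which \<open>s\<close> enters the oriented integral from \<open>0\<close> to \<open>t\<close>.\<close>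

definition osig :: "real \<Rightarrow> real \<Rightarrow> real" where
  "osig t s = (if 0 \<le> t then indicator {0..t} s else - indicator {t..0} s)"

lemma osig_measurable [measurable]: "osig t \<in> borel_measurable borel"
  unfolding osig_def[abs_def] by measurable

lemma abs_osig: "\<bar>osig t s\<bar> = indicator {min 0 t..max 0 t} s"
  by (auto simp: osig_def indicator_def)

lemma interval_integral_osig:
  fixes \<phi> :: "real \<Rightarrow> complex"
  assumes i: "integrable lborel (\<lambda>s. osig t s *\<^sub>R \<phi> s)"
  shows "interval_lebesgue_integrable lborel (ereal 0) (ereal t) \<phi>"
    "(LBINT s=ereal 0..ereal t. \<phi> s) = (\<integral>s. osig t s *\<^sub>R \<phi> s \<partial>lborel)"
proof -
  show "interval_lebesgue_integrable lborel (ereal 0) (ereal t) \<phi>"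
  proof (cases "0 \<le> t")
    case True
    then have "set_integrable lborel {0..t} \<phi>" using i by (simp add: set_integrable_def osig_def)
    then have "set_integrable lborel (einterval (ereal 0) (ereal t)) \<phi>"
      by (rule set_integrable_subset) (auto simp: einterval_iff)
    then show ?thesis using True by (simp only: interval_lebesgue_integrable_def ereal_less_eq if_True)
  next
    case False
    then have "integrable lborel (\<lambda>s. - (indicator {t..0} s *\<^sub>R \<phi> s))" using i by (simp add: osig_def)
    then have "set_integrable lborel {t..0} \<phi>" unfolding set_integrable_def by simp
    then have "set_integrable lborel (einterval (ereal t) (ereal 0)) \<phi>"
      by (rule set_integrable_subset) (auto simp: einterval_iff)
    then show ?thesis using False by (simp only: interval_lebesgue_integrable_def ereal_less_eq if_False)
  qed
  show "(LBINT s=ereal 0..ereal t. \<phi> s) = (\<integral>s. osig t s *\<^sub>R \<phi> s \<partial>lborel)"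
  proof (cases "0 \<le> t")
    case True
    then show ?thesis by (simp only: interval_integral_Icc set_lebesgue_integral_def osig_def if_True)
  next
    case False
    then have "t \<le> 0" by simp
    have "(LBINT s=ereal 0..ereal t. \<phi> s) = - (LBINT s=ereal t..ereal 0. \<phi> s)"
      by (rule interval_integral_endpoints_reverse)
    also have "\<dots> = - (\<integral>s. indicator {t..0} s *\<^sub>R \<phi> s \<partial>lborel)"
      using \<open>t \<le> 0\<close> by (simp only: interval_integral_Icc set_lebesgue_integral_def)
    finally show ?thesis using False by (simp add: osig_def)
  qed
qed

section \<open>The Fourier transform of the Duhamel integral\<close>

context nice_duhamel
begin

lemma \<gamma>_bounded: obtains c where "0 \<le> c" "\<And>s k. norm (\<gamma> s k) \<le> c"
proof -
  obtain H K where H: "integrable cylinder H" "\<And>s z. norm (f s z) \<le> H z" "\<And>z. H z \<le> (K :: real)"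
    by (rule nice_family_bound[OF n]) (rule that)
  have H0: "0 \<le> H z" for z using order_trans[OF norm_ge_zero H(2)] .
  show ?thesis
  proof (rule that[of "\<integral>z. H z \<partial>cylinder"])
    show "0 \<le> (\<integral>z. H z \<partial>cylinder)" using H0 by (intro integral_nonneg_AE) auto
    fix s k
    have "1 * 1 \<le> pi * pi" using pi_gt3 by (intro mult_mono) auto
    then have "1 * norm (\<gamma> s k) \<le> 4 * pi\<^sup>2 * norm (\<gamma> s k)" by (intro mult_right_mono) (auto simp: power2_eq_square)
    also have "\<dots> = norm (\<integral>z. f s z * cis (- phase k z) \<partial>cylinder)"
      unfolding nice_family_fourier[OF n] norm_mult norm_of_real by simp
    also have "\<dots> \<le> (\<integral>z. norm (f s z) \<partial>cylinder)" by (rule norm_phase_integral_le)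
    also have "\<dots> \<le> (\<integral>z. H z \<partial>cylinder)"
      by (rule integral_mono) (use nice_family_integrable[OF n] H in auto)
    finally show "norm (\<gamma> s k) \<le> (\<integral>z. H z \<partial>cylinder)" by simp
  qed
qed

lemma Gam_osig:
  assumes t: "t \<in> {- len..len}"
  shows "Gam (- len) t k - Gam (- len) 0 k = (\<integral>s. osig t s *\<^sub>R (\<gamma> s k * cis (s * symb om k)) \<partial>lborel)"
proof (cases "0 \<le> t")
  case True
  have "Gam (- len) t k - Gam (- len) 0 k = Gam 0 t k"
    using Gam_add[of "- len" 0 t k] True by simp
  also have "\<dots> = (\<integral>s. osig t s *\<^sub>R (\<gamma> s k * cis (s * symb om k)) \<partial>lborel)"
    unfolding Gam_def by (intro Bochner_Integration.integral_cong refl) (use True in \<open>auto simp: integrand_def osig_def indicator_def\<close>)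
  finally show ?thesis .
next
  case False
  have "Gam (- len) t k - Gam (- len) 0 k = - Gam t 0 k"
    using Gam_add[of "- len" t 0 k] False t by simp
  also have "\<dots> = (\<integral>s. - integrand t 0 k s \<partial>lborel)" unfolding Gam_def by simp
  also have "\<dots> = (\<integral>s. osig t s *\<^sub>R (\<gamma> s k * cis (s * symb om k)) \<partial>lborel)"
    by (intro Bochner_Integration.integral_cong refl) (use False in \<open>auto simp: integrand_def osig_def indicator_def\<close>)
  finally show ?thesis .
qed

lemma u_eq_ext: "u t z = ext om (\<lambda>k. Gam (- len) t k - Gam (- len) 0 k) t z"
proof -
  have "ext om (\<lambda>k. Gam (- len) t k + (- 1) * Gam (- len) 0 k) t z = V (- len) t t z + (- 1) * V (- len) 0 t z"
    unfolding V_def ext_mult[symmetric] by (rule ext_add) (simp_all add: integrable_Gam)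
  then show ?thesis by (simp add: u_def)
qed

lemma group_multiplier_nice:
  assumes h: "h \<in> test_functions"
  shows "group_multiplier \<alpha> \<epsilon> (t - s) (fourier (f s)) n' h
    = complex_of_real (4 * pi\<^sup>2) * (\<integral>\<xi>. \<gamma> s (n', \<xi>) * (cis (- ((t - s) * (om n' + \<xi>\<^sup>2))) * h \<xi>) \<partial>lborel)"
  unfolding group_multiplier_def by (rule nice_family_fourier_pairing[OF n multiplier_integrable(1)[OF h]])

text \<open>The profile of \<open>u t\<close> is the oriented integral of \<gamma>(s) cis (s
  \<sigma>) over s, where \<sigma> is the symbol. Multiplication by cis (-t \<sigma>) completes this
  to the propagator from s to t, and Fubini in \<xi> and s moves the time integral outside.\<close>

lemma u_fourier:
  assumes t: "t \<in> {- len..len}" and h: "h \<in> test_functions"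
  shows "has_bochner_integral cylinder (fourier_integrand (u t) n' h)
      (\<integral>s. osig t s *\<^sub>R group_multiplier \<alpha> \<epsilon> (t - s) (fourier (f s)) n' h \<partial>lborel)"
proof -
  note [measurable] = test_function_measurable[OF h]
  obtain c where c: "0 \<le> c" "\<And>s k. norm (\<gamma> s k) \<le> c" by (rule \<gamma>_bounded) (rule that)
  let ?S = "\<lambda>\<xi>. symb om (n', \<xi>)"
  let ?F = "\<lambda>\<xi> s. (osig t s *\<^sub>R (\<gamma> s (n', \<xi>) * cis (s * ?S \<xi>))) * (cis (- (t * ?S \<xi>)) * h \<xi>)"
  have pm[measurable]: "(\<lambda>p. (n', fst p)) \<in> measurable (borel \<Otimes>\<^sub>M borel) freq"
    by (intro measurable_Pair) simp_all
  have [measurable]: "(\<lambda>\<xi>. (n', \<xi>)) \<in> measurable borel freq"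
    by (intro measurable_Pair) simp_all
  have Fm: "case_prod ?F \<in> borel_measurable (lborel \<Otimes>\<^sub>M lborel)"
  proof -
    have [measurable]: "(\<lambda>p. \<gamma> (snd p) (n', fst p)) \<in> borel_measurable (borel \<Otimes>\<^sub>M borel)"
      by (rule \<gamma>_measurable'[OF _ pm]) simp
    have [measurable]: "(\<lambda>p. symb om (n', fst p)) \<in> borel_measurable (borel \<Otimes>\<^sub>M borel)"
      by (rule measurable_symb[OF pm])
    have "(\<lambda>p. ?F (fst p) (snd p)) \<in> borel_measurable (borel \<Otimes>\<^sub>M borel)" by measurable
    then have "case_prod ?F \<in> borel_measurable (borel \<Otimes>\<^sub>M borel)" by (simp only: case_prod_beta')
    moreover have S: "sets (lborel \<Otimes>\<^sub>M lborel) = sets (borel \<Otimes>\<^sub>M borel :: (real \<times> real) measure)"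
      by (intro sets_pair_measure_cong) simp_all
    ultimately show ?thesis unfolding measurable_cong_sets[OF S refl] by blast
  qed
  have Fb: "norm (?F \<xi> s) \<le> indicator {min 0 t..max 0 t} s * (c * norm (h \<xi>))" for \<xi> s
  proof -
    have "norm (?F \<xi> s) = indicator {min 0 t..max 0 t} s * (norm (\<gamma> s (n', \<xi>)) * norm (h \<xi>))"
      by (simp only: norm_mult norm_scaleR norm_cis abs_osig mult_1_right mult_1_left mult.assoc)
    also have "\<dots> \<le> indicator {min 0 t..max 0 t} s * (c * norm (h \<xi>))"
      by (intro mult_left_mono mult_right_mono c) auto
    finally show ?thesis .
  qed
  have ii: "integrable lborel (indicator {min 0 t..max 0 t} :: real \<Rightarrow> real)"
    by (intro integrable_real_indicator) (auto simp: emeasure_lborel_Icc_eq)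
  have iF: "integrable (lborel \<Otimes>\<^sub>M lborel) (case_prod ?F)"
  proof (rule Bochner_Integration.integrable_bound[OF _ Fm])
    have "integrable (lborel \<Otimes>\<^sub>M lborel) (\<lambda>z. complex_of_real (c * norm (h (fst z))) * complex_of_real (indicator {min 0 t..max 0 t} (snd z)))"
      by (rule integral_pair_product(1)[OF lborel.sigma_finite_measure_axioms lborel.sigma_finite_measure_axioms])
        (use ii integrable_norm[OF test_function_integrable[OF h]] in \<open>auto intro!: integrable_of_real\<close>)
    then show "integrable (lborel \<Otimes>\<^sub>M lborel) (\<lambda>z. complex_of_real (c * norm (h (fst z))) * complex_of_real (indicator {min 0 t..max 0 t} (snd z)))" .
    show "AE z in lborel \<Otimes>\<^sub>M lborel. norm (case_prod ?F z) \<le> norm (complex_of_real (c * norm (h (fst z))) * complex_of_real (indicator {min 0 t..max 0 t} (snd z)))"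
    proof (intro AE_I2)
      fix z :: "real \<times> real"
      have "norm (case_prod ?F z) \<le> indicator {min 0 t..max 0 t} (snd z) * (c * norm (h (fst z)))"
        using Fb[of "snd z" "fst z"] by (simp only: case_prod_beta)
      also have "\<dots> = norm (complex_of_real (c * norm (h (fst z))) * complex_of_real (indicator {min 0 t..max 0 t} (snd z)))"
        using c(1) by (simp add: norm_mult abs_mult)
      finally show "norm (case_prod ?F z) \<le> norm (complex_of_real (c * norm (h (fst z))) * complex_of_real (indicator {min 0 t..max 0 t} (snd z)))" .
    qed
  qed
  let ?\<Gamma> = "\<lambda>k. Gam (- len) t k - Gam (- len) 0 k"
  have i\<Gamma>: "integrable freq ?\<Gamma>" by (simp add: integrable_Gam)
  have "has_bochner_integral cylinder (fourier_integrand (ext om ?\<Gamma> t) n' h)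
      (complex_of_real (4 * pi\<^sup>2) * (\<integral>\<xi>. ?\<Gamma> (n', \<xi>) * cis (- (t * ?S \<xi>)) * h \<xi> \<partial>lborel))"
    by (rule has_fourier_ext[OF i\<Gamma> h])
  also have "(\<integral>\<xi>. ?\<Gamma> (n', \<xi>) * cis (- (t * ?S \<xi>)) * h \<xi> \<partial>lborel) = (\<integral>\<xi>. (\<integral>s. ?F \<xi> s \<partial>lborel) \<partial>lborel)"
    unfolding Gam_osig[OF t] by (simp only: integral_mult_left_zero mult.assoc)
  also have "\<dots> = (\<integral>s. (\<integral>\<xi>. ?F \<xi> s \<partial>lborel) \<partial>lborel)"
    by (rule lborel_pair.Fubini_integral[OF iF, symmetric])
  also have "complex_of_real (4 * pi\<^sup>2) * \<dots> = (\<integral>s. complex_of_real (4 * pi\<^sup>2) * (\<integral>\<xi>. ?F \<xi> s \<partial>lborel) \<partial>lborel)"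
    by (rule integral_mult_right_zero[symmetric])
  also have "\<dots> = (\<integral>s. osig t s *\<^sub>R group_multiplier \<alpha> \<epsilon> (t - s) (fourier (f s)) n' h \<partial>lborel)"
  proof (intro Bochner_Integration.integral_cong refl)
    fix s
    have "?F \<xi> s = complex_of_real (osig t s) * (\<gamma> s (n', \<xi>) * (cis (- ((t - s) * (om n' + \<xi>\<^sup>2))) * h \<xi>))" for \<xi>
    proof -
      have "cis (- ((t - s) * (om n' + \<xi>\<^sup>2))) = cis (s * ?S \<xi>) * cis (- (t * ?S \<xi>))"
        by (simp add: cis_mult symb_def algebra_simps)
      then show ?thesis by (simp only: scaleR_conv_of_real mult.assoc)
    qed
    then show "complex_of_real (4 * pi\<^sup>2) * (\<integral>\<xi>. ?F \<xi> s \<partial>lborel) = osig t s *\<^sub>R group_multiplier \<alpha> \<epsilon> (t - s) (fourier (f s)) n' h"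
      unfolding group_multiplier_nice[OF h] by (simp only: integral_mult_right_zero scaleR_conv_of_real mult.left_commute)
  qed
  finally show ?thesis unfolding u_eq_ext[abs_def] .
qed

end

section \<open>Density of nice families in space-time\<close>

context flow_time
begin

text \<open>By linearity the L^4 bound for one family controls differences of consecutive
  approximations.\<close>

lemma u_diff:
  assumes 1: "nice_family f \<gamma>" and 2: "nice_family f' \<gamma>'"
  shows "nice_duhamel.u \<alpha> \<epsilon> I (\<lambda>s k. \<gamma> s k - \<gamma>' s k) t z = nice_duhamel.u \<alpha> \<epsilon> I \<gamma> t z - nice_duhamel.u \<alpha> \<epsilon> I \<gamma>' t z"
proof -
  have 3: "nice_family (\<lambda>s z. f s z - f' s z) (\<lambda>s k. \<gamma> s k - \<gamma>' s k)"
    using nice_family_add[OF 1 nice_family_mult[OF 2, of "\<lambda>_. - 1" 1]] by simp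
  interpret a: nice_duhamel \<alpha> \<epsilon> B I f \<gamma> by unfold_locales (rule 1)
  interpret b: nice_duhamel \<alpha> \<epsilon> B I f' \<gamma>' by unfold_locales (rule 2)
  interpret c: nice_duhamel \<alpha> \<epsilon> B I "\<lambda>s z. f s z - f' s z" "\<lambda>s k. \<gamma> s k - \<gamma>' s k" by unfold_locales (rule 3)
  have G: "c.Gam p q k = a.Gam p q k - b.Gam p q k" for p q k
  proof -
    have e: "c.integrand p q k = (\<lambda>s. a.integrand p q k s - b.integrand p q k s)"
      by (simp add: fun_eq_iff a.integrand_def b.integrand_def c.integrand_def left_diff_distrib)
    show ?thesis
      unfolding a.Gam_def b.Gam_def c.Gam_def e using a.integrable_integrand b.integrable_integrand by simp
  qed
  have V: "c.V p q t z = a.V p q t z - b.V p q t z" for p q t z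
  proof -
    have "c.Gam p q = (\<lambda>k. a.Gam p q k + (- 1) * b.Gam p q k)" using G by auto
    then have "c.V p q t z = ext om (a.Gam p q) t z + ext om (\<lambda>k. (- 1) * b.Gam p q k) t z"
      unfolding c.V_def by (simp only:) (rule ext_add, simp_all add: a.integrable_Gam b.integrable_Gam)
    then show ?thesis unfolding ext_mult a.V_def b.V_def by simp
  qed
  show ?thesis unfolding a.u_def b.u_def c.u_def V by simp
qed

definition families :: "(real \<times> real \<times> real \<Rightarrow> complex) set" where
  "families = {g. \<exists>f \<gamma>. nice_family f \<gamma> \<and> g = (\<lambda>p. f (fst p) (snd p))}"

lemma Lp_closure_families: "0 < p \<Longrightarrow> Lp_closure (spacetime I) p families"
proof
  show "f \<in> borel_measurable (spacetime I)" if "f \<in> families" for f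
    using that measurable_spacetimeI nice_family_measurable(1) by (auto simp: families_def)
  show "(\<lambda>x. f x + g x) \<in> families" if "f \<in> families" "g \<in> families" for f g
    using that nice_family_add unfolding families_def by blast
  show "(\<lambda>x. c * f x) \<in> families" if "f \<in> families" for f c
    using that nice_family_mult[of _ _ "\<lambda>_. c" "norm c"] unfolding families_def by auto
  show "(\<lambda>_. 0) \<in> families" using nice_zero unfolding families_def by blast
qed

text \<open>Rectangles J \<times> A with \<open>A\<close> cut off to a box generate the space-time
  sets. Their indicators are approximated by the indicator of J times a nice function: a nice family
  tolerates any bounded measurable factor in time, so approximation is only needed in space.\<close>

lemma families_dense:
  assumes p: "0 < p" and f: "f \<in> borel_measurable (spacetime I)" and fin: "(\<integral>\<^sup>+x. ennreal (norm (f x) powr p) \<partial>spacetime I) < \<infinity>"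
  shows "Lp_closure.cl (spacetime I) p families f"
proof -
  interpret S: Lp_closure "spacetime I" p families by (rule Lp_closure_families[OF p])
  interpret C: Lp_closure cylinder p nices by (rule Lp_closure_nices[OF refl p])
  let ?G = "{J \<times> A | J A. J \<in> sets TI \<and> A \<in> sets cylinder}"
  let ?\<Omega> = "\<lambda>i. I \<times> box_exhaustion i"
  have I_TI: "I \<in> sets TI" using sets.top[of TI] by (simp add: space_TI)
  have base: "S.cl (indicator (J \<times> (A \<inter> box_exhaustion i)))" if J: "J \<in> sets TI" and A: "A \<in> sets cylinder" for J A i
  proof (rule S.cl_lim)
    have JAm: "J \<times> (A \<inter> box_exhaustion i) \<in> sets (spacetime I)"
      unfolding spacetime_eq using J A box_exhaustion(1)[of i] by (intro pair_measureI) auto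
    then show "indicator (J \<times> (A \<inter> box_exhaustion i)) \<in> borel_measurable (spacetime I)" by simp
    fix e :: real assume e: "0 < e"
    \<comment> \<open>The spatial error is integrated over a time set of length \<open>len\<close>,
      which may be 0; hence the 1 in the denominator.\<close>
    define e' where "e' = e / (len + 1)"
    have len0: "0 \<le> len" by simp
    have e': "0 < e'" using e by (simp add: e'_def add_nonneg_pos)
    have "C.cl (indicator (A \<inter> box_exhaustion i))" by (rule cylinder_nices_cl_indicator[OF p A])
    then obtain \<psi> where \<psi>: "\<psi> \<in> nices" "C.N (\<lambda>z. indicator (A \<inter> box_exhaustion i) z - \<psi> z) < ennreal e'"
      using e' unfolding C.cl_def by blast
    from \<psi>(1) obtain g where n: "nice \<psi> g" by blast
    have Jb: "J \<in> sets borel"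
      using J by (auto simp: sets_restrict_space)
    have nf: "nice_family (\<lambda>s z. indicator J s * \<psi> z) (\<lambda>s k. indicator J s * g k)"
      by (rule nice_family_mult[OF n, of "indicator J" 1]) (use Jb in \<open>auto simp: indicator_def\<close>)
    let ?g = "\<lambda>p :: real \<times> real \<times> real. indicator J (fst p) * \<psi> (snd p)"
    have gD: "?g \<in> families" using nf unfolding families_def by blast
    have [measurable]: "?g \<in> borel_measurable (spacetime I)" by (rule S.D_measurable[OF gD])
    note [measurable] = JAm nice_family_measurable(3)[OF n] A box_exhaustion(1)[of i]
    have "S.N (\<lambda>x. indicator (J \<times> (A \<inter> box_exhaustion i)) x - ?g x)
      = (\<integral>\<^sup>+t. (\<integral>\<^sup>+z. ennreal (norm (indicator (J \<times> (A \<inter> box_exhaustion i)) (t, z) - ?g (t, z)) powr p) \<partial>cylinder) \<partial>TI)"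
      by (rule nn_integral_spacetime) measurable
    also have "\<dots> \<le> (\<integral>\<^sup>+t. C.N (\<lambda>z. indicator (A \<inter> box_exhaustion i) z - \<psi> z) \<partial>TI)"
      using p by (intro nn_integral_mono) (auto simp: indicator_def)
    also have "\<dots> = C.N (\<lambda>z. indicator (A \<inter> box_exhaustion i) z - \<psi> z) * ennreal len"
      by (simp add: emeasure_restrict_space space_TI emeasure_I_eq)
    also have "\<dots> \<le> ennreal e' * ennreal len" by (rule mult_right_mono[OF less_imp_le[OF \<psi>(2)]]) simp
    also have "\<dots> = ennreal (e' * len)" using e' len0 by (simp add: ennreal_mult)
    also have "\<dots> < ennreal e"
    proof (rule ennreal_lessI[OF e])
      have "e' * len < e' * (len + 1)" using e' by simp
      also have "\<dots> = e"
      proof -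
        have "0 < len + 1" using len0 by linarith
        then show ?thesis by (simp add: e'_def)
      qed
      finally show "e' * len < e" .
    qed
    finally show "\<exists>g. S.cl g \<and> S.N (\<lambda>x. indicator (J \<times> (A \<inter> box_exhaustion i)) x - g x) < ennreal e"
      using S.cl_D[OF gD] by (intro exI[of _ ?g]) simp
  qed
  show ?thesis
  proof (rule S.cl_Lp[of ?G ?\<Omega>, OF _ _ _ _ _ _ _ _ _ f fin])
    show "Int_stable ?G"
    proof (rule Int_stableI)
      fix a b assume "a \<in> ?G" "b \<in> ?G"
      then obtain J C J' C' where "a = J \<times> C" "b = J' \<times> C'" "J \<in> sets TI" "C \<in> sets cylinder" "J' \<in> sets TI" "C' \<in> sets cylinder"
        by blast
      then have "a \<inter> b = (J \<inter> J') \<times> (C \<inter> C')" "J \<inter> J' \<in> sets TI" "C \<inter> C' \<in> sets cylinder" by (auto simp: Times_Int_Times)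
      then show "a \<inter> b \<in> ?G" by blast
    qed
    show "?G \<subseteq> Pow (space (spacetime I))"
    proof (intro subsetI)
      fix a assume "a \<in> ?G"
      then obtain J C where "a = J \<times> C" "J \<in> sets TI" "C \<in> sets cylinder" by blast
      moreover from this(2,3) have "J \<subseteq> I" "C \<subseteq> space cylinder" using sets.sets_into_space by (fastforce simp: space_TI)+
      ultimately show "a \<in> Pow (space (spacetime I))" unfolding space_spacetime by blast
    qed
    show "sets (spacetime I) = sigma_sets (space (spacetime I)) ?G"
      unfolding spacetime_eq by (simp only: sets_pair_measure space_pair_measure)
    show "?\<Omega> i \<in> sets (spacetime I)" for i
      unfolding spacetime_eq by (rule pair_measureI[OF I_TI box_exhaustion(1)])
    show "incseq ?\<Omega>" using box_exhaustion(2) by (auto simp: incseq_def)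
    show "(\<Union>i. ?\<Omega> i) = space (spacetime I)" unfolding space_spacetime box_exhaustion(3)[symmetric] by auto
    show "emeasure (spacetime I) (?\<Omega> i) < \<infinity>" for i
      unfolding spacetime_eq using I_TI box_exhaustion(1)[of i] emeasure_I emeasure_box_exhaustion[OF refl p AE_cylinder_fst_neq_0 nn_integral_gaussian_powr_cylinder[OF p], of i]
      by (simp only: cyl.emeasure_pair_measure_Times) (simp add: emeasure_restrict_space ennreal_mult_less_top)
    show "S.cl (indicator (?\<Omega> i))" for i
    proof -
      have "space cylinder \<inter> box_exhaustion i = box_exhaustion i"
        using sets.sets_into_space[OF box_exhaustion(1)[of i]] by blast
      then show ?thesis using base[OF I_TI sets.top[of cylinder], of i] by (simp only:)
    qed
    fix A i assume "A \<in> ?G"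
    then obtain J C where A: "A = J \<times> C" "J \<in> sets TI" "C \<in> sets cylinder" by blast
    have "A \<inter> ?\<Omega> i = J \<times> (C \<inter> box_exhaustion i)"
      using sets.sets_into_space[OF A(2)] by (auto simp: A(1) space_TI)
    then show "S.cl (indicator (A \<inter> ?\<Omega> i))" using base[OF A(2,3)] by simp
  qed
qed

end

text \<open>Serves both parts of the theorem: with \<open>X\<close> the p-th power of the norm of
  the data, \<open>X powr (a / 4)\<close> is that norm for a = 2, p = 2 and for a = 3, p =
  4/3.\<close>

lemma Lp_4_bound:
  assumes v[measurable]: "v \<in> borel_measurable M" and K: "0 \<le> K" and X: "0 \<le> X"
    and le: "(\<integral>\<^sup>+p. ennreal ((norm (v p)) ^ 4) \<partial>M) \<le> ennreal (K * X powr a)"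
  shows "v \<in> Lp_functions 4 M \<and> Lp_norm 4 M v \<le> K powr (1/4) * X powr (a / 4)"
proof
  show "v \<in> Lp_functions 4 M"
    using v le_less_trans[OF le ennreal_less_top] by (simp add: Lp_functions_iff norm_powr_4)
  have "(\<integral>p. norm (v p) powr 4 \<partial>M) = enn2real (\<integral>\<^sup>+p. ennreal ((norm (v p)) ^ 4) \<partial>M)"
    unfolding norm_powr_4 by (rule integral_eq_nn_integral) auto
  also have "\<dots> \<le> K * X powr a" by (rule enn2real_leI[OF _ le]) (use K in simp)
  finally have "(\<integral>p. norm (v p) powr 4 \<partial>M) \<le> K * X powr a" .
  then have "Lp_norm 4 M v \<le> (K * X powr a) powr (1/4)"
    unfolding Lp_norm_def by (intro powr_mono2 integral_nonneg_AE) auto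
  also have "\<dots> = K powr (1/4) * X powr (a / 4)" using K by (simp add: powr_mult powr_powr)
  finally show "Lp_norm 4 M v \<le> K powr (1/4) * X powr (a / 4)" .
qed

context nice_duhamel
begin

text \<open>The bound on \<open>u\<close> involves the mass of \<open>f\<close> on all of
  [-len, len]; vanishing of \<open>f\<close> outside I reduces it to the mass on I.\<close>

lemma u_spacetime_bound:
  assumes z: "\<And>s z. s \<notin> I \<Longrightarrow> f s z = 0" and Y: "0 \<le> Y"
    and le: "(\<integral>\<^sup>+p. ennreal (norm (f (fst p) (snd p)) powr (4/3)) \<partial>spacetime I) \<le> ennreal Y"
  shows "(\<integral>\<^sup>+p. ennreal ((norm (u (fst p) (snd p))) ^ 4) \<partial>spacetime I) \<le> ennreal (72 * SC\<^sup>2 * Y ^ 3)"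
proof -
  note [measurable] = u_measurable[unfolded case_prod_beta] measurable_spacetimeI[OF u_measurable]
    measurable_spacetimeI[OF nice_family_measurable(1)[OF n]]
  have "X (- len) len \<le> (\<integral>\<^sup>+s. indicator I s * x s \<partial>lborel)"
    unfolding X_def using z by (intro nn_integral_mono) (auto simp: indicator_def x_def)
  also have "\<dots> = (\<integral>\<^sup>+s. x s \<partial>TI)" by (rule nn_integral_TI[symmetric]) measurable
  also have "\<dots> = (\<integral>\<^sup>+p. ennreal (norm (f (fst p) (snd p)) powr (4/3)) \<partial>spacetime I)"
    unfolding x_def by (subst nn_integral_spacetime) auto
  finally have "ennreal (Xr (- len) len) \<le> ennreal Y" using le unfolding X_eq by simp
  then have XY: "Xr (- len) len \<le> Y" using Y by (simp add: ennreal_le_iff)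
  have "(\<integral>\<^sup>+p. ennreal ((norm (u (fst p) (snd p))) ^ 4) \<partial>spacetime I) = (\<integral>\<^sup>+t. (\<integral>\<^sup>+z. ennreal ((norm (u t z)) ^ 4) \<partial>cylinder) \<partial>TI)"
    by (subst nn_integral_spacetime) auto
  also have "\<dots> = (\<integral>\<^sup>+t. indicator I t * (\<integral>\<^sup>+z. ennreal ((norm (u t z)) ^ 4) \<partial>cylinder) \<partial>lborel)"
    by (rule nn_integral_TI) measurable
  also have "\<dots> \<le> (\<integral>\<^sup>+t. indicator {- len..len} t * (\<integral>\<^sup>+z. ennreal ((norm (u t z)) ^ 4) \<partial>cylinder) \<partial>lborel)"
    using I_subset by (intro nn_integral_mono mult_right_mono) (auto simp: indicator_def)
  also have "\<dots> \<le> ennreal (72 * SC\<^sup>2 * (Xr (- len) len) ^ 3)" by (rule u_L4_bound)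
  also have "\<dots> \<le> ennreal (72 * SC\<^sup>2 * Y ^ 3)"
    by (intro ennreal_leI mult_left_mono power_mono XY Xr_nonneg) simp
  finally show ?thesis .
qed

end

section \<open>Pairing general data with test functions\<close>

context flow_time
begin

text \<open>Moving the multiplier onto the test function turns the pairing of \<open>\<integral> S(t - s) f(s) ds\<close> with \<open>h\<close> into an integral of \<open>f\<close> against \<open>kern t n h\<close>.\<close>

definition kern :: "real \<Rightarrow> int \<Rightarrow> (real \<Rightarrow> complex) \<Rightarrow> real \<times> real \<times> real \<Rightarrow> complex" where
  "kern t n h p = cis (- (of_int n * fst (snd p))) *
     line_fourier (\<lambda>\<xi>. cis (- ((t - fst p) * (om n + \<xi>\<^sup>2))) * h \<xi>) (snd (snd p))"

lemma kern_measurable: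
  assumes h: "h \<in> test_functions"
  shows "kern t n h \<in> borel_measurable (spacetime I)" "(\<lambda>z. kern t n h (s, z)) \<in> borel_measurable cylinder"
proof -
  note [measurable] = test_function_measurable[OF h]
  have "(\<lambda>(s, z). kern t n h (s, z)) \<in> borel_measurable (lborel \<Otimes>\<^sub>M cylinder)"
    unfolding kern_def case_prod_beta by measurable
  from measurable_spacetimeI[OF this] show "kern t n h \<in> borel_measurable (spacetime I)" by simp
  show "(\<lambda>z. kern t n h (s, z)) \<in> borel_measurable cylinder"
    unfolding kern_def fst_conv snd_conv by measurable
qed

lemma group_multiplier_kern:
  "group_multiplier \<alpha> \<epsilon> (t - s) (fourier (\<lambda>z. g (s, z))) n h = (\<integral>z. g (s, z) * kern t n h (s, z) \<partial>cylinder)"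
  unfolding group_multiplier_def fourier_def
  by (intro Bochner_Integration.integral_cong refl) (simp add: fourier_integrand_def kern_def case_prod_beta mult.assoc)

text \<open>A transform is bounded by the L^1 norm of its argument and lies in L^2, hence in L^4.
  The multiplier has modulus one, so both norms, and the bound, are uniform in s.\<close>

lemma kern_L4:
  assumes h: "h \<in> test_functions"
  obtains R where "0 \<le> R" "\<And>s. (\<integral>\<^sup>+z. ennreal ((norm (kern t n h (s, z))) ^ 4) \<partial>cylinder) \<le> ennreal R"
proof -
  note [measurable] = test_function_measurable[OF h]
  define A where "A = (\<integral>\<xi>. norm (h \<xi>) \<partial>lborel)"
  define H where "H = enn2real (\<integral>\<^sup>+\<xi>. ennreal ((norm (h \<xi>))\<^sup>2) \<partial>lborel)"
  have H: "(\<integral>\<^sup>+\<xi>. ennreal ((norm (h \<xi>))\<^sup>2) \<partial>lborel) = ennreal H" "0 \<le> H"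
    using test_function_L2[OF h] by (simp_all add: H_def less_top)
  have A: "0 \<le> A" unfolding A_def by (intro integral_nonneg_AE) auto
  show ?thesis
  proof (rule that[of "A\<^sup>2 * (2 * pi * (2 * pi * H))"])
    show "0 \<le> A\<^sup>2 * (2 * pi * (2 * pi * H))" using H by simp
    fix s
    let ?h = "\<lambda>\<xi>. cis (- ((t - s) * (om n + \<xi>\<^sup>2))) * h \<xi>"
    note hi = multiplier_integrable(1)[OF h, of "t - s" n]
    have lm: "(\<lambda>y. ennreal ((norm (line_fourier ?h y))\<^sup>2)) \<in> borel_measurable borel" by measurable
    have nk: "norm (kern t n h (s, z)) = norm (line_fourier ?h (snd z))" for z by (simp add: kern_def norm_mult)
    have bound: "norm (line_fourier ?h y) \<le> A" for y
      using norm_line_fourier_le[of ?h y] by (simp add: A_def norm_mult)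
    have "(\<integral>\<^sup>+z. ennreal ((norm (kern t n h (s, z))) ^ 4) \<partial>cylinder) \<le> (\<integral>\<^sup>+z. ennreal (A\<^sup>2) * ennreal ((norm (line_fourier ?h (snd z)))\<^sup>2) \<partial>cylinder)"
    proof (intro nn_integral_mono)
      fix z :: "real \<times> real"
      let ?l = "norm (line_fourier ?h (snd z))"
      have "?l ^ 4 = ?l\<^sup>2 * ?l\<^sup>2" by (simp add: power_add[symmetric])
      also have "\<dots> \<le> A\<^sup>2 * ?l\<^sup>2" by (intro mult_right_mono power_mono bound) auto
      finally have "ennreal (?l ^ 4) \<le> ennreal (A\<^sup>2 * ?l\<^sup>2)" by (rule ennreal_leI)
      then show "ennreal ((norm (kern t n h (s, z))) ^ 4) \<le> ennreal (A\<^sup>2) * ennreal (?l\<^sup>2)"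
        unfolding nk by (simp only: ennreal_mult zero_le_power2)
    qed
    also have "\<dots> = ennreal (A\<^sup>2) * (\<integral>\<^sup>+z. ennreal ((norm (line_fourier ?h (snd z)))\<^sup>2) \<partial>cylinder)"
      by (rule nn_integral_cmult) measurable
    also have "(\<integral>\<^sup>+z. ennreal ((norm (line_fourier ?h (snd z)))\<^sup>2) \<partial>cylinder) = ennreal (2 * pi) * (\<integral>\<^sup>+y. ennreal ((norm (line_fourier ?h y))\<^sup>2) \<partial>lborel)"
      by (rule cylinder_nn_integral_snd[OF lm])
    also have "ennreal (A\<^sup>2) * (ennreal (2 * pi) * (\<integral>\<^sup>+y. ennreal ((norm (line_fourier ?h y))\<^sup>2) \<partial>lborel))
      \<le> ennreal (A\<^sup>2) * (ennreal (2 * pi) * (ennreal (2 * pi) * (\<integral>\<^sup>+\<xi>. ennreal ((norm (?h \<xi>))\<^sup>2) \<partial>lborel)))"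
      by (intro mult_left_mono line_fourier_L2_le[OF hi]) auto
    also have "\<dots> = ennreal (A\<^sup>2) * (ennreal (2 * pi) * (ennreal (2 * pi) * ennreal H))"
      unfolding H(1)[symmetric] by (simp add: norm_mult)
    also have "\<dots> = ennreal (A\<^sup>2 * (2 * pi * (2 * pi * H)))"
      using H(2) pi_ge_zero by (simp only: ennreal_mult zero_le_power2 mult_nonneg_nonneg zero_le_numeral)
    finally show "(\<integral>\<^sup>+z. ennreal ((norm (kern t n h (s, z))) ^ 4) \<partial>cylinder) \<le> ennreal (A\<^sup>2 * (2 * pi * (2 * pi * H)))" .
  qed
qed

text \<open>Hoelder's inequality between L^(4/3) and L^4 in the form of Young. The parameter is 1
  for integrability and 2^j for convergence of approximations.\<close>

lemma kern_pairing_le: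
  assumes h: "h \<in> test_functions" and g[measurable]: "g \<in> borel_measurable (spacetime I)" and l: "0 < l"
    and R: "0 \<le> R" "\<And>s. (\<integral>\<^sup>+z. ennreal ((norm (kern t n h (s, z))) ^ 4) \<partial>cylinder) \<le> ennreal R"
  shows "(\<integral>\<^sup>+p. ennreal (norm (g p * kern t n h p)) \<partial>spacetime I)
    \<le> ennreal l * (\<integral>\<^sup>+p. ennreal (norm (g p) powr (4/3)) \<partial>spacetime I) + ennreal (1 / l ^ 3 * (R * len))"
proof -
  note [measurable] = kern_measurable(1)[OF h]
  have "(\<integral>\<^sup>+p. ennreal (norm (g p * kern t n h p)) \<partial>spacetime I)
    \<le> (\<integral>\<^sup>+p. ennreal l * ennreal (norm (g p) powr (4/3)) + ennreal (1 / l ^ 3) * ennreal ((norm (kern t n h p)) ^ 4) \<partial>spacetime I)"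
  proof (intro nn_integral_mono)
    fix p
    have "0 \<le> 1 / l ^ 3" using l by simp
    have "ennreal (norm (g p * kern t n h p)) \<le> ennreal (l * norm (g p) powr (4/3) + 1 / l ^ 3 * (norm (kern t n h p)) ^ 4)"
      unfolding norm_mult by (intro ennreal_leI young_four_thirds l) auto
    also have "\<dots> = ennreal l * ennreal (norm (g p) powr (4/3)) + ennreal (1 / l ^ 3) * ennreal ((norm (kern t n h p)) ^ 4)"
      using less_imp_le[OF l] \<open>0 \<le> 1 / l ^ 3\<close>
      by (simp only: ennreal_plus ennreal_mult mult_nonneg_nonneg zero_le_power norm_ge_zero powr_ge_zero)
    finally show "ennreal (norm (g p * kern t n h p)) \<le> ennreal l * ennreal (norm (g p) powr (4/3)) + ennreal (1 / l ^ 3) * ennreal ((norm (kern t n h p)) ^ 4)" .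
  qed
  also have "\<dots> = ennreal l * (\<integral>\<^sup>+p. ennreal (norm (g p) powr (4/3)) \<partial>spacetime I) + ennreal (1 / l ^ 3) * (\<integral>\<^sup>+p. ennreal ((norm (kern t n h p)) ^ 4) \<partial>spacetime I)"
    by (subst nn_integral_add, measurable, subst nn_integral_cmult, measurable, subst nn_integral_cmult, measurable)
  also have "(\<integral>\<^sup>+p. ennreal ((norm (kern t n h p)) ^ 4) \<partial>spacetime I) = (\<integral>\<^sup>+s. (\<integral>\<^sup>+z. ennreal ((norm (kern t n h (s, z))) ^ 4) \<partial>cylinder) \<partial>TI)"
    by (rule nn_integral_spacetime) measurable
  also have "ennreal l * (\<integral>\<^sup>+p. ennreal (norm (g p) powr (4/3)) \<partial>spacetime I) + ennreal (1 / l ^ 3) * (\<integral>\<^sup>+s. (\<integral>\<^sup>+z. ennreal ((norm (kern t n h (s, z))) ^ 4) \<partial>cylinder) \<partial>TI)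
    \<le> ennreal l * (\<integral>\<^sup>+p. ennreal (norm (g p) powr (4/3)) \<partial>spacetime I) + ennreal (1 / l ^ 3) * (\<integral>\<^sup>+s. ennreal R \<partial>TI)"
    by (intro add_left_mono mult_left_mono nn_integral_mono R) simp
  also have "(\<integral>\<^sup>+s. ennreal R \<partial>TI) = ennreal (R * len)"
    using R(1) by (simp add: emeasure_restrict_space space_TI emeasure_I_eq ennreal_mult)
  also have "ennreal (1 / l ^ 3) * ennreal (R * len) = ennreal (1 / l ^ 3 * (R * len))"
    by (rule ennreal_mult[symmetric]) (use l R(1) in auto)
  finally show ?thesis .
qed

lemma osig_I: "t \<in> I \<Longrightarrow> indicator I s *\<^sub>R (osig t s *\<^sub>R c) = osig t s *\<^sub>R (c :: complex)"
  using mem_is_interval_1_I[OF I(1) I(3), of t s] mem_is_interval_1_I[OF I(1) _ I(3), of t s]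
  by (auto simp: osig_def indicator_def)

lemma norm_osig_le: "norm (osig t s *\<^sub>R c) \<le> norm (c :: complex)"
  using abs_osig[of t s] by (simp add: indicator_def)

text \<open>Although the slices of S(t - s) f(s) are distributions, their pairing with
  \<open>h\<close> is a spatial integral of an absolutely integrable function on space-time. Fubini
  therefore gives integrability in s and identifies the oriented time integral with a space-time
  integral.\<close>

lemma duhamel_pairing:
  assumes g: "g \<in> Lp_functions (4/3) (spacetime I)" and h: "h \<in> test_functions" and t: "t \<in> I"
  shows "integrable (spacetime I) (\<lambda>p. osig t (fst p) *\<^sub>R (g p * kern t n h p))"
    "interval_lebesgue_integrable lborel (ereal 0) (ereal t)
       (\<lambda>s. group_multiplier \<alpha> \<epsilon> (t - s) (fourier (\<lambda>z. g (s, z))) n h)"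
    "(LBINT s=ereal 0..ereal t. group_multiplier \<alpha> \<epsilon> (t - s) (fourier (\<lambda>z. g (s, z))) n h)
       = (\<integral>p. osig t (fst p) *\<^sub>R (g p * kern t n h p) \<partial>spacetime I)"
    "(\<integral>s. osig t s *\<^sub>R group_multiplier \<alpha> \<epsilon> (t - s) (fourier (\<lambda>z. g (s, z))) n h \<partial>lborel)
       = (\<integral>p. osig t (fst p) *\<^sub>R (g p * kern t n h p) \<partial>spacetime I)"
proof -
  have gm[measurable]: "g \<in> borel_measurable (spacetime I)" and gf: "(\<integral>\<^sup>+p. ennreal (norm (g p) powr (4/3)) \<partial>spacetime I) < \<infinity>"
    using g by (simp_all add: Lp_functions_iff)
  note [measurable] = kern_measurable(1)[OF h]
  obtain R where R: "0 \<le> R" "\<And>s. (\<integral>\<^sup>+z. ennreal ((norm (kern t n h (s, z))) ^ 4) \<partial>cylinder) \<le> ennreal R"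
    by (rule kern_L4[OF h]) (rule that)
  have fm[measurable]: "fst \<in> borel_measurable (spacetime I)"
    using measurable_spacetimeI[of "\<lambda>t _. t"] by simp
  have gk: "integrable (spacetime I) (\<lambda>p. g p * kern t n h p)"
  proof (rule integrableI_bounded)
    have "(\<integral>\<^sup>+p. ennreal (norm (g p * kern t n h p)) \<partial>spacetime I)
      \<le> ennreal 1 * (\<integral>\<^sup>+p. ennreal (norm (g p) powr (4/3)) \<partial>spacetime I) + ennreal (1 / 1 ^ 3 * (R * len))"
      by (rule kern_pairing_le[OF h gm _ R]) simp
    also have "\<dots> < \<infinity>" using gf by simp
    finally show "(\<integral>\<^sup>+p. ennreal (norm (g p * kern t n h p)) \<partial>spacetime I) < \<infinity>" .
  qed measurable
  show i: "integrable (spacetime I) (\<lambda>p. osig t (fst p) *\<^sub>R (g p * kern t n h p))"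
    by (rule Bochner_Integration.integrable_bound[OF gk]) (measurable, intro AE_I2 norm_osig_le)
  let ?\<Phi> = "\<lambda>s. group_multiplier \<alpha> \<epsilon> (t - s) (fourier (\<lambda>z. g (s, z))) n h"
  have e: "(\<integral>z. osig t (fst (s, z)) *\<^sub>R (g (s, z) * kern t n h (s, z)) \<partial>cylinder) = osig t s *\<^sub>R ?\<Phi> s" for s
    unfolding group_multiplier_kern by simp
  have iT: "integrable TI (\<lambda>s. osig t s *\<^sub>R ?\<Phi> s)"
    using TC.integrable_fst'[OF i[unfolded spacetime_eq]] unfolding e .
  then have iL: "integrable lborel (\<lambda>s. osig t s *\<^sub>R ?\<Phi> s)"
    by (subst (asm) integrable_restrict_space) (simp_all add: osig_I[OF t] del: scaleR_scaleR)
  show "interval_lebesgue_integrable lborel (ereal 0) (ereal t) ?\<Phi>" by (rule interval_integral_osig(1)[OF iL])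
  have "(\<integral>s. osig t s *\<^sub>R ?\<Phi> s \<partial>lborel) = (\<integral>s. osig t s *\<^sub>R ?\<Phi> s \<partial>TI)"
    by (subst integral_restrict_space) (simp_all add: osig_I[OF t] del: scaleR_scaleR)
  also have "\<dots> = (\<integral>p. osig t (fst p) *\<^sub>R (g p * kern t n h p) \<partial>spacetime I)"
    using TC.integral_fst'[OF i[unfolded spacetime_eq]] unfolding e spacetime_eq[symmetric] .
  finally show L: "(\<integral>s. osig t s *\<^sub>R ?\<Phi> s \<partial>lborel) = (\<integral>p. osig t (fst p) *\<^sub>R (g p * kern t n h p) \<partial>spacetime I)" .
  then show "(LBINT s=ereal 0..ereal t. ?\<Phi> s) = (\<integral>p. osig t (fst p) *\<^sub>R (g p * kern t n h p) \<partial>spacetime I)"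
    unfolding interval_integral_osig(2)[OF iL] .
qed

lemma duhamel_pairing_tendsto:
  assumes f: "f \<in> Lp_functions (4/3) (spacetime I)" and g: "\<And>j. g j \<in> Lp_functions (4/3) (spacetime I)"
    and close: "\<And>j. (\<integral>\<^sup>+p. ennreal (norm (g j p - f p) powr (4/3)) \<partial>spacetime I) \<le> ennreal ((1/32) ^ j)"
    and h: "h \<in> test_functions" and t: "t \<in> I"
  shows "(\<lambda>j. \<integral>p. osig t (fst p) *\<^sub>R (g j p * kern t n h p) \<partial>spacetime I) \<longlonglongrightarrow> (\<integral>p. osig t (fst p) *\<^sub>R (f p * kern t n h p) \<partial>spacetime I)"
proof -
  obtain R where R: "0 \<le> R" "\<And>s. (\<integral>\<^sup>+z. ennreal ((norm (kern t n h (s, z))) ^ 4) \<partial>cylinder) \<le> ennreal R"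
    by (rule kern_L4[OF h]) (rule that)
  let ?T = "\<lambda>g. \<integral>p. osig t (fst p) *\<^sub>R (g p * kern t n h p) \<partial>spacetime I"
  let ?b = "\<lambda>j::nat. (1/16) ^ j + (1/8) ^ j * (R * len)"
  have "norm (?T (g j) - ?T f) \<le> ?b j" for j
  proof -
    have m: "(\<lambda>p. g j p - f p) \<in> borel_measurable (spacetime I)"
      using f g by (intro borel_measurable_diff) (simp_all add: Lp_functions_iff)
    have "?T (g j) - ?T f = (\<integral>p. osig t (fst p) *\<^sub>R ((g j p - f p) * kern t n h p) \<partial>spacetime I)"
      by (subst Bochner_Integration.integral_diff[symmetric, OF duhamel_pairing(1)[OF g h t] duhamel_pairing(1)[OF f h t]])
        (simp only: left_diff_distrib scaleR_diff_right)
    then have "ennreal (norm (?T (g j) - ?T f)) \<le> (\<integral>\<^sup>+p. ennreal (norm (osig t (fst p) *\<^sub>R ((g j p - f p) * kern t n h p))) \<partial>spacetime I)"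
      by (simp only: ennreal_norm_integral_le)
    also have "\<dots> \<le> (\<integral>\<^sup>+p. ennreal (norm ((g j p - f p) * kern t n h p)) \<partial>spacetime I)"
      by (intro nn_integral_mono ennreal_leI norm_osig_le)
    \<comment> \<open>With the parameter 2^j the terms become 2^j 32^-j = 16^-j and a multiple of
      (2^j)^-3 = 8^-j.\<close>
    also have "\<dots> \<le> ennreal (2 ^ j) * (\<integral>\<^sup>+p. ennreal (norm (g j p - f p) powr (4/3)) \<partial>spacetime I) + ennreal (1 / (2 ^ j) ^ 3 * (R * len))"
      by (rule kern_pairing_le[OF h m _ R]) simp
    also have "\<dots> \<le> ennreal (2 ^ j) * ennreal ((1/32) ^ j) + ennreal (1 / (2 ^ j) ^ 3 * (R * len))"
      by (intro add_right_mono mult_left_mono close) simp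
    also have "\<dots> = ennreal (2 ^ j * (1/32) ^ j + 1 / (2 ^ j) ^ 3 * (R * len))"
      using R(1) by (subst ennreal_plus) (auto simp: ennreal_mult)
    also have "2 ^ j * (1/32) ^ j + 1 / (2 ^ j) ^ 3 * (R * len) = ?b j"
    proof -
      have "(2 :: real) ^ j * (1/32) ^ j = (1/16) ^ j" unfolding power_mult_distrib[symmetric] by simp
      moreover have "((2 :: real) ^ j) ^ 3 = (2 ^ 3) ^ j" by (simp only: power_mult[symmetric] mult.commute)
      ultimately show ?thesis by (simp add: power_one_over)
    qed
    finally show ?thesis using R(1) by (simp add: ennreal_le_iff del: ennreal_plus)
  qed
  then have e: "\<forall>\<^sub>F j in sequentially. norm (?T (g j) - ?T f) \<le> ?b j" by (intro always_eventually allI)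
  have "?b \<longlonglongrightarrow> 0 + 0 * (R * len)" by (intro tendsto_intros LIMSEQ_power_zero) simp_all
  then have "?b \<longlonglongrightarrow> 0" by simp
  from Lim_null_comparison[OF e this] show ?thesis by (rule LIM_zero_cancel)
qed

lemma is_duhamel_integralI:
  assumes f: "f \<in> Lp_functions (4/3) (spacetime I)" and n: "\<And>j. nice_family (f' j) (\<gamma> j)"
    and close: "\<And>j. (\<integral>\<^sup>+p. ennreal (norm (f' j (fst p) (snd p) - f p) powr (4/3)) \<partial>spacetime I) \<le> ennreal ((1/32) ^ j)"
    and Lp: "\<And>j. (\<lambda>p. f' j (fst p) (snd p)) \<in> Lp_functions (4/3) (spacetime I)"
    and um: "u \<in> borel_measurable (spacetime I)" and Hm: "H \<in> borel_measurable (spacetime I)"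
    and H0: "\<And>p. 0 \<le> (H p :: real)" and Hi: "(\<integral>\<^sup>+p. ennreal (H p) \<partial>spacetime I) < \<infinity>"
    and lim: "AE p in spacetime I. \<forall>j. (norm (u p - nice_duhamel.u \<alpha> \<epsilon> I (\<gamma> j) (fst p) (snd p))) ^ 4 \<le> 16 * (1/16) ^ j * H p"
  shows "is_duhamel_integral \<alpha> \<epsilon> I f u"
  unfolding is_duhamel_integral_def
proof (intro conjI um)
  note [measurable] = Hm
  have aeH: "AE t in TI. (\<integral>\<^sup>+z. ennreal (H (t, z)) \<partial>cylinder) \<noteq> \<infinity>"
  proof (rule nn_integral_noteq_infinite)
    show "(\<lambda>t. \<integral>\<^sup>+z. ennreal (H (t, z)) \<partial>cylinder) \<in> borel_measurable TI"
      using Hm unfolding spacetime_eq by measurable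
    show "(\<integral>\<^sup>+t. (\<integral>\<^sup>+z. ennreal (H (t, z)) \<partial>cylinder) \<partial>TI) \<noteq> \<infinity>"
      using Hi by (subst (asm) nn_integral_spacetime) auto
  qed
  \<comment> \<open>The exceptional times come from the majorant \<open>H\<close> and the pointwise
    limit alone, and so serve all frequencies and test functions.\<close>
  show "AE t in TI. (\<forall>n. \<forall>h\<in>test_functions. interval_lebesgue_integrable lborel (ereal 0) (ereal t)
           (\<lambda>t'. group_multiplier \<alpha> \<epsilon> (t - t') (fourier (\<lambda>z. f (t', z))) n h)) \<and>
        has_fourier (\<lambda>z. u (t, z))
          (\<lambda>n h. LBINT t'=ereal 0..ereal t. group_multiplier \<alpha> \<epsilon> (t - t') (fourier (\<lambda>z. f (t', z))) n h)"
    using aeH AE_spacetime_slice[OF lim] AE_TI_in_I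
  proof eventually_elim
    case (elim t)
    note t = elim(3)
    have close_t: "AE z in cylinder. \<forall>j. (norm (u (t, z) - nice_duhamel.u \<alpha> \<epsilon> I (\<gamma> j) t z)) ^ 4 \<le> 16 * (1/16) ^ j * H (t, z)"
      using elim(2) by simp
    have utm: "(\<lambda>z. u (t, z)) \<in> borel_measurable cylinder" by (rule measurable_spacetime_slice[OF um t])
    have Htm: "(\<lambda>z. H (t, z)) \<in> borel_measurable cylinder"
      using measurable_Pair2[OF Hm[unfolded spacetime_eq], of t] t by (simp add: space_TI)
    have Hti: "(\<integral>\<^sup>+z. ennreal (H (t, z)) \<partial>cylinder) < \<infinity>" using elim(1) by (simp add: less_top)
    show ?case
      unfolding has_fourier_def
    proof (intro conjI allI ballI)
      fix n' h assume h: "h \<in> test_functions"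
      show "interval_lebesgue_integrable lborel (ereal 0) (ereal t)
           (\<lambda>t'. group_multiplier \<alpha> \<epsilon> (t - t') (fourier (\<lambda>z. f (t', z))) n' h)"
        by (rule duhamel_pairing(2)[OF f h t])
      show "has_bochner_integral cylinder (fourier_integrand (\<lambda>z. u (t, z)) n' h)
          (LBINT t'=ereal 0..ereal t. group_multiplier \<alpha> \<epsilon> (t - t') (fourier (\<lambda>z. f (t', z))) n' h)"
        unfolding duhamel_pairing(3)[OF f h t]
      proof (rule has_fourier_limit[OF utm Htm H0 Hti close_t h])
        show "has_bochner_integral cylinder (fourier_integrand (nice_duhamel.u \<alpha> \<epsilon> I (\<gamma> j) t) n' h)
            (\<integral>p. osig t (fst p) *\<^sub>R (f' j (fst p) (snd p) * kern t n' h p) \<partial>spacetime I)" for j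
        proof -
          interpret nice_duhamel \<alpha> \<epsilon> B I "f' j" "\<gamma> j" by unfold_locales (rule n)
          have "t \<in> {- len..len}" using t I_subset by blast
          from u_fourier[OF this h] show ?thesis
            unfolding duhamel_pairing(4)[OF Lp h t, of j n', symmetric] by simp
        qed
        show "(\<lambda>j. \<integral>p. osig t (fst p) *\<^sub>R (f' j (fst p) (snd p) * kern t n' h p) \<partial>spacetime I) \<longlonglongrightarrow> (\<integral>p. osig t (fst p) *\<^sub>R (f p * kern t n' h p) \<partial>spacetime I)"
          by (rule duhamel_pairing_tendsto[OF f Lp close h t])
      qed
    qed
  qed
qed

end

section \<open>The Duhamel integral of general data\<close>

context flow_time
begin

text \<open>The constant is 4608 = 72 * 4^3: the mass of the approximations is compared with that of
  \<open>f\<close> at the cost of a factor 4, and the estimate is cubic in the mass.\<close>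

lemma duhamel_exists:
  assumes f: "f \<in> Lp_functions (4/3) (spacetime I)"
  shows "\<exists>u. is_duhamel_integral \<alpha> \<epsilon> I f u \<and>
    (\<integral>\<^sup>+p. ennreal ((norm (u p)) ^ 4) \<partial>spacetime I) \<le> ennreal (4608 * SC\<^sup>2 * (\<integral>p. norm (f p) powr (4/3) \<partial>spacetime I) ^ 3)"
proof -
  have fm[measurable]: "f \<in> borel_measurable (spacetime I)" and ff: "(\<integral>\<^sup>+p. ennreal (norm (f p) powr (4/3)) \<partial>spacetime I) < \<infinity>"
    using f by (simp_all add: Lp_functions_iff)
  define X where "X = (\<integral>p. norm (f p) powr (4/3) \<partial>spacetime I)"
  have X0: "0 \<le> X" unfolding X_def by (intro integral_nonneg_AE) auto
  interpret S: Lp_closure "spacetime I" "4/3" families by (rule Lp_closure_families) simp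
  have X: "S.N f = ennreal X"
    unfolding X_def by (rule nn_integral_eq_integral) (use f in \<open>auto simp: Lp_functions_def\<close>)
  have N_add: "S.N (\<lambda>p. a p + b p) \<le> 4 * (S.N a + S.N b)"
    if "a \<in> borel_measurable (spacetime I)" "b \<in> borel_measurable (spacetime I)" for a b
  proof -
    \<comment> \<open>The constant of the quasi-triangle inequality for the exponent 4/3, rounded up
      to an integer.\<close>
    have "(2 :: real) powr (4/3) \<le> 2 powr 2" by (rule powr_mono) auto
    then have "ennreal (2 powr (4/3)) \<le> ennreal 4" by (intro ennreal_leI) simp
    then have "ennreal (2 powr (4/3)) * (S.N a + S.N b) \<le> ennreal 4 * (S.N a + S.N b)" by (rule mult_right_mono) simp
    with S.N_add_le[OF that] show ?thesis by simp
  qed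
  have "S.cl f" by (rule families_dense[OF _ fm ff]) simp
  then have c: "\<forall>e>0. \<exists>g\<in>families. S.N (\<lambda>p. f p - g p) < ennreal e"
    unfolding S.cl_def by (rule conjunct2)
  have "\<exists>F. nice_family (fst F) (snd F) \<and> S.N (\<lambda>p. f p - fst F (fst p) (snd p)) < ennreal ((1/32) ^ j)" for j :: nat
  proof -
    obtain g where g: "g \<in> families" "S.N (\<lambda>p. f p - g p) < ennreal ((1/32) ^ j)"
      using c[rule_format, of "(1/32) ^ j"] by (elim bexE[rotated]) (simp_all only: zero_less_power zero_less_divide_1_iff zero_less_numeral)
    from g(1) obtain f' \<gamma> where "nice_family f' \<gamma>" "g = (\<lambda>p. f' (fst p) (snd p))" unfolding families_def by (elim CollectE exE conjE) (rule that)
    with g(2) show ?thesis by (intro exI[of _ "(f', \<gamma>)"]) (simp only: fst_conv snd_conv)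
  qed
  then have "\<forall>j. \<exists>F. nice_family (fst F) (snd F) \<and> S.N (\<lambda>p. f p - fst F (fst p) (snd p)) < ennreal ((1/32) ^ j)" by (rule allI)
  from choice[OF this] obtain F where F: "\<forall>j. nice_family (fst (F j)) (snd (F j)) \<and> S.N (\<lambda>p. f p - fst (F j) (fst p) (snd p)) < ennreal ((1/32) ^ j)"
    by (rule exE)
  \<comment> \<open>Cutting off to I leaves the values on space-time unchanged and provides the
    vanishing required by \<open>u_spacetime_bound\<close>.\<close>
  define f' where "f' j s z = indicator I s * fst (F j) s z" for j s z
  define \<gamma> where "\<gamma> j s k = indicator I s * snd (F j) s k" for j s k
  have n: "nice_family (f' j) (\<gamma> j)" for j
    unfolding f'_def[abs_def] \<gamma>_def[abs_def]
    by (rule nice_family_mult[OF conjunct1[OF F[rule_format]], where c="indicator I" and B=1]) (simp_all add: indicator_def)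
  let ?g = "\<lambda>j p. f' j (fst p) (snd p)"
  have gm[measurable]: "?g j \<in> borel_measurable (spacetime I)" for j
    by (rule measurable_spacetimeI[OF nice_family_measurable(1)[OF n]])
  have close: "S.N (\<lambda>p. f p - ?g j p) \<le> ennreal ((1/32) ^ j)" for j
  proof -
    have "S.N (\<lambda>p. f p - ?g j p) = S.N (\<lambda>p. f p - fst (F j) (fst p) (snd p))"
      by (rule nn_integral_cong) (auto simp: f'_def space_spacetime)
    also have "\<dots> \<le> ennreal ((1/32) ^ j)" by (rule less_imp_le[OF conjunct2[OF F[rule_format]]])
    finally show ?thesis .
  qed
  have close': "S.N (\<lambda>p. ?g j p - f p) \<le> ennreal ((1/32) ^ j)" for j
    using close[of j] by (subst norm_minus_commute)
  have Ng: "S.N (?g j) \<le> ennreal (4 * (X + (1/32) ^ j))" for j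
  proof -
    have "S.N (\<lambda>p. f p + (?g j p - f p)) \<le> 4 * (S.N f + S.N (\<lambda>p. ?g j p - f p))" by (rule N_add) measurable
    also have "\<dots> \<le> 4 * (ennreal X + ennreal ((1/32) ^ j))" by (intro mult_left_mono add_mono close') (simp_all add: X)
    also have "\<dots> = ennreal (4 * (X + (1/32) ^ j))"
      using X0 by (subst ennreal_mult) simp_all
    finally show ?thesis by simp
  qed
  have gLp: "?g j \<in> Lp_functions (4/3) (spacetime I)" for j
    using Ng[of j] le_less_trans[OF _ ennreal_less_top] by (simp only: Lp_functions_iff gm infinity_ennreal_def)
  have Nd: "S.N (\<lambda>p. ?g (Suc j) p - ?g j p) \<le> ennreal (8 * (1/32) ^ j)" for j
  proof -
    have "S.N (\<lambda>p. (?g (Suc j) p - f p) + (f p - ?g j p)) \<le> 4 * (S.N (\<lambda>p. ?g (Suc j) p - f p) + S.N (\<lambda>p. f p - ?g j p))"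
      by (rule N_add) measurable
    also have "\<dots> \<le> 4 * (ennreal ((1/32) ^ Suc j) + ennreal ((1/32) ^ j))" by (intro mult_left_mono add_mono close close') simp
    also have "\<dots> \<le> 4 * (ennreal ((1/32) ^ j) + ennreal ((1/32) ^ j))"
      by (intro mult_left_mono add_mono ennreal_leI) auto
    also have "\<dots> = ennreal (4 * ((1/32) ^ j + (1/32) ^ j))"
      by (simp add: ennreal_plus[symmetric] ennreal_mult del: ennreal_plus)
    also have "4 * ((1/32) ^ j + (1/32) ^ j) = (8 * (1/32) ^ j :: real)" by simp
    finally show ?thesis by simp
  qed
  let ?u = "\<lambda>j p. nice_duhamel.u \<alpha> \<epsilon> I (\<gamma> j) (fst p) (snd p)"
  have um[measurable]: "?u j \<in> borel_measurable (spacetime I)" for j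
  proof -
    interpret nice_duhamel \<alpha> \<epsilon> B I "f' j" "\<gamma> j" by unfold_locales (rule n)
    show ?thesis by (rule measurable_spacetimeI[OF u_measurable])
  qed
  have ub: "(\<integral>\<^sup>+p. ennreal ((norm (?u j p)) ^ 4) \<partial>spacetime I) \<le> ennreal (72 * SC\<^sup>2 * (4 * (X + (1/32) ^ j)) ^ 3)" for j
  proof -
    interpret nice_duhamel \<alpha> \<epsilon> B I "f' j" "\<gamma> j" by unfold_locales (rule n)
    show ?thesis by (rule u_spacetime_bound[OF _ _ Ng]) (use X0 in \<open>simp_all add: f'_def\<close>)
  qed
  have diff: "(\<integral>\<^sup>+p. ennreal ((norm (?u (Suc j) p - ?u j p)) ^ 4) \<partial>spacetime I) \<le> ennreal (72 * SC\<^sup>2 * 512 * (1/32) ^ j)" for j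
  proof -
    have "nice_family (\<lambda>s z. f' (Suc j) s z - f' j s z) (\<lambda>s k. \<gamma> (Suc j) s k - \<gamma> j s k)"
      using nice_family_add[OF n[of "Suc j"] nice_family_mult[OF n[of j], of "\<lambda>_. - 1" 1]] by simp
    then interpret d: nice_duhamel \<alpha> \<epsilon> B I "\<lambda>s z. f' (Suc j) s z - f' j s z" "\<lambda>s k. \<gamma> (Suc j) s k - \<gamma> j s k"
      by unfold_locales
    have "(\<integral>\<^sup>+p. ennreal ((norm (?u (Suc j) p - ?u j p)) ^ 4) \<partial>spacetime I) \<le> ennreal (72 * SC\<^sup>2 * (8 * (1/32) ^ j) ^ 3)"
      unfolding u_diff[OF n[of "Suc j"] n[of j], symmetric]
      by (rule d.u_spacetime_bound[OF _ _ Nd]) (simp_all add: f'_def)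
    also have "\<dots> \<le> ennreal (72 * SC\<^sup>2 * 512 * (1/32) ^ j)"
    proof (rule ennreal_leI)
      have "((1/32 :: real) ^ j) ^ 3 \<le> ((1/32) ^ j) ^ 1" by (rule power_decreasing) (auto simp: power_le_one)
      then have "72 * SC\<^sup>2 * 512 * ((1/32 :: real) ^ j) ^ 3 \<le> 72 * SC\<^sup>2 * 512 * (1/32) ^ j"
        by (intro mult_left_mono) auto
      moreover have "72 * SC\<^sup>2 * (8 * (1/32) ^ j) ^ 3 = 72 * SC\<^sup>2 * 512 * ((1/32 :: real) ^ j) ^ 3"
        unfolding power_mult_distrib[of 8] by simp
      ultimately show "72 * SC\<^sup>2 * (8 * (1/32) ^ j) ^ 3 \<le> 72 * SC\<^sup>2 * 512 * (1/32) ^ j" by simp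
    qed
    finally show ?thesis .
  qed
  have K0: "0 \<le> 72 * SC\<^sup>2 * 512" by simp
  obtain u H where um': "u \<in> borel_measurable (spacetime I)" and Hm: "H \<in> borel_measurable (spacetime I)"
    and H0: "\<And>p. 0 \<le> (H p :: real)" and Hi: "(\<integral>\<^sup>+p. ennreal (H p) \<partial>spacetime I) < \<infinity>"
    and lim: "AE p in spacetime I. \<forall>j. (norm (u p - ?u j p)) ^ 4 \<le> 16 * (1/16) ^ j * H p"
    by (rule fast_limit[OF um K0 diff]) (rule that)
  have duh: "is_duhamel_integral \<alpha> \<epsilon> I f u"
    by (rule is_duhamel_integralI[OF f n close' gLp um' Hm H0 Hi lim])
  have "(\<integral>\<^sup>+p. ennreal ((norm (u p)) ^ 4) \<partial>spacetime I) = (\<integral>\<^sup>+p. liminf (\<lambda>j. ennreal ((norm (?u j p)) ^ 4)) \<partial>spacetime I)"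
  proof (rule nn_integral_cong_AE)
    show "AE p in spacetime I. ennreal ((norm (u p)) ^ 4) = liminf (\<lambda>j. ennreal ((norm (?u j p)) ^ 4))"
      using lim
    proof eventually_elim
      case (elim p)
      from fast_limit_tendsto[OF elim] have T: "(\<lambda>j. ennreal ((norm (?u j p)) ^ 4)) \<longlonglongrightarrow> ennreal ((norm (u p)) ^ 4)"
        by (intro tendsto_intros)
      show ?case by (rule lim_imp_Liminf[OF sequentially_bot T, symmetric])
    qed
  qed
  also have "\<dots> \<le> liminf (\<lambda>j. \<integral>\<^sup>+p. ennreal ((norm (?u j p)) ^ 4) \<partial>spacetime I)"
    by (rule nn_integral_liminf) measurable
  also have "\<dots> \<le> liminf (\<lambda>j. ennreal (72 * SC\<^sup>2 * (4 * (X + (1/32) ^ j)) ^ 3))"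
    by (intro Liminf_mono always_eventually allI ub)
  also have "\<dots> = ennreal (72 * SC\<^sup>2 * (4 * (X + 0)) ^ 3)"
  proof (rule lim_imp_Liminf)
    show "(\<lambda>j. ennreal (72 * SC\<^sup>2 * (4 * (X + (1/32) ^ j)) ^ 3)) \<longlonglongrightarrow> ennreal (72 * SC\<^sup>2 * (4 * (X + 0)) ^ 3)"
      by (intro tendsto_intros LIMSEQ_power_zero) simp
  qed simp
  also have "72 * SC\<^sup>2 * (4 * (X + 0)) ^ 3 = 4608 * SC\<^sup>2 * X ^ 3" by (simp add: power_mult_distrib)
  finally show ?thesis using duh unfolding X_def by blast
qed

lemma duhamel_unique:
  assumes "is_duhamel_integral \<alpha> \<epsilon> I f u" "is_duhamel_integral \<alpha> \<epsilon> I f v"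
  shows "AE p in spacetime I. u p = v p"
proof (rule AE_spacetimeI_eq)
  show "u \<in> borel_measurable (spacetime I)" "v \<in> borel_measurable (spacetime I)"
    using assms by (auto simp: is_duhamel_integral_def)
  let ?T = "\<lambda>t n h. LBINT t'=ereal 0..ereal t. group_multiplier \<alpha> \<epsilon> (t - t') (fourier (\<lambda>z. f (t', z))) n h"
  have "AE t in TI. has_fourier (\<lambda>z. u (t, z)) (?T t)" "AE t in TI. has_fourier (\<lambda>z. v (t, z)) (?T t)"
    using assms by (auto simp: is_duhamel_integral_def)
  then show "AE t in TI. AE z in cylinder. u (t, z) = v (t, z)"
    by eventually_elim (rule has_fourier_unique)
qed

lemma free_evolution_Lp_bound:
  assumes \<phi>: "\<phi> \<in> Lp_functions 2 cylinder"
  shows "\<exists>u. is_free_evolution \<alpha> \<epsilon> I \<phi> u"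
    and "is_free_evolution \<alpha> \<epsilon> I \<phi> u \<Longrightarrow> u \<in> Lp_functions 4 (spacetime I) \<and>
      Lp_norm 4 (spacetime I) u \<le> (4 * SC) powr (1/4) * Lp_norm 2 cylinder \<phi>"
proof -
  define X where "X = (\<integral>z. norm (\<phi> z) powr 2 \<partial>cylinder)"
  have X0: "0 \<le> X" unfolding X_def by (intro integral_nonneg_AE) auto
  obtain v where v: "is_free_evolution \<alpha> \<epsilon> I \<phi> v"
    and le: "(\<integral>\<^sup>+p. ennreal ((norm (v p)) ^ 4) \<partial>spacetime I) \<le> ennreal (4 * SC * X\<^sup>2)"
    using free_evolution_exists[OF \<phi>] unfolding X_def norm_powr_2 by blast
  show "\<exists>u. is_free_evolution \<alpha> \<epsilon> I \<phi> u" using v by blast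
  assume u: "is_free_evolution \<alpha> \<epsilon> I \<phi> u"
  have um: "u \<in> borel_measurable (spacetime I)" using u by (simp add: is_free_evolution_def)
  have "(\<integral>\<^sup>+p. ennreal ((norm (u p)) ^ 4) \<partial>spacetime I) = (\<integral>\<^sup>+p. ennreal ((norm (v p)) ^ 4) \<partial>spacetime I)"
    using free_evolution_unique[OF u v] by (intro nn_integral_cong_AE) auto
  with le have "(\<integral>\<^sup>+p. ennreal ((norm (u p)) ^ 4) \<partial>spacetime I) \<le> ennreal (4 * SC * X powr 2)"
    using powr_realpow'[OF X0, of 2] by simp
  from Lp_4_bound[OF um _ X0 this] SC_pos
  show "u \<in> Lp_functions 4 (spacetime I) \<and> Lp_norm 4 (spacetime I) u \<le> (4 * SC) powr (1/4) * Lp_norm 2 cylinder \<phi>"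
    unfolding Lp_norm_def[of 2] X_def by simp
qed

lemma duhamel_Lp_bound:
  assumes f: "f \<in> Lp_functions (4/3) (spacetime I)"
  shows "\<exists>u. is_duhamel_integral \<alpha> \<epsilon> I f u"
    and "is_duhamel_integral \<alpha> \<epsilon> I f u \<Longrightarrow> u \<in> Lp_functions 4 (spacetime I) \<and>
      Lp_norm 4 (spacetime I) u \<le> (4608 * SC\<^sup>2) powr (1/4) * Lp_norm (4/3) (spacetime I) f"
proof -
  define X where "X = (\<integral>p. norm (f p) powr (4/3) \<partial>spacetime I)"
  have X0: "0 \<le> X" unfolding X_def by (intro integral_nonneg_AE) auto
  obtain v where v: "is_duhamel_integral \<alpha> \<epsilon> I f v"
    and le: "(\<integral>\<^sup>+p. ennreal ((norm (v p)) ^ 4) \<partial>spacetime I) \<le> ennreal (4608 * SC\<^sup>2 * X ^ 3)"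
    using duhamel_exists[OF f] unfolding X_def by blast
  show "\<exists>u. is_duhamel_integral \<alpha> \<epsilon> I f u" using v by blast
  assume u: "is_duhamel_integral \<alpha> \<epsilon> I f u"
  have um: "u \<in> borel_measurable (spacetime I)" using u by (simp add: is_duhamel_integral_def)
  have "(\<integral>\<^sup>+p. ennreal ((norm (u p)) ^ 4) \<partial>spacetime I) = (\<integral>\<^sup>+p. ennreal ((norm (v p)) ^ 4) \<partial>spacetime I)"
    using duhamel_unique[OF u v] by (intro nn_integral_cong_AE) auto
  with le have "(\<integral>\<^sup>+p. ennreal ((norm (u p)) ^ 4) \<partial>spacetime I) \<le> ennreal (4608 * SC\<^sup>2 * X powr 3)"
    using powr_realpow'[OF X0, of 3] by simp
  from Lp_4_bound[OF um _ X0 this]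
  show "u \<in> Lp_functions 4 (spacetime I) \<and> Lp_norm 4 (spacetime I) u \<le> (4608 * SC\<^sup>2) powr (1/4) * Lp_norm (4/3) (spacetime I) f"
    unfolding Lp_norm_def[of "4/3"] X_def by simp
qed

end

theorem proposition2p1:
  fixes \<alpha> \<epsilon> :: real
  assumes "\<alpha> < 0" and "\<epsilon> \<in> {0, 1}"
  shows
    "(\<exists>C :: real \<Rightarrow> real. (\<forall>l. 0 < C l) \<and>
       (\<forall>I \<phi>. is_interval I \<and> bounded I \<and> 0 \<in> I \<and> \<phi> \<in> Lp_functions 2 cylinder \<longrightarrow>
          (\<exists>u. is_free_evolution \<alpha> \<epsilon> I \<phi> u) \<and>
          (\<forall>u. is_free_evolution \<alpha> \<epsilon> I \<phi> u \<longrightarrow>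
             u \<in> Lp_functions 4 (spacetime I) \<and>
             Lp_norm 4 (spacetime I) u
               \<le> C (measure lborel I) * Lp_norm 2 cylinder \<phi>))) \<and>
     (\<exists>C' :: real \<Rightarrow> real. (\<forall>l. 0 < C' l) \<and>
       (\<forall>I f. is_interval I \<and> bounded I \<and> 0 \<in> I \<and> f \<in> Lp_functions (4 / 3) (spacetime I) \<longrightarrow>
          (\<exists>u. is_duhamel_integral \<alpha> \<epsilon> I f u) \<and>
          (\<forall>u. is_duhamel_integral \<alpha> \<epsilon> I f u \<longrightarrow>
             u \<in> Lp_functions 4 (spacetime I) \<and>
             Lp_norm 4 (spacetime I) u
               \<le> C' (measure lborel I) * Lp_norm (4 / 3) (spacetime I) f)))"
proof -
  have "0 \<le> \<epsilon>" using assms(2) by auto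
  from bounded_counting_dispersion[OF assms(1) this] obtain B where B: "bounded_counting (dispersion \<alpha> \<epsilon>) B" by blast
  \<comment> \<open>\<open>SC\<close> as a function of the length alone. The counting bound
    \<open>B\<close> is fixed before any interval is given, so the constants depend on \<alpha>,
    \<epsilon> and the length only.\<close>
  define SCf where "SCf l = exp (l\<^sup>2 / 2) * bounded_counting.strichartz_const B" for l :: real
  have flow: "flow_time \<alpha> \<epsilon> B I" if "is_interval I \<and> bounded I \<and> 0 \<in> I" for I :: "real set"
    using B that by (simp add: flow_time_def time_set_def)
  have SC: "flow_time.SC B I = SCf (measure lborel I)" if "is_interval I \<and> bounded I \<and> 0 \<in> I" for I :: "real set"
    by (simp add: flow_time.SC_def[OF flow[OF that]] SCf_def)
  have pos: "0 < SCf l" for l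
    using bounded_counting.B_pos[OF B] by (simp add: SCf_def bounded_counting.strichartz_const_def[OF B])
  show ?thesis
  proof (intro conjI exI)
    show "\<forall>l. 0 < (4 * SCf l) powr (1/4)" "\<forall>l. 0 < (4608 * (SCf l)\<^sup>2) powr (1/4)"
      using pos by (simp_all add: less_imp_neq[symmetric])
    show "\<forall>I \<phi>. is_interval I \<and> bounded I \<and> 0 \<in> I \<and> \<phi> \<in> Lp_functions 2 cylinder \<longrightarrow>
          (\<exists>u. is_free_evolution \<alpha> \<epsilon> I \<phi> u) \<and>
          (\<forall>u. is_free_evolution \<alpha> \<epsilon> I \<phi> u \<longrightarrow>
             u \<in> Lp_functions 4 (spacetime I) \<and>
             Lp_norm 4 (spacetime I) u
               \<le> (4 * SCf (measure lborel I)) powr (1/4) * Lp_norm 2 cylinder \<phi>)"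
    proof (intro allI impI)
      fix I :: "real set" and \<phi> assume *: "is_interval I \<and> bounded I \<and> 0 \<in> I \<and> \<phi> \<in> Lp_functions 2 cylinder"
      then have I: "is_interval I \<and> bounded I \<and> 0 \<in> I" and \<phi>: "\<phi> \<in> Lp_functions 2 cylinder" by simp_all
      show "(\<exists>u. is_free_evolution \<alpha> \<epsilon> I \<phi> u) \<and>
          (\<forall>u. is_free_evolution \<alpha> \<epsilon> I \<phi> u \<longrightarrow> u \<in> Lp_functions 4 (spacetime I) \<and>
             Lp_norm 4 (spacetime I) u \<le> (4 * SCf (measure lborel I)) powr (1/4) * Lp_norm 2 cylinder \<phi>)"
        unfolding SC[OF I, symmetric]
        using flow_time.free_evolution_Lp_bound[OF flow[OF I] \<phi>] by blast
    qed
    show "\<forall>I f. is_interval I \<and> bounded I \<and> 0 \<in> I \<and> f \<in> Lp_functions (4 / 3) (spacetime I) \<longrightarrow>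
          (\<exists>u. is_duhamel_integral \<alpha> \<epsilon> I f u) \<and>
          (\<forall>u. is_duhamel_integral \<alpha> \<epsilon> I f u \<longrightarrow>
             u \<in> Lp_functions 4 (spacetime I) \<and>
             Lp_norm 4 (spacetime I) u
               \<le> (4608 * (SCf (measure lborel I))\<^sup>2) powr (1/4) * Lp_norm (4 / 3) (spacetime I) f)"
    proof (intro allI impI)
      fix I :: "real set" and f assume *: "is_interval I \<and> bounded I \<and> 0 \<in> I \<and> f \<in> Lp_functions (4 / 3) (spacetime I)"
      then have I: "is_interval I \<and> bounded I \<and> 0 \<in> I" and f: "f \<in> Lp_functions (4 / 3) (spacetime I)" by simp_all
      show "(\<exists>u. is_duhamel_integral \<alpha> \<epsilon> I f u) \<and>
          (\<forall>u. is_duhamel_integral \<alpha> \<epsilon> I f u \<longrightarrow> u \<in> Lp_functions 4 (spacetime I) \<and>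
             Lp_norm 4 (spacetime I) u \<le> (4608 * (SCf (measure lborel I))\<^sup>2) powr (1/4) * Lp_norm (4 / 3) (spacetime I) f)"
        unfolding SC[OF I, symmetric]
        using flow_time.duhamel_Lp_bound[OF flow[OF I] f] by blast
    qed
  qed
qed

end
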